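(* Let $u_0:\mathbb{R}^d\to\mathbb{R}$ be bounded, uniformly continuous and compactly supported, and for $h>0$ let $u_h(x,t)=\big((T_h)^{[t/h]}u_0\big)(x)$, $(x,t)\in\mathbb{R}^d\times[0,\infty)$, be the time-discrete minimizing movement evolution defined in the context. Let $h_k\to0^+$ be a sequence such that $u_{h_k}$ converges locally uniformly in $\mathbb{R}^d\times[0,\infty)$ to a bounded and uniformly continuous function $u$. Then $u$ is a viscosity solution of $$\begin{cases}u_t(x,t)+F_f\big(x,Du(x,t),D^2u(x,t),\{y:\ u(y,t)\ge u(x,t)\}\big)=0, & t>0,\ x\in\mathbb{R}^d,\\ u(\cdot,0)=u_0,\end{cases}$$ where $F_f$ is the non-local curvature Hamiltonian defined in the context.
   Context: Energy. Fix $\rho_0>0$, $\underline\delta\in(0,\rho_0)$ and a Lipschitz even function $f:\mathbb{R}\to[0,\infty)$ with support $[-\rho_0,\rho_0]$, constant on $[-\underline\delta,\underline\delta]$ and nonincreasing on $[0,\infty)$. For measurable $E\subset\mathbb{R}^d$ and $s>0$ let $\mathcal{E}_s(E)=\frac1{2s}\int_{\mathbb{R}^d}\mathrm{osc}_{B(x,s)}(\chi_E)\,dx$, where $\mathrm{osc}_A(v)=\mathrm{ess\,sup}_Av-\mathrm{ess\,inf}_Av$, and let $\mathcal{E}^f(E)=\int_0^{\rho_0}(-2sf'(s))\,\mathcal{E}_s(E)\,ds$. Discrete scheme. Let $d_E(x)=\mathrm{dist}(x,E)-\mathrm{dist}(x,\mathbb{R}^d\setminus E)$ (with $\mathrm{dist}(x,\emptyset)=+\infty$).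 For $h>0$ and a bounded set $E$ with compact boundary, $T_h^-E$ (resp. $T_h^+E$) is the minimal (resp. maximal), with respect to inclusion, solution $F$ of $$\min_{F\subset\mathbb{R}^d}\Big\{\mathcal{E}^f(F)+\frac1h\int_{F\triangle E}\mathrm{dist}(x,\partial E)\,dx\Big\};$$ $T_h^\pm\emptyset=\emptyset$. If $E$ is unbounded with bounded complement, $T_h^\pm E=\mathbb{R}^d\setminus T_h^\mp(\mathbb{R}^d\setminus E)$. Minimizers are determined up to Lebesgue null sets and are represented by sets whose topological boundary is $\{x:0<|F\cap B(x,r)|<|B(x,r)|\ \forall r>0\}$. For $u$ bounded, uniformly continuous and constant outside a compact set, $T_hu(x)=\sup\{s:\ x\in T_h^+\{u\ge s\}\}=\sup\{s:\ x\in T_h^-\{u\ge s\}\}$; $T_hu$ is again of this type. $[\cdot]$ is the integer part and $(T_h)^n$ the $n$-fold iterate. Hamiltonian. $\mathbb{M}^{d\times d}_{\rm sym}$ is the set of real symmetric $d\times d$ matrices. For $p\in\mathbb{R}^d\setminus\{0\}$, $\hat p=p/|p|$ and $\mathcal{P}_{\hat p}=I-\hat p\otimes\hat p$; $[X]^+$ is the symmetric matrix $X$ with each eigenvalue replaced by its positive part. For $s>0$ and $K\subset\mathbb{R}^d$ closed: $F_s^+(x,p,X,K)=\frac{|p|}{2s}\det[I-\frac{s}{|p|}\mathcal{P}_{\hat p}X\mathcal{P}_{\hat p}]^+$ if $p\ne0$ and $\mathrm{dist}(x-s\hat p,K)\ge s$, and $0$ otherwise; $F_s^-(x,p,X,K)=-\frac{|p|}{2s}\det[I+\frac{s}{|p|}\mathcal{P}_{\hat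 p}X\mathcal{P}_{\hat p}]^+$ if $p\ne0$ and $\mathrm{dist}(x+s\hat p,K^c)\ge s$, and $0$ otherwise; $F_s=F_s^++F_s^-$ and $F_f(x,p,X,K)=\int_0^{\rho_0}(-2sf'(s))F_s(x,p,X,K)\,ds$. For $A$ open, $F_f(x,p,X,A):=-F_f(x,-p,-X,A^c)$. Test functions. Fix a continuous $c:(0,\infty)\to(0,\infty)$ with $-c(|p|)\le F_f(x,p,\pm I,E)\le c(|p|)$ for all $x\in\mathbb{R}^d$, $p\neq0$ and all closed or open $E$. $\mathcal{F}$ is the family of $g\in C^2([0,\infty))$ with $g(0)=g'(0)=g''(0)=0$, $g''(r)>0$ for $r>0$, and $\lim_{p\to0}\frac{g'(|p|)}{|p|}c(|p|)=0$. A function $\varphi\in C^0(\mathbb{R}^d\times(0,\infty))$ is admissible at $\hat z=(\hat x,\hat t)$ if it is $C^2$ near $\hat z$ and, in case $D\varphi(\hat z)=0$ ($D$ is the spatial gradient), there are $g\in\mathcal{F}$ and $\omega\in C^0([0,\infty))$ with $\lim_{r\to0}\omega(r)/r=0$ such that $|\varphi(x,t)-\varphi(\hat z)-\varphi_t(\hat z)(t-\hat t)|\le g(|x-\hat x|)+\omega(|t-\hat t|)$ for $(x,t)$ near $\hat z$. Viscosity solutions. An upper semicontinuous $u:\mathbb{R}^d\times[0,\infty)\to\mathbb{R}$ is a subsolution if for all $z=(x,t)$ with $t>0$ and all $\varphi\in C^0(\mathbb{R}^d\times(0,\infty))$ admissible at $z$ such that $u-\varphi$ has a maximum at $z$: $\varphi_t(z)+F_f(x,D\varphi(z),D^2\varphi(z),\{y:\varphi(y,t)\ge\varphi(z)\})\le0$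 if $D\varphi(z)\ne0$, and $\varphi_t(z)\le0$ otherwise. A lower semicontinuous $u$ is a supersolution if for all such $z$ and all $\varphi$ admissible at $z$ such that $u-\varphi$ has a minimum at $z$: $\varphi_t(z)+F_f(x,D\varphi(z),D^2\varphi(z),\{y:\varphi(y,t)>\varphi(z)\})\ge0$ if $D\varphi(z)\ne0$, and $\varphi_t(z)\ge0$ otherwise. $u$ is a viscosity solution if its upper semicontinuous envelope is a subsolution and its lower semicontinuous envelope is a supersolution; the Cauchy problem additionally requires the initial condition. *)

theory Defs
  imports "HOL-Analysis.Analysis" "HOL-Probability.Essential_Supremum"
begin

text \<open>
  The ambient space is \<^typ>\<open>real^'n\<close>, so the dimension is \<^term>\<open>CARD('n)\<close>. The parameters
  \<open>\<rho>\<close> and \<open>f\<close> are the radius and the profile in the energy. Only the values of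
  the derivative of \<open>f\<close> on the open interval from 0 to \<open>\<rho>\<close> are used, and these are
  determined almost everywhere when \<open>f\<close> is Lipschitz.
\<close>

section \<open>The energy\<close>

definition essinf :: "'a measure \<Rightarrow> ('a \<Rightarrow> ereal) \<Rightarrow> ereal" where
  "essinf M v = - esssup M (\<lambda>x. - v x)"

definition ess_osc :: "(real^'n) set \<Rightarrow> (real^'n \<Rightarrow> real) \<Rightarrow> ereal" where
  "ess_osc A v = esssup (lebesgue_on A) (\<lambda>x. ereal (v x)) - essinf (lebesgue_on A) (\<lambda>x. ereal (v x))"

definition energy_at :: "real \<Rightarrow> (real^'n) set \<Rightarrow> ennreal" where
  "energy_at s E = ennreal (1 / (2 * s)) * (\<integral>\<^sup>+ x. e2ennreal (ess_osc (ball x s) (indicator E)) \<partial>lebesgue)"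

text \<open>The weight \<open>- 2 s f'(s)\<close> is nonnegative for almost every \<open>s > 0\<close> when \<open>f\<close> is
  nonincreasing there, so the truncation performed by \<^const>\<open>ennreal\<close> is harmless.\<close>

definition energy :: "real \<Rightarrow> (real \<Rightarrow> real) \<Rightarrow> (real^'n) set \<Rightarrow> ennreal" where
  "energy \<rho> f E = (\<integral>\<^sup>+ s\<in>{0<..<\<rho>}. (ennreal (- 2 * s * deriv f s) * energy_at s E) \<partial>lebesgue)"

section \<open>The discrete scheme\<close>

definition step_functional ::
  "real \<Rightarrow> (real \<Rightarrow> real) \<Rightarrow> real \<Rightarrow> (real^'n) set \<Rightarrow> (real^'n) set \<Rightarrow> ennreal" where
  "step_functional \<rho> f h E F =
     energy \<rho> f F + ennreal (1 / h) * (\<integral>\<^sup>+ x\<in>sym_diff F E. ennreal (infdist x (frontier E)) \<partial>lebesgue)"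

definition step_solution ::
  "real \<Rightarrow> (real \<Rightarrow> real) \<Rightarrow> real \<Rightarrow> (real^'n) set \<Rightarrow> (real^'n) set \<Rightarrow> bool" where
  "step_solution \<rho> f h E F \<longleftrightarrow>
     F \<in> sets lebesgue \<and>
     (\<forall>G \<in> sets lebesgue. step_functional \<rho> f h E F \<le> step_functional \<rho> f h E G)"

definition good_representative :: "(real^'n) set \<Rightarrow> bool" where
  "good_representative F \<longleftrightarrow>
     frontier F = {x. \<forall>r>0. 0 < emeasure lebesgue (F \<inter> ball x r) \<and>
                            emeasure lebesgue (F \<inter> ball x r) < emeasure lebesgue (ball x r)}"

text \<open>Solutions are determined up to null sets, so inclusion between them is inclusion up to a
  null set.\<close>

definition minimal_solution ::
  "real \<Rightarrow> (real \<Rightarrow> real) \<Rightarrow> real \<Rightarrow> (real^'n) set \<Rightarrow> (real^'n) set \<Rightarrow> bool" where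
  "minimal_solution \<rho> f h E F \<longleftrightarrow>
     step_solution \<rho> f h E F \<and> good_representative F \<and>
     (\<forall>G. step_solution \<rho> f h E G \<longrightarrow> F - G \<in> null_sets lebesgue)"

definition maximal_solution ::
  "real \<Rightarrow> (real \<Rightarrow> real) \<Rightarrow> real \<Rightarrow> (real^'n) set \<Rightarrow> (real^'n) set \<Rightarrow> bool" where
  "maximal_solution \<rho> f h E F \<longleftrightarrow>
     step_solution \<rho> f h E F \<and> good_representative F \<and>
     (\<forall>G. step_solution \<rho> f h E G \<longrightarrow> G - F \<in> null_sets lebesgue)"

text \<open>The step for bounded sets; the boundary of a bounded set is compact. The condition
  \<^const>\<open>good_representative\<close> does not say which boundary points belong to the set, hence the
  use of a choice operator. The empty set is treated apart because its boundary is empty and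
  \<^term>\<open>infdist x {} = 0\<close>.\<close>

definition step_minus_bdd :: "real \<Rightarrow> (real \<Rightarrow> real) \<Rightarrow> real \<Rightarrow> (real^'n) set \<Rightarrow> (real^'n) set" where
  "step_minus_bdd \<rho> f h E = (if E = {} then {} else (SOME F. minimal_solution \<rho> f h E F))"

definition step_plus_bdd :: "real \<Rightarrow> (real \<Rightarrow> real) \<Rightarrow> real \<Rightarrow> (real^'n) set \<Rightarrow> (real^'n) set" where
  "step_plus_bdd \<rho> f h E = (if E = {} then {} else (SOME F. maximal_solution \<rho> f h E F))"

text \<open>The second branches are meant for sets with bounded complement; the two operators are never
  applied to other unbounded sets.\<close>

definition step_minus :: "real \<Rightarrow> (real \<Rightarrow> real) \<Rightarrow> real \<Rightarrow> (real^'n) set \<Rightarrow> (real^'n) set" where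
  "step_minus \<rho> f h E = (if bounded E then step_minus_bdd \<rho> f h E else - step_plus_bdd \<rho> f h (- E))"

definition step_plus :: "real \<Rightarrow> (real \<Rightarrow> real) \<Rightarrow> real \<Rightarrow> (real^'n) set \<Rightarrow> (real^'n) set" where
  "step_plus \<rho> f h E = (if bounded E then step_plus_bdd \<rho> f h E else - step_minus_bdd \<rho> f h (- E))"

definition function_step ::
  "real \<Rightarrow> (real \<Rightarrow> real) \<Rightarrow> real \<Rightarrow> (real^'n \<Rightarrow> real) \<Rightarrow> real^'n \<Rightarrow> real" where
  "function_step \<rho> f h u x = Sup {s. x \<in> step_plus \<rho> f h {y. u y \<ge> s}}"

definition discrete_evolution ::
  "real \<Rightarrow> (real \<Rightarrow> real) \<Rightarrow> (real^'n \<Rightarrow> real) \<Rightarrow> real \<Rightarrow> (real^'n) \<times> real \<Rightarrow> real" where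
  "discrete_evolution \<rho> f u0 h = (\<lambda>(x, t). (function_step \<rho> f h ^^ nat \<lfloor>t / h\<rfloor>) u0 x)"

section \<open>The Hamiltonian\<close>

text \<open>Unlike \<^const>\<open>infdist\<close>, this distance to the empty set is infinite.\<close>

definition set_distance :: "real^'n \<Rightarrow> (real^'n) set \<Rightarrow> ereal" where
  "set_distance x A = (INF a\<in>A. ereal (dist x a))"

definition diag_matrix :: "real^'n \<Rightarrow> real^'n^'n" where
  "diag_matrix v = (\<chi> i j. if i = j then v $ i else 0)"

text \<open>Meaningful for symmetric matrices: a spectral decomposition exists, and the matrix obtained
  from it does not depend on the decomposition.\<close>

definition matrix_pos_part :: "real^'n^'n \<Rightarrow> real^'n^'n" where
  "matrix_pos_part X = (THE Y. \<exists>Q v. orthogonal_matrix Q \<and>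
     X = Q ** diag_matrix v ** transpose Q \<and>
     Y = Q ** diag_matrix (\<chi> i. max 0 (v $ i)) ** transpose Q)"

definition unit_dir :: "real^'n \<Rightarrow> real^'n" where
  "unit_dir p = p /\<^sub>R norm p"

definition perp_proj :: "real^'n \<Rightarrow> real^'n^'n" where
  "perp_proj q = mat 1 - (\<chi> i j. q $ i * q $ j)"

definition F_plus :: "real \<Rightarrow> real^'n \<Rightarrow> real^'n \<Rightarrow> real^'n^'n \<Rightarrow> (real^'n) set \<Rightarrow> real" where
  "F_plus s x p X K =
     (if p \<noteq> 0 \<and> set_distance (x - s *\<^sub>R unit_dir p) K \<ge> ereal s
      then norm p / (2 * s) *
        det (matrix_pos_part (mat 1 - (s / norm p) *\<^sub>R
          (perp_proj (unit_dir p) ** X ** perp_proj (unit_dir p))))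
      else 0)"

definition F_minus :: "real \<Rightarrow> real^'n \<Rightarrow> real^'n \<Rightarrow> real^'n^'n \<Rightarrow> (real^'n) set \<Rightarrow> real" where
  "F_minus s x p X K =
     (if p \<noteq> 0 \<and> set_distance (x + s *\<^sub>R unit_dir p) (- K) \<ge> ereal s
      then - (norm p / (2 * s)) *
        det (matrix_pos_part (mat 1 + (s / norm p) *\<^sub>R
          (perp_proj (unit_dir p) ** X ** perp_proj (unit_dir p))))
      else 0)"

definition F_scale :: "real \<Rightarrow> real^'n \<Rightarrow> real^'n \<Rightarrow> real^'n^'n \<Rightarrow> (real^'n) set \<Rightarrow> real" where
  "F_scale s x p X K = F_plus s x p X K + F_minus s x p X K"

definition hamiltonian_closed ::
  "real \<Rightarrow> (real \<Rightarrow> real) \<Rightarrow> real^'n \<Rightarrow> real^'n \<Rightarrow> real^'n^'n \<Rightarrow> (real^'n) set \<Rightarrow> real" where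
  "hamiltonian_closed \<rho> f x p X K =
     (LINT s:{0<..<\<rho>}|lebesgue. (- 2 * s * deriv f s) * F_scale s x p X K)"

text \<open>The second branch is the definition for open sets. On the two sets that are both open and
  closed the branches agree, by the lemmas below.\<close>

definition hamiltonian ::
  "real \<Rightarrow> (real \<Rightarrow> real) \<Rightarrow> real^'n \<Rightarrow> real^'n \<Rightarrow> real^'n^'n \<Rightarrow> (real^'n) set \<Rightarrow> real" where
  "hamiltonian \<rho> f x p X A =
     (if closed A then hamiltonian_closed \<rho> f x p X A
      else - hamiltonian_closed \<rho> f x (- p) (- X) (- A))"

lemma set_distance_empty [simp]: "set_distance x {} = \<infinity>"
  by (simp add: set_distance_def top_ereal_def)

lemma set_distance_UNIV [simp]: "set_distance x UNIV = 0"
proof (rule antisym)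
  show "set_distance x UNIV \<le> 0"
    unfolding set_distance_def by (rule INF_lower2[of x]) auto
  show "0 \<le> set_distance x UNIV"
    unfolding set_distance_def by (rule INF_greatest) simp
qed

lemma unit_dir_minus: "unit_dir (- p) = - unit_dir p"
  by (simp add: unit_dir_def)

lemma perp_proj_minus: "perp_proj (- q) = perp_proj q"
  by (simp add: perp_proj_def)

lemma matrix_mult_uminus:
  fixes A X :: "real^'n^'n"
  shows "A ** (- X) ** A = - (A ** X ** A)"
  by (simp add: vec_eq_iff matrix_matrix_mult_def sum_negf)

lemma F_scale_UNIV:
  assumes "s > 0"
  shows "F_scale s x p X UNIV = - F_scale s x (- p) (- X) {}"
  using assms
  by (simp add: F_scale_def F_plus_def F_minus_def unit_dir_minus perp_proj_minus
      matrix_mult_uminus)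

lemma F_scale_empty:
  assumes "s > 0"
  shows "F_scale s x p X {} = - F_scale s x (- p) (- X) UNIV"
  using F_scale_UNIV[OF assms, of x "- p" "- X"] by simp

lemma hamiltonian_closed_UNIV:
  "hamiltonian_closed \<rho> f x p X UNIV = - hamiltonian_closed \<rho> f x (- p) (- X) {}"
proof -
  have "hamiltonian_closed \<rho> f x p X UNIV =
      (LINT s:{0<..<\<rho>}|lebesgue. - ((- 2 * s * deriv f s) * F_scale s x (- p) (- X) {}))"
    unfolding hamiltonian_closed_def
    by (rule set_lebesgue_integral_cong) (auto simp: F_scale_UNIV)
  then show ?thesis
    unfolding hamiltonian_closed_def set_lebesgue_integral_def by simp
qed

lemma hamiltonian_closed_empty:
  "hamiltonian_closed \<rho> f x p X {} = - hamiltonian_closed \<rho> f x (- p) (- X) UNIV"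
  using hamiltonian_closed_UNIV[of \<rho> f x "- p" "- X"] by simp

section \<open>Test functions\<close>

definition hamiltonian_bound ::
  "real \<Rightarrow> (real \<Rightarrow> real) \<Rightarrow> 'n::finite itself \<Rightarrow> (real \<Rightarrow> real) \<Rightarrow> bool" where
  "hamiltonian_bound \<rho> f _ c \<longleftrightarrow>
     continuous_on {0<..} c \<and> (\<forall>r>0. c r > 0) \<and>
     (\<forall>(x :: real^'n) p E. p \<noteq> 0 \<and> (closed E \<or> open E) \<longrightarrow>
        hamiltonian \<rho> f x p (mat 1) E \<in> {- c (norm p)..c (norm p)} \<and>
        hamiltonian \<rho> f x p (- mat 1) E \<in> {- c (norm p)..c (norm p)})"

definition radial_family :: "(real \<Rightarrow> real) \<Rightarrow> (real \<Rightarrow> real) set" where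
  "radial_family c = {g. \<exists>g' g''.
     (\<forall>r\<ge>0. (g has_real_derivative g' r) (at r within {0..})) \<and>
     (\<forall>r\<ge>0. (g' has_real_derivative g'' r) (at r within {0..})) \<and>
     continuous_on {0..} g'' \<and>
     g 0 = 0 \<and> g' 0 = 0 \<and> g'' 0 = 0 \<and> (\<forall>r>0. g'' r > 0) \<and>
     ((\<lambda>r. g' r / r * c r) \<longlongrightarrow> 0) (at_right 0)}"

definition C2_near :: "('a::real_normed_vector \<Rightarrow> real) \<Rightarrow> 'a \<Rightarrow> bool" where
  "C2_near \<phi> z \<longleftrightarrow> (\<exists>U (\<phi>' :: 'a \<Rightarrow> 'a \<Rightarrow>\<^sub>L real) (\<phi>'' :: 'a \<Rightarrow> 'a \<Rightarrow>\<^sub>L 'a \<Rightarrow>\<^sub>L real).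
     open U \<and> z \<in> U \<and>
     (\<forall>w\<in>U. (\<phi> has_derivative blinfun_apply (\<phi>' w)) (at w)) \<and>
     (\<forall>w\<in>U. (\<phi>' has_derivative blinfun_apply (\<phi>'' w)) (at w)) \<and>
     continuous_on U \<phi>'')"

definition time_deriv :: "((real^'n) \<times> real \<Rightarrow> real) \<Rightarrow> (real^'n) \<times> real \<Rightarrow> real" where
  "time_deriv \<phi> z = deriv (\<lambda>\<tau>. \<phi> (fst z, \<tau>)) (snd z)"

definition space_grad :: "((real^'n) \<times> real \<Rightarrow> real) \<Rightarrow> (real^'n) \<times> real \<Rightarrow> real^'n" where
  "space_grad \<phi> z = (\<chi> i. deriv (\<lambda>r. \<phi> (fst z + r *\<^sub>R axis i 1, snd z)) 0)"

definition space_hessian :: "((real^'n) \<times> real \<Rightarrow> real) \<Rightarrow> (real^'n) \<times> real \<Rightarrow> real^'n^'n" where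
  "space_hessian \<phi> z = (\<chi> i j. deriv (\<lambda>r. space_grad \<phi> (fst z + r *\<^sub>R axis i 1, snd z) $ j) 0)"

definition admissible ::
  "(real \<Rightarrow> real) \<Rightarrow> ((real^'n) \<times> real \<Rightarrow> real) \<Rightarrow> (real^'n) \<times> real \<Rightarrow> bool" where
  "admissible c \<phi> z \<longleftrightarrow>
     continuous_on (UNIV \<times> {0<..}) \<phi> \<and> C2_near \<phi> z \<and>
     (space_grad \<phi> z = 0 \<longrightarrow>
       (\<exists>g \<omega>. g \<in> radial_family c \<and> continuous_on {0..} \<omega> \<and>
          ((\<lambda>r. \<omega> r / r) \<longlongrightarrow> 0) (at_right 0) \<and>
          (\<forall>\<^sub>F w in nhds z.
             \<bar>\<phi> w - \<phi> z - time_deriv \<phi> z * (snd w - snd z)\<bar>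
               \<le> g (norm (fst w - fst z)) + \<omega> \<bar>snd w - snd z\<bar>)))"

section \<open>Viscosity solutions\<close>

definition usc_on :: "'a::topological_space set \<Rightarrow> ('a \<Rightarrow> real) \<Rightarrow> bool" where
  "usc_on S u \<longleftrightarrow> (\<forall>z\<in>S. \<forall>a>u z. \<forall>\<^sub>F w in at z within S. u w < a)"

definition lsc_on :: "'a::topological_space set \<Rightarrow> ('a \<Rightarrow> real) \<Rightarrow> bool" where
  "lsc_on S u \<longleftrightarrow> (\<forall>z\<in>S. \<forall>a<u z. \<forall>\<^sub>F w in at z within S. a < u w)"

text \<open>The filter contains the point \<open>z\<close> itself. The envelopes are real-valued for locally
  bounded \<open>u\<close>.\<close>

definition usc_envelope :: "'a::topological_space set \<Rightarrow> ('a \<Rightarrow> real) \<Rightarrow> 'a \<Rightarrow> real" where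
  "usc_envelope S u z = real_of_ereal (Limsup (inf (nhds z) (principal S)) (\<lambda>w. ereal (u w)))"

definition lsc_envelope :: "'a::topological_space set \<Rightarrow> ('a \<Rightarrow> real) \<Rightarrow> 'a \<Rightarrow> real" where
  "lsc_envelope S u z = real_of_ereal (Liminf (inf (nhds z) (principal S)) (\<lambda>w. ereal (u w)))"

text \<open>Maxima and minima of \<open>u - \<phi>\<close> are global, over the domain of \<open>\<phi>\<close>: the Hamiltonian
  depends on a whole superlevel set of \<open>\<phi>\<close>.\<close>

definition subsolution ::
  "real \<Rightarrow> (real \<Rightarrow> real) \<Rightarrow> (real \<Rightarrow> real) \<Rightarrow> ((real^'n) \<times> real \<Rightarrow> real) \<Rightarrow> bool" where
  "subsolution \<rho> f c u \<longleftrightarrow>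
     usc_on (UNIV \<times> {0..}) u \<and>
     (\<forall>x t \<phi>. t > 0 \<and> admissible c \<phi> (x, t) \<and>
        (\<forall>w \<in> UNIV \<times> {0<..}. u w - \<phi> w \<le> u (x, t) - \<phi> (x, t)) \<longrightarrow>
        (if space_grad \<phi> (x, t) \<noteq> 0
         then time_deriv \<phi> (x, t) +
           hamiltonian \<rho> f x (space_grad \<phi> (x, t)) (space_hessian \<phi> (x, t))
             {y. \<phi> (y, t) \<ge> \<phi> (x, t)} \<le> 0
         else time_deriv \<phi> (x, t) \<le> 0))"

definition supersolution ::
  "real \<Rightarrow> (real \<Rightarrow> real) \<Rightarrow> (real \<Rightarrow> real) \<Rightarrow> ((real^'n) \<times> real \<Rightarrow> real) \<Rightarrow> bool" where
  "supersolution \<rho> f c u \<longleftrightarrow>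
     lsc_on (UNIV \<times> {0..}) u \<and>
     (\<forall>x t \<phi>. t > 0 \<and> admissible c \<phi> (x, t) \<and>
        (\<forall>w \<in> UNIV \<times> {0<..}. u w - \<phi> w \<ge> u (x, t) - \<phi> (x, t)) \<longrightarrow>
        (if space_grad \<phi> (x, t) \<noteq> 0
         then time_deriv \<phi> (x, t) +
           hamiltonian \<rho> f x (space_grad \<phi> (x, t)) (space_hessian \<phi> (x, t))
             {y. \<phi> (y, t) > \<phi> (x, t)} \<ge> 0
         else time_deriv \<phi> (x, t) \<ge> 0))"

definition viscosity_solution ::
  "real \<Rightarrow> (real \<Rightarrow> real) \<Rightarrow> (real \<Rightarrow> real) \<Rightarrow> ((real^'n) \<times> real \<Rightarrow> real) \<Rightarrow> bool" where
  "viscosity_solution \<rho> f c u \<longleftrightarrow>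
     subsolution \<rho> f c (usc_envelope (UNIV \<times> {0..}) u) \<and>
     supersolution \<rho> f c (lsc_envelope (UNIV \<times> {0..}) u)"

definition cauchy_viscosity_solution ::
  "real \<Rightarrow> (real \<Rightarrow> real) \<Rightarrow> (real \<Rightarrow> real) \<Rightarrow> (real^'n \<Rightarrow> real) \<Rightarrow>
   ((real^'n) \<times> real \<Rightarrow> real) \<Rightarrow> bool" where
  "cauchy_viscosity_solution \<rho> f c u0 u \<longleftrightarrow>
     viscosity_solution \<rho> f c u \<and> (\<forall>x. u (x, 0) = u0 x)"

end

(*
  The energy is submodular under union and intersection. This replaces compactness in the existence of
  minimal and maximal solutions, and, comparing a solution F with its union with a superlevel set G of a
  test function, it shows that adding W = F - G to G costs at most the distance that F has travelled:
  E(G u W) + c |W| <= E(G) whenever F has moved by at least c h in W.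

  The cost is a first variation. Let n be the normal field of the level sets. If the s-neighbourhood of
  the complement of G loses a point x by adding W, then x = y + s n(y) for a point y where the ball about x
  touches W; and a point y in W adds to the s-neighbourhood of G the points y - t n(y) with t < s close to s,
  if the ball about y - s n(y) lies below the level of y. The change of variables y -> y + s n(y) turns both
  volumes into the determinants of the Hamiltonian, and Fatou's lemma in s bounds the cost divided by |W|
  from below as W shrinks to a point. Such sets W arise from the almost maximum points of the discrete
  evolution minus the test function.

  Where the gradient of the test function vanishes, balls serve as barriers; their speed is at most
  c(r) / r, and the admissible functions g are flat enough for a ball of radius r to survive long enough.
  Passing to complements turns subsolutions into supersolutions.
*)
theory Submission
  imports Defs
begin

text \<open>Two obstacles shape the proof. Solutions of a time step are fixed only up to null sets
  and boundary points, so nothing may depend on the representative that the choice operator picks.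
  Hence the proof works with an arbitrary minimizer (\<open>solves\<close>) and sandwiches it
  between superlevel sets (\<open>step_relation\<close>). Order is preserved for sets separated by a
  positive distance, where translating one of them upgrades inclusion up to a null set to inclusion
  in the interior; uniform continuity supplies that distance between different levels. The
  Hamiltonian is discontinuous in its set argument: at the largest scale s at which the exterior
  ball still avoids the superlevel set, a small perturbation of the test function can turn contact
  into overlap. At any smaller scale a larger exterior ball fits as well, and its slack in position
  and curvature survives the perturbation. So at most one scale is bad, and the integral over s
  ignores it. Fatou's lemma needs a lower bound uniform in s; it holds because f is constant near 0,
  which keeps s above \<delta> and the Jacobians bounded.\<close>

abbreviation vol :: "'a::euclidean_space set \<Rightarrow> ennreal" where "vol \<equiv> emeasure lebesgue"
abbreviation rvol :: "'a::euclidean_space set \<Rightarrow> real" where "rvol \<equiv> measure lebesgue"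
abbreviation leb :: "'a::euclidean_space set set" where "leb \<equiv> sets lebesgue"
abbreviation nulls :: "'a::euclidean_space set set" where "nulls \<equiv> null_sets lebesgue"

section \<open>Almost everywhere differentiability of monotone Lipschitz functions\<close>

text \<open>The Stieltjes measures of F and G add up to L times Lebesgue measure, since both sides
  agree on half-open intervals; dropping the measure of G leaves the bound. For a monotone
  L-Lipschitz F the function L x - F(x) serves as G.\<close>

lemma sum_of_measures_eq:
  fixes F G :: "real \<Rightarrow> real"
  assumes F: "mono F" "continuous_on UNIV F" and G: "mono G" "continuous_on UNIV G"
    and sum: "\<And>x. F x + G x = L * x" and L: "0 \<le> L" and A: "A \<in> sets borel"
  shows "emeasure (interval_measure F) A \<le> ennreal L * emeasure lborel A"
proof -
  let ?F = "interval_measure F" and ?G = "interval_measure G"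
  have Fc: "\<And>a. continuous (at_right a) F" and Gc: "\<And>a. continuous (at_right a) G"
    using F G by (auto simp: continuous_on_eq_continuous_at continuous_at_imp_continuous_at_within)
  have Fm: "\<And>x y. x \<le> y \<Longrightarrow> F x \<le> F y" and Gm: "\<And>x y. x \<le> y \<Longrightarrow> G x \<le> G y"
    using F G by (auto dest: monoD)
  define K where "K = measure_of UNIV (sets borel) (\<lambda>A. emeasure ?F A + emeasure ?G A)"
  have setsK: "sets K = sets borel"
    unfolding K_def by (metis sets.sets_measure_of_eq space_borel)
  have emK: "emeasure K B = emeasure ?F B + emeasure ?G B" if "B \<in> sets borel" for B
    unfolding K_def
  proof (rule emeasure_measure_of_sigma)
    show "sigma_algebra UNIV (sets borel)"
      by (metis sets.sigma_algebra_axioms space_borel)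
    show "positive (sets borel) (\<lambda>A. emeasure ?F A + emeasure ?G A)"
      by (simp add: positive_def)
    show "countably_additive (sets borel) (\<lambda>A. emeasure ?F A + emeasure ?G A)"
      unfolding countably_additive_def
      by (auto simp: suminf_add[symmetric] suminf_emeasure)
    show "B \<in> sets borel" by fact
  qed
  have "K = scale_measure (ennreal L) lborel"
  proof (rule measure_eqI_generator_eq[where \<Omega>=UNIV and E="range (\<lambda>(a::real,b). {a<..b})" and A="\<lambda>i. {- real i<..real i}"])
    show "Int_stable (range (\<lambda>(a::real, b). {a<..b}))"
      by (auto simp: Int_stable_def)
    show "range (\<lambda>(a::real, b). {a<..b}) \<subseteq> Pow UNIV" by auto
    show "emeasure K X = emeasure (scale_measure (ennreal L) lborel) X"
      if X: "X \<in> range (\<lambda>(a::real, b). {a<..b})" for X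
    proof -
      obtain a b where X: "X = {a<..b}" using X by auto
      show ?thesis
      proof (cases "a \<le> b")
        case True
        have "F b - F a + (G b - G a) = L * (b - a)"
          using sum[of a] sum[of b] by (simp add: algebra_simps)
        thus ?thesis
          using True Fm[OF True] Gm[OF True] L unfolding X
          by (simp add: emK emeasure_interval_measure_Ioc[OF _ Fm Fc] emeasure_interval_measure_Ioc[OF _ Gm Gc]
              ennreal_plus[symmetric] ennreal_mult[symmetric] del: ennreal_plus)
      qed (auto simp: X)
    qed
    have "sets borel = sigma_sets UNIV (range (\<lambda>(a::real, b). {a<..b}))"
      by (subst borel_sigma_sets_Ioc) (rule sets_measure_of, auto)
    thus "sets K = sigma_sets UNIV (range (\<lambda>(a::real, b). {a<..b}))"
      "sets (scale_measure (ennreal L) lborel) = sigma_sets UNIV (range (\<lambda>(a::real, b). {a<..b}))"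
      by (simp_all add: setsK)
    show "range (\<lambda>i. {- real i<..real i}) \<subseteq> range (\<lambda>(a::real, b). {a<..b})" by auto
    show "(\<Union>i. {- real i<..real i}) = UNIV"
    proof -
      have "\<exists>i. - real i < x \<and> x \<le> real i" for x :: real
        using reals_Archimedean2[of "\<bar>x\<bar>"] by (auto simp: abs_less_iff intro!: less_imp_le) (metis abs_less_iff less_eq_real_def minus_less_iff)
      thus ?thesis by auto
    qed
    show "emeasure K {- real i<..real i} \<noteq> \<infinity>" for i
      by (simp add: emK emeasure_interval_measure_Ioc[OF _ Fm Fc] emeasure_interval_measure_Ioc[OF _ Gm Gc])
  qed
  hence "emeasure K A = ennreal L * emeasure lborel A" by simp
  thus ?thesis using emK[OF A] by (metis le_iff_add)
qed

text \<open>Domination by Lebesgue measure makes the Stieltjes measure of F absolutely continuous,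
  and its Radon-Nikodym density is the candidate for the derivative.\<close>

lemma lipschitz_mono_has_density:
  fixes F :: "real \<Rightarrow> real"
  assumes F: "mono F" and L: "L-lipschitz_on UNIV F"
  obtains g :: "real \<Rightarrow> real" where "\<And>a b. a \<le> b \<Longrightarrow> (g has_integral (F b - F a)) {a..b}"
proof -
  have L0: "0 \<le> L" using L by (rule lipschitz_on_nonneg)
  have Fc: "continuous_on UNIV F" using L by (rule lipschitz_on_continuous_on)
  define G where "G x = L * x - F x" for x
  have lip: "F y - F x \<le> L * (y - x)" if "x \<le> y" for x y
    using lipschitz_onD[OF L, of x y] that by (auto simp: dist_real_def abs_if split: if_splits)
  have G: "mono G" "continuous_on UNIV G"
  proof -
    show "mono G" using lip by (auto simp: mono_def G_def algebra_simps)
    show "continuous_on UNIV G" unfolding G_def by (intro continuous_intros Fc)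
  qed
  have le: "emeasure (interval_measure F) A \<le> ennreal L * emeasure lborel A" if "A \<in> sets borel" for A
    by (rule sum_of_measures_eq[OF F Fc G _ L0 that]) (simp add: G_def)
  have "absolutely_continuous lborel (interval_measure F)"
    unfolding absolutely_continuous_def
  proof
    fix N assume N: "N \<in> null_sets (lborel :: real measure)"
    hence "emeasure (interval_measure F) N \<le> 0" using le[of N] by (auto simp: null_sets_def)
    thus "N \<in> null_sets (interval_measure F)" using N by (auto simp: null_sets_def)
  qed
  then obtain f where f: "f \<in> borel_measurable lborel" "density lborel f = interval_measure F"
    using sigma_finite_measure.Radon_Nikodym[OF sigma_finite_lborel, of "interval_measure F"] by auto
  have [measurable]: "f \<in> borel_measurable borel" using f by simp
  have Fr: "\<And>a. continuous (at_right a) F"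
    using Fc by (auto simp: continuous_on_eq_continuous_at continuous_at_imp_continuous_at_within)
  have Fm: "\<And>x y. x \<le> y \<Longrightarrow> F x \<le> F y" using F by (auto dest: monoD)
  show thesis
  proof (rule that[of "\<lambda>x. enn2real (f x)"])
    fix a b :: real assume ab: "a \<le> b"
    have "(\<integral>\<^sup>+ x. f x * indicator {a<..b} x \<partial>lborel) = emeasure (interval_measure F) {a<..b}"
      by (simp add: f(2)[symmetric] emeasure_density)
    also have "\<dots> = ennreal (F b - F a)" by (rule emeasure_interval_measure_Ioc[OF ab Fm Fr])
    finally have I: "(\<integral>\<^sup>+ x. f x * indicator {a<..b} x \<partial>lborel) = ennreal (F b - F a)" .
    have ae: "AE x in lborel. f x * indicator {a<..b} x \<noteq> \<infinity>"
      by (rule nn_integral_PInf_AE) (auto simp: I)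
    have I2: "(\<integral>\<^sup>+ x. ennreal (enn2real (f x) * indicator {a<..b} x) \<partial>lborel) = ennreal (F b - F a)"
      unfolding I[symmetric]
      by (rule nn_integral_cong_AE, use ae in eventually_elim) (auto simp: indicator_def less_top)
    have "((\<lambda>x. enn2real (f x) * indicator {a<..b} x) has_integral (F b - F a)) UNIV"
    proof -
      have "integrable lborel (\<lambda>x. enn2real (f x) * indicator {a<..b} x)"
        by (rule integrableI_nn_integral_finite[OF _ _ I2]) auto
      moreover have "integral\<^sup>L lborel (\<lambda>x. enn2real (f x) * indicator {a<..b} x) = F b - F a"
        by (subst integral_eq_nn_integral) (use Fm[OF ab] in \<open>auto simp: I2\<close>)
      ultimately show ?thesis
        using has_integral_integral_lborel[of "\<lambda>x. enn2real (f x) * indicator {a<..b} x"] by simp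
    qed
    moreover have "(\<lambda>x. enn2real (f x) * indicator {a<..b} x) = (\<lambda>x. if x \<in> {a<..b} then enn2real (f x) else 0)"
      by (auto simp: indicator_def)
    ultimately have "((\<lambda>x. enn2real (f x)) has_integral (F b - F a)) {a<..b}"
      by (simp only: has_integral_restrict_UNIV)
    thus "((\<lambda>x. enn2real (f x)) has_integral (F b - F a)) {a..b}"
      by (subst has_integral_spike_set_eq[of _ "{a<..b}"]) (rule negligible_subset[of "{a}"], auto)+
  qed
qed

text \<open>This is Lebesgue differentiation. The averages in
  \<open>integrable_ccontinuous_explicit\<close> run over cubes with lower corner x, so only the
  right derivative results.\<close>

lemma indefinite_integral_right_derivative:
  fixes F g :: "real \<Rightarrow> real"
  assumes g: "\<And>a b. a \<le> b \<Longrightarrow> (g has_integral (F b - F a)) {a..b}"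
  obtains N where "negligible N" "\<And>x. x \<notin> N \<Longrightarrow> (F has_real_derivative g x) (at_right x)"
proof -
  have "g integrable_on cbox a b" for a b
    using g[of a b] by (cases "a \<le> b") (auto intro: has_integral_integrable)
  then obtain N where N: "negligible N"
    and lim: "\<And>x e. \<lbrakk>x \<notin> N; 0 < e\<rbrakk> \<Longrightarrow> \<exists>d>0. \<forall>h. 0 < h \<and> h < d \<longrightarrow>
                 norm(integral (cbox x (x + h *\<^sub>R One)) g /\<^sub>R h ^ DIM(real) - g x) < e"
    using integrable_ccontinuous_explicit[of g] by blast
  show thesis
  proof (rule that[OF N])
    fix x assume x: "x \<notin> N"
    show "(F has_real_derivative g x) (at_right x)"
      unfolding has_field_derivative_iff
    proof (rule tendstoI)
      fix e :: real assume "0 < e"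
      then obtain d where d: "d > 0" and dd: "\<And>h. 0 < h \<Longrightarrow> h < d \<Longrightarrow>
                 norm(integral (cbox x (x + h *\<^sub>R One)) g /\<^sub>R h ^ DIM(real) - g x) < e"
        using lim[OF x] by blast
      show "\<forall>\<^sub>F y in at_right x. dist ((F y - F x) / (y - x)) (g x) < e"
      proof (rule eventually_at_rightI[of x "x + d"])
        fix y assume y: "y \<in> {x<..<x+d}"
        have "integral {x..y} g = F y - F x" using g[of x y] y by (auto intro: integral_unique)
        with dd[of "y - x"] y show "dist ((F y - F x) / (y - x)) (g x) < e"
          by (simp add: dist_real_def divide_inverse mult.commute)
      qed (use d in auto)
    qed
  qed
qed

text \<open>Gives meaning to \<open>deriv f\<close> almost everywhere, which is all that the energy
  and the Hamiltonian see of the profile.\<close>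

theorem lipschitz_mono_differentiable_AE:
  fixes F :: "real \<Rightarrow> real"
  assumes F: "mono F" and L: "L-lipschitz_on UNIV F"
  shows "AE x in lebesgue. F differentiable at x"
proof -
  obtain g where g: "\<And>a b. a \<le> b \<Longrightarrow> (g has_integral (F b - F a)) {a..b}"
    using lipschitz_mono_has_density[OF F L] by blast
  obtain N where N: "negligible N" "\<And>x. x \<notin> N \<Longrightarrow> (F has_real_derivative g x) (at_right x)"
    using indefinite_integral_right_derivative[OF g] by blast
  \<comment> \<open>Reflection turns left difference quotients of F into right ones of - F(-x),
    whose density is g(-x). At points good for both, the one-sided derivatives are both
    g(x).\<close>
  have g': "((\<lambda>x. g (- x)) has_integral ((- F (- b)) - (- F (- a)))) {a..b}" if "a \<le> b" for a b
    using has_integral_reflect_lemma_real[OF g[of "-b" "-a"]] that by simp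
  obtain N' where N': "negligible N'"
      "\<And>x. x \<notin> N' \<Longrightarrow> ((\<lambda>x. - F (- x)) has_real_derivative g (- x)) (at_right x)"
    using indefinite_integral_right_derivative[of "\<lambda>x. g (- x)" "\<lambda>x. - F (- x)"] g' by blast
  have "negligible (N \<union> uminus ` N')"
    using N(1) negligible_differentiable_image_negligible[OF _ N'(1), of uminus]
    by (auto intro!: derivative_intros)
  moreover have "F differentiable at x" if x: "x \<notin> N \<union> uminus ` N'" for x
  proof -
    have x': "- x \<notin> N'" using x by (force simp: image_iff)
    have r: "(F has_real_derivative g x) (at_right x)" using N(2) x by auto
    have "(((\<lambda>x. - F (- x)) \<circ> uminus) has_real_derivative g (- (- x)) * (-1)) (at_left x)"
    proof (rule DERIV_image_chain)
      show "((\<lambda>x. - F (- x)) has_real_derivative g (- (- x))) (at (- x) within uminus ` {..<x})"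
        using N'(2)[OF x'] by simp
    qed (auto intro!: derivative_eq_intros)
    hence "((\<lambda>x. - F x) has_real_derivative - g x) (at_left x)" by (simp add: o_def)
    hence "(F has_real_derivative g x) (at_left x)" using DERIV_minus by fastforce
    hence "(F has_real_derivative g x) (at x)"
      using r by (simp add: has_field_derivative_iff filterlim_at_split)
    thus ?thesis by (auto simp: real_differentiable_def)
  qed
  ultimately show ?thesis
    using AE_iff_null_sets negligible_iff_null_sets eventually_ae_filter
    by (smt (verit, ccfv_SIG) AE_I' mem_Collect_eq subsetI)
qed

section \<open>Symmetric matrices\<close>

text \<open>Symmetry is encoded through the inner product, the form in which the eigenvector
  argument and the conjugation by projections use it.\<close>

definition self_adjoint_matrix :: "real^'n^'n \<Rightarrow> bool" where
  "self_adjoint_matrix A \<longleftrightarrow> (\<forall>x y. (A *v x) \<bullet> y = x \<bullet> (A *v y))"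

lemma self_adjoint_matrixI:
  fixes A :: "real^'n^'n"
  assumes "\<And>i j. A $ i $ j = A $ j $ i"
  shows "self_adjoint_matrix A"
proof -
  have "transpose A = A" using assms by (simp add: transpose_def vec_eq_iff)
  thus ?thesis
    unfolding self_adjoint_matrix_def by (metis dot_lmul_matrix vector_transpose_matrix)
qed

lemma quadratic_nonneg_linear_zero:
  fixes a b :: real
  assumes "\<And>t. 0 \<le> 2 * t * a + t\<^sup>2 * b"
  shows "a = 0"
proof (rule ccontr)
  assume "a \<noteq> 0"
  \<comment> \<open>Minimizes the quadratic with b replaced by the positive number |b| + 1.\<close>
  define t where "t = - a / (\<bar>b\<bar> + 1)"
  have "2 * t * a + t\<^sup>2 * b \<le> 2 * t * a + t\<^sup>2 * (\<bar>b\<bar> + 1)"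
    by (intro add_left_mono mult_left_mono) auto
  also have "\<dots> = - (a\<^sup>2 / (\<bar>b\<bar> + 1))"
    by (simp add: t_def power2_eq_square divide_simps add_nonneg_eq_0_iff)
  also have "\<dots> < 0" using \<open>a \<noteq> 0\<close> by (auto intro!: divide_pos_pos)
  finally show False using assms[of t] by simp
qed

text \<open>A maximizer of the quadratic form on the unit sphere of S exists by compactness, and its
  first order condition is the eigenvalue equation.\<close>

lemma self_adjoint_eigenvector:
  fixes A :: "real^'n^'n"
  assumes A: "self_adjoint_matrix A" and S: "subspace S" and ne: "S \<noteq> {0}"
    and inv: "\<And>x. x \<in> S \<Longrightarrow> A *v x \<in> S"
  obtains x c where "x \<in> S" "norm x = 1" "A *v x = c *\<^sub>R x"
proof -
  define K where "K = S \<inter> sphere 0 1"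
  obtain z where z: "z \<in> S" "z \<noteq> 0" using ne S subspace_0 by blast
  hence "z /\<^sub>R norm z \<in> K"
    using S by (auto simp: K_def subspace_scale)
  moreover have "compact K"
    unfolding K_def by (intro closed_Int_compact closed_subspace S) auto
  moreover have "continuous_on K (\<lambda>x. x \<bullet> (A *v x))"
    by (intro continuous_intros linear_continuous_on_compose[of _ id, unfolded id_o] linear_continuous_on linear_linear[THEN iffD2] )
  ultimately obtain x where x: "x \<in> K" and max: "\<And>y. y \<in> K \<Longrightarrow> y \<bullet> (A *v y) \<le> x \<bullet> (A *v x)"
    using continuous_attains_sup[of K "\<lambda>x. x \<bullet> (A *v x)"] by blast
  have xS: "x \<in> S" and nx: "norm x = 1" using x by (auto simp: K_def)
  define c where "c = x \<bullet> (A *v x)"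
  have quad: "y \<bullet> (A *v y) \<le> c * (y \<bullet> y)" if "y \<in> S" for y
  proof (cases "y = 0")
    case False
    hence "y /\<^sub>R norm y \<in> K" using S that by (auto simp: K_def subspace_scale)
    from max[OF this] have "(y \<bullet> (A *v y)) / (norm y)\<^sup>2 \<le> c"
      by (simp add: c_def matrix_vector_mult_scaleR divide_inverse power2_eq_square mult_ac)
    thus ?thesis using False by (simp add: power2_norm_eq_inner divide_simps split: if_splits)
  qed simp
  \<comment> \<open>The function c |y|^2 - y . A y is nonnegative on S and vanishes at x, so its
    linear term at x in any direction w of S is zero.\<close>
  have orth: "(c *\<^sub>R x - A *v x) \<bullet> w = 0" if w: "w \<in> S" for w
  proof (rule quadratic_nonneg_linear_zero[where b = "c * (w \<bullet> w) - w \<bullet> (A *v w)"])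
    fix t :: real
    have "x + t *\<^sub>R w \<in> S" using xS w S by (intro subspace_add subspace_scale)
    from quad[OF this] have "0 \<le> c * ((x + t *\<^sub>R w) \<bullet> (x + t *\<^sub>R w)) - (x + t *\<^sub>R w) \<bullet> (A *v (x + t *\<^sub>R w))"
      by simp
    also have "x \<bullet> (A *v w) = w \<bullet> (A *v x)"
      using A by (metis inner_commute self_adjoint_matrix_def)
    hence "c * ((x + t *\<^sub>R w) \<bullet> (x + t *\<^sub>R w)) - (x + t *\<^sub>R w) \<bullet> (A *v (x + t *\<^sub>R w))
        = 2 * t * ((c *\<^sub>R x - A *v x) \<bullet> w) + t\<^sup>2 * (c * (w \<bullet> w) - w \<bullet> (A *v w)) + (c * (x \<bullet> x) - c)"
      by (simp add: c_def matrix_vector_right_distrib matrix_vector_mult_scaleR inner_add_left inner_add_right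
          inner_diff_left inner_commute[of w x] inner_commute[of "A *v x" w] algebra_simps power2_eq_square)
    also have "c * (x \<bullet> x) - c = 0" using nx by (simp add: norm_eq_1)
    finally show "0 \<le> 2 * t * ((c *\<^sub>R x - A *v x) \<bullet> w) + t\<^sup>2 * (c * (w \<bullet> w) - w \<bullet> (A *v w))" by simp
  qed
  have "c *\<^sub>R x - A *v x \<in> S" using S xS inv by (simp add: subspace_diff subspace_scale)
  from orth[OF this] have "A *v x = c *\<^sub>R x" by simp
  thus thesis using that xS nx by blast
qed

text \<open>Induction on the dimension: the orthogonal complement in S of an eigenvector is
  invariant because A is self-adjoint.\<close>

lemma self_adjoint_orthonormal_basis:
  fixes A :: "real^'n^'n"
  assumes A: "self_adjoint_matrix A" and "subspace S" and "\<And>x. x \<in> S \<Longrightarrow> A *v x \<in> S"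
  shows "\<exists>B. finite B \<and> card B = dim S \<and> B \<subseteq> S \<and> pairwise orthogonal B \<and>
    (\<forall>x\<in>B. norm x = 1 \<and> (\<exists>c. A *v x = c *\<^sub>R x))"
  using assms(2,3)
proof (induction "dim S" arbitrary: S)
  case 0
  thus ?case by (intro exI[of _ "{}"]) auto
next
  case (Suc k)
  have "S \<noteq> {0}" using Suc.hyps(2) by auto
  then obtain x c where x: "x \<in> S" "norm x = 1" "A *v x = c *\<^sub>R x"
    using self_adjoint_eigenvector[OF A Suc.prems(1)] Suc.prems(2) by metis
  define T where "T = {y \<in> S. \<forall>z\<in>span {x}. orthogonal z y}"
  have T: "T = {y \<in> S. x \<bullet> y = 0}"
    by (auto simp: T_def orthogonal_def span_singleton)
  have "dim T + dim (span {x}) = dim S"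
    unfolding T_def by (rule dim_subspace_orthogonal_to_vectors) (use Suc.prems x span_minimal[of "{x}" S] in auto)
  moreover have "dim (span {x}) = 1" using x by (auto simp: dim_span dim_singleton)
  ultimately have k: "k = dim T" using Suc.hyps(2) by simp
  have sub: "subspace T"
    using Suc.prems(1) unfolding T subspace_def by (auto simp: inner_add_right)
  have inv: "A *v y \<in> T" if "y \<in> T" for y
  proof -
    have "x \<bullet> (A *v y) = (A *v x) \<bullet> y" using A by (simp add: self_adjoint_matrix_def)
    thus ?thesis using that x(3) Suc.prems(2) by (auto simp: T)
  qed
  obtain B where B: "finite B" "card B = dim T" "B \<subseteq> T" "pairwise orthogonal B"
     "\<forall>x\<in>B. norm x = 1 \<and> (\<exists>c. A *v x = c *\<^sub>R x)"
    using Suc.hyps(1)[OF k sub] inv by blast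
  have "x \<notin> B" using B(3) x(2) by (auto simp: T)
  hence "finite (insert x B) \<and> card (insert x B) = dim S \<and> insert x B \<subseteq> S \<and> pairwise orthogonal (insert x B) \<and>
    (\<forall>x\<in>insert x B. norm x = 1 \<and> (\<exists>c. A *v x = c *\<^sub>R x))"
    using B x k Suc.hyps(2)
    by (auto simp: T pairwise_insert orthogonal_def inner_commute)
  thus ?case by blast
qed

lemma diag_matrix_mult_right:
  "(Q ** diag_matrix v) $ i $ j = Q $ i $ j * v $ j"
  by (simp add: matrix_matrix_mult_def diag_matrix_def if_distrib cong: if_cong)

lemma diag_matrix_vec: "diag_matrix v *v y = (\<chi> i. v $ i * y $ i)"
proof -
  have "(\<Sum>j\<in>UNIV. (if i = j then v $ i else 0) * y $ j) = (\<Sum>j\<in>UNIV. if i = j then v $ i * y $ j else 0)" for i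
    by (rule sum.cong) auto
  thus ?thesis by (simp add: vec_eq_iff matrix_vector_mult_def diag_matrix_def)
qed

theorem spectral_decomposition:
  fixes A :: "real^'n^'n"
  assumes A: "self_adjoint_matrix A"
  obtains Q v where "orthogonal_matrix Q" "A = Q ** diag_matrix v ** transpose Q"
proof -
  obtain B where B: "finite B" "card B = CARD('n)" "pairwise orthogonal B"
     "\<forall>x\<in>B. norm x = 1 \<and> (\<exists>c. A *v x = c *\<^sub>R x)"
    using self_adjoint_orthonormal_basis[OF A subspace_UNIV] by (auto simp: dim_UNIV)
  then obtain g where g: "bij_betw g (UNIV :: 'n set) B"
    by (metis finite_class.finite_UNIV finite_same_card_bij)
  hence gB: "g i \<in> B" for i by (auto simp: bij_betw_def)
  obtain c where c: "\<And>x. x \<in> B \<Longrightarrow> A *v x = c x *\<^sub>R x" using B(4) by metis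
  define Q :: "real^'n^'n" where "Q = (\<chi> i j. g j $ i)"
  define v :: "real^'n" where "v = (\<chi> j. c (g j))"
  have col: "column j Q = g j" for j by (simp add: Q_def column_def vec_eq_iff)
  have orth: "orthogonal_matrix Q"
    unfolding orthogonal_matrix_orthonormal_columns col
  proof (intro conjI allI impI)
    fix i j :: 'n assume "i \<noteq> j"
    hence "g i \<noteq> g j" using g by (auto simp: bij_betw_def inj_on_def)
    thus "orthogonal (g i) (g j)" using B(3) gB by (auto simp: pairwise_def)
  qed (use B(4) gB in auto)
  have "A ** Q = Q ** diag_matrix v"
  proof -
    have "(A ** Q) $ i $ j = (Q ** diag_matrix v) $ i $ j" for i j
    proof -
      have "(A ** Q) $ i $ j = (A *v g j) $ i"
        by (simp add: Q_def matrix_matrix_mult_def matrix_vector_mult_def)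
      also have "\<dots> = c (g j) * g j $ i" using c[OF gB, of j] by simp
      finally show ?thesis by (simp add: diag_matrix_mult_right Q_def v_def)
    qed
    thus ?thesis by (simp add: vec_eq_iff)
  qed
  hence "A ** (Q ** transpose Q) = Q ** diag_matrix v ** transpose Q"
    by (simp add: matrix_mul_assoc)
  hence "A = Q ** diag_matrix v ** transpose Q"
    using orth by (simp add: orthogonal_matrix_def)
  thus thesis using that orth by blast
qed

lemma psd_eigenvalue_nonneg:
  fixes M :: "real^'n^'n"
  assumes pos: "\<And>x. 0 \<le> x \<bullet> (M *v x)" and Q: "orthogonal_matrix Q" "M = Q ** diag_matrix v ** transpose Q"
  shows "0 \<le> v $ i"
proof -
  let ?x = "Q *v axis i 1"
  have "transpose Q *v ?x = axis i 1"
    using Q(1) by (simp add: matrix_vector_mul_assoc orthogonal_matrix)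
  hence "M *v ?x = Q *v (diag_matrix v *v axis i 1)"
    using Q(2) by (metis matrix_vector_mul_assoc)
  hence "?x \<bullet> (M *v ?x) = axis i 1 \<bullet> (transpose Q *v (Q *v (diag_matrix v *v axis i 1)))"
    by (metis dot_lmul_matrix inner_commute vector_transpose_matrix)
  also have "\<dots> = axis i 1 \<bullet> (diag_matrix v *v axis i 1)"
    using Q(1) by (simp add: matrix_vector_mul_assoc orthogonal_matrix matrix_mul_assoc)
  also have "\<dots> = v $ i"
    by (simp add: inner_axis' matrix_vector_mult_basis column_def diag_matrix_def)
  finally show ?thesis using pos[of ?x] by simp
qed

lemma det_psd_nonneg:
  fixes M :: "real^'n^'n"
  assumes M: "self_adjoint_matrix M" and pos: "\<And>x. 0 \<le> x \<bullet> (M *v x)"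
  shows "0 \<le> det M"
proof -
  obtain Q v where Q: "orthogonal_matrix Q" "M = Q ** diag_matrix v ** transpose Q"
    using spectral_decomposition[OF M] .
  have "det M = (det Q)\<^sup>2 * det (diag_matrix v)" by (simp add: Q(2) det_mul power2_eq_square)
  also have "det (diag_matrix v) = (\<Prod>i\<in>UNIV. v $ i)" by (subst det_diagonal) (auto simp: diag_matrix_def)
  finally show ?thesis using psd_eigenvalue_nonneg[OF pos Q] by (simp add: prod_nonneg)
qed

text \<open>Every spectral decomposition of a positive semidefinite matrix has nonnegative
  eigenvalues, so the truncation changes nothing and the definite description has the single value
  M. The touching condition brings the matrices of the Hamiltonian into this case.\<close>

lemma matrix_pos_part_psd:
  fixes M :: "real^'n^'n"
  assumes M: "self_adjoint_matrix M" and pos: "\<And>x. 0 \<le> x \<bullet> (M *v x)"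
  shows "matrix_pos_part M = M"
proof -
  have max: "(\<chi> i. max 0 (v $ i)) = v" if "orthogonal_matrix Q" "M = Q ** diag_matrix v ** transpose Q" for Q v
    using psd_eigenvalue_nonneg[OF pos that] by (simp add: vec_eq_iff)
  obtain Q v where Qv: "orthogonal_matrix Q" "M = Q ** diag_matrix v ** transpose Q"
    using spectral_decomposition[OF M] .
  show ?thesis
    unfolding matrix_pos_part_def
  proof (rule the_equality)
    show "\<exists>Q v. orthogonal_matrix Q \<and> M = Q ** diag_matrix v ** transpose Q \<and>
        M = Q ** diag_matrix (\<chi> i. max 0 (v $ i)) ** transpose Q"
      using Qv max[OF Qv] by (intro exI[of _ Q] exI[of _ v]) simp
  next
    fix Y assume "\<exists>Q v. orthogonal_matrix Q \<and> M = Q ** diag_matrix v ** transpose Q \<and>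
        Y = Q ** diag_matrix (\<chi> i. max 0 (v $ i)) ** transpose Q"
    then obtain Q v where "orthogonal_matrix Q" "M = Q ** diag_matrix v ** transpose Q"
        "Y = Q ** diag_matrix (\<chi> i. max 0 (v $ i)) ** transpose Q" by blast
    with max[of Q v] show "Y = M" by simp
  qed
qed

section \<open>Determinants\<close>

lemma tendsto_det:
  fixes f :: "'a \<Rightarrow> real^'n^'n"
  assumes "(f \<longlongrightarrow> l) F"
  shows "((\<lambda>x. det (f x)) \<longlongrightarrow> det l) F"
  unfolding det_def by (intro tendsto_intros assms)

lemma continuous_on_det:
  fixes f :: "'a::topological_space \<Rightarrow> real^'n^'n"
  assumes "continuous_on S f"
  shows "continuous_on S (\<lambda>x. det (f x))"
  using assms by (auto simp: continuous_on_def intro: tendsto_det)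

lemma perp_proj_vec: "perp_proj q *v x = x - (q \<bullet> x) *\<^sub>R q"
proof -
  have "(\<chi> i j. q $ i * q $ j) *v x = (q \<bullet> x) *\<^sub>R q"
    by (simp add: vec_eq_iff matrix_vector_mult_def inner_vec_def sum_distrib_left mult_ac)
  thus ?thesis by (simp add: perp_proj_def matrix_vector_mult_diff_rdistrib)
qed

lemma perp_proj_idem:
  assumes "norm q = 1"
  shows "perp_proj q ** perp_proj q = perp_proj q"
proof -
  have "q \<bullet> q = 1" using assms by (simp add: norm_eq_1)
  thus ?thesis
    by (simp add: matrix_eq perp_proj_vec inner_diff_right matrix_vector_mul_assoc[symmetric])
qed

lemma perp_proj_self_adjoint: "self_adjoint_matrix (perp_proj q)"
  by (rule self_adjoint_matrixI) (auto simp: perp_proj_def mat_def)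

lemma perp_proj_nonneg:
  assumes "norm q = 1"
  shows "0 \<le> x \<bullet> (perp_proj q *v x)"
proof -
  have "(q \<bullet> x)\<^sup>2 \<le> (q \<bullet> q) * (x \<bullet> x)" by (rule Cauchy_Schwarz_ineq)
  thus ?thesis
    using assms by (simp add: perp_proj_vec inner_diff_right inner_commute power2_eq_square norm_eq_1)
qed

text \<open>Sylvester's identity det(1 + AB) = det(1 + BA) for A = P and B = P X, where P is the
  projection. It links the Jacobian of the normal field, which contains P X, to the Hamiltonian,
  which contains P X P.\<close>

lemma det_one_plus_proj_mult:
  fixes P X :: "real^'n^'n"
  assumes q: "norm q = 1"
  shows "det (mat 1 + c *\<^sub>R (perp_proj q ** X)) = det (mat 1 + c *\<^sub>R (perp_proj q ** X ** perp_proj q))"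
proof -
  let ?P = "perp_proj q" and ?B = "perp_proj q ** X"
  \<comment> \<open>P is singular; adding t times the identity makes it invertible, so that it can
    be cancelled, and then t tends to 0.\<close>
  define Pt where "Pt t = ?P + t *\<^sub>R mat 1" for t
  have eq: "det (mat 1 + c *\<^sub>R (Pt t ** ?B)) = det (mat 1 + c *\<^sub>R (?B ** Pt t))" if t: "t > 0" for t
  proof -
    have "x = 0" if "Pt t *v x = 0" for x
    proof -
      have "0 = x \<bullet> (Pt t *v x)" using that by simp
      also have "\<dots> = x \<bullet> (?P *v x) + t * (x \<bullet> x)"
        by (simp add: Pt_def matrix_vector_mult_add_rdistrib scaleR_matrix_vector_assoc[symmetric] inner_add_right)
      finally have "t * (x \<bullet> x) \<le> 0" using perp_proj_nonneg[OF q, of x] by linarith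
      hence "x \<bullet> x \<le> 0" using t by (simp add: mult_le_0_iff)
      thus ?thesis by (metis inner_eq_zero_iff inner_ge_zero order_antisym)
    qed
    hence "invertible (Pt t)"
      using matrix_left_invertible_ker[of "Pt t"] invertible_left_inverse[of "Pt t"] by blast
    hence nz: "det (Pt t) \<noteq> 0" by (simp add: invertible_det_nz)
    have comm: "(mat 1 + c *\<^sub>R (C ** B)) ** C = C ** (mat 1 + c *\<^sub>R (B ** C))" for B C :: "real^'n^'n"
      unfolding matrix_eq matrix_vector_mul_assoc[symmetric] matrix_vector_mult_add_rdistrib
        scaleR_matrix_vector_assoc[symmetric]
      by (simp add: matrix_vector_right_distrib matrix_vector_mult_scaleR)
    have "det (mat 1 + c *\<^sub>R (Pt t ** ?B)) * det (Pt t) = det (Pt t) * det (mat 1 + c *\<^sub>R (?B ** Pt t))"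
      using arg_cong[OF comm[of "Pt t" ?B], of det] unfolding det_mul .
    thus ?thesis using nz by simp
  qed
  have lim: "(Pt \<longlongrightarrow> ?P) (at_right 0)"
    unfolding Pt_def by (auto intro!: tendsto_eq_intros)
  have mm: "((\<lambda>t. A t ** B t) \<longlongrightarrow> a ** b) (at_right (0::real))"
    if "(A \<longlongrightarrow> a) (at_right 0)" "(B \<longlongrightarrow> b) (at_right 0)" for A B :: "real \<Rightarrow> real^'n^'n" and a b
    unfolding matrix_matrix_mult_def by (intro tendsto_vec_lambda tendsto_intros that)
  have L1: "((\<lambda>t. det (mat 1 + c *\<^sub>R (Pt t ** ?B))) \<longlongrightarrow> det (mat 1 + c *\<^sub>R (?P ** ?B))) (at_right 0)"
    by (intro tendsto_det tendsto_intros mm lim)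
  have L2: "((\<lambda>t. det (mat 1 + c *\<^sub>R (?B ** Pt t))) \<longlongrightarrow> det (mat 1 + c *\<^sub>R (?B ** ?P))) (at_right 0)"
    by (intro tendsto_det tendsto_intros mm lim)
  have ev: "\<forall>\<^sub>F t in at_right 0. det (mat 1 + c *\<^sub>R (?B ** Pt t)) = det (mat 1 + c *\<^sub>R (Pt t ** ?B))"
    using eq by (auto simp: eventually_at_filter)
  have "det (mat 1 + c *\<^sub>R (?P ** ?B)) = det (mat 1 + c *\<^sub>R (?B ** ?P))"
    by (rule tendsto_unique[OF trivial_limit_at_right_real L1 Lim_transform_eventually[OF L2 ev]])
  thus ?thesis using perp_proj_idem[OF q] by (simp add: matrix_mul_assoc)
qed

text \<open>A rotation taking a coordinate axis to q makes the matrix diagonal, with eigenvalue 1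
  once and 1 + a otherwise. This is the Jacobian of parallel spheres.\<close>

lemma det_one_plus_perp_proj:
  fixes q :: "real^'n"
  assumes q: "norm q = 1"
  shows "det (mat 1 + a *\<^sub>R perp_proj q) = (1 + a) ^ (CARD('n) - 1)"
proof -
  fix k :: 'n
  obtain Q where Q: "orthogonal_matrix Q" "Q *v axis k 1 = q"
    using orthogonal_matrix_exists_basis[OF q] by metis
  define v :: "real^'n" where "v = (\<chi> i. if i = k then 1 else 1 + a)"
  have QQ: "Q ** transpose Q = mat 1" "transpose Q ** Q = mat 1" using Q(1) by (auto simp: orthogonal_matrix_def)
  have "mat 1 + a *\<^sub>R perp_proj q = Q ** diag_matrix v ** transpose Q"
  proof -
    have "(mat 1 + a *\<^sub>R perp_proj q) *v x = (Q ** diag_matrix v ** transpose Q) *v x" for x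
    proof -
      define y where "y = transpose Q *v x"
      have x: "x = Q *v y" unfolding y_def by (metis QQ(1) matrix_vector_mul_assoc matrix_vector_mul_lid)
      have qx: "q \<bullet> x = y $ k"
      proof -
        have "q \<bullet> x = axis k 1 \<bullet> y" unfolding y_def Q(2)[symmetric]
          by (metis dot_lmul_matrix inner_commute vector_transpose_matrix)
        thus ?thesis by (simp add: inner_axis')
      qed
      have "diag_matrix v *v y = (1 + a) *\<^sub>R y - (a * y $ k) *\<^sub>R axis k 1"
      proof -
        have "(diag_matrix v *v y) $ i = ((1 + a) *\<^sub>R y - (a * y $ k) *\<^sub>R axis k 1) $ i" for i
          by (cases "i = k") (simp_all add: diag_matrix_vec v_def axis_def algebra_simps)
        thus ?thesis by (simp add: vec_eq_iff)
      qed
      hence "(Q ** diag_matrix v ** transpose Q) *v x = (1 + a) *\<^sub>R x - (a * y $ k) *\<^sub>R q"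
        unfolding y_def[symmetric] matrix_vector_mul_assoc[symmetric]
        by (simp add: x matrix_vector_mult_diff_distrib matrix_vector_mult_scaleR Q(2))
      moreover have "(mat 1 + a *\<^sub>R perp_proj q) *v x = (1 + a) *\<^sub>R x - (a * y $ k) *\<^sub>R q"
        by (simp add: matrix_vector_mult_add_rdistrib scaleR_matrix_vector_assoc[symmetric] perp_proj_vec qx algebra_simps)
      ultimately show ?thesis by simp
    qed
    thus ?thesis by (simp add: matrix_eq)
  qed
  moreover have "det (Q ** diag_matrix v ** transpose Q) = det (diag_matrix v)"
  proof -
    have "det (Q ** diag_matrix v ** transpose Q) = det (Q ** transpose Q) * det (diag_matrix v)"
      by (simp add: det_mul)
    thus ?thesis by (simp add: QQ)
  qed
  moreover have "det (diag_matrix v) = (\<Prod>i\<in>UNIV. v $ i)"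
    by (subst det_diagonal) (auto simp: diag_matrix_def)
  moreover have "(\<Prod>i\<in>UNIV. v $ i) = v $ k * (\<Prod>i\<in>UNIV - {k}. v $ i)"
    by (rule prod.remove) auto
  moreover have "(\<Prod>i\<in>UNIV - {k}. v $ i) = (\<Prod>i\<in>UNIV - {k}. 1 + a)"
    by (rule prod.cong) (auto simp: v_def)
  ultimately show ?thesis by (simp add: v_def card_Diff_singleton)
qed

section \<open>Change of variables\<close>

text \<open>The change of variables theorems of the library require a well-ordered index type. They are
  transferred to an arbitrary finite index type through a well-ordered copy of that type.\<close>

typedef 'a enumerated = "UNIV :: 'a set" by auto

definition enumeration_index :: "'a::finite enumerated \<Rightarrow> nat" where
  "enumeration_index = (SOME g. inj g) \<circ> Rep_enumerated"

lemma inj_enumeration_index: "inj enumeration_index"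
proof -
  have "\<exists>g :: 'a \<Rightarrow> nat. inj g"
    using finite_imp_inj_to_nat_seg[of "UNIV :: 'a set"] by auto
  hence "inj (SOME g :: 'a \<Rightarrow> nat. inj g)" by (rule someI_ex)
  moreover have "inj (Rep_enumerated :: 'a enumerated \<Rightarrow> 'a)" by (simp add: inj_def Rep_enumerated_inject)
  ultimately show ?thesis unfolding enumeration_index_def by (rule inj_compose)
qed

instantiation enumerated :: (finite) "{finite, wellorder}"
begin

definition less_eq_enumerated :: "'a enumerated \<Rightarrow> 'a enumerated \<Rightarrow> bool" where
  "less_eq_enumerated x y \<longleftrightarrow> enumeration_index x \<le> enumeration_index y"

definition less_enumerated :: "'a enumerated \<Rightarrow> 'a enumerated \<Rightarrow> bool" where
  "less_enumerated x y \<longleftrightarrow> enumeration_index x < enumeration_index y"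

instance
proof
  show "finite (UNIV :: 'a enumerated set)"
    by (rule finite_imageD[of Rep_enumerated]) (auto simp: inj_def Rep_enumerated_inject)
next
  fix P :: "'a enumerated \<Rightarrow> bool" and a
  assume "\<And>x. (\<And>y. y < x \<Longrightarrow> P y) \<Longrightarrow> P x"
  thus "P a" unfolding less_enumerated_def by (rule measure_induct_rule)
qed (auto simp: less_eq_enumerated_def less_enumerated_def inj_eq[OF inj_enumeration_index])

end

lemma bij_Rep_enumerated: "bij Rep_enumerated"
  by (metis Abs_enumerated_inverse Rep_enumerated_inverse UNIV_I bijI')

definition reindex :: "('b \<Rightarrow> 'a) \<Rightarrow> real^'a \<Rightarrow> real^'b" where
  "reindex r x = (\<chi> i. x $ r i)"

lemma linear_reindex: "linear (reindex r)"
  by (rule linearI) (auto simp: reindex_def vec_eq_iff)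

lemma reindex_inverse:
  assumes "bij r"
  shows "reindex (inv r) (reindex r x) = x" "reindex r (reindex (inv r) y) = y"
  using assms by (auto simp: reindex_def vec_eq_iff bij_def surj_f_inv_f)

lemma prod_Basis_cart: "(\<Prod>b\<in>Basis. (x :: real^'n) \<bullet> b) = (\<Prod>i\<in>UNIV. x $ i)"
proof -
  have B: "(Basis :: (real^'n) set) = range (\<lambda>i. axis i 1)" by (auto simp: Basis_vec_def)
  have "inj (\<lambda>i. axis i 1 :: real^'n)" by (auto simp: inj_def axis_eq_axis)
  thus ?thesis unfolding B by (subst prod.reindex) (auto simp: inner_axis)
qed

lemma lborel_distr_reindex:
  fixes r :: "'b::finite \<Rightarrow> 'a::finite"
  assumes r: "bij r"
  shows "distr lborel lborel (reindex r) = lborel"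
proof (rule lborel_eqI[symmetric])
  have meas: "reindex r \<in> lborel \<rightarrow>\<^sub>M lborel"
    using borel_measurable_continuous_onI[OF linear_continuous_on[of "reindex r"]] linear_reindex[of r]
    by (simp add: linear_conv_bounded_linear)
  fix l u :: "real^'b" assume lu: "\<And>b. b \<in> Basis \<Longrightarrow> l \<bullet> b \<le> u \<bullet> b"
  have ri: "r (inv r i) = i" "inv r (r j) = j" for i j using r by (auto simp: bij_def surj_f_inv_f)
  have lu': "l $ i \<le> u $ i" for i using lu[of "axis i 1"] by (auto simp: inner_axis)
  have "reindex r -` box l u = box (reindex (inv r) l) (reindex (inv r) u)"
    by (auto simp: mem_box_cart reindex_def) (metis ri)+
  hence "emeasure (distr lborel lborel (reindex r)) (box l u) = emeasure lborel (box (reindex (inv r) l) (reindex (inv r) u))"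
    by (subst emeasure_distr[OF meas]) auto
  also have "\<dots> = ennreal (\<Prod>b\<in>Basis. (reindex (inv r) u - reindex (inv r) l) \<bullet> b)"
    using lu' by (intro emeasure_lborel_box) (auto simp: Basis_vec_def inner_axis reindex_def)
  also have "(\<Prod>b\<in>Basis. (reindex (inv r) u - reindex (inv r) l) \<bullet> b) = (\<Prod>b\<in>Basis. (u - l) \<bullet> b)"
    using prod.reindex_bij_betw[OF bij_imp_bij_inv[OF r], of "\<lambda>i. (u - l) $ i"]
    by (simp add: prod_Basis_cart reindex_def)
  finally show "emeasure (distr lborel lborel (reindex r)) (box l u) = (\<Prod>b\<in>Basis. (u - l) \<bullet> b)" .
qed simp

lemma reindex_lebesgue:
  fixes r :: "'b::finite \<Rightarrow> 'a::finite"
  assumes r: "bij r"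
  shows "reindex r \<in> lebesgue \<rightarrow>\<^sub>M lebesgue" "distr lebesgue lebesgue (reindex r) = lebesgue"
proof -
  have cont: "reindex r \<in> borel \<rightarrow>\<^sub>M borel"
    using borel_measurable_continuous_onI[OF linear_continuous_on[of "reindex r"]] linear_reindex[of r]
    by (simp add: linear_conv_bounded_linear)
  have meas: "reindex r \<in> lebesgue \<rightarrow>\<^sub>M lborel"
    using cont by (intro measurable_completion) simp
  have eq: "distr lebesgue lborel (reindex r) = lborel"
    using cont by (subst distr_completion) (auto simp: lborel_distr_reindex[OF r])
  show "reindex r \<in> lebesgue \<rightarrow>\<^sub>M lebesgue"
    by (rule completion.measurable_completion2[OF meas]) (simp add: eq)
  show "distr lebesgue lebesgue (reindex r) = lebesgue"
    using completion.completion_distr_eq[OF meas] by (simp add: eq)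
qed

lemma reindex_image_lebesgue:
  fixes r :: "'b::finite \<Rightarrow> 'a::finite"
  assumes r: "bij r" and S: "S \<in> leb"
  shows "reindex r ` S \<in> leb" "vol (reindex r ` S) = vol S"
proof -
  have im: "reindex r ` S = reindex (inv r) -` S \<inter> space lebesgue"
    by (auto simp: reindex_inverse[OF r]) (metis image_eqI reindex_inverse(2)[OF r])
  show "reindex r ` S \<in> leb"
    unfolding im by (rule measurable_sets[OF reindex_lebesgue(1)[OF bij_imp_bij_inv[OF r]] S])
  show "vol (reindex r ` S) = vol S"
    unfolding im emeasure_distr[OF reindex_lebesgue(1)[OF bij_imp_bij_inv[OF r]] S, symmetric]
    by (simp only: reindex_lebesgue(2)[OF bij_imp_bij_inv[OF r]])
qed

text \<open>In the Leibniz formula the permutations are transported by conjugation with r, which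
  preserves signs.\<close>

lemma det_reindex:
  fixes A :: "real^'a^'a" and r :: "'b::finite \<Rightarrow> 'a::finite"
  assumes r: "bij r"
  shows "det (\<chi> i j. A $ r i $ r j) = det A"
proof -
  let ?m = "map_permutation UNIV r"
  have bb: "bij_betw ?m {p. p permutes UNIV} {p. p permutes UNIV}"
  proof (rule bij_betwI[where g = "map_permutation UNIV (inv r)"])
    show "?m \<in> {p. p permutes UNIV} \<rightarrow> {p. p permutes UNIV}"
      using map_permutation_permutes[OF r] by auto
    show "map_permutation UNIV (inv r) \<in> {p. p permutes UNIV} \<rightarrow> {p. p permutes UNIV}"
      using map_permutation_permutes[OF bij_imp_bij_inv[OF r]] by auto
    show "map_permutation UNIV (inv r) (?m p) = p" if "p \<in> {p. p permutes UNIV}" for p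
      using that r by (intro map_permutation_compose_inv[where B=UNIV]) (auto simp: bij_def)
    show "?m (map_permutation UNIV (inv r) p) = p" if "p \<in> {p. p permutes UNIV}" for p
      using that r by (intro map_permutation_compose_inv[where B=UNIV]) (auto simp: bij_def bij_imp_bij_inv surj_f_inv_f inj_imp_surj_inv intro: surj_imp_inj_inv)
  qed
  have inj: "inj r" using r by (simp add: bij_def)
  have "det A = (\<Sum>p\<in>{p. p permutes (UNIV::'b set)}. of_int (sign (?m p)) * (\<Prod>i\<in>UNIV. A $ i $ ?m p i))"
    unfolding det_def by (rule sum.reindex_bij_betw[OF bb, symmetric])
  also have "\<dots> = (\<Sum>p\<in>{p. p permutes (UNIV::'b set)}. of_int (sign p) * (\<Prod>i\<in>UNIV. A $ r i $ r (p i)))"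
  proof (rule sum.cong[OF refl])
    fix p :: "'b \<Rightarrow> 'b" assume p: "p \<in> {p. p permutes UNIV}"
    have "sign (?m p) = sign p" using p inj by (intro sign_map_permutation) auto
    moreover have "(\<Prod>i\<in>UNIV. A $ i $ ?m p i) = (\<Prod>i\<in>UNIV. A $ r i $ ?m p (r i))"
      by (rule prod.reindex_bij_betw[OF r, symmetric])
    ultimately show "of_int (sign (?m p)) * (\<Prod>i\<in>UNIV. A $ i $ ?m p i) = of_int (sign p) * (\<Prod>i\<in>UNIV. A $ r i $ r (p i))"
      by (simp add: map_permutation_apply[OF inj])
  qed
  finally show ?thesis by (simp add: det_def)
qed

lemma measure_image_bounds_wellorder:
  fixes f :: "real^'n::{finite,wellorder} \<Rightarrow> real^'n::_"
  assumes S: "S \<in> lmeasurable"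
    and deriv: "\<And>x. x \<in> S \<Longrightarrow> (f has_derivative f' x) (at x within S)"
    and D: "\<And>x. x \<in> S \<Longrightarrow> \<bar>det (matrix (f' x))\<bar> \<le> D"
  shows "f ` S \<in> lmeasurable" "rvol (f ` S) \<le> D * rvol S"
    "inj_on f S \<Longrightarrow> (\<And>x. x \<in> S \<Longrightarrow> d \<le> \<bar>det (matrix (f' x))\<bar>) \<Longrightarrow> d * rvol S \<le> rvol (f ` S)"
proof -
  have Sl: "S \<in> leb" using S by blast
  have meas: "(\<lambda>x. \<bar>det (matrix (f' x))\<bar>) \<in> borel_measurable (lebesgue_on S)"
    using borel_measurable_det_Jacobian[OF Sl deriv] by measurable
  have Di: "(\<lambda>x. c) integrable_on S" for c :: real
    by (metis S integrable_on_const)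
  have int: "(\<lambda>x. \<bar>det (matrix (f' x))\<bar>) integrable_on S"
    by (rule measurable_bounded_by_integrable_imp_integrable[OF meas Di[of D] _ Sl]) (use D in auto)
  have cS: "integral S (\<lambda>x. c) = c * rvol S" for c :: real
  proof -
    have "integral S (\<lambda>x. c) = integral S (\<lambda>x. c *\<^sub>R 1)" by simp
    also have "\<dots> = c *\<^sub>R integral S (\<lambda>x. 1)" by (rule integral_cmul)
    finally show ?thesis using S by (simp add: lmeasure_integral)
  qed
  show "f ` S \<in> lmeasurable" by (rule measurable_differentiable_image[OF Sl deriv int])
  have "rvol (f ` S) \<le> integral S (\<lambda>x. \<bar>det (matrix (f' x))\<bar>)"
    by (rule measure_differentiable_image[OF Sl deriv int])
  also have "\<dots> \<le> integral S (\<lambda>x. D)" by (rule integral_le[OF int Di]) (use D in auto)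
  finally show "rvol (f ` S) \<le> D * rvol S" by (simp add: cS)
  assume inj: "inj_on f S" and d: "\<And>x. x \<in> S \<Longrightarrow> d \<le> \<bar>det (matrix (f' x))\<bar>"
  have "integral S (\<lambda>x. d) \<le> integral S (\<lambda>x. \<bar>det (matrix (f' x))\<bar>)"
    by (rule integral_le[OF Di int]) (use d in auto)
  also have "\<dots> = rvol (f ` S)"
    by (rule measure_differentiable_image_eq[OF Sl deriv inj int, symmetric])
  finally show "d * rvol S \<le> rvol (f ` S)" by (simp add: cS)
qed

lemma measure_image_bounds:
  fixes f :: "real^'n \<Rightarrow> real^'n"
  assumes S: "S \<in> lmeasurable"
    and deriv: "\<And>x. x \<in> S \<Longrightarrow> (f has_derivative f' x) (at x within S)"
    and D: "\<And>x. x \<in> S \<Longrightarrow> \<bar>det (matrix (f' x))\<bar> \<le> D"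
  shows measurable_image: "f ` S \<in> lmeasurable"
    and measure_image_le: "rvol (f ` S) \<le> D * rvol S"
    and measure_image_ge: "inj_on f S \<Longrightarrow> (\<And>x. x \<in> S \<Longrightarrow> d \<le> \<bar>det (matrix (f' x))\<bar>) \<Longrightarrow>
      d * rvol S \<le> rvol (f ` S)"
proof -
  define R where "R = reindex (Rep_enumerated :: 'n enumerated \<Rightarrow> 'n)"
  define Ri where "Ri = reindex (inv (Rep_enumerated :: 'n enumerated \<Rightarrow> 'n))"
  note br = bij_Rep_enumerated[where 'a='n]
  have RiR: "Ri (R x) = x" "R (Ri y) = y" for x y
    unfolding R_def Ri_def using reindex_inverse[OF br] by auto
  have linR: "linear R" "linear Ri" unfolding R_def Ri_def by (rule linear_reindex)+
  have R_im: "R ` T \<in> lmeasurable \<longleftrightarrow> T \<in> lmeasurable" "rvol (R ` T) = rvol T"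
    if "T \<in> leb \<or> R ` T \<in> leb" for T
  proof -
    have "T \<in> leb"
    proof (cases "T \<in> leb")
      case False
      hence "R ` T \<in> leb" using that by simp
      hence "Ri ` (R ` T) \<in> leb"
        unfolding Ri_def by (rule reindex_image_lebesgue(1)[OF bij_imp_bij_inv[OF br]])
      thus ?thesis by (simp add: image_image RiR)
    qed
    thus "R ` T \<in> lmeasurable \<longleftrightarrow> T \<in> lmeasurable" "rvol (R ` T) = rvol T"
      using reindex_image_lebesgue[OF br, of T] by (auto simp: R_def fmeasurable_def measure_def)
  qed
  define g where "g = R \<circ> f \<circ> Ri"
  define g' where "g' y = R \<circ> f' (Ri y) \<circ> Ri" for y
  have gim: "g ` (R ` S) = R ` (f ` S)" by (auto simp: g_def RiR image_iff)
  have dR: "(R has_derivative R) F" "(Ri has_derivative Ri) G" for F G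
    using linR by (auto simp: linear_conv_bounded_linear bounded_linear_imp_has_derivative)
  have deriv_g: "(g has_derivative g' y) (at y within R ` S)" if y: "y \<in> R ` S" for y
  proof -
    have "Ri ` R ` S = S" by (simp add: image_image RiR)
    hence "(f has_derivative f' (Ri y)) (at (Ri y) within Ri ` R ` S)"
      using deriv[of "Ri y"] y by (auto simp: RiR)
    hence "(f \<circ> Ri has_derivative f' (Ri y) \<circ> Ri) (at y within R ` S)"
      by (rule diff_chain_within[OF dR(2)])
    from diff_chain_within[OF this dR(1)] show ?thesis
      unfolding g_def g'_def o_assoc[symmetric] .
  qed
  have det_g: "det (matrix (g' y)) = det (matrix (f' (Ri y)))" for y
  proof -
    have ax: "Ri (axis j 1) = axis (Rep_enumerated j) 1" for j
      using br by (auto simp: Ri_def reindex_def vec_eq_iff axis_def bij_def surj_f_inv_f)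
    have "matrix (g' y) = (\<chi> i j. matrix (f' (Ri y)) $ Rep_enumerated i $ Rep_enumerated j)"
      by (simp add: matrix_def g'_def ax) (simp add: R_def reindex_def)
    thus ?thesis by (simp add: det_reindex[OF br])
  qed
  have RS: "R ` S \<in> lmeasurable" using R_im(1)[of S] S by auto
  have Dg: "\<bar>det (matrix (g' y))\<bar> \<le> D" if "y \<in> R ` S" for y
    using that D by (auto simp: det_g RiR)
  note B = measure_image_bounds_wellorder[OF RS deriv_g Dg]
  have Rf: "R ` f ` S \<in> lmeasurable" using B(1) by (simp add: gim)
  hence Rfs: "R ` f ` S \<in> leb" by blast
  show "f ` S \<in> lmeasurable" using R_im(1)[of "f ` S"] Rf Rfs by auto
  have mS: "rvol (R ` S) = rvol S" using R_im(2)[of S] S by auto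
  have mf: "rvol (R ` f ` S) = rvol (f ` S)" using R_im(2)[of "f ` S"] Rfs by auto
  show "rvol (f ` S) \<le> D * rvol S" using B(2) by (simp add: gim mS mf)
  assume inj: "inj_on f S" and d: "\<And>x. x \<in> S \<Longrightarrow> d \<le> \<bar>det (matrix (f' x))\<bar>"
  have "inj_on g (R ` S)"
  proof (rule inj_onI)
    fix x y assume x: "x \<in> R ` S" and y: "y \<in> R ` S" and xy: "g x = g y"
    obtain a b where ab: "a \<in> S" "b \<in> S" "x = R a" "y = R b" using x y by blast
    have "Ri (R (f (Ri x))) = Ri (R (f (Ri y)))" using xy by (simp add: g_def)
    hence "f a = f b" unfolding ab RiR .
    hence "a = b" using inj ab by (auto dest: inj_onD)
    thus "x = y" using ab by simp
  qed
  moreover have "d \<le> \<bar>det (matrix (g' y))\<bar>" if "y \<in> R ` S" for y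
    using that d by (auto simp: det_g RiR)
  ultimately show "d * rvol S \<le> rvol (f ` S)"
    using B(3)[of d] by (simp add: gim mS mf)
qed

section \<open>Oscillation of sets\<close>

text \<open>The open s-neighbourhood of A in the sense of measure: it depends on A only up to null
  sets.\<close>

definition outer :: "real \<Rightarrow> (real^'n) set \<Rightarrow> (real^'n) set" where
  "outer s A = {x. 0 < vol (A \<inter> ball x s)}"

text \<open>The centres x for which the indicator of A has essential oscillation 1 on the ball of
  radius s.\<close>

definition osc :: "real \<Rightarrow> (real^'n) set \<Rightarrow> (real^'n) set" where
  "osc s A = outer s A \<inter> outer s (- A)"

lemma lebesgue_Int_ball [intro, simp]: "A \<in> leb \<Longrightarrow> A \<inter> ball x s \<in> leb"
  by auto

lemma lebesgue_Compl [intro]: "A \<in> leb \<Longrightarrow> - A \<in> leb"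
  by (metis Compl_in_sets_lebesgue)

lemma outer_mono:
  assumes "A \<subseteq> B" "s \<le> t" "B \<in> leb"
  shows "outer s A \<subseteq> outer t B"
proof
  fix x assume "x \<in> outer s A"
  moreover have "vol (A \<inter> ball x s) \<le> vol (B \<inter> ball x t)"
    by (rule emeasure_mono) (use assms in auto)
  ultimately show "x \<in> outer t B" unfolding outer_def by (auto intro: less_le_trans)
qed

lemma outer_Un:
  assumes "A \<in> leb" "B \<in> leb"
  shows "outer s (A \<union> B) = outer s A \<union> outer s B"
proof
  show "outer s A \<union> outer s B \<subseteq> outer s (A \<union> B)" using assms by (auto dest: outer_mono[THEN subsetD, rotated 3])
  show "outer s (A \<union> B) \<subseteq> outer s A \<union> outer s B"
  proof
    fix x assume x: "x \<in> outer s (A \<union> B)"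
    show "x \<in> outer s A \<union> outer s B"
    proof (rule ccontr)
      assume "x \<notin> outer s A \<union> outer s B"
      hence "A \<inter> ball x s \<in> nulls" "B \<inter> ball x s \<in> nulls"
        using assms by (auto simp: outer_def null_sets_def)
      hence "(A \<union> B) \<inter> ball x s \<in> nulls"
        by (simp add: Int_Un_distrib2 null_sets.Un)
      thus False using x by (auto simp: outer_def)
    qed
  qed
qed

lemma outer_null_diff:
  assumes "A \<in> leb" "B \<in> leb" "A - B \<in> nulls"
  shows "outer s A \<subseteq> outer s B"
proof
  fix x assume "x \<in> outer s A"
  hence "0 < vol (A \<inter> ball x s)" by (simp add: outer_def)
  also have "\<dots> \<le> vol ((B \<inter> ball x s) \<union> (A - B))"
    using assms by (intro emeasure_mono) auto
  also have "\<dots> = vol (B \<inter> ball x s)"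
    by (rule emeasure_Un_null_set) (use assms in auto)
  finally show "x \<in> outer s B" by (simp add: outer_def)
qed

text \<open>By continuity from below a slightly smaller ball already meets A in positive measure,
  and it is contained in the balls of radius s about nearby centres.\<close>

lemma open_outer:
  assumes A: "A \<in> leb"
  shows "open (outer s A)"
  unfolding open_contains_ball
proof
  fix x assume x: "x \<in> outer s A"
  have "A \<inter> ball x s = (\<Union>n. A \<inter> ball x (s - 1 / Suc n))"
  proof -
    have "\<exists>n. dist x y < s - 1 / Suc n" if "dist x y < s" for y
      using reals_Archimedean[of "s - dist x y"] that by (auto simp: inverse_eq_divide algebra_simps)
    moreover have "dist x y < s" if "dist x y < s - 1 / Suc n" for y n
      using that by (rule less_le_trans) simp
    ultimately show ?thesis by (auto simp del: of_nat_Suc)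
  qed
  moreover have "A \<inter> ball x s \<notin> nulls" using x by (auto simp: outer_def)
  ultimately have "\<exists>n. A \<inter> ball x (s - 1 / Suc n) \<notin> nulls"
    using null_sets_UN[of "\<lambda>n. A \<inter> ball x (s - 1 / Suc n)" lebesgue] by auto
  then obtain n where n: "A \<inter> ball x (s - 1 / Suc n) \<notin> nulls" ..
  have "ball x (1 / Suc n) \<subseteq> outer s A"
  proof
    fix y assume y: "y \<in> ball x (1 / Suc n)"
    have "ball x (s - 1 / Suc n) \<subseteq> ball y s"
    proof
      fix z assume "z \<in> ball x (s - 1 / Suc n)"
      thus "z \<in> ball y s" using y dist_triangle[of y z x] by (simp add: dist_commute)
    qed
    hence "vol (A \<inter> ball x (s - 1 / Suc n)) \<le> vol (A \<inter> ball y s)"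
      by (intro emeasure_mono) (use A in auto)
    moreover have "0 < vol (A \<inter> ball x (s - 1 / Suc n))"
      using n A by (metis lebesgue_Int_ball not_gr_zero null_setsI)
    ultimately show "y \<in> outer s A" by (auto simp: outer_def)
  qed
  thus "\<exists>e>0. ball x e \<subseteq> outer s A" by (intro exI[of _ "1 / Suc n"]) auto
qed

lemma open_osc: "A \<in> leb \<Longrightarrow> open (osc s A)"
  unfolding osc_def by (intro open_Int open_outer lebesgue_Compl)

lemma open_sets_lebesgue: "open A \<Longrightarrow> A \<in> leb"
  by (rule sets_completionI_sets) simp

lemma osc_sets [simp]: "A \<in> leb \<Longrightarrow> osc s A \<in> leb"
  by (rule open_sets_lebesgue[OF open_osc])

lemma osc_Compl: "osc s (- A) = osc s A"
  by (auto simp: osc_def)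

lemma osc_mono: "A \<in> leb \<Longrightarrow> s \<le> t \<Longrightarrow> osc s A \<subseteq> osc t A"
  unfolding osc_def by (intro Int_mono outer_mono lebesgue_Compl) auto

lemma outer_subset_neighborhood: "outer s A \<subseteq> {x. \<exists>y\<in>A. dist x y < s}"
proof
  fix x assume "x \<in> outer s A"
  hence "A \<inter> ball x s \<noteq> {}" by (auto simp: outer_def)
  thus "x \<in> {x. \<exists>y\<in>A. dist x y < s}" by auto
qed

lemma esssup_two_values:
  fixes a b :: ereal
  assumes A: "A \<in> sets M" and ab: "a \<le> b" and M: "emeasure M (space M) \<noteq> 0"
    and f: "\<And>x. x \<in> space M \<Longrightarrow> f x = (if x \<in> A then b else a)"
  shows "esssup M f = (if 0 < emeasure M A then b else a)"
proof -
  have "(\<lambda>x. if x \<in> A then b else a) \<in> borel_measurable M" using A by measurable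
  hence meas: "f \<in> borel_measurable M" using measurable_cong[of M f] f by simp
  show ?thesis
  proof (cases "0 < emeasure M A")
    case True
    have "esssup M f \<le> b" by (rule esssup_I[OF meas]) (use ab f in auto)
    moreover have "b \<le> esssup M f"
    proof (rule ccontr)
      assume less: "\<not> b \<le> esssup M f"
      have "AE x in M. f x \<le> esssup M f" by (rule esssup_AE)
      moreover have "AE x in M. x \<in> space M" by simp
      ultimately have "AE x in M. x \<notin> A" by eventually_elim (use less in \<open>auto simp: f\<close>)
      hence "A \<in> null_sets M" using A by (metis AE_iff_null_sets)
      thus False using True by (simp add: null_sets_def)
    qed
    ultimately show ?thesis using True by simp
  next
    case False
    hence "A \<in> null_sets M" using A by (auto simp: null_sets_def)
    hence "AE x in M. x \<notin> A" by (rule AE_not_in)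
    moreover have "AE x in M. x \<in> space M" by simp
    ultimately have "AE x in M. f x = a" by eventually_elim (auto simp: f)
    hence "esssup M f = esssup M (\<lambda>x. a)" by (intro esssup_AE_cong meas) auto
    thus ?thesis using False esssup_const[OF M] by simp
  qed
qed

lemma emeasure_ball_pos: "0 < s \<Longrightarrow> 0 < vol (ball (x::'a::euclidean_space) s)"
  using content_ball_pos[of s x] by (simp add: measure_def enn2real_positive_iff)

lemma ess_osc_indicator:
  assumes A: "A \<in> leb" and s: "0 < s"
  shows "e2ennreal (ess_osc (ball x s) (indicator A)) = indicator (osc s A) x"
proof -
  let ?M = "lebesgue_on (ball x s)"
  have b: "ball x s \<in> leb" by auto
  have M: "emeasure ?M (space ?M) \<noteq> 0"
    using emeasure_ball_pos[OF s, of x] by (simp add: emeasure_restrict_space b)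
  have em: "emeasure ?M (T \<inter> ball x s) = vol (T \<inter> ball x s)" "T \<inter> ball x s \<in> sets ?M"
    if "T \<in> leb" for T
    using that b by (auto simp: emeasure_restrict_space sets_restrict_space)
  have "esssup ?M (\<lambda>y. ereal (indicator A y)) = (if 0 < emeasure ?M (A \<inter> ball x s) then 1 else 0)"
    by (rule esssup_two_values[OF em(2)[OF A] _ M]) (auto simp: indicator_def)
  hence 1: "esssup ?M (\<lambda>y. ereal (indicator A y)) = (if x \<in> outer s A then 1 else 0)"
    by (simp add: em(1)[OF A] outer_def)
  have A': "- A \<in> leb" using A by auto
  have "esssup ?M (\<lambda>y. - ereal (indicator A y)) = (if 0 < emeasure ?M (- A \<inter> ball x s) then 0 else - 1)"
    by (rule esssup_two_values[OF em(2)[OF A'] _ M]) (auto simp: indicator_def one_ereal_def)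
  hence 2: "esssup ?M (\<lambda>y. - ereal (indicator A y)) = (if x \<in> outer s (- A) then 0 else - 1)"
    by (simp add: em(1)[OF A'] outer_def)
  show ?thesis
    unfolding ess_osc_def essinf_def 1 2 using outer_Un[OF A A', of s] emeasure_ball_pos[OF s, of x]
    by (auto simp: osc_def outer_def one_ereal_def zero_ereal_def ennreal_neg)
qed

lemma energy_eq_osc:
  assumes A: "A \<in> leb"
  shows "energy \<rho> f A = (\<integral>\<^sup>+ s\<in>{0<..<\<rho>}. (ennreal (- deriv f s) * vol (osc s A)) \<partial>lebesgue)"
  unfolding energy_def
proof (rule nn_integral_cong)
  fix s :: real
  show "ennreal (- 2 * s * deriv f s) * energy_at s A * indicator {0<..<\<rho>} s =
      ennreal (- deriv f s) * vol (osc s A) * indicator {0<..<\<rho>} s"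
  proof (cases "0 < s")
    case True
    have "energy_at s A = ennreal (1 / (2 * s)) * vol (osc s A)"
      unfolding energy_at_def using A by (simp add: ess_osc_indicator[OF A True])
    moreover have "ennreal (- 2 * s * deriv f s) * ennreal (1 / (2 * s)) = ennreal (- deriv f s)"
      using True by (subst ennreal_mult''[symmetric]) auto
    ultimately show ?thesis by (metis mult.assoc)
  qed (simp add: indicator_def)
qed

text \<open>The volume increases with s, so its superlevel sets are intervals.\<close>

lemma emeasure_osc_measurable:
  assumes A: "A \<in> leb"
  shows "(\<lambda>s. vol (osc s A)) \<in> borel_measurable borel"
proof (rule borel_measurableI_greater)
  fix y :: ennreal
  have "is_interval {s. y < vol (osc s A)}"
    unfolding is_interval_1
    using emeasure_mono[OF osc_mono[OF A] osc_sets[OF A]] by (auto intro: less_le_trans)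
  thus "{s \<in> space borel. y < vol (osc s A)} \<in> sets borel"
    by (simp add: real_interval_borel_measurable)
qed

text \<open>The oscillation sets of union and intersection have their union inside the union, and
  their intersection inside the intersection, of the oscillation sets of A and B. Volumes of two
  sets add up to those of their union and intersection.\<close>

lemma emeasure_osc_submodular:
  assumes A: "A \<in> leb" and B: "B \<in> leb"
  shows "vol (osc s (A \<union> B)) + vol (osc s (A \<inter> B)) \<le>
    vol (osc s A) + vol (osc s B)"
proof -
  have AB: "A \<union> B \<in> leb" "A \<inter> B \<in> leb" using A B by auto
  have m: "outer s (A \<inter> B) \<subseteq> outer s A" "outer s (A \<inter> B) \<subseteq> outer s B"
    "outer s (- (A \<union> B)) \<subseteq> outer s (- A)" "outer s (- (A \<union> B)) \<subseteq> outer s (- B)"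
    using outer_mono[of "A \<inter> B" A s s] outer_mono[of "A \<inter> B" B s s] A B
      outer_mono[of "- (A \<union> B)" "- A" s s] outer_mono[of "- (A \<union> B)" "- B" s s]
    by (simp_all add: lebesgue_Compl)
  have u: "outer s (A \<union> B) = outer s A \<union> outer s B" "outer s (- (A \<inter> B)) = outer s (- A) \<union> outer s (- B)"
    using A B outer_Un[of A B] outer_Un[of "-A" "-B"] by (auto simp: Compl_Int)
  have "vol (osc s (A \<union> B)) + vol (osc s (A \<inter> B)) =
      vol (osc s (A \<union> B) \<union> osc s (A \<inter> B)) + vol (osc s (A \<union> B) \<inter> osc s (A \<inter> B))"
    by (rule emeasure_Un_Int) (use AB in auto)
  also have "\<dots> \<le> vol (osc s A \<union> osc s B) + vol (osc s A \<inter> osc s B)"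
  proof (intro add_mono emeasure_mono)
    show "osc s (A \<union> B) \<union> osc s (A \<inter> B) \<subseteq> osc s A \<union> osc s B"
      "osc s (A \<union> B) \<inter> osc s (A \<inter> B) \<subseteq> osc s A \<inter> osc s B"
      unfolding osc_def u using m by blast+
  qed (use A B in auto)
  also have "\<dots> = vol (osc s A) + vol (osc s B)"
    by (rule emeasure_Un_Int[symmetric]) (use A B in auto)
  finally show ?thesis .
qed

text \<open>Fatou's lemma for the indicators: the volume in the ball is lower semicontinuous, so it
  stays positive.\<close>

lemma outer_pointwise_limit:
  assumes F: "\<And>n. F n \<in> leb" and A: "A \<in> leb"
    and lim: "\<And>x. \<forall>\<^sub>F n in sequentially. x \<in> F n \<longleftrightarrow> x \<in> A" and x: "x \<in> outer s A"
  shows "\<forall>\<^sub>F n in sequentially. x \<in> outer s (F n)"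
proof -
  have "vol (A \<inter> ball x s) = (\<integral>\<^sup>+ y. indicator (A \<inter> ball x s) y \<partial>lebesgue)"
    using A by simp
  also have "\<dots> \<le> (\<integral>\<^sup>+ y. liminf (\<lambda>n. indicator (F n \<inter> ball x s) y) \<partial>lebesgue)"
  proof (rule nn_integral_mono)
    fix y
    have "\<forall>\<^sub>F n in sequentially. (indicator (A \<inter> ball x s) y :: ennreal) \<le> indicator (F n \<inter> ball x s) y"
      using lim[of y] by eventually_elim (auto simp: indicator_def)
    thus "(indicator (A \<inter> ball x s) y :: ennreal) \<le> liminf (\<lambda>n. indicator (F n \<inter> ball x s) y)"
      by (rule Liminf_bounded)
  qed
  also have "\<dots> \<le> liminf (\<lambda>n. (\<integral>\<^sup>+ y. indicator (F n \<inter> ball x s) y \<partial>lebesgue))"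
    by (rule nn_integral_liminf) (intro borel_measurable_indicator lebesgue_Int_ball F)
  also have "\<dots> = liminf (\<lambda>n. vol (F n \<inter> ball x s))"
    using F by simp
  finally have "0 < liminf (\<lambda>n. vol (F n \<inter> ball x s))"
    using x by (auto simp: outer_def intro: less_le_trans)
  thus ?thesis
    unfolding outer_def by (auto dest: less_LiminfD)
qed

lemma osc_subset_ball:
  assumes "A \<subseteq> ball 0 R \<or> - A \<subseteq> ball 0 R"
  shows "osc s A \<subseteq> ball 0 (R + s)"
proof -
  have "outer s B \<subseteq> ball 0 (R + s)" if B: "B \<subseteq> ball 0 R" for B :: "(real^'n) set"
  proof
    fix x assume "x \<in> outer s B"
    then obtain y where "y \<in> B" "dist x y < s" using outer_subset_neighborhood by fastforce
    thus "x \<in> ball 0 (R + s)"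
      using B dist_triangle[of 0 x y] by (auto simp: dist_commute)
  qed
  thus ?thesis using assms unfolding osc_def by blast
qed

section \<open>The energy as a weighted measure of oscillation\<close>

locale radial_profile =
  fixes \<rho> \<delta> L :: real and f :: "real \<Rightarrow> real"
  assumes delta: "0 < \<delta>" "\<delta> < \<rho>"
    and lipschitz: "L-lipschitz_on UNIV f"
    and const: "f constant_on {- \<delta>..\<delta>}"
    and anti: "antimono_on {0..} f"
begin

abbreviation \<E> :: "(real^'k) set \<Rightarrow> ennreal" where "\<E> \<equiv> energy \<rho> f"

text \<open>A Borel version of - f' that is defined and bounded everywhere: a limit of difference
  quotients, clamped to the interval from 0 to L and cut off to scales from \<delta> to \<rho>.
  Below \<delta> the profile is constant.\<close>

definition weight :: "real \<Rightarrow> real" where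
  "weight s = indicator {\<delta>..<\<rho>} s *
    max 0 (min L (- lim (\<lambda>n. (f (s + 1 / Suc n) - f s) * Suc n)))"

lemma L_nonneg: "0 \<le> L" using lipschitz by (rule lipschitz_on_nonneg)

lemma f_measurable [measurable]: "f \<in> borel_measurable borel"
  using lipschitz by (intro borel_measurable_continuous_onI lipschitz_on_continuous_on)

lemma weight_measurable [measurable]: "weight \<in> borel_measurable borel"
  unfolding weight_def by (intro borel_measurable_times borel_measurable_max borel_measurable_min
      borel_measurable_uminus borel_measurable_lim_metric) measurable

lemma weight_nonneg: "0 \<le> weight s" and weight_le: "weight s \<le> L"
  using L_nonneg by (auto simp: weight_def indicator_def)

lemma weight_eq_0: "s \<notin> {\<delta>..<\<rho>} \<Longrightarrow> weight s = 0"
  by (simp add: weight_def)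

lemma weight_AE: "AE s in lebesgue. s \<in> {0<..<\<rho>} \<longrightarrow> deriv f s = - weight s"
proof -
  \<comment> \<open>f is monotone on the half line from 0 on; freezing it to the left of 0 gives a
    monotone function on the whole line.\<close>
  define F where "F x = - f (max 0 x)" for x
  have "mono F"
    using anti by (auto simp: F_def mono_def monotone_on_def)
  moreover have "L-lipschitz_on UNIV F"
  proof (rule lipschitz_onI[OF _ L_nonneg])
    fix x y :: real
    have "dist (F x) (F y) \<le> L * dist (max 0 x) (max 0 y)"
      using lipschitz_onD[OF lipschitz, of "max 0 x" "max 0 y"] by (simp add: F_def dist_minus)
    also have "\<dots> \<le> L * dist x y"
      by (intro mult_left_mono L_nonneg) (auto simp: dist_real_def max_def abs_if)
    finally show "dist (F x) (F y) \<le> L * dist x y" .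
  qed
  ultimately have "AE s in lebesgue. F differentiable at s" by (rule lipschitz_mono_differentiable_AE)
  thus ?thesis
  proof eventually_elim
    case (elim s)
    show ?case
    proof
      assume s: "s \<in> {0<..<\<rho>}"
      obtain D where "(F has_real_derivative D) (at s)" using elim by (auto simp: real_differentiable_def)
      hence "((\<lambda>x. - F x) has_real_derivative - D) (at s)" by (rule DERIV_minus)
      hence D: "(f has_real_derivative - D) (at s)"
        by (rule DERIV_cong_ev[OF refl _ refl, THEN iffD1, rotated])
           (use s eventually_nhds_in_open[of "{0<..}" s] in \<open>auto simp: F_def elim: eventually_mono\<close>)
      define q where "q n = (f (s + 1 / Suc n) - f s) * Suc n" for n
      have "(\<lambda>n. (f (s + 1 / Suc n) - f s) / (1 / Suc n)) \<longlonglongrightarrow> - D"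
      proof (rule filterlim_compose[OF D[unfolded DERIV_def]])
        show "filterlim (\<lambda>n. 1 / real (Suc n)) (at 0) sequentially"
          unfolding filterlim_at using LIMSEQ_inverse_real_of_nat by (simp add: inverse_eq_divide)
      qed
      hence q: "q \<longlonglongrightarrow> - D" by (simp add: q_def[abs_def])
      have "q n \<le> 0" for n
        using anti s by (auto simp: q_def monotone_on_def intro!: mult_nonpos_nonneg)
      hence D0: "- D \<le> 0" using q by (intro LIMSEQ_le_const2) auto
      have "- L \<le> q n" for n
      proof -
        have "\<bar>f (s + 1 / Suc n) - f s\<bar> \<le> L * (1 / Suc n)"
          using lipschitz_onD[OF lipschitz, of "s + 1 / Suc n" s] by (simp add: dist_real_def)
        hence "\<bar>q n\<bar> \<le> L" by (simp add: q_def abs_mult pos_le_divide_eq)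
        thus ?thesis by linarith
      qed
      hence DL: "- L \<le> - D" using q by (intro LIMSEQ_le_const) auto
      have lim: "lim q = - D" using q by (rule limI)
      have d: "deriv f s = - D" using D by (rule DERIV_imp_deriv)
      show "deriv f s = - weight s"
      proof (cases "\<delta> \<le> s")
        case True
        thus ?thesis using s D0 DL lim d by (simp add: weight_def q_def[abs_def])
      next
        case False
        obtain c where "\<And>x. x \<in> {-\<delta>..\<delta>} \<Longrightarrow> f x = c" using const by (auto simp: constant_on_def)
        hence c: "\<And>x. x \<in> {0<..<\<delta>} \<Longrightarrow> c = f x" by force
        have "(f has_real_derivative 0) (at s)"
          by (rule has_field_derivative_transform_within_open[of "\<lambda>x. c" 0 s "{0<..<\<delta>}"])
             (use s False c in auto)
        thus ?thesis using False by (simp add: weight_def DERIV_imp_deriv)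
      qed
    qed
  qed
qed

lemma energy_eq:
  assumes A: "A \<in> leb"
  shows "\<E> A = (\<integral>\<^sup>+ s. ennreal (weight s) * vol (osc s A) \<partial>lborel)"
proof -
  have "\<E> A = (\<integral>\<^sup>+ s. ennreal (weight s) * vol (osc s A) \<partial>lebesgue)"
    unfolding energy_eq_osc[OF A]
  proof (rule nn_integral_cong_AE, use weight_AE in eventually_elim)
    case (elim s)
    thus ?case using weight_eq_0[of s] delta by (auto simp: indicator_def)
  qed
  also have "\<dots> = (\<integral>\<^sup>+ s. ennreal (weight s) * vol (osc s A) \<partial>lborel)"
    by (rule nn_integral_completion)
  finally show ?thesis .
qed

lemma energy_Compl: "A \<in> leb \<Longrightarrow> \<E> (- A) = \<E> A"
  by (simp add: energy_eq osc_Compl lebesgue_Compl)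

lemma energy_submodular:
  assumes A: "A \<in> leb" and B: "B \<in> leb"
  shows "\<E> (A \<union> B) + \<E> (A \<inter> B) \<le> \<E> A + \<E> B"
proof -
  have AB: "A \<union> B \<in> leb" "A \<inter> B \<in> leb" using A B by auto
  note [measurable] = emeasure_osc_measurable[OF A] emeasure_osc_measurable[OF B]
    emeasure_osc_measurable[OF AB(1)] emeasure_osc_measurable[OF AB(2)]
  show ?thesis
    unfolding energy_eq[OF A] energy_eq[OF B] energy_eq[OF AB(1)] energy_eq[OF AB(2)]
    by (subst (1 2) nn_integral_add[symmetric])
       (auto simp: distrib_left[symmetric] intro!: nn_integral_mono mult_left_mono emeasure_osc_submodular A B)
qed

text \<open>Fatou's lemma is used twice, over the centres x for fixed s and then over s.\<close>

lemma energy_lsc: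
  assumes F: "\<And>n. F n \<in> leb" and A: "A \<in> leb"
    and lim: "\<And>x. \<forall>\<^sub>F n in sequentially. x \<in> F n \<longleftrightarrow> x \<in> A"
  shows "\<E> A \<le> liminf (\<lambda>n. \<E> (F n))"
proof -
  have lim': "\<forall>\<^sub>F n in sequentially. x \<in> - F n \<longleftrightarrow> x \<in> - A" for x
    using lim[of x] by simp
  have pw: "ennreal (weight s) * vol (osc s A) \<le> liminf (\<lambda>n. ennreal (weight s) * vol (osc s (F n)))" for s
  proof -
    have "ennreal (weight s) * vol (osc s A) = (\<integral>\<^sup>+ x. ennreal (weight s) * indicator (osc s A) x \<partial>lebesgue)"
      by (rule nn_integral_cmult_indicator[OF osc_sets[OF A], symmetric])
    also have "\<dots> \<le> (\<integral>\<^sup>+ x. liminf (\<lambda>n. ennreal (weight s) * indicator (osc s (F n)) x) \<partial>lebesgue)"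
    proof (rule nn_integral_mono)
      fix x
      have "\<forall>\<^sub>F n in sequentially. ennreal (weight s) * indicator (osc s A) x \<le> ennreal (weight s) * indicator (osc s (F n)) x"
      proof (cases "x \<in> osc s A")
        case True
        hence "\<forall>\<^sub>F n in sequentially. x \<in> outer s (F n)" "\<forall>\<^sub>F n in sequentially. x \<in> outer s (- F n)"
          using outer_pointwise_limit[OF F A lim] outer_pointwise_limit[OF _ _ lim', where s=s and x=x] F A
          by (auto simp: osc_def lebesgue_Compl)
        thus ?thesis by eventually_elim (simp add: osc_def indicator_def)
      qed simp
      thus "ennreal (weight s) * indicator (osc s A) x \<le> liminf (\<lambda>n. ennreal (weight s) * indicator (osc s (F n)) x)"
        by (rule Liminf_bounded)
    qed
    also have "\<dots> \<le> liminf (\<lambda>n. \<integral>\<^sup>+ x. ennreal (weight s) * indicator (osc s (F n)) x \<partial>lebesgue)"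
      by (rule nn_integral_liminf)
         (intro borel_measurable_times_ennreal borel_measurable_const borel_measurable_indicator osc_sets F)
    also have "\<dots> = liminf (\<lambda>n. ennreal (weight s) * vol (osc s (F n)))"
      unfolding nn_integral_cmult_indicator[OF osc_sets[OF F]] ..
    finally show ?thesis .
  qed
  note [measurable] = emeasure_osc_measurable[OF F]
  have "\<E> A \<le> (\<integral>\<^sup>+ s. liminf (\<lambda>n. ennreal (weight s) * vol (osc s (F n))) \<partial>lborel)"
    unfolding energy_eq[OF A] by (intro nn_integral_mono pw)
  also have "\<dots> \<le> liminf (\<lambda>n. \<E> (F n))"
    unfolding energy_eq[OF F] by (rule nn_integral_liminf) measurable
  finally show ?thesis .
qed

lemma energy_null_diff:
  assumes "A \<in> leb" "B \<in> leb" "sym_diff A B \<in> nulls"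
  shows "\<E> A = \<E> B"
proof -
  have n: "A - B \<in> nulls" "B - A \<in> nulls"
    using assms by (auto intro: null_sets_subset)
  have n': "- A - - B \<in> nulls" "- B - - A \<in> nulls"
    using n by (simp_all add: Diff_eq Int_commute)
  have "outer s A = outer s B" for s
    by (rule subset_antisym[OF outer_null_diff[OF assms(1,2) n(1)] outer_null_diff[OF assms(2,1) n(2)]])
  moreover have "outer s (- A) = outer s (- B)" for s
    using outer_null_diff[OF _ _ n'(1)] outer_null_diff[OF _ _ n'(2)] assms(1,2)
    by (intro subset_antisym) (auto simp: lebesgue_Compl)
  ultimately have "osc s A = osc s B" for s by (simp add: osc_def)
  thus ?thesis using assms by (simp add: energy_eq)
qed

lemma energy_finite:
  assumes A: "A \<in> leb" and "bounded A \<or> bounded (- A)"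
  shows "\<E> A < \<infinity>"
proof -
  obtain R where R: "A \<subseteq> ball 0 R \<or> - A \<subseteq> ball 0 R" "0 < R"
    using assms(2) bounded_subset_ballD[of A 0] bounded_subset_ballD[of "- A" 0] by blast
  have "\<E> A \<le> (\<integral>\<^sup>+ s. (ennreal L * vol (ball (0::real^'a) (R + \<rho>))) * indicator {\<delta>..<\<rho>} s \<partial>lborel)"
    unfolding energy_eq[OF A]
  proof (rule nn_integral_mono)
    fix s
    show "ennreal (weight s) * vol (osc s A) \<le> (ennreal L * vol (ball (0::real^'a) (R + \<rho>))) * indicator {\<delta>..<\<rho>} s"
    proof (cases "s \<in> {\<delta>..<\<rho>}")
      case True
      have "osc s A \<subseteq> ball 0 (R + \<rho>)" using osc_subset_ball[OF R(1), of s] True by auto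
      hence "vol (osc s A) \<le> vol (ball (0::real^'a) (R + \<rho>))"
        by (rule emeasure_mono) auto
      with ennreal_leI[OF weight_le[of s]]
      have "ennreal (weight s) * vol (osc s A) \<le> ennreal L * vol (ball (0::real^'a) (R + \<rho>))"
        by (rule mult_mono) simp_all
      thus ?thesis using True by simp
    qed (simp add: weight_eq_0)
  qed
  also have "\<dots> < \<infinity>"
    using delta emeasure_lborel_ball_finite[of "0::real^'a" "R + \<rho>"]
    by (simp add: nn_integral_cmult ennreal_mult_less_top)
  finally show ?thesis .
qed

end

section \<open>Good representatives\<close>

text \<open>The interior in the sense of measure: points around which A misses only a null
  set.\<close>

definition full :: "(real^'n) set \<Rightarrow> (real^'n) set" where
  "full A = {x. \<exists>r>0. ball x r - A \<in> nulls}"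

lemma full_ball:
  assumes A: "A \<in> leb" and null: "ball x r - A \<in> nulls"
  shows "ball x r \<subseteq> full A"
proof
  fix y assume y: "y \<in> ball x r"
  then obtain e where e: "e > 0" "ball y e \<subseteq> ball x r" using openE[OF open_ball y] by blast
  hence "ball y e - A \<in> nulls" using A by (intro null_sets_subset[OF null]) auto
  thus "y \<in> full A" using e by (auto simp: full_def)
qed

lemma open_full: "A \<in> leb \<Longrightarrow> open (full A)"
  unfolding open_contains_ball
proof
  fix x assume A: "A \<in> leb" and "x \<in> full A"
  then obtain r where "r > 0" "ball x r - A \<in> nulls" by (auto simp: full_def)
  thus "\<exists>e>0. ball x e \<subseteq> full A" using full_ball[OF A] by blast
qed

text \<open>By Lindelof's theorem countably many of the balls that A fills up to a null set cover
  \<open>full A\<close>.\<close>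

lemma full_diff_null:
  assumes A: "A \<in> leb"
  shows "full A - A \<in> nulls"
proof -
  define \<B> where "\<B> = {ball x r | x r. 0 < r \<and> ball x r - A \<in> nulls}"
  obtain \<C> where C: "\<C> \<subseteq> \<B>" "countable \<C>" "\<Union>\<C> = \<Union>\<B>"
    using Lindelof[of \<B>] by (auto simp: \<B>_def)
  have "full A \<subseteq> \<Union>\<B>" by (force simp: full_def \<B>_def)
  hence "full A - A \<subseteq> (\<Union>B\<in>\<C>. B - A)" using C(3) by auto
  moreover have "(\<Union>B\<in>\<C>. B - A) \<in> nulls"
    by (rule null_sets_UN') (use C in \<open>auto simp: \<B>_def\<close>)
  ultimately show ?thesis
    by (rule null_sets_subset[rotated 2]) (use open_sets_lebesgue[OF open_full[OF A]] A in auto)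
qed

lemma full_disjoint:
  assumes A: "A \<in> leb"
  shows "full A \<inter> full (- A) = {}"
proof (rule ccontr)
  assume "full A \<inter> full (- A) \<noteq> {}"
  then obtain x r s where r: "r > 0" "ball x r - A \<in> nulls" "s > 0" "ball x s - - A \<in> nulls"
    by (auto simp: full_def)
  have "ball x (min r s) \<subseteq> (ball x r - A) \<union> (ball x s - - A)" by auto
  hence "ball x (min r s) \<in> nulls"
    by (rule null_sets_subset[OF null_sets.Un[OF r(2) r(4)], rotated]) simp
  thus False using emeasure_ball_pos[of "min r s" x] r by auto
qed

text \<open>Phrased with \<open>full\<close>, the condition is visibly invariant under complements:
  the frontier consists of the points around which neither F nor its complement has full
  measure.\<close>

lemma good_representative_iff:
  assumes F: "F \<in> leb"
  shows "good_representative F \<longleftrightarrow> frontier F = - (full F \<union> full (- F))"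
proof -
  have "vol (F \<inter> ball x r) < vol (ball x r) \<longleftrightarrow> ball x r - F \<notin> nulls" for x r
  proof -
    have fin: "vol (F \<inter> ball x r) \<noteq> \<infinity>"
      using emeasure_lborel_ball_finite[of x r] emeasure_mono[of "F \<inter> ball x r" "ball x r" lebesgue]
      by (auto simp: top_unique)
    have "vol (ball x r) = vol (F \<inter> ball x r) + vol (ball x r - F)"
    proof -
      have un: "F \<inter> ball x r \<union> (ball x r - F) = ball x r" by auto
      have "vol (F \<inter> ball x r) + vol (ball x r - F) =
          vol (F \<inter> ball x r \<union> (ball x r - F))"
        by (rule plus_emeasure) (use F in auto)
      thus ?thesis by (simp only: un)
    qed
    moreover have "vol (F \<inter> ball x r) < vol (F \<inter> ball x r) + c \<longleftrightarrow> c \<noteq> 0" for c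
      using fin ennreal_add_left_cancel_less[of "vol (F \<inter> ball x r)" 0 c]
      by (simp add: less_top zero_less_iff_neq_zero del: emeasure_completion)
    moreover have "ball x r - F \<in> nulls \<longleftrightarrow> vol (ball x r - F) = 0"
    proof -
      have "ball x r - F \<in> leb" using F by auto
      thus ?thesis by (simp add: null_sets_def del: emeasure_completion)
    qed
    ultimately show ?thesis by metis
  qed
  moreover have "0 < vol (F \<inter> ball x r) \<longleftrightarrow> ball x r - - F \<notin> nulls" for x r
    using F by (auto simp: null_sets_def zero_less_iff_neq_zero Int_commute Diff_eq)
  ultimately show ?thesis
    unfolding good_representative_def by (auto simp: full_def)
qed

lemma good_representative_Compl:
  assumes F: "F \<in> leb"
  shows "good_representative (- F) \<longleftrightarrow> good_representative F"
  using F by (simp add: good_representative_iff lebesgue_Compl frontier_complement Un_commute)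

lemma good_representative_full_interior:
  assumes F: "F \<in> leb" and g: "good_representative F"
  shows "full F \<subseteq> interior F"
proof
  fix x assume x: "x \<in> full F"
  hence "x \<notin> frontier F" using g F by (auto simp: good_representative_iff)
  moreover have "x \<notin> interior (- F)"
  proof
    assume "x \<in> interior (- F)"
    then obtain e where "e > 0" "ball x e \<subseteq> - F" by (auto simp: mem_interior)
    hence "x \<in> full (- F)" by (auto simp: full_def intro!: exI[of _ e]) (metis Diff_Compl Int_absorb2 Int_commute disjoint_eq_subset_Compl null_sets.empty_sets)
    thus False using full_disjoint[OF F] x by auto
  qed
  ultimately show "x \<in> interior F" by (auto simp: frontier_def interior_closure)
qed

text \<open>Turns a single point of a solution into positive volume nearby, so that nonempty pieces
  can be fed into volume estimates.\<close>

lemma good_representative_pos: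
  assumes F: "F \<in> leb" and g: "good_representative F" and x: "x \<in> F" and r: "0 < r"
  shows "x \<in> outer r F"
proof (rule ccontr)
  assume "x \<notin> outer r F"
  hence "ball x r - - F \<in> nulls"
    using F by (auto simp: outer_def null_sets_def Int_commute Diff_eq)
  hence "x \<in> full (- F)" using r by (auto simp: full_def)
  hence "x \<in> interior (- F)"
    using good_representative_full_interior[of "- F"] F g by (auto simp: good_representative_Compl lebesgue_Compl)
  thus False using x interior_subset by blast
qed

text \<open>Adding \<open>full F\<close> and removing \<open>full (- F)\<close> changes F by a null
  set, and afterwards these open sets lie in the interior and the exterior. Every other point has
  both sets in each of its neighbourhoods.\<close>

lemma good_representative_exists:
  assumes F: "F \<in> leb"
  obtains G where "G \<in> leb" "good_representative G" "sym_diff F G \<in> nulls"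
proof -
  define G where "G = (F \<union> full F) - full (- F)"
  have F': "- F \<in> leb" using F by auto
  have o: "full F \<in> leb" "full (- F) \<in> leb"
    using F F' by (auto intro!: open_sets_lebesgue open_full)
  have G: "G \<in> leb" unfolding G_def using F o by auto
  have "sym_diff F G \<subseteq> (full F - F) \<union> (full (- F) - - F)" by (auto simp: G_def)
  hence nul: "sym_diff F G \<in> nulls"
    using F G by (intro null_sets_subset[OF null_sets.Un[OF full_diff_null[OF F] full_diff_null[OF F']]]) auto
  have eq: "full A = full B" if "sym_diff A B \<in> nulls" "A \<in> leb" "B \<in> leb" for A B :: "(real^'a) set"
  proof -
    have "ball x r - A \<in> nulls \<longleftrightarrow> ball x r - B \<in> nulls" for x r
    proof
      assume nA: "ball x r - A \<in> nulls"
      show "ball x r - B \<in> nulls"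
        by (rule null_sets_subset[OF null_sets.Un[OF nA that(1)]]) (use that in auto)
    next
      assume nB: "ball x r - B \<in> nulls"
      show "ball x r - A \<in> nulls"
        by (rule null_sets_subset[OF null_sets.Un[OF nB that(1)]]) (use that in auto)
    qed
    thus ?thesis by (simp add: full_def)
  qed
  have e1: "full G = full F" by (rule eq[symmetric]) (use nul F G in auto)
  have "sym_diff (- F) (- G) = sym_diff F G" by auto
  hence e2: "full (- G) = full (- F)" by (intro eq[symmetric]) (use nul F G in auto)
  have "frontier G = - (full F \<union> full (- F))"
  proof
    have "full F \<subseteq> interior G"
      by (rule interior_maximal) (use full_disjoint[OF F] open_full[OF F] in \<open>auto simp: G_def\<close>)
    moreover have "full (- F) \<subseteq> interior (- G)"
      by (rule interior_maximal) (use open_full[OF F'] in \<open>auto simp: G_def\<close>)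
    ultimately show "frontier G \<subseteq> - (full F \<union> full (- F))"
      by (auto simp: frontier_def interior_closure)
    show "- (full F \<union> full (- F)) \<subseteq> frontier G"
    proof
      fix x assume x: "x \<in> - (full F \<union> full (- F))"
      have nx: "ball x r - G \<notin> nulls" "ball x r - - G \<notin> nulls" if "r > 0" for r
        using x that unfolding e1[symmetric] e2[symmetric] by (auto simp: full_def)
      have "\<exists>y\<in>ball x r. y \<in> G" "\<exists>y\<in>ball x r. y \<notin> G" if "r > 0" for r
      proof -
        have "ball x r - G \<noteq> {}" "ball x r - - G \<noteq> {}"
          using nx[OF that] null_sets.empty_sets by metis+
        thus "\<exists>y\<in>ball x r. y \<in> G" "\<exists>y\<in>ball x r. y \<notin> G" by auto
      qed
      thus "x \<in> frontier G" unfolding frontier_straddle mem_Collect_eq by (metis mem_ball)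
    qed
  qed
  hence "good_representative G" by (simp add: good_representative_iff[OF G] e1 e2)
  thus thesis using that G nul by blast
qed

text \<open>Fatou's lemma on a space of two points with counting measure.\<close>

lemma ennreal_liminf_add_le:
  fixes u v :: "nat \<Rightarrow> ennreal"
  shows "liminf u + liminf v \<le> liminf (\<lambda>n. u n + v n)"
  using nn_integral_liminf[of "\<lambda>n b. if b then u n else v n" "count_space (UNIV :: bool set)"]
  by (simp add: nn_integral_count_space_finite UNIV_bool if_distrib cong: if_cong) (simp add: ac_simps)

section \<open>The functional of the incremental problem\<close>

text \<open>The dissipation density becomes a measure, so that symmetric differences can be split by
  additivity.\<close>

definition boundary_mass :: "(real^'n) set \<Rightarrow> (real^'n) measure" where
  "boundary_mass E = density lebesgue (\<lambda>x. ennreal (infdist x (frontier E)))"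

abbreviation bmass :: "(real^'n) set \<Rightarrow> (real^'n) set \<Rightarrow> ennreal" where "bmass E \<equiv> emeasure (boundary_mass E)"

lemma infdist_measurable_lebesgue: "(\<lambda>x. ennreal (infdist (x::real^'n) A)) \<in> borel_measurable lebesgue"
proof -
  have "(\<lambda>x::real^'n. infdist x A) \<in> borel_measurable borel"
    by (intro borel_measurable_continuous_onI continuous_intros)
  thus ?thesis by (intro measurable_completion) simp
qed

lemma sets_boundary_mass [simp]: "sets (boundary_mass E) = leb"
  by (simp add: boundary_mass_def)

lemma emeasure_boundary_mass:
  "A \<in> leb \<Longrightarrow> bmass E A = (\<integral>\<^sup>+ x\<in>A. ennreal (infdist x (frontier E)) \<partial>lebesgue)"
  unfolding boundary_mass_def by (rule emeasure_density[OF infdist_measurable_lebesgue])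

lemma boundary_mass_Compl: "boundary_mass (- E) = boundary_mass E"
  by (simp add: boundary_mass_def frontier_complement)

lemma boundary_mass_ge:
  assumes A: "A \<in> leb" and c: "0 \<le> c" and le: "\<And>x. x \<in> A \<Longrightarrow> c \<le> infdist x (frontier E)"
  shows "ennreal c * vol A \<le> bmass E A"
proof -
  have "ennreal c * vol A = (\<integral>\<^sup>+ x. ennreal c * indicator A x \<partial>lebesgue)"
    using A by (simp add: nn_integral_cmult_indicator)
  also have "\<dots> \<le> bmass E A"
    unfolding emeasure_boundary_mass[OF A]
    by (intro nn_integral_mono) (auto simp: indicator_def intro!: ennreal_leI le)
  finally show ?thesis .
qed

lemma boundary_mass_le:
  assumes A: "A \<in> leb" and le: "\<And>x. x \<in> A \<Longrightarrow> infdist x (frontier E) \<le> c"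
  shows "bmass E A \<le> ennreal c * vol A"
proof -
  have "bmass E A \<le> (\<integral>\<^sup>+ x. ennreal c * indicator A x \<partial>lebesgue)"
    unfolding emeasure_boundary_mass[OF A]
    by (intro nn_integral_mono) (auto simp: indicator_def intro!: ennreal_leI le)
  thus ?thesis using A by (simp add: nn_integral_cmult_indicator)
qed

lemma step_functional_eq:
  assumes "E \<in> leb" "F \<in> leb"
  shows "step_functional \<rho> f h E F = energy \<rho> f F + ennreal (1 / h) * bmass E (sym_diff F E)"
  unfolding step_functional_def using assms by (simp add: emeasure_boundary_mass)

context radial_profile
begin

abbreviation J where "J h E F \<equiv> step_functional \<rho> f h E F"

lemma J_Compl:
  assumes "E \<in> leb" "F \<in> leb"
  shows "J h (- E) (- F) = J h E F"
proof -
  have "sym_diff (- F) (- E) = sym_diff F E" by auto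
  thus ?thesis
    using assms by (simp add: step_functional_eq lebesgue_Compl energy_Compl boundary_mass_Compl)
qed

lemma J_submodular:
  assumes E: "E \<in> leb" and A: "A \<in> leb" and B: "B \<in> leb"
  shows "J h E (A \<union> B) + J h E (A \<inter> B) \<le> J h E A + J h E B"
proof -
  let ?m = "bmass E"
  have AB: "A \<union> B \<in> leb" "A \<inter> B \<in> leb" using A B by auto
  have "?m (sym_diff (A \<union> B) E) + ?m (sym_diff (A \<inter> B) E) =
      ?m (sym_diff (A \<union> B) E \<union> sym_diff (A \<inter> B) E) + ?m (sym_diff (A \<union> B) E \<inter> sym_diff (A \<inter> B) E)"
    by (rule emeasure_Un_Int) (use E A B in auto)
  also have "sym_diff (A \<union> B) E \<union> sym_diff (A \<inter> B) E = sym_diff A E \<union> sym_diff B E" by auto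
  also have "sym_diff (A \<union> B) E \<inter> sym_diff (A \<inter> B) E = sym_diff A E \<inter> sym_diff B E" by auto
  also have "?m (sym_diff A E \<union> sym_diff B E) + ?m (sym_diff A E \<inter> sym_diff B E) = ?m (sym_diff A E) + ?m (sym_diff B E)"
    by (rule emeasure_Un_Int[symmetric]) (use E A B in auto)
  finally have m: "?m (sym_diff (A \<union> B) E) + ?m (sym_diff (A \<inter> B) E) = ?m (sym_diff A E) + ?m (sym_diff B E)" .
  have "J h E (A \<union> B) + J h E (A \<inter> B) = (\<E> (A \<union> B) + \<E> (A \<inter> B)) +
      ennreal (1 / h) * (?m (sym_diff (A \<union> B) E) + ?m (sym_diff (A \<inter> B) E))"
    by (simp only: step_functional_eq[OF E AB(1)] step_functional_eq[OF E AB(2)] distrib_left ac_simps)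
  also have "\<dots> \<le> (\<E> A + \<E> B) + ennreal (1 / h) * (?m (sym_diff A E) + ?m (sym_diff B E))"
    unfolding m by (intro add_right_mono energy_submodular A B)
  also have "\<dots> = J h E A + J h E B"
    by (simp only: step_functional_eq[OF E A] step_functional_eq[OF E B] distrib_left ac_simps)
  finally show ?thesis .
qed

lemma J_lsc:
  assumes E: "E \<in> leb" and F: "\<And>n. F n \<in> leb" and A: "A \<in> leb"
    and lim: "\<And>x. \<forall>\<^sub>F n in sequentially. x \<in> F n \<longleftrightarrow> x \<in> A"
  shows "J h E A \<le> liminf (\<lambda>n. J h E (F n))"
proof -
  let ?g = "\<lambda>F x. ennreal (1 / h) * (ennreal (infdist x (frontier E)) * indicator (sym_diff F E) x)"
  have meas: "?g G \<in> borel_measurable lebesgue" if "G \<in> leb" for G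
    using that E by (intro borel_measurable_times_ennreal borel_measurable_const infdist_measurable_lebesgue borel_measurable_indicator) auto
  have J: "J h E G = \<E> G + (\<integral>\<^sup>+ x. ?g G x \<partial>lebesgue)" if "G \<in> leb" for G
    using that E unfolding step_functional_def
    by (subst nn_integral_cmult) (auto intro!: borel_measurable_times_ennreal infdist_measurable_lebesgue borel_measurable_indicator)
  have "(\<integral>\<^sup>+ x. ?g A x \<partial>lebesgue) \<le> (\<integral>\<^sup>+ x. liminf (\<lambda>n. ?g (F n) x) \<partial>lebesgue)"
  proof (rule nn_integral_mono)
    fix x
    have "\<forall>\<^sub>F n in sequentially. ?g A x \<le> ?g (F n) x"
      using lim[of x] by eventually_elim (auto simp: indicator_def)
    thus "?g A x \<le> liminf (\<lambda>n. ?g (F n) x)" by (rule Liminf_bounded)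
  qed
  also have "\<dots> \<le> liminf (\<lambda>n. \<integral>\<^sup>+ x. ?g (F n) x \<partial>lebesgue)"
    by (rule nn_integral_liminf) (use meas F in auto)
  finally have "\<E> A + (\<integral>\<^sup>+ x. ?g A x \<partial>lebesgue) \<le>
      liminf (\<lambda>n. \<E> (F n)) + liminf (\<lambda>n. \<integral>\<^sup>+ x. ?g (F n) x \<partial>lebesgue)"
    by (intro add_mono energy_lsc F A lim)
  also have "\<dots> \<le> liminf (\<lambda>n. \<E> (F n) + (\<integral>\<^sup>+ x. ?g (F n) x \<partial>lebesgue))"
    by (rule ennreal_liminf_add_le)
  finally show ?thesis by (simp only: J[OF A] J[OF F])
qed

lemma J_null_diff:
  assumes E: "E \<in> leb" and "A \<in> leb" "B \<in> leb" "sym_diff A B \<in> nulls"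
  shows "J h E A = J h E B"
proof -
  have "AE x in lebesgue. x \<notin> sym_diff A B" using assms(4) by (rule AE_not_in)
  hence "(\<integral>\<^sup>+ x\<in>sym_diff A E. ennreal (infdist x (frontier E)) \<partial>lebesgue) =
     (\<integral>\<^sup>+ x\<in>sym_diff B E. ennreal (infdist x (frontier E)) \<partial>lebesgue)"
  proof (intro nn_integral_cong_AE, elim eventually_mono)
    fix x assume "x \<notin> sym_diff A B"
    hence "x \<in> A \<longleftrightarrow> x \<in> B" by blast
    thus "ennreal (infdist x (frontier E)) * indicator (sym_diff A E) x =
        ennreal (infdist x (frontier E)) * indicator (sym_diff B E) x"
      by (simp add: indicator_def)
  qed
  thus ?thesis using energy_null_diff[OF assms(2-4)] by (simp add: step_functional_def)
qed

end

lemma liminf_le_const: "(\<And>n. (X n :: ennreal) \<le> c) \<Longrightarrow> liminf X \<le> c"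
  using Liminf_mono[of X "\<lambda>_. c" sequentially] by (simp add: Liminf_const)

context radial_profile
begin

text \<open>Excesses over a lower bound m add up under unions: in the submodular inequality the
  value at the intersection is at least m, and the finite m cancels.\<close>

lemma J_Un_le:
  assumes E: "E \<in> leb" and A: "A \<in> leb" and B: "B \<in> leb"
    and m: "\<And>G. G \<in> leb \<Longrightarrow> m \<le> J h E G" "m < \<infinity>"
    and le: "J h E A \<le> m + a" "J h E B \<le> m + b"
  shows "J h E (A \<union> B) \<le> m + (a + b)"
proof -
  have "m + J h E (A \<union> B) \<le> J h E (A \<inter> B) + J h E (A \<union> B)"
    by (intro add_right_mono m) (use A B in auto)
  also have "\<dots> \<le> J h E A + J h E B" using J_submodular[OF E A B] by (simp add: add.commute)
  also have "\<dots> \<le> (m + a) + (m + b)" by (intro add_mono le)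
  also have "\<dots> = m + (m + (a + b))" by (simp add: ac_simps)
  finally show ?thesis using m(2) by (auto simp: ennreal_add_left_cancel_le)
qed

text \<open>Unions and monotone limits of almost minimizers are almost minimizers, by submodularity and
  lower semicontinuity; this replaces a compactness argument.\<close>

lemma minimizer_exists:
  assumes E: "E \<in> leb" and G0: "G0 \<in> leb" "J h E G0 < \<infinity>"
  obtains W where "W \<in> leb" "J h E W = (INF G\<in>leb. J h E G)"
proof -
  define m where "m = (INF G\<in>leb. J h E G)"
  have m: "\<And>G. G \<in> leb \<Longrightarrow> m \<le> J h E G" unfolding m_def by (rule INF_lower)
  have mfin: "m < \<infinity>" using m[OF G0(1)] G0(2) by (rule le_less_trans)
  have "\<exists>F \<in> leb. J h E F \<le> m + ennreal ((1/2) ^ n)" for n :: nat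
  proof -
    have "m < m + ennreal ((1/2) ^ n)" using mfin by (cases m) (auto simp: ennreal_plus[symmetric] ennreal_less_iff simp del: ennreal_plus)
    then obtain F where "F \<in> leb" "J h E F < m + ennreal ((1/2) ^ n)"
      unfolding m_def INF_less_iff by blast
    thus ?thesis by (intro bexI[of _ F]) auto
  qed
  then obtain F where F: "\<And>n. F n \<in> leb" "\<And>n. J h E (F n) \<le> m + ennreal ((1/2) ^ n)" by metis
  \<comment> \<open>The excesses (1/2)^j of the sets from index k to k + p are summed; the closed
    form of the geometric sum carries the induction.\<close>
  have U: "J h E (\<Union>j\<in>{k..k+p}. F j) \<le> m + ennreal (2 * (1/2)^k - (1/2)^(k+p))" for k p
  proof (induction p)
    case 0
    thus ?case using F(2)[of k] by simp
  next
    case (Suc p)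
    have "J h E ((\<Union>j\<in>{k..k+p}. F j) \<union> F (k + Suc p)) \<le>
        m + (ennreal (2 * (1/2)^k - (1/2)^(k+p)) + ennreal ((1/2) ^ (k + Suc p)))"
      by (rule J_Un_le[OF E _ F(1) m mfin Suc F(2)]) (use F in auto)
    also have "ennreal (2 * (1/2)^k - (1/2)^(k+p)) + ennreal ((1/2) ^ (k + Suc p)) =
        ennreal (2 * (1/2)^k - (1/2)^(k+Suc p))"
    proof -
      have "(1/2::real)^(k+p) \<le> (1/2)^k" by (rule power_decreasing) auto
      thus ?thesis by (subst ennreal_plus[symmetric]) (auto simp: power_add)
    qed
    also have "(\<Union>j\<in>{k..k+p}. F j) \<union> F (k + Suc p) = (\<Union>j\<in>{k..k+Suc p}. F j)"
      by (auto simp: atLeastAtMostSuc_conv)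
    finally show ?case .
  qed
  define V where "V k = (\<Union>j\<in>{k..}. F j)" for k
  have V: "V k \<in> leb" for k using F by (auto simp: V_def)
  have JV: "J h E (V k) \<le> m + ennreal (2 * (1/2)^k)" for k
  proof -
    have "J h E (V k) \<le> liminf (\<lambda>p. J h E (\<Union>j\<in>{k..k+p}. F j))"
    proof (rule J_lsc[OF E _ V])
      fix x
      show "\<forall>\<^sub>F p in sequentially. x \<in> (\<Union>j\<in>{k..k+p}. F j) \<longleftrightarrow> x \<in> V k"
      proof (cases "x \<in> V k")
        case True
        then obtain j where j: "j \<ge> k" "x \<in> F j" by (auto simp: V_def)
        have "\<forall>\<^sub>F p in sequentially. j \<le> k + p" using eventually_ge_at_top[of j] by eventually_elim simp
        thus ?thesis by eventually_elim (use j True in auto)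
      qed (auto simp: V_def)
    qed (use F in auto)
    also have "\<dots> \<le> m + ennreal (2 * (1/2)^k)"
      by (rule liminf_le_const) (rule order_trans[OF U], auto intro!: add_left_mono ennreal_leI)
    finally show ?thesis .
  qed
  \<comment> \<open>The upper limit of the sets F j: an increasing limit gives each V k with excess
    at most 2 (1/2)^k, and the decreasing limit of the V k has excess 0.\<close>
  define W where "W = (\<Inter>k. V k)"
  have W: "W \<in> leb" unfolding W_def using V by (intro sets.countable_INT) auto
  have "J h E W \<le> liminf (\<lambda>k. J h E (V k))"
  proof (rule J_lsc[OF E V W])
    fix x
    show "\<forall>\<^sub>F k in sequentially. x \<in> V k \<longleftrightarrow> x \<in> W"
    proof (cases "x \<in> W")
      case False
      then obtain k where k: "x \<notin> V k" by (auto simp: W_def)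
      have "x \<notin> V k'" if "k \<le> k'" for k' using k that by (auto simp: V_def)
      thus ?thesis using False by (auto simp: eventually_sequentially)
    qed (auto simp: W_def)
  qed
  also have "\<dots> \<le> liminf (\<lambda>k. m + ennreal (2 * (1/2)^k))"
    by (rule Liminf_mono) (simp add: JV)
  also have "(\<lambda>k. m + ennreal (2 * (1/2)^k)) \<longlonglongrightarrow> m + ennreal (2 * 0)"
    by (intro tendsto_intros tendsto_ennrealI LIMSEQ_realpow_zero) auto
  hence "liminf (\<lambda>k. m + ennreal (2 * (1/2)^k)) = m"
    using lim_imp_Liminf[of sequentially] by fastforce
  finally have "J h E W = m" using m[OF W] by simp
  thus thesis using that W by (simp add: m_def)
qed

text \<open>Exhaustion: solutions are closed under finite unions and, by lower semicontinuity, under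
  countable ones. A countable union that attains the supremum of a finite measure contains every
  solution up to a null set.\<close>

theorem maximal_solution_exists:
  fixes E :: "(real^'n) set"
  assumes E: "E \<in> leb" and G0: "G0 \<in> leb" "J h E G0 < \<infinity>"
  shows "\<exists>F. maximal_solution \<rho> f h E F"
proof -
  define m where "m = (INF G\<in>leb. J h E G)"
  have m: "\<And>G. G \<in> leb \<Longrightarrow> m \<le> J h E G" unfolding m_def by (rule INF_lower)
  have mfin: "m < \<infinity>" using m[OF G0(1)] G0(2) by (rule le_less_trans)
  define M where "M = {F \<in> leb. J h E F = m}"
  have M_step: "F \<in> M \<longleftrightarrow> step_solution \<rho> f h E F" for F
  proof
    assume "step_solution \<rho> f h E F"
    hence "F \<in> leb" "J h E F \<le> m"
      unfolding m_def step_solution_def by (auto intro: INF_greatest)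
    thus "F \<in> M" using m[of F] by (simp add: M_def)
  qed (use m in \<open>auto simp: M_def step_solution_def\<close>)
  have M_Un: "A \<union> B \<in> M" if "A \<in> M" "B \<in> M" for A B
  proof -
    have "J h E (A \<union> B) \<le> m + (0 + 0)"
      by (rule J_Un_le[OF E _ _ m mfin]) (use that in \<open>auto simp: M_def\<close>)
    thus ?thesis using that m[of "A \<union> B"] by (auto simp: M_def)
  qed
  have M_ne: "M \<noteq> {}" using minimizer_exists[OF E G0] by (auto simp: M_def m_def)
  \<comment> \<open>A positive integrable density makes \<nu> a finite measure with the Lebesgue
    null sets, so that the supremum over solutions is finite.\<close>
  obtain w where w: "w \<in> borel_measurable (lborel :: (real^'n) measure)"
    "integral\<^sup>N lborel w \<noteq> \<infinity>" "\<And>x. 0 < w x"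
    using sigma_finite_measure.Ex_finite_integrable_function[OF sigma_finite_lborel] by auto
  have w': "w \<in> borel_measurable lebesgue" using w(1) by (rule measurable_completion)
  define \<nu> where "\<nu> = density lebesgue w"
  have nu_fin: "emeasure \<nu> A < \<infinity>" for A
  proof -
    have "emeasure \<nu> A \<le> emeasure \<nu> UNIV"
      by (metis emeasure_space space_density space_completion space_lborel \<nu>_def UNIV_I top_greatest space_borel)
    also have "\<dots> = integral\<^sup>N lebesgue w" unfolding \<nu>_def by (subst emeasure_density[OF w']) auto
    also have "\<dots> < \<infinity>" using w(2) by (simp add: nn_integral_completion less_top)
    finally show ?thesis .
  qed
  have nu_sets: "sets \<nu> = leb" by (simp add: \<nu>_def)
  obtain g :: "nat \<Rightarrow> ennreal" where g: "range g \<subseteq> emeasure \<nu> ` M" "(SUP F\<in>M. emeasure \<nu> F) = (SUP n. g n)"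
    using ennreal_SUP_countable_SUP[OF M_ne] by metis
  hence "\<exists>F. F \<in> M \<and> g n = emeasure \<nu> F" for n by auto
  then obtain F where F: "\<And>n. F n \<in> M" "\<And>n. g n = emeasure \<nu> (F n)" by metis
  have Fs: "F n \<in> leb" for n using F(1) by (auto simp: M_def)
  define U where "U = (\<Union>n. F n)"
  have Us: "U \<in> leb" unfolding U_def using Fs by auto
  have fin: "(\<Union>i\<le>n. F i) \<in> M" for n
    by (induction n) (auto simp: atMost_Suc M_Un F Un_commute)
  have "J h E U \<le> liminf (\<lambda>n. J h E (\<Union>i\<le>n. F i))"
  proof (rule J_lsc[OF E _ Us])
    fix x
    show "\<forall>\<^sub>F n in sequentially. x \<in> (\<Union>i\<le>n. F i) \<longleftrightarrow> x \<in> U"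
    proof (cases "x \<in> U")
      case True
      then obtain j where j: "x \<in> F j" by (auto simp: U_def)
      show ?thesis using eventually_ge_at_top[of j] by eventually_elim (use j True in auto)
    qed (auto simp: U_def)
  qed (use Fs in auto)
  also have "\<dots> \<le> m" by (rule liminf_le_const) (use fin in \<open>auto simp: M_def\<close>)
  finally have UM: "U \<in> M" using Us m[OF Us] by (simp add: M_def)
  have max: "G - U \<in> nulls" if G: "G \<in> M" for G
  proof -
    have Gs: "G \<in> leb" using G by (simp add: M_def)
    have "emeasure \<nu> U + emeasure \<nu> (G - U) = emeasure \<nu> (U \<union> (G - U))"
      by (rule plus_emeasure) (use Us Gs nu_sets in auto)
    also have "U \<union> (G - U) = U \<union> G" by auto
    also have "emeasure \<nu> (U \<union> G) \<le> (SUP n. emeasure \<nu> (F n))"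
      unfolding F(2)[symmetric] g(2)[symmetric] by (rule SUP_upper) (rule M_Un[OF UM G])
    also have "\<dots> \<le> emeasure \<nu> U"
      by (rule SUP_least, rule emeasure_mono) (auto simp: U_def nu_sets Fs)
    finally have "emeasure \<nu> (G - U) = 0"
      using nu_fin[of U] by (metis add.right_neutral ennreal_add_left_cancel_le infinity_ennreal_def less_irrefl le_zero_eq)
    hence "G - U \<in> null_sets \<nu>" using Us Gs by (auto simp: null_sets_def nu_sets)
    hence "AE x in lebesgue. x \<in> G - U \<longrightarrow> w x = 0"
      unfolding \<nu>_def by (subst (asm) null_sets_density_iff[OF w']) auto
    hence "AE x in lebesgue. x \<notin> G - U"
      by eventually_elim (use w(3) in \<open>auto simp: less_le\<close>)
    thus ?thesis using Us Gs by (metis AE_iff_null_sets sets.Diff)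
  qed
  obtain R where R: "R \<in> leb" "good_representative R" "sym_diff U R \<in> nulls"
    using good_representative_exists[OF Us] .
  have "J h E R = J h E U" by (rule J_null_diff[OF E Us R(1,3), symmetric])
  hence "R \<in> M" using UM R(1) by (simp add: M_def)
  moreover have "G - R \<in> nulls" if "G \<in> M" for G
  proof (rule null_sets_subset[OF null_sets.Un[OF max[OF that] R(3)]])
    show "G - R \<in> leb" using that R by (auto simp: M_def)
  qed auto
  ultimately show ?thesis using R(2) unfolding maximal_solution_def M_step by blast
qed

lemma step_solution_Compl:
  assumes E: "E \<in> leb"
  shows "step_solution \<rho> f h (- E) (- F) \<longleftrightarrow> step_solution \<rho> f h E F"
proof -
  have *: "step_solution \<rho> f h (- E) (- F)" if s: "step_solution \<rho> f h E F" and E: "E \<in> leb"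
    for E F :: "(real^'a) set"
    unfolding step_solution_def
  proof (intro conjI ballI)
    have F: "F \<in> leb" using s by (simp add: step_solution_def)
    thus "- F \<in> leb" by auto
    fix G :: "(real^'a) set" assume G: "G \<in> leb"
    have "J h (- E) (- F) = J h E F" using J_Compl[OF E F] .
    also have "\<dots> \<le> J h E (- G)" using s G by (simp add: step_solution_def lebesgue_Compl)
    also have "\<dots> = J h (- E) G" using J_Compl[OF E, of "- G"] G by (simp add: lebesgue_Compl)
    finally show "J h (- E) (- F) \<le> J h (- E) G" .
  qed
  show ?thesis using *[of E F] *[of "- E" "- F"] E by (auto simp: lebesgue_Compl)
qed

text \<open>Complements preserve the functional and exchange maximal with minimal solutions.\<close>

lemma minimal_solution_exists:
  assumes E: "E \<in> leb" and G0: "G0 \<in> leb" "J h E G0 < \<infinity>"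
  shows "\<exists>F. minimal_solution \<rho> f h E F"
proof -
  have "J h (- E) (- G0) < \<infinity>" using J_Compl[OF E G0(1)] G0(2) by simp
  then obtain F where F: "maximal_solution \<rho> f h (- E) F"
    using maximal_solution_exists[of "- E" "- G0"] E G0 by (auto simp: lebesgue_Compl)
  have Fs: "F \<in> leb" using F by (simp add: maximal_solution_def step_solution_def)
  have "minimal_solution \<rho> f h E (- F)"
    unfolding minimal_solution_def
  proof (intro conjI allI impI)
    show "step_solution \<rho> f h E (- F)"
      using F step_solution_Compl[OF E, of h "- F"] by (simp add: maximal_solution_def)
    show "good_representative (- F)"
      using F by (simp add: maximal_solution_def good_representative_Compl[OF Fs])
    fix G assume "step_solution \<rho> f h E G"
    hence "- G - F \<in> nulls"
      using F step_solution_Compl[OF E, of h G] by (simp add: maximal_solution_def)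
    moreover have "- G - F = - F - G" by auto
    ultimately show "- F - G \<in> nulls" by simp
  qed
  thus ?thesis ..
qed

lemma energy_empty: "\<E> {} = 0"
  by (simp add: energy_eq osc_def outer_def)

lemma infdist_frontier_le:
  fixes E :: "(real^'n) set"
  assumes "E \<subseteq> ball 0 R" "x \<in> E"
  shows "infdist x (frontier E) \<le> 2 * R"
proof (cases "frontier E = {}")
  case True
  have "0 < R" using assms by (metis ball_empty empty_subsetI not_le subset_empty empty_iff)
  thus ?thesis using True by (simp add: infdist_def)
next
  case False
  then obtain a where a: "a \<in> frontier E" by auto
  have "closure E \<subseteq> cball 0 R" using assms(1) by (intro closure_minimal) auto
  hence "norm a \<le> R" using a by (auto simp: frontier_def)
  moreover have "norm x < R" using assms by auto
  ultimately have "dist x a \<le> 2 * R" by (simp add: dist_norm norm_triangle_le_diff order_trans[OF norm_triangle_ineq4])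
  thus ?thesis using infdist_le[OF a, of x] by linarith
qed

lemma J_empty_le:
  fixes E :: "(real^'n) set"
  assumes E: "E \<in> leb" "E \<subseteq> ball 0 R"
  shows "J h E {} \<le> ennreal (1 / h) * (ennreal (2 * R) * vol (ball (0::real^'n) R))"
proof -
  have "bmass E E \<le> ennreal (2 * R) * vol E"
    by (rule boundary_mass_le[OF E(1)]) (rule infdist_frontier_le[OF E(2)])
  also have "\<dots> \<le> ennreal (2 * R) * vol (ball (0::real^'n) R)"
    by (intro mult_left_mono emeasure_mono[OF E(2)]) simp_all
  finally show ?thesis
    using E by (simp add: step_functional_eq energy_empty mult_left_mono)
qed

lemma J_finite:
  assumes E: "E \<in> leb" and "bounded E \<or> bounded (- E)"
  shows "\<exists>G\<in>leb. J h E G < \<infinity>"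
proof -
  have *: "J h E {} < \<infinity>" if Es: "E \<in> leb" and Eb: "bounded E" for E :: "(real^'a) set"
  proof -
    obtain R where "E \<subseteq> ball 0 R" using bounded_subset_ballD[OF Eb] by blast
    from J_empty_le[OF Es this, of h] show ?thesis
      using emeasure_lborel_ball_finite[of "0::real^'a" R]
      by (auto simp: ennreal_mult_less_top intro: le_less_trans)
  qed
  show ?thesis
  proof (cases "bounded E")
    case True
    thus ?thesis using *[OF E] by (intro bexI[of _ "{}"]) auto
  next
    case False
    hence "J h (- E) {} < \<infinity>" using assms by (intro *) auto
    hence "J h E UNIV < \<infinity>" using J_Compl[of "- E" "{}" h] E by (auto simp: lebesgue_Compl)
    thus ?thesis by (intro bexI[of _ UNIV]) auto
  qed
qed

text \<open>What the rest of the proof retains of a time step; whether the minimizer is minimal or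
  maximal is forgotten. For E empty or the whole space the boundary is empty, \<open>infdist\<close>
  to it is 0 and minimality controls no distance, so F is prescribed.\<close>

definition solves :: "real \<Rightarrow> (real^'n) set \<Rightarrow> (real^'n) set \<Rightarrow> bool" where
  "solves h E F \<longleftrightarrow> E \<in> leb \<and> step_solution \<rho> f h E F \<and> good_representative F \<and>
     J h E F < \<infinity> \<and> (E = {} \<longrightarrow> F = {}) \<and> (E = UNIV \<longrightarrow> F = UNIV)"

lemma solvesD:
  assumes "solves h E F"
  shows "E \<in> leb" "F \<in> leb" "good_representative F" "J h E F < \<infinity>"
    "\<E> F < \<infinity>" "\<And>G. G \<in> leb \<Longrightarrow> J h E F \<le> J h E G"
    "E = {} \<Longrightarrow> F = {}" "E = UNIV \<Longrightarrow> F = UNIV"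
proof -
  show *: "E \<in> leb" "F \<in> leb" "good_representative F" "J h E F < \<infinity>"
    "\<And>G. G \<in> leb \<Longrightarrow> J h E F \<le> J h E G" "E = {} \<Longrightarrow> F = {}" "E = UNIV \<Longrightarrow> F = UNIV"
    using assms by (auto simp: solves_def step_solution_def)
  show "\<E> F < \<infinity>" using *(4) by (simp add: step_functional_def less_top)
qed

lemma solves_Compl:
  assumes "solves h E F"
  shows "solves h (- E) (- F)"
  using solvesD(1-3)[OF assms] assms
  unfolding solves_def by (auto simp: lebesgue_Compl step_solution_Compl good_representative_Compl J_Compl)

lemma solves_empty: "solves h ({} :: (real^'n) set) {}"
proof -
  have "J h ({} :: (real^'n) set) {} = 0" by (simp add: step_functional_eq energy_empty)
  moreover have "full (- {} :: (real^'n) set) = UNIV"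
    by (auto simp: full_def intro!: exI[of _ 1])
  ultimately show ?thesis
    by (auto simp: solves_def step_solution_def good_representative_iff)
qed

text \<open>The only place that looks inside the selected solutions; the cases {} and UNIV are
  settled by the definition of the step, the others by existence and by complements.\<close>

lemma step_plus_solves:
  assumes E: "E \<in> leb" and b: "bounded E \<or> bounded (- E)"
  shows "solves h E (step_plus \<rho> f h E)"
proof (cases "E = {} \<or> E = UNIV")
  case True
  have "\<not> bounded (UNIV :: (real^'n) set)" by simp
  moreover have "solves h (UNIV::(real^'n) set) UNIV" using solves_Compl[OF solves_empty] by simp
  ultimately show ?thesis using True solves_empty
    by (auto simp: step_plus_def step_plus_bdd_def step_minus_bdd_def)
next
  case False
  obtain G where G: "G \<in> leb" "J h E G < \<infinity>" using J_finite[OF assms] by blast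
  show ?thesis
  proof (cases "bounded E")
    case True
    have "maximal_solution \<rho> f h E (step_plus \<rho> f h E)"
      using True False someI_ex[OF maximal_solution_exists[OF E G]] by (simp add: step_plus_def step_plus_bdd_def)
    hence "step_solution \<rho> f h E (step_plus \<rho> f h E)" "good_representative (step_plus \<rho> f h E)"
      by (auto simp: maximal_solution_def)
    thus ?thesis using False G E by (auto simp: solves_def step_solution_def intro: le_less_trans)
  next
    case nb: False
    have G': "- G \<in> leb" "J h (- E) (- G) < \<infinity>" using G J_Compl[OF E G(1)] by (auto simp: lebesgue_Compl)
    have E': "- E \<in> leb" using E by auto
    have ne: "- E \<noteq> {}" "- E \<noteq> UNIV" using False by auto
    define F where "F = step_minus_bdd \<rho> f h (- E)"
    have "minimal_solution \<rho> f h (- E) F"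
      using ne someI_ex[OF minimal_solution_exists[OF E' G']] by (simp add: F_def step_minus_bdd_def)
    hence "step_solution \<rho> f h (- E) F" "good_representative F"
      by (auto simp: minimal_solution_def)
    hence "solves h (- E) F" using ne G' E' by (auto simp: solves_def step_solution_def intro: le_less_trans)
    from solves_Compl[OF this] show ?thesis using nb by (simp add: step_plus_def F_def)
  qed
qed

end

section \<open>Comparison of solutions\<close>

lemma infdist_closure_eq: "infdist x (closure A) = infdist (x::'a::heine_borel) A"
  by (simp add: infdist_eq_setdist)

text \<open>A nearest point of the closure of E is not interior to E, because a small move towards y
  would stay in E and come closer.\<close>

lemma infdist_frontier:
  fixes E :: "(real^'n) set"
  assumes y: "y \<notin> E" and ne: "E \<noteq> {}"
  shows "infdist y (frontier E) = infdist y E"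
proof -
  obtain e where e: "e \<in> closure E" "infdist y (closure E) = dist y e"
    using infdist_attains_inf[of "closure E" y] ne by auto
  have "e \<notin> interior E"
  proof
    assume ei: "e \<in> interior E"
    then obtain r where r: "r > 0" "ball e r \<subseteq> E" by (auto simp: mem_interior)
    have "y \<noteq> e" using y ei interior_subset by blast
    hence d: "0 < dist y e" by simp
    define t where "t = min 1 (r / (2 * dist y e))"
    define p where "p = e + t *\<^sub>R (y - e)"
    have t: "0 < t" "t \<le> 1" "t * dist y e < r"
      using r d by (auto simp: t_def min_def field_simps)
    have "dist e p = t * dist y e" using t by (simp add: p_def dist_norm norm_minus_commute)
    hence "p \<in> E" using r t by auto
    hence "infdist y E \<le> dist y p" by (rule infdist_le)
    also have "y - p = (1 - t) *\<^sub>R (y - e)" by (simp add: p_def algebra_simps)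
    hence "dist y p = (1 - t) * dist y e" using t by (simp add: dist_norm)
    also have "\<dots> < dist y e" using t d by simp
    finally show False using e(2) by (simp add: infdist_closure_eq)
  qed
  hence ef: "e \<in> frontier E" using e(1) by (simp add: frontier_def)
  hence "infdist y (frontier E) \<le> infdist y E" using infdist_le[OF ef, of y] e(2) by (simp add: infdist_closure_eq)
  moreover have "infdist y (closure E) \<le> infdist y (frontier E)"
    by (rule infdist_mono) (use ef in \<open>auto simp: frontier_def\<close>)
  ultimately show ?thesis by (simp add: infdist_closure_eq)
qed

lemma infdist_frontier_mem:
  fixes E :: "(real^'n) set"
  assumes "y \<in> E" and "E \<noteq> UNIV"
  shows "infdist y (frontier E) = infdist y (- E)"
  using infdist_frontier[of y "- E"] assms by (auto simp: frontier_complement)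

text \<open>From the nearest point of the closure of - E' one can move r / 2 towards y and still be
  closer than r to - E', hence outside E. So the complement of E comes nearer to y by at least r /
  2.\<close>

lemma infdist_Compl_strict_mono:
  fixes E E' :: "(real^'n) set"
  assumes r: "0 < r" and sub: "\<And>x. x \<in> E \<Longrightarrow> ball x r \<subseteq> E'" and y: "y \<in> E" and ne: "E' \<noteq> UNIV"
  shows "infdist y (- E) < infdist y (- E')"
proof -
  have far: "x \<notin> closure (- E')" if "x \<in> E" for x
    using sub[OF that] r by (auto simp: closure_approachable subset_iff dist_commute)
  have far': "p \<notin> E" if p: "dist p e < r" "e \<in> closure (- E')" for p e
  proof
    assume "p \<in> E"
    hence "ball p r \<subseteq> E'" by (rule sub)
    hence "ball p r \<inter> closure (- E') = {}"
      using open_Int_closure_eq_empty[of "ball p r" "- E'"] by auto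
    thus False using p by auto
  qed
  obtain e where e: "e \<in> closure (- E')" "infdist y (closure (- E')) = dist y e"
    using infdist_attains_inf[of "closure (- E')" y] ne by auto
  have d: "r \<le> dist y e" using far'[of y e] e(1) y by force
  define t where "t = r / (2 * dist y e)"
  define p where "p = e + t *\<^sub>R (y - e)"
  have t: "0 < t" "t \<le> 1" "t * dist y e = r / 2"
  proof -
    have "0 < dist y e" using r d by linarith
    thus "0 < t" "t \<le> 1" "t * dist y e = r / 2" using r d by (simp_all add: t_def divide_le_eq)
  qed
  have "dist p e = r / 2" using t by (simp add: p_def dist_norm)
  hence "p \<in> - E" using far'[of p e] e(1) r by simp
  hence "infdist y (- E) \<le> dist y p" by (rule infdist_le)
  also have "y - p = (1 - t) *\<^sub>R (y - e)" by (simp add: p_def algebra_simps)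
  hence "dist y p = (1 - t) * dist y e" using t by (simp add: dist_norm)
  also have "\<dots> < dist y e" using t r d by (simp add: left_diff_distrib)
  finally show ?thesis using e(2) by (simp add: infdist_closure_eq)
qed

lemma nn_integral_strict_null:
  assumes W: "W \<in> sets M" and a: "a \<in> borel_measurable M" and b: "b \<in> borel_measurable M"
    and less: "\<And>x. x \<in> W \<Longrightarrow> a x < (b x :: ennreal)"
    and le: "(\<integral>\<^sup>+x\<in>W. b x \<partial>M) \<le> (\<integral>\<^sup>+x\<in>W. a x \<partial>M)" and fin: "(\<integral>\<^sup>+x\<in>W. a x \<partial>M) < \<infinity>"
  shows "W \<in> null_sets M"
proof -
  note [measurable] = W a b
  have "(\<integral>\<^sup>+x\<in>W. b x \<partial>M) = (\<integral>\<^sup>+x. a x * indicator W x + (b x - a x) * indicator W x \<partial>M)"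
    by (intro nn_integral_cong) (use less in \<open>auto simp: indicator_def less_imp_le add_diff_inverse_ennreal\<close>)
  also have "\<dots> = (\<integral>\<^sup>+x\<in>W. a x \<partial>M) + (\<integral>\<^sup>+x\<in>W. (b x - a x) \<partial>M)"
    by (rule nn_integral_add) measurable
  finally have "(\<integral>\<^sup>+x\<in>W. a x \<partial>M) + (\<integral>\<^sup>+x\<in>W. (b x - a x) \<partial>M) \<le> (\<integral>\<^sup>+x\<in>W. a x \<partial>M) + 0"
    using le by simp
  hence "(\<integral>\<^sup>+x\<in>W. (b x - a x) \<partial>M) \<le> 0"
    using fin unfolding ennreal_add_left_cancel_le by auto
  hence "AE x in M. (b x - a x) * indicator W x = 0"
    by (subst (asm) le_zero_eq, subst (asm) nn_integral_0_iff_AE) measurable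
  hence "AE x in M. x \<notin> W"
  proof eventually_elim
    case (elim x)
    thus ?case using less[of x] by (auto simp: indicator_def diff_eq_0_iff_ennreal not_le[symmetric] split: if_splits)
  qed
  thus ?thesis using W by (metis AE_iff_null_sets)
qed

section \<open>Translation invariance\<close>

lemma translation_lebesgue:
  fixes v :: "real^'n"
  shows "(+) v \<in> lebesgue \<rightarrow>\<^sub>M lebesgue" "distr lebesgue lebesgue ((+) v) = lebesgue"
proof -
  have meas: "(+) v \<in> lebesgue \<rightarrow>\<^sub>M lborel" by (intro measurable_completion) simp
  have eq: "distr lebesgue lborel ((+) v) = lborel"
    by (subst distr_completion) (auto simp: lborel_distr_plus cong: distr_cong)
  show "(+) v \<in> lebesgue \<rightarrow>\<^sub>M lebesgue"
    by (rule completion.measurable_completion2[OF meas]) (simp add: eq)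
  show "distr lebesgue lebesgue ((+) v) = lebesgue"
    using completion.completion_distr_eq[OF meas] by (simp add: eq)
qed

lemma emeasure_translation: "A \<in> leb \<Longrightarrow> vol ((+) (v::real^'n) ` A) = vol A"
  using emeasure_lebesgue_affine[of 1 v A] by (simp add: add.commute cong: image_cong_simp)

lemma mem_translation: "x \<in> (+) (v::real^'n) ` B \<longleftrightarrow> x - v \<in> B"
proof
  assume "x - v \<in> B"
  hence "v + (x - v) \<in> (+) v ` B" by (rule imageI)
  thus "x \<in> (+) v ` B" by simp
qed auto

lemma dist_minus_translation: "dist (x - v) (y - v) = dist (x::real^'n) y"
  by (simp add: dist_norm)

lemma outer_translation:
  assumes A: "A \<in> leb"
  shows "outer s ((+) v ` A) = (+) v ` outer s A"
proof -
  have "x \<in> outer s ((+) v ` A) \<longleftrightarrow> x - v \<in> outer s A" for x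
  proof -
    have "(+) v ` A \<inter> ball x s = (+) v ` (A \<inter> ball (x - v) s)"
      by (intro set_eqI) (simp add: mem_translation dist_minus_translation)
    thus ?thesis using A by (simp add: outer_def emeasure_translation del: emeasure_completion)
  qed
  thus ?thesis unfolding set_eq_iff mem_translation by blast
qed

lemma Compl_translation: "- ((+) (v::real^'n) ` A) = (+) v ` (- A)"
  by (simp add: translation_Compl)

lemma infdist_translation: "infdist (v + x) ((+) (v::real^'n) ` A) = infdist x A"
  by (simp add: infdist_def image_image)

lemma full_translation:
  assumes A: "A \<in> leb"
  shows "full ((+) v ` A) = (+) v ` full A"
proof -
  have eq: "ball x r - (+) v ` A = (+) v ` (ball (x - v) r - A)" for x r
    by (intro set_eqI) (simp add: mem_translation dist_minus_translation)
  have "x \<in> full ((+) v ` A) \<longleftrightarrow> x - v \<in> full A" for x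
  proof -
    have "(+) v ` B \<in> nulls \<longleftrightarrow> B \<in> nulls" if "B \<in> leb" for B
      using that lebesgue_sets_translation[OF that] by (simp add: null_sets_def emeasure_translation del: emeasure_completion)
    moreover have "ball y r - A \<in> leb" for y r using A by auto
    ultimately show ?thesis unfolding full_def eq by simp
  qed
  thus ?thesis unfolding set_eq_iff mem_translation by blast
qed

text \<open>Fubini's theorem for the pairs (v, y) with y in B and y + v in A: if almost no y is hit
  for each small shift, then for almost every y in B the ball of radius \<tau> about y contains
  almost nothing of A.\<close>

lemma translates_null_imp_outer_null:
  fixes A B :: "(real^'n) set"
  assumes A: "A \<in> leb" and B: "B \<in> leb"
    and null: "\<And>v. norm v < \<tau> \<Longrightarrow> ((+) v ` A) \<inter> B \<in> nulls"
  shows "outer \<tau> A \<inter> B \<in> nulls"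
proof -
  \<comment> \<open>Borel parts of A and B, as the integrand must be measurable for the product of
    Borel measures.\<close>
  define A0 where "A0 = main_part lborel A"
  define B0 where "B0 = main_part lborel B"
  have [measurable]: "A0 \<in> sets borel" "B0 \<in> sets borel"
    using main_part_sets[OF A] main_part_sets[OF B] by (auto simp: A0_def B0_def)
  have sub: "A0 \<subseteq> A" "B0 \<subseteq> B" using main_part_null_part_Un[OF A] main_part_null_part_Un[OF B] by (auto simp: A0_def B0_def)
  have nullAB: "A - A0 \<in> nulls" "B - B0 \<in> nulls"
  proof -
    have "X - main_part lborel X \<in> nulls" if X: "X \<in> leb" for X :: "(real^'n) set"
    proof -
      obtain N where "N \<in> null_sets lborel" "null_part lborel X \<subseteq> N" using null_part[OF X] by blast
      moreover have "X - main_part lborel X \<subseteq> null_part lborel X" using main_part_null_part_Un[OF X] by blast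
      ultimately show ?thesis by (meson null_sets_completionI null_sets_completion_subset subset_trans)
    qed
    thus "A - A0 \<in> nulls" "B - B0 \<in> nulls" using A B by (auto simp: A0_def B0_def)
  qed
  define g where "g = (\<lambda>(v, y). indicator (ball 0 \<tau>) v * indicator B0 y * (indicator A0 (y + v) :: ennreal))"
  have [measurable]: "g \<in> borel_measurable (lborel \<Otimes>\<^sub>M lborel)"
  proof -
    have d: "(\<lambda>x. snd x + fst x) \<in> borel_measurable (lborel \<Otimes>\<^sub>M (lborel :: (real^'n) measure))"
      by (intro borel_measurable_add measurable_compose[OF measurable_snd] measurable_compose[OF measurable_fst]) auto
    have "(\<lambda>x. indicator (ball 0 \<tau>) (fst x) * indicator B0 (snd x) * (indicator A0 (snd x + fst x) :: ennreal))
        \<in> borel_measurable (lborel \<Otimes>\<^sub>M (lborel :: (real^'n) measure))"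
      by (intro borel_measurable_times_ennreal measurable_compose[OF measurable_fst borel_measurable_indicator]
          measurable_compose[OF measurable_snd borel_measurable_indicator] measurable_compose[OF d borel_measurable_indicator]) auto
    thus ?thesis by (simp add: g_def case_prod_beta')
  qed
  have 0: "(\<integral>\<^sup>+y. g (v, y) \<partial>lborel) = 0" for v
  proof (cases "norm v < \<tau>")
    case True
    have null': "(+) (- v) ` A \<inter> B \<in> nulls" using null[of "- v"] True by simp
    have sh: "(\<lambda>y. y + v) -` A0 \<inter> B0 \<in> sets borel" by measurable
    have "(\<integral>\<^sup>+y. g (v, y) \<partial>lborel) = (\<integral>\<^sup>+y. indicator ((\<lambda>y. y + v) -` A0 \<inter> B0) y \<partial>lborel)"
      using True by (intro nn_integral_cong) (auto simp: g_def indicator_def)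
    also have "\<dots> = emeasure lborel ((\<lambda>y. y + v) -` A0 \<inter> B0)" using sh by simp
    also have "\<dots> = vol ((\<lambda>y. y + v) -` A0 \<inter> B0)" using sh by simp
    also have "\<dots> \<le> vol ((+) (- v) ` A \<inter> B)"
    proof (rule emeasure_mono)
      show "(\<lambda>y. y + v) -` A0 \<inter> B0 \<subseteq> (+) (- v) ` A \<inter> B"
        using sub by (simp only: subset_eq mem_translation Int_iff vimage_eq minus_minus diff_minus_eq_add) blast
      show "(+) (- v) ` A \<inter> B \<in> leb" using null' by blast
    qed
    also have "\<dots> = 0" using null' by (simp only: null_sets_def mem_Collect_eq)
    finally show ?thesis by simp
  qed (simp add: g_def)
  have "(\<integral>\<^sup>+y. \<integral>\<^sup>+v. g (v, y) \<partial>lborel \<partial>lborel) = (\<integral>\<^sup>+v. \<integral>\<^sup>+y. g (v, y) \<partial>lborel \<partial>lborel)"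
    by (rule lborel_pair.Fubini) simp
  also have "\<dots> = 0" by (simp add: 0)
  finally have "AE y in lborel. (\<integral>\<^sup>+v. g (v, y) \<partial>lborel) = 0"
    by (subst (asm) nn_integral_0_iff_AE) auto
  hence ae: "AE y in lebesgue. (\<integral>\<^sup>+v. g (v, y) \<partial>lborel) = 0" by (rule AE_completion)
  have inner: "(\<integral>\<^sup>+v. g (v, y) \<partial>lborel) = emeasure lborel (A0 \<inter> ball y \<tau>)" if y: "y \<in> B0" for y
  proof -
    have "A0 \<inter> ball y \<tau> \<in> sets borel" by (intro sets.Int) auto
    hence m1: "(indicator (A0 \<inter> ball y \<tau>) :: _ \<Rightarrow> ennreal) \<in> borel_measurable borel"
      by (rule borel_measurable_indicator)
    have "(\<integral>\<^sup>+z. indicator (A0 \<inter> ball y \<tau>) z \<partial>lborel) = (\<integral>\<^sup>+z. indicator (A0 \<inter> ball y \<tau>) z \<partial>distr lborel borel ((+) y))"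
      by (simp only: lborel_distr_plus)
    also have "\<dots> = (\<integral>\<^sup>+z. indicator (A0 \<inter> ball y \<tau>) (y + z) \<partial>lborel)"
      by (rule nn_integral_distr) (use m1 in simp_all)
    also have "\<dots> = (\<integral>\<^sup>+v. g (v, y) \<partial>lborel)"
      using y by (intro nn_integral_cong) (auto simp: g_def indicator_def dist_norm norm_minus_commute)
    finally show ?thesis by simp
  qed
  have ball: "vol (A \<inter> ball y \<tau>) = emeasure lborel (A0 \<inter> ball y \<tau>)" for y
  proof -
    have "vol (A \<inter> ball y \<tau>) \<le> vol ((A0 \<inter> ball y \<tau>) \<union> (A - A0))"
      by (rule emeasure_mono) (use A nullAB in auto)
    also have "\<dots> = vol (A0 \<inter> ball y \<tau>)"
      by (rule emeasure_Un_null_set) (use nullAB in auto)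
    finally have "vol (A \<inter> ball y \<tau>) \<le> emeasure lborel (A0 \<inter> ball y \<tau>)" by simp
    moreover have "vol (A0 \<inter> ball y \<tau>) \<le> vol (A \<inter> ball y \<tau>)"
      by (rule emeasure_mono) (use A sub in auto)
    ultimately show ?thesis by simp
  qed
  have "AE y in lebesgue. y \<notin> B - B0" using nullAB(2) by (rule AE_not_in)
  with ae have "AE y in lebesgue. y \<notin> outer \<tau> A \<inter> B"
  proof eventually_elim
    case (elim y)
    show ?case
    proof
      assume y: "y \<in> outer \<tau> A \<inter> B"
      hence "y \<in> B0" using elim by auto
      hence "emeasure lborel (A0 \<inter> ball y \<tau>) = 0" using elim(1) inner by simp
      thus False using y ball[of y] by (simp add: outer_def)
    qed
  qed
  thus ?thesis
    using open_sets_lebesgue[OF open_outer[OF A]] B by (metis AE_iff_null_sets sets.Int)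
qed

context radial_profile
begin

text \<open>F is tested against F \<inter> G, and submodularity converts the energies of F and F
  \<inter> G into those of F \<union> G and G. The dissipations of F and F \<inter> G differ only
  over F - G.\<close>

lemma solves_upper_comparison:
  assumes s: "solves h E F" and h: "0 < h" and G: "G \<in> leb" "\<E> G < \<infinity>"
  shows "\<E> (F \<union> G) + ennreal (1 / h) * bmass E ((F - G) - E) \<le>
    \<E> G + ennreal (1 / h) * bmass E ((F - G) \<inter> E)"
proof -
  note sD = solvesD[OF s]
  let ?m = "bmass E" and ?c = "ennreal (1 / h)" and ?e = "\<E>"
  \<comment> \<open>The region where F and F \<inter> G pay the same dissipation; its cost is finite
    and cancels.\<close>
  define S where "S = sym_diff F E - (F - G)"
  have FG: "F \<inter> G \<in> leb" using sD G by auto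
  have 1: "?m (sym_diff F E) = ?m S + ?m ((F - G) - E)"
    by (subst plus_emeasure) (use sD G in \<open>auto simp: S_def intro!: arg_cong[where f="?m"]\<close>)
  have 2: "?m (sym_diff (F \<inter> G) E) = ?m S + ?m ((F - G) \<inter> E)"
    by (subst plus_emeasure) (use sD G in \<open>auto simp: S_def intro!: arg_cong[where f="?m"]\<close>)
  have fin: "?e F + ?c * (?m S + ?m ((F - G) - E)) < \<infinity>"
    using sD(4) unfolding step_functional_eq[OF sD(1,2)] 1 .
  hence Sfin: "?c * ?m S \<noteq> \<infinity>" by (auto simp: distrib_left less_top)
  have "?e F + ?c * (?m S + ?m ((F - G) - E)) \<le> ?e (F \<inter> G) + ?c * (?m S + ?m ((F - G) \<inter> E))"
    using sD(6)[OF FG] unfolding step_functional_eq[OF sD(1,2)] step_functional_eq[OF sD(1) FG] 1 2 .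
  hence "?c * ?m S + (?e F + ?c * ?m ((F - G) - E)) \<le> ?c * ?m S + (?e (F \<inter> G) + ?c * ?m ((F - G) \<inter> E))"
    by (simp only: distrib_left ac_simps)
  hence i: "?e F + ?c * ?m ((F - G) - E) \<le> ?e (F \<inter> G) + ?c * ?m ((F - G) \<inter> E)"
    using Sfin unfolding ennreal_add_left_cancel_le by auto
  have sub: "?e (F \<union> G) + ?e (F \<inter> G) \<le> ?e F + ?e G" by (rule energy_submodular[OF sD(2) G(1)])
  have "?e (F \<inter> G) \<le> ?e (F \<union> G) + ?e (F \<inter> G)" by simp
  also note sub
  also have "?e F + ?e G < \<infinity>" using sD(5) G(2) by simp
  finally have Ifin: "?e (F \<inter> G) < \<infinity>" .
  have "?e (F \<inter> G) + (?e (F \<union> G) + ?c * ?m ((F - G) - E)) = (?e (F \<union> G) + ?e (F \<inter> G)) + ?c * ?m ((F - G) - E)"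
    by (simp only: ac_simps)
  also have "\<dots> \<le> (?e F + ?e G) + ?c * ?m ((F - G) - E)" by (intro add_right_mono sub)
  also have "\<dots> = (?e F + ?c * ?m ((F - G) - E)) + ?e G" by (simp only: ac_simps)
  also have "\<dots> \<le> (?e (F \<inter> G) + ?c * ?m ((F - G) \<inter> E)) + ?e G" by (intro add_right_mono i)
  also have "\<dots> = ?e (F \<inter> G) + (?e G + ?c * ?m ((F - G) \<inter> E))" by (simp only: ac_simps)
  finally show ?thesis using Ifin unfolding ennreal_add_left_cancel_le by auto
qed

text \<open>Let W = F - F'. Adding the comparison of F with F' to the minimality of F' against F
  \<union> F' cancels all energies and leaves an inequality between signed distances to E and E'
  over W. Since E lies inside E' with margin r, it contradicts the strict order of these distances
  unless W is null.\<close>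

lemma solves_strict_mono_null:
  assumes h: "0 < h" and r: "0 < r" and s: "solves h E F" and s': "solves h E' F'"
    and sub: "\<And>x. x \<in> E \<Longrightarrow> ball x r \<subseteq> E'"
  shows "F - F' \<in> nulls"
proof (cases "E = {} \<or> E' = UNIV")
  case True
  thus ?thesis using solvesD(7)[OF s] solvesD(8)[OF s'] by auto
next
  case False
  note sD = solvesD[OF s] and sD' = solvesD[OF s']
  let ?m = "bmass E" and ?m' = "bmass E'" and ?c = "ennreal (1 / h)" and ?e = "\<E>"
  let ?d = "\<lambda>x. ennreal (infdist x (frontier E))" and ?d' = "\<lambda>x. ennreal (infdist x (frontier E'))"
  define W where "W = F - F'"
  have W: "W \<in> leb" using sD sD' by (auto simp: W_def)
  have EE: "E \<subseteq> E'" using sub r by fastforce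
  have E1: "infdist x (frontier E) < infdist x (frontier E')" if "x \<in> E" for x
  proof -
    have "E \<noteq> UNIV" "E' \<noteq> UNIV" "x \<in> E'" using False EE that by auto
    thus ?thesis
      using infdist_Compl_strict_mono[OF r sub that] infdist_frontier_mem[of x E] infdist_frontier_mem[of x E'] that by simp
  qed
  have sub': "ball x r \<subseteq> - E" if "x \<in> - E'" for x
  proof
    fix z assume "z \<in> ball x r"
    thus "z \<in> - E" using sub[of z] that by (auto simp: dist_commute subset_iff)
  qed
  have E3: "infdist x (frontier E') < infdist x (frontier E)" if "x \<notin> E'" for x
  proof -
    have "infdist x (- (- E')) < infdist x (- (- E))"
      by (rule infdist_Compl_strict_mono[OF r sub']) (use that False in auto)
    thus ?thesis using that EE False by (subst (1 2) infdist_frontier) auto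
  qed
  \<comment> \<open>If both distances vanished, some point of E and some point of - E' would be
    closer than r to each other.\<close>
  have E2: "0 < infdist x (frontier E) + infdist x (frontier E')" if x: "x \<in> E'" "x \<notin> E" for x
  proof (rule ccontr)
    assume "\<not> 0 < infdist x (frontier E) + infdist x (frontier E')"
    hence "infdist x (frontier E) = 0" "infdist x (frontier E') = 0"
      using infdist_nonneg[of x "frontier E"] infdist_nonneg[of x "frontier E'"] by linarith+
    hence "infdist x E = 0" "infdist x (- E') = 0"
      using x False by (auto simp: infdist_frontier infdist_frontier_mem)
    moreover have "E \<noteq> {}" "- E' \<noteq> {}" using False by auto
    ultimately have "x \<in> closure E" "x \<in> closure (- E')" 
      using in_closure_iff_infdist_zero[of E x] in_closure_iff_infdist_zero[of "- E'" x] by blast+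
    then obtain a b where "a \<in> E" "dist a x < r / 2" "b \<in> - E'" "dist b x < r / 2"
      using r by (meson closure_approachable half_gt_zero)
    hence "dist a b < r" using dist_triangle_half_l[of a x r b] by (simp add: dist_commute)
    thus False using sub[OF \<open>a \<in> E\<close>] \<open>b \<in> - E'\<close> by auto
  qed
  have Ff: "F \<union> F' \<in> leb" using sD sD' by auto
  have i1: "?e (F \<union> F') + ?c * ?m (W - E) \<le> ?e F' + ?c * ?m (W \<inter> E)"
    unfolding W_def by (rule solves_upper_comparison[OF s h sD'(2,5)])
  define S where "S = sym_diff F' E' - W"
  have 1: "?m' (sym_diff F' E') = ?m' S + ?m' (W \<inter> E')"
    by (subst plus_emeasure) (use sD sD' in \<open>auto simp: S_def W_def intro!: arg_cong[where f="?m'"]\<close>)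
  have 2: "?m' (sym_diff (F \<union> F') E') = ?m' S + ?m' (W - E')"
    by (subst plus_emeasure) (use sD sD' in \<open>auto simp: S_def W_def intro!: arg_cong[where f="?m'"]\<close>)
  have "?e F' + ?c * (?m' S + ?m' (W \<inter> E')) < \<infinity>"
    using sD'(4) unfolding step_functional_eq[OF sD'(1,2)] 1 .
  hence Sfin: "?c * ?m' S \<noteq> \<infinity>" and WE'fin: "?c * ?m' (W \<inter> E') < \<infinity>" by (auto simp: distrib_left less_top)
  have "?e F' + ?c * (?m' S + ?m' (W \<inter> E')) \<le> ?e (F \<union> F') + ?c * (?m' S + ?m' (W - E'))"
    using sD'(6)[OF Ff] unfolding step_functional_eq[OF sD'(1,2)] step_functional_eq[OF sD'(1) Ff] 1 2 .
  hence "?c * ?m' S + (?e F' + ?c * ?m' (W \<inter> E')) \<le> ?c * ?m' S + (?e (F \<union> F') + ?c * ?m' (W - E'))"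
    by (simp only: distrib_left ac_simps)
  hence i2: "?e F' + ?c * ?m' (W \<inter> E') \<le> ?e (F \<union> F') + ?c * ?m' (W - E')"
    using Sfin unfolding ennreal_add_left_cancel_le by auto
  have eU: "?e (F \<union> F') < \<infinity>"
  proof -
    have "?e (F \<union> F') \<le> ?e (F \<union> F') + ?e (F \<inter> F')" by simp
    also have "\<dots> \<le> ?e F + ?e F'" by (rule energy_submodular[OF sD(2) sD'(2)])
    also have "\<dots> < \<infinity>" using sD(5) sD'(5) by simp
    finally show ?thesis .
  qed
  have "(?e (F \<union> F') + ?e F') + ?c * (?m (W - E) + ?m' (W \<inter> E')) =
     (?e (F \<union> F') + ?c * ?m (W - E)) + (?e F' + ?c * ?m' (W \<inter> E'))"
    by (simp only: distrib_left ac_simps)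
  also have "\<dots> \<le> (?e F' + ?c * ?m (W \<inter> E)) + (?e (F \<union> F') + ?c * ?m' (W - E'))"
    by (rule add_mono[OF i1 i2])
  also have "\<dots> = (?e (F \<union> F') + ?e F') + ?c * (?m (W \<inter> E) + ?m' (W - E'))"
    by (simp only: distrib_left ac_simps)
  finally have "?c * (?m (W - E) + ?m' (W \<inter> E')) \<le> ?c * (?m (W \<inter> E) + ?m' (W - E'))"
    using eU sD'(5) unfolding ennreal_add_left_cancel_le by auto
  hence "ennreal h * (?c * (?m (W - E) + ?m' (W \<inter> E'))) \<le> ennreal h * (?c * (?m (W \<inter> E) + ?m' (W - E')))"
    by (rule mult_left_mono) simp
  moreover have hc: "ennreal h * (?c * x) = x" for x
    using h by (simp add: mult.assoc[symmetric] ennreal_mult[symmetric])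
  ultimately have main: "?m (W - E) + ?m' (W \<inter> E') \<le> ?m (W \<inter> E) + ?m' (W - E')" by simp
  \<comment> \<open>b - a is the signed distance to E minus that to E'; negative terms are moved to
    the other side to stay within \<open>ennreal\<close>.\<close>
  define a where "a x = ?d x * indicator E x + ?d' x * indicator (- E') x" for x
  define b where "b x = ?d x * indicator (- E) x + ?d' x * indicator E' x" for x
  have E's: "- E' \<in> leb" "- E \<in> leb" using sD sD' by auto
  note meas = borel_measurable_add borel_measurable_times_ennreal infdist_measurable_lebesgue borel_measurable_indicator
  have ma: "a \<in> borel_measurable lebesgue" and mb: "b \<in> borel_measurable lebesgue"
    unfolding a_def b_def by (intro meas sD(1) sD'(1) E's)+
  have Ia: "(\<integral>\<^sup>+x\<in>W. a x \<partial>lebesgue) = ?m (W \<inter> E) + ?m' (W - E')"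
  proof -
    have "(\<integral>\<^sup>+x\<in>W. a x \<partial>lebesgue) = (\<integral>\<^sup>+x. ?d x * indicator (W \<inter> E) x + ?d' x * indicator (W - E') x \<partial>lebesgue)"
      by (intro nn_integral_cong) (auto simp: a_def indicator_def)
    also have "\<dots> = ?m (W \<inter> E) + ?m' (W - E')"
      using W sD(1) sD'(1)
      by (subst nn_integral_add) (auto simp: emeasure_boundary_mass intro!: borel_measurable_times_ennreal infdist_measurable_lebesgue borel_measurable_indicator)
    finally show ?thesis .
  qed
  have Ib: "(\<integral>\<^sup>+x\<in>W. b x \<partial>lebesgue) = ?m (W - E) + ?m' (W \<inter> E')"
  proof -
    have "(\<integral>\<^sup>+x\<in>W. b x \<partial>lebesgue) = (\<integral>\<^sup>+x. ?d x * indicator (W - E) x + ?d' x * indicator (W \<inter> E') x \<partial>lebesgue)"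
      by (intro nn_integral_cong) (auto simp: b_def indicator_def)
    also have "\<dots> = ?m (W - E) + ?m' (W \<inter> E')"
      using W sD(1) sD'(1)
      by (subst nn_integral_add) (auto simp: emeasure_boundary_mass intro!: borel_measurable_times_ennreal infdist_measurable_lebesgue borel_measurable_indicator)
    finally show ?thesis .
  qed
  have less: "a x < b x" for x
  proof -
    consider "x \<in> E" | "x \<in> E'" "x \<notin> E" | "x \<notin> E'" using EE by auto
    thus ?thesis
    proof cases
      case 1
      thus ?thesis using E1[OF 1] EE by (auto simp: a_def b_def ennreal_less_iff infdist_nonneg)
    next
      case 2
      thus ?thesis using E2[OF 2] by (simp add: a_def b_def ennreal_plus[symmetric] infdist_nonneg del: ennreal_plus)
    next
      case 3
      hence "x \<notin> E" using EE by auto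
      thus ?thesis using E3[OF 3] 3 by (simp add: a_def b_def ennreal_less_iff infdist_nonneg)
    qed
  qed
  have "?m (W \<inter> E) + ?m' (W - E') < \<infinity>"
  proof -
    have "?m (W \<inter> E) \<le> ?m' (W \<inter> E')"
      unfolding emeasure_boundary_mass[OF sets.Int[OF W sD(1)]] emeasure_boundary_mass[OF sets.Int[OF W sD'(1)]]
      by (rule nn_integral_mono) (use EE E1[THEN less_imp_le] in \<open>auto simp: indicator_def subset_iff intro!: ennreal_leI\<close>)
    also have "\<dots> = ennreal h * (?c * ?m' (W \<inter> E'))" by (simp add: hc)
    also have "\<dots> < \<infinity>" using WE'fin by (simp add: ennreal_mult_less_top)
    finally have f1: "?m (W \<inter> E) < \<infinity>" .
    have FE: "sym_diff F E \<in> leb" using sD by auto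
    have "?m' (W - E') \<le> ?m (sym_diff F E)"
      unfolding emeasure_boundary_mass[OF sets.Diff[OF W sD'(1)]] emeasure_boundary_mass[OF FE]
      by (rule nn_integral_mono)
         (use EE E3[THEN less_imp_le] in \<open>auto simp: W_def indicator_def subset_iff intro!: ennreal_leI\<close>)
    also have "\<dots> = ennreal h * (?c * ?m (sym_diff F E))" by (simp add: hc)
    also have "\<dots> < \<infinity>"
      using sD(4) unfolding step_functional_eq[OF sD(1,2)] by (simp add: ennreal_mult_less_top)
    finally show ?thesis using f1 by simp
  qed
  thus ?thesis
    using nn_integral_strict_null[OF W ma mb less] main unfolding Ia Ib by (simp add: W_def)
qed

lemma J_translation:
  assumes E: "E \<in> leb" and F: "F \<in> leb"
  shows "J h ((+) v ` E) ((+) v ` F) = J h E F"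
proof -
  have Ev: "(+) v ` E \<in> leb" and Fv: "(+) v ` F \<in> leb" using E F by (auto intro: lebesgue_sets_translation)
  have "osc s ((+) v ` F) = (+) v ` osc s F" for s
    using outer_translation[OF F] outer_translation[of "- F"] F
    by (auto simp: osc_def Compl_translation lebesgue_Compl)
  hence "\<E> ((+) v ` F) = \<E> F"
    using F Fv by (simp add: energy_eq emeasure_translation del: emeasure_completion)
  moreover have "emeasure (boundary_mass ((+) v ` E)) (sym_diff ((+) v ` F) ((+) v ` E)) = bmass E (sym_diff F E)"
  proof -
    let ?g = "\<lambda>x. ennreal (infdist x (frontier ((+) v ` E))) * indicator (sym_diff ((+) v ` F) ((+) v ` E)) x"
    have meas: "?g \<in> borel_measurable lebesgue"
      using Ev Fv by (intro borel_measurable_times_ennreal infdist_measurable_lebesgue borel_measurable_indicator) auto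
    have "emeasure (boundary_mass ((+) v ` E)) (sym_diff ((+) v ` F) ((+) v ` E)) = (\<integral>\<^sup>+x. ?g x \<partial>lebesgue)"
      using Ev Fv by (intro emeasure_boundary_mass) auto
    also have "\<dots> = (\<integral>\<^sup>+x. ?g x \<partial>distr lebesgue lebesgue ((+) v))" by (simp only: translation_lebesgue(2))
    also have "\<dots> = (\<integral>\<^sup>+x. ?g (v + x) \<partial>lebesgue)"
      by (rule nn_integral_distr[OF translation_lebesgue(1)]) (simp only: translation_lebesgue(2) meas)
    also have "\<dots> = (\<integral>\<^sup>+x\<in>sym_diff F E. ennreal (infdist x (frontier E)) \<partial>lebesgue)"
      by (intro nn_integral_cong) (auto simp: frontier_translation infdist_translation indicator_def)
    also have "\<dots> = bmass E (sym_diff F E)"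
      using E F by (intro emeasure_boundary_mass[symmetric]) auto
    finally show ?thesis .
  qed
  ultimately show ?thesis using E F Ev Fv by (simp add: step_functional_eq)
qed

lemma solves_translation:
  assumes s: "solves h E F"
  shows "solves h ((+) v ` E) ((+) v ` F)"
proof -
  note sD = solvesD[OF s]
  have Ev: "(+) v ` E \<in> leb" and Fv: "(+) v ` F \<in> leb" using sD by (auto intro: lebesgue_sets_translation)
  have shift_back: "(+) v ` (+) (- v) ` G = G" for G by (simp add: image_image)
  have "J h ((+) v ` E) ((+) v ` F) \<le> J h ((+) v ` E) G" if G: "G \<in> leb" for G
  proof -
    have G': "(+) (- v) ` G \<in> leb" using G by (rule lebesgue_sets_translation)
    show ?thesis
      using sD(6)[OF G'] J_translation[OF sD(1,2), of h v] J_translation[OF sD(1) G', of h v]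
      unfolding shift_back by simp
  qed
  moreover have "good_representative ((+) v ` F)"
    using sD(2,3) Fv full_translation[OF sD(2), of v] full_translation[of "- F" v]
    by (simp add: good_representative_iff frontier_translation Compl_translation lebesgue_Compl image_Un[symmetric])
  moreover have "E = UNIV" if "(+) v ` E = UNIV"
  proof -
    have "x \<in> E" for x
    proof -
      have "v + x \<in> (+) v ` E" using that by simp
      thus ?thesis unfolding mem_translation by simp
    qed
    thus ?thesis by auto
  qed
  ultimately show ?thesis
    using Ev Fv sD J_translation[OF sD(1,2), of h v] by (auto simp: solves_def step_solution_def)
qed

text \<open>Every translate of F by less than r / 2 lies in F' up to a null set, so a whole
  neighbourhood of F does. Points of F carry mass, so F' has full measure around them, and a good
  representative contains such points in its interior.\<close>

theorem solves_strict_mono: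
  assumes h: "0 < h" and r: "0 < r" and s: "solves h E F" and s': "solves h E' F'"
    and sub: "\<And>x. x \<in> E \<Longrightarrow> ball x r \<subseteq> E'"
  shows "F \<subseteq> interior F'"
proof
  fix x assume x: "x \<in> F"
  note sD = solvesD[OF s] and sD' = solvesD[OF s']
  have "((+) v ` F) \<inter> - F' \<in> nulls" if v: "norm v < r / 2" for v
  proof -
    have "(+) v ` F - F' \<in> nulls"
    proof (rule solves_strict_mono_null[OF h _ solves_translation[OF s] s'])
      show "0 < r / 2" using r by simp
      fix y assume "y \<in> (+) v ` E"
      then obtain z where z: "z \<in> E" "y = v + z" by auto
      have "ball y (r / 2) \<subseteq> ball z r"
      proof
        fix w assume "w \<in> ball y (r / 2)"
        hence "norm (y - w) < r / 2" by (simp add: dist_norm)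
        moreover have "norm (z - w) \<le> norm (y - w) + norm v"
        proof -
          have "z - w = (y - w) - v" using z by simp
          thus ?thesis using norm_triangle_ineq4[of "y - w" v] by metis
        qed
        ultimately have "norm (z - w) < r" using v by linarith
        thus "w \<in> ball z r" by (simp add: dist_norm)
      qed
      thus "ball y (r / 2) \<subseteq> E'" using sub[OF z(1)] by blast
    qed
    thus ?thesis by (simp add: Diff_eq)
  qed
  hence null: "outer (r / 2) F \<inter> - F' \<in> nulls"
    by (rule translates_null_imp_outer_null[rotated 2]) (use sD sD' in auto)
  have "x \<in> outer (r / 2) F" by (rule good_representative_pos[OF sD(2,3) x]) (use r in simp)
  then obtain e where e: "e > 0" "ball x e \<subseteq> outer (r / 2) F"
    using openE[OF open_outer[OF sD(2)]] by blast
  have "ball x e - F' \<in> nulls"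
    by (rule null_sets_subset[OF null]) (use e sD' in auto)
  hence "x \<in> full F'" using e by (auto simp: full_def)
  thus "x \<in> interior F'" using good_representative_full_interior[OF sD'(2,3)] by blast
qed

end

section \<open>First variation of the oscillation\<close>

text \<open>Otherwise arbitrarily many pairwise disjoint translates of a bounded piece of S, all of
  the same volume, would fit into one ball.\<close>

lemma translates_avoiding_imp_null:
  fixes S :: "(real^'n) set"
  assumes S: "S \<in> leb" and tmax: "0 < tmax"
    and avoid: "\<And>y t. y \<in> S \<Longrightarrow> 0 < t \<Longrightarrow> t < tmax \<Longrightarrow> y + t *\<^sub>R q \<notin> S"
  shows "S \<in> nulls"
proof -
  have "S \<inter> ball 0 (real N) \<in> nulls" for N :: nat
  proof -
    define T where "T = S \<inter> ball 0 (real N)"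
    have T: "T \<in> lmeasurable" 
      unfolding T_def by (rule fmeasurableI2[OF lmeasurable_ball[of 0 "real N"]]) (use S in auto)
    define B :: "(real^'n) set" where "B = ball 0 (real N + tmax * norm q)"
    \<comment> \<open>Infinitely many distinct shifts in the admissible range; their positive
      differences are in that range too, which makes the translates disjoint.\<close>
    define \<tau> where "\<tau> i = tmax / (real i + 2)" for i :: nat
    have tau: "0 < \<tau> i" "\<tau> i < tmax" for i using tmax by (auto simp: \<tau>_def divide_less_eq)
    have tau_inj: "\<tau> i \<noteq> \<tau> j" if "i \<noteq> j" for i j using tmax that by (auto simp: \<tau>_def divide_simps)
    define Ti where "Ti i = (+) (\<tau> i *\<^sub>R q) ` T" for i
    have Ti: "Ti i \<in> lmeasurable" "rvol (Ti i) = rvol T" for i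
      unfolding Ti_def using T by (auto simp: measurable_translation measure_translation)
    have disj: "disjoint_family_on Ti I" for I
      unfolding disjoint_family_on_def
    proof (intro ballI impI)
      have *: "False" if "i \<noteq> j" "\<tau> j < \<tau> i" "z \<in> Ti i" "z \<in> Ti j" for i j z
      proof -
        have z: "z - \<tau> i *\<^sub>R q \<in> S" "z - \<tau> j *\<^sub>R q \<in> S" using that(3,4) unfolding Ti_def T_def mem_translation by auto
        have "(z - \<tau> i *\<^sub>R q) + (\<tau> i - \<tau> j) *\<^sub>R q \<notin> S"
          by (rule avoid[OF z(1)]) (use that tau[of i] tau[of j] in auto)
        thus False using z(2) by (simp add: algebra_simps)
      qed
      fix i j :: nat assume "i \<noteq> j"
      thus "Ti i \<inter> Ti j = {}" using *[of i j] *[of j i] tau_inj[of i j] by (metis disjoint_iff linorder_neqE_linordered_idom)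
    qed
    have "real K * rvol T \<le> rvol B" for K :: nat
    proof -
      have "real K * rvol T = (\<Sum>i<K. rvol (Ti i))" by (simp add: Ti)
      also have "\<dots> = rvol (\<Union>i<K. Ti i)"
        by (rule measure_UNION_AE[symmetric]) (use Ti disj[of UNIV] in \<open>auto simp: disjoint_family_on_def pairwise_def disjoint_iff intro!: AE_I2\<close>)
      also have "\<dots> \<le> rvol B"
      proof (rule measure_mono_fmeasurable)
        show "(\<Union>i<K. Ti i) \<subseteq> B"
        proof
          fix z assume "z \<in> (\<Union>i<K. Ti i)"
          then obtain i where "z - \<tau> i *\<^sub>R q \<in> T" unfolding Ti_def UN_iff mem_translation by blast
          hence "norm (z - \<tau> i *\<^sub>R q) < real N" by (auto simp: T_def)
          moreover have "norm (\<tau> i *\<^sub>R q) \<le> tmax * norm q" using tau[of i] by (auto intro: mult_right_mono)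
          moreover have "norm z \<le> norm (z - \<tau> i *\<^sub>R q) + norm (\<tau> i *\<^sub>R q)" using norm_triangle_ineq[of "z - \<tau> i *\<^sub>R q" "\<tau> i *\<^sub>R q"] by simp
          ultimately show "z \<in> B" by (simp add: B_def)
        qed
      qed (use Ti in \<open>auto simp: B_def\<close>)
      finally show ?thesis .
    qed
    hence "rvol T = 0"
      by (metis ex_less_of_nat_mult measure_nonneg not_le order_le_less)
    hence "vol T = 0" using emeasure_eq_measure2[OF T] by simp
    thus ?thesis using T unfolding T_def[symmetric] by (auto simp: null_sets_def fmeasurable_def)
  qed
  hence "(\<Union>N. S \<inter> ball 0 (real N)) \<in> nulls" by (rule null_sets_UN)
  moreover have "(\<Union>N. S \<inter> ball 0 (real N)) = S"
    using reals_Archimedean2 by auto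
  ultimately show ?thesis by simp
qed

lemma continuous_preimage_borel:
  fixes g :: "'a::euclidean_space \<Rightarrow> 'b::euclidean_space"
  assumes "continuous_on V g" "V \<in> sets borel" "X \<in> sets borel"
  shows "{y \<in> V. g y \<in> X} \<in> sets borel"
proof -
  have "g -` X \<inter> space (restrict_space borel V) \<in> sets (restrict_space borel V)"
    by (rule measurable_sets[OF borel_measurable_continuous_on_restrict[OF assms(1)] assms(3)])
  hence "g -` X \<inter> V \<in> sets borel"
    using assms(2) by (simp add: space_restrict_space sets_restrict_space_iff)
  moreover have "g -` X \<inter> V = {y \<in> V. g y \<in> X}" by auto
  ultimately show ?thesis by simp
qed

text \<open>If the ball of radius \<open>s\<close> about \<open>x\<close> lies in \<open>G \<union> W\<close> and touches the complement of \<open>G\<close> at \<open>y\<close>, then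
  \<open>y\<close> is the vertex of small balls inside \<open>W\<close> in the direction of \<open>x\<close>. Hence almost all touching points belong
  to \<open>W\<close>.\<close>

lemma inner_variation_le:
  fixes \<psi> :: "real^'n \<Rightarrow> real" and n :: "real^'n \<Rightarrow> real^'n"
  defines "G \<equiv> \<lambda>a. {x. a \<le> \<psi> x}"
  assumes s: "0 < s" and V: "open V" and \<psi>: "continuous_on UNIV \<psi>" and W: "W \<in> lmeasurable"
    and deriv: "\<And>y. y \<in> V \<Longrightarrow> (n has_derivative n' y) (at y)"
    and unit: "\<And>y. y \<in> V \<Longrightarrow> norm (n y) = 1"
    and D: "\<And>y. y \<in> V \<Longrightarrow> \<bar>det (matrix (\<lambda>v. v + s *\<^sub>R n' y v))\<bar> \<le> D"
    and touch: "\<And>x. x \<in> outer s (- G a) - outer s (- (G a \<union> W)) \<Longrightarrow> \<exists>y\<in>V. \<psi> y < a \<and> x = y + s *\<^sub>R n y"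
  shows "vol (outer s (- G a) - outer s (- (G a \<union> W))) \<le> ennreal D * vol W"
proof -
  define X where "X = outer s (- G a) - outer s (- (G a \<union> W))"
  have closedG: "closed (G a)"
    unfolding G_def using continuous_closed_vimage[of "{a..}" \<psi>] \<psi>
    by (simp add: vimage_def continuous_on_eq_continuous_at)
  have Gs: "G a \<in> leb" using closedG by (metis borel_closed sets_completionI_sets sets_lborel)
  have Ws: "W \<in> leb" using W by blast
  have GW: "- (G a \<union> W) \<in> leb" "- G a \<in> leb" using Gs Ws by auto
  have Xb: "X \<in> sets borel" unfolding X_def using open_outer[OF GW(1)] open_outer[OF GW(2)] by auto
  have ncont: "continuous_on V n"
    using deriv by (meson continuous_at_imp_continuous_on has_derivative_continuous)
  \<comment> \<open>The touching points whose partner x was lost. X is contained in the image of Y,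
    so it remains to compare the volume of Y with that of W.\<close>
  define Y where "Y = {y \<in> V. \<psi> y < a \<and> y + s *\<^sub>R n y \<in> X}"
  have Yb: "Y \<in> sets borel"
  proof -
    have "{y \<in> V. y + s *\<^sub>R n y \<in> X} \<in> sets borel"
      by (rule continuous_preimage_borel) (use V Xb in \<open>auto intro!: continuous_intros ncont\<close>)
    moreover have "Y = {y \<in> V. y + s *\<^sub>R n y \<in> X} - G a" by (auto simp: Y_def G_def)
    ultimately show ?thesis using closedG by auto
  qed
  have Ys: "Y \<in> leb" using Yb by (intro sets_completionI_sets) simp
  have fW: "open (full W)" using Ws by (rule open_full)
  \<comment> \<open>The ball of radius t about y + t n(y) touches y from inside the ball about x.
    Close to y it misses G, so W fills it up to a null set, and q points from y into it because q
    differs from n(y) by less than 1.\<close>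
  have in_full: "y + t *\<^sub>R q \<in> full W"
    if y: "y \<in> Y" and r: "ball y (2 * r) \<inter> G a = {}" and t: "0 < t" "t < r" "t < s" and q: "norm (n y - q) < 1" for y t r q
  proof -
    have u: "norm (n y) = 1" using y unit by (auto simp: Y_def)
    define x where "x = y + s *\<^sub>R n y"
    have "x \<notin> outer s (- (G a \<union> W))" using y by (simp add: Y_def X_def x_def)
    hence null: "- (G a \<union> W) \<inter> ball x s \<in> nulls"
      using GW by (auto simp: outer_def null_sets_def simp del: emeasure_completion)
    have "ball (y + t *\<^sub>R n y) t - W \<subseteq> - (G a \<union> W) \<inter> ball x s"
    proof
      fix z assume z: "z \<in> ball (y + t *\<^sub>R n y) t - W"
      hence zt: "norm (y + t *\<^sub>R n y - z) < t" by (simp add: dist_norm)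
      have "norm (x - z) \<le> norm (y + t *\<^sub>R n y - z) + norm ((s - t) *\<^sub>R n y)"
        using norm_triangle_ineq[of "y + t *\<^sub>R n y - z" "(s - t) *\<^sub>R n y"] by (simp add: x_def algebra_simps)
      also have "norm ((s - t) *\<^sub>R n y) = s - t" using t u by simp
      finally have 1: "norm (x - z) < s" using zt by simp
      have "norm (y - z) \<le> norm (y + t *\<^sub>R n y - z) + norm (t *\<^sub>R n y)"
        using norm_triangle_ineq4[of "y + t *\<^sub>R n y - z" "t *\<^sub>R n y"] by simp
      also have "norm (t *\<^sub>R n y) = t" using t u by simp
      finally have "norm (y - z) < 2 * r" using zt t by simp
      hence "z \<notin> G a" using r by (auto simp: dist_norm)
      thus "z \<in> - (G a \<union> W) \<inter> ball x s" using 1 z by (simp add: dist_norm)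
    qed
    hence "ball (y + t *\<^sub>R n y) t - W \<in> nulls"
      using Ws by (intro null_sets_subset[OF null]) auto
    hence "ball (y + t *\<^sub>R n y) t \<subseteq> full W" by (rule full_ball[OF Ws])
    moreover have "y + t *\<^sub>R q \<in> ball (y + t *\<^sub>R n y) t"
    proof -
      have "norm (t *\<^sub>R (n y - q)) < t" using t q by simp
      thus ?thesis by (simp add: dist_norm algebra_simps)
    qed
    ultimately show ?thesis by blast
  qed
  \<comment> \<open>A countable dense set of directions: one fixed q serves all y whose normal is
    near q.\<close>
  obtain Q :: "(real^'n) set" where Q: "countable Q" "\<And>X. open X \<Longrightarrow> X \<noteq> {} \<Longrightarrow> \<exists>d\<in>Q. d \<in> X"
    using countable_dense_exists by metis
  \<comment> \<open>Small shifts by t q lead from here into \<open>full W\<close>, hence out of S m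
    q, so each of these countably many pieces is null.\<close>
  define S where "S m q = {y \<in> Y. norm (n y - q) < 1 \<and> ball y (2 / Suc m) \<inter> G a = {}} - full W" for m :: nat and q
  have Snull: "S m q \<in> nulls" for m q
  proof (rule translates_avoiding_imp_null[where tmax = "min s (1 / Suc m)"])
    have "S m q = Y \<inter> {y \<in> V. n y \<in> ball q 1} - (\<Union>z\<in>G a. ball z (2 / Suc m)) - full W"
      by (auto simp: S_def Y_def dist_norm norm_minus_commute disjoint_iff)
    moreover have "{y \<in> V. n y \<in> ball q 1} \<in> sets borel"
      by (rule continuous_preimage_borel) (use V ncont in auto)
    moreover have "open (\<Union>z\<in>G a. ball z (2 / Suc m))" by (intro open_UN ballI open_ball)
    ultimately have "S m q \<in> sets borel" using Yb fW by (metis (no_types, lifting) borel_open sets.Diff sets.Int)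
    thus "S m q \<in> leb" by (intro sets_completionI_sets) simp
    show "0 < min s (1 / Suc m)" using s by simp
    fix y t assume y: "y \<in> S m q" and t: "0 < t" "t < min s (1 / Suc m)"
    have "y + t *\<^sub>R q \<in> full W"
      by (rule in_full[where r = "1 / Suc m"]) (use y t in \<open>auto simp: S_def\<close>)
    thus "y + t *\<^sub>R q \<notin> S m q" by (simp add: S_def)
  qed
  have "Y - full W \<subseteq> (\<Union>m. \<Union>q\<in>Q. S m q)"
  proof
    fix y assume y: "y \<in> Y - full W"
    obtain q where q: "q \<in> Q" "q \<in> ball (n y) 1" using Q(2)[of "ball (n y) 1"] by auto
    have "y \<in> - G a" using y by (auto simp: Y_def G_def)
    then obtain e where e: "e > 0" "ball y e \<subseteq> - G a" using closedG by (meson open_Compl openE)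
    obtain m where "inverse (Suc m) < e / 2" using reals_Archimedean[of "e/2"] e by auto
    hence "2 / Suc m < e" by (simp add: inverse_eq_divide field_simps)
    hence "ball y (2 / Suc m) \<subseteq> ball y e" by (intro subset_ball) simp
    hence "ball y (2 / Suc m) \<inter> G a = {}" using e by blast
    thus "y \<in> (\<Union>m. \<Union>q\<in>Q. S m q)" using y q by (auto simp: S_def dist_norm intro!: exI[of _ m])
  qed
  moreover have "(\<Union>m. \<Union>q\<in>Q. S m q) \<in> nulls"
    by (intro null_sets_UN null_sets_UN' Q(1) Snull)
  ultimately have Ynull: "Y - full W \<in> nulls"
    by (rule null_sets_subset[rotated 2]) (use Ys open_sets_lebesgue[OF fW] in auto)
  have YW: "vol Y \<le> vol W"
  proof -
    have "vol Y \<le> vol (W \<union> ((full W - W) \<union> (Y - full W)))"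
      by (rule emeasure_mono) (use Ws Ys open_sets_lebesgue[OF fW] in auto)
    also have "\<dots> = vol W"
      by (rule emeasure_Un_null_set[OF Ws null_sets.Un[OF full_diff_null[OF Ws] Ynull]])
    finally show ?thesis .
  qed
  have Yl: "Y \<in> lmeasurable" using Ys YW W by (auto simp: fmeasurable_def)
  have mYW: "rvol Y \<le> rvol W"
    using YW W by (auto simp: measure_def fmeasurable_def intro!: enn2real_mono)
  let ?\<Phi> = "\<lambda>y. y + s *\<^sub>R n y"
  have der: "(?\<Phi> has_derivative (\<lambda>v. v + s *\<^sub>R n' y v)) (at y within Y)" if "y \<in> Y" for y
  proof -
    have "(n has_derivative n' y) (at y within Y)" using that by (intro has_derivative_at_withinI[OF deriv]) (simp add: Y_def)
    thus ?thesis by (rule has_derivative_add[OF has_derivative_ident has_derivative_scaleR_right])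
  qed
  have D': "\<bar>det (matrix (\<lambda>v. v + s *\<^sub>R n' y v))\<bar> \<le> D" if "y \<in> Y" for y
    using D[of y] that by (simp add: Y_def)
  have im: "?\<Phi> ` Y \<in> lmeasurable" "rvol (?\<Phi> ` Y) \<le> D * rvol Y"
    using measurable_image[OF Yl der D'] measure_image_le[OF Yl der D'] by auto
  have "X \<subseteq> ?\<Phi> ` Y"
    using touch by (fastforce simp: X_def Y_def)
  hence "vol X \<le> vol (?\<Phi> ` Y)" using im(1) by (intro emeasure_mono) auto
  also have "\<dots> = ennreal (rvol (?\<Phi> ` Y))" using im(1) by (rule emeasure_eq_measure2)
  also have "\<dots> \<le> ennreal D * ennreal (rvol W)"
  proof (cases "Y = {}")
    case False
    hence "0 \<le> D" using D' by (meson abs_ge_zero all_not_in_conv order_trans)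
    hence "rvol (?\<Phi> ` Y) \<le> D * rvol W"
      using im(2) mYW by (meson mult_left_mono order_trans)
    thus ?thesis using \<open>0 \<le> D\<close> by (simp add: ennreal_mult[symmetric] ennreal_leI)
  qed simp
  also have "ennreal (rvol W) = vol W" using W by (rule emeasure_eq_measure2[symmetric])
  finally show ?thesis unfolding X_def .
qed

text \<open>The point y of W is moved to y - t n(y) with t slightly below s. As t < s, the ball of
  radius s about the image contains a neighbourhood of y and so a positive part of W. It is a small
  shift of the ball about y - s n(y), which lies below the level of y, and so it misses G. The
  change of variables turns the images into volume.\<close>

lemma outer_variation_ge:
  fixes \<psi> :: "real^'n \<Rightarrow> real" and n :: "real^'n \<Rightarrow> real^'n"
  defines "G \<equiv> \<lambda>a. {x. a \<le> \<psi> x}"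
  assumes s: "0 < s" and V: "open V" "bounded V" and \<psi>: "continuous_on UNIV \<psi>" and W: "W \<in> lmeasurable"
    and WV: "W \<subseteq> V" "W \<inter> G a = {}"
    and deriv: "\<And>y. y \<in> V \<Longrightarrow> (n has_derivative n' y) (at y)"
    and unit: "\<And>y. y \<in> V \<Longrightarrow> norm (n y) = 1"
    and tau: "0 < \<tau>"
    and D: "\<And>y t. y \<in> V \<Longrightarrow> s - \<tau> < t \<Longrightarrow> t < s \<Longrightarrow> d \<le> \<bar>det (matrix (\<lambda>v. v - t *\<^sub>R n' y v))\<bar>"
    and D': "\<And>y t. y \<in> V \<Longrightarrow> s - \<tau> < t \<Longrightarrow> t < s \<Longrightarrow> \<bar>det (matrix (\<lambda>v. v - t *\<^sub>R n' y v))\<bar> \<le> D"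
    and touch: "\<And>y z. y \<in> V \<Longrightarrow> z \<in> ball (y - s *\<^sub>R n y) s \<Longrightarrow> \<psi> z < \<psi> y"
  shows "ennreal d * vol W \<le> vol (outer s (G a \<union> W) - outer s (G a))"
proof -
  have closedG: "closed (G b)" for b
    unfolding G_def using continuous_closed_vimage[of "{b..}" \<psi>] \<psi>
    by (simp add: vimage_def continuous_on_eq_continuous_at)
  have Gs: "G b \<in> leb" for b using closedG by (metis borel_closed sets_completionI_sets sets_lborel)
  have Ws: "W \<in> leb" using W by blast
  have Ps: "outer s (G a \<union> W) - outer s (G a) \<in> leb"
    using open_sets_lebesgue[OF open_outer[of "G a \<union> W" s]] open_sets_lebesgue[OF open_outer[of "G a" s]] Gs Ws by auto
  \<comment> \<open>W without its points of zero density mass and without points within 1 / (m + 1)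
    of the level a; this margin absorbs the shift from s to t. The sets exhaust W up to a null
    set.\<close>
  define Wm where "Wm m = W - full (- W) - G (a - 1 / Suc m)" for m :: nat
  have fs: "full (- W) \<in> leb" by (rule open_sets_lebesgue[OF open_full[OF lebesgue_Compl[OF Ws]]])
  have Wms: "Wm m \<in> leb" for m unfolding Wm_def using Ws Gs fs by auto
  have Wml: "Wm m \<in> lmeasurable" for m
    by (rule fmeasurableI2[OF W _ Wms]) (auto simp: Wm_def)
  have step: "ennreal d * vol (Wm m) \<le> vol (outer s (G a \<union> W) - outer s (G a))" for m
  proof -
    obtain R where R: "0 < R" "V \<subseteq> ball 0 R" using V(2) bounded_subset_ballD by blast
    have "uniformly_continuous_on (cball 0 (R + 3 * s)) \<psi>"
      by (rule compact_uniformly_continuous) (use \<psi> in \<open>auto intro: continuous_on_subset\<close>)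
    then obtain \<eta> where eta: "0 < \<eta>" "\<And>z z'. z \<in> cball 0 (R + 3 * s) \<Longrightarrow> z' \<in> cball 0 (R + 3 * s) \<Longrightarrow> dist z' z < \<eta> \<Longrightarrow> dist (\<psi> z') (\<psi> z) < 1 / Suc m"
      unfolding uniformly_continuous_on_def by (metis divide_pos_pos of_nat_0_less_iff zero_less_Suc zero_less_one)
    \<comment> \<open>e = s - t must lie below the modulus of continuity for the margin, below the
      range \<tau> of the determinant bounds, and below s.\<close>
    define e where "e = min (min \<eta> \<tau>) s / 2"
    define t where "t = s - e"
    have e: "0 < e" "e < \<eta>" "e < \<tau>" "e < s" using eta(1) tau s by (auto simp: e_def)
    have t: "0 < t" "t < s" "s - \<tau> < t" using e by (auto simp: t_def)
    let ?\<Phi> = "\<lambda>y. y - t *\<^sub>R n y"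
    have der: "(?\<Phi> has_derivative (\<lambda>v. v - t *\<^sub>R n' y v)) (at y within Wm m)" if "y \<in> Wm m" for y
    proof -
      have "y \<in> V" using that WV(1) by (auto simp: Wm_def)
      hence "(n has_derivative n' y) (at y within Wm m)" by (rule has_derivative_at_withinI[OF deriv])
      thus ?thesis by (rule has_derivative_diff[OF has_derivative_ident has_derivative_scaleR_right])
    qed
    \<comment> \<open>If y1 and y2 have the same image, then y2 - (y1 - s n(y1)) = t n(y2) + e
      n(y1). For different unit normals its norm is less than t + e = s, so y2 lies strictly below
      the level of y1; by symmetry this excludes collisions.\<close>
    have inj: "inj_on ?\<Phi> (Wm m)"
    proof (rule inj_onI)
      have *: "y1 = y2" if y: "y1 \<in> V" "y2 \<in> V" "?\<Phi> y1 = ?\<Phi> y2" "\<psi> y1 \<le> \<psi> y2" for y1 y2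
      proof (rule ccontr)
        assume ne: "y1 \<noteq> y2"
        hence nn: "n y1 \<noteq> n y2" using y(3) by auto
        have u: "n y1 \<bullet> n y1 = 1" "n y2 \<bullet> n y2 = 1" using unit y by (auto simp: norm_eq_1)
        have "0 < (n y1 - n y2) \<bullet> (n y1 - n y2)" using nn by simp
        hence c: "n y1 \<bullet> n y2 < 1" using u by (simp add: inner_diff_left inner_diff_right inner_commute)
        have "(t *\<^sub>R n y2 + e *\<^sub>R n y1) \<bullet> (t *\<^sub>R n y2 + e *\<^sub>R n y1) = t\<^sup>2 + e\<^sup>2 + 2 * t * e * (n y1 \<bullet> n y2)"
          using u by (simp add: inner_add_left inner_add_right inner_commute power2_eq_square algebra_simps)
        also have "\<dots> < t\<^sup>2 + e\<^sup>2 + 2 * t * e * 1" using c e t by (intro add_strict_left_mono mult_strict_left_mono) auto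
        also have "\<dots> = s\<^sup>2" by (simp add: t_def power2_eq_square algebra_simps)
        finally have "(norm (t *\<^sub>R n y2 + e *\<^sub>R n y1))\<^sup>2 < s\<^sup>2" by (simp add: power2_norm_eq_inner)
        hence "norm (t *\<^sub>R n y2 + e *\<^sub>R n y1) < s" using s by (meson less_imp_le power2_less_imp_less)
        moreover have "t *\<^sub>R n y2 + e *\<^sub>R n y1 = y2 - (y1 - s *\<^sub>R n y1)"
        proof -
          have "t *\<^sub>R n y2 = y2 - (y1 - t *\<^sub>R n y1)" using y(3) by (simp add: algebra_simps)
          thus ?thesis by (simp add: t_def algebra_simps)
        qed
        ultimately have "y2 \<in> ball (y1 - s *\<^sub>R n y1) s" by (simp add: dist_norm norm_minus_commute)
        hence "\<psi> y2 < \<psi> y1" by (rule touch[OF y(1)])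
        thus False using y(4) by simp
      qed
      fix y1 y2 assume "y1 \<in> Wm m" "y2 \<in> Wm m" and eq: "?\<Phi> y1 = ?\<Phi> y2"
      hence "y1 \<in> V" "y2 \<in> V" using WV by (auto simp: Wm_def)
      thus "y1 = y2" using *[of y1 y2] *[of y2 y1] eq by (metis linear)
    qed
    have det: "\<bar>det (matrix (\<lambda>v. v - t *\<^sub>R n' y v))\<bar> \<le> D" "d \<le> \<bar>det (matrix (\<lambda>v. v - t *\<^sub>R n' y v))\<bar>" if "y \<in> Wm m" for y
      using D[of y t] D'[of y t] that WV(1) t by (auto simp: Wm_def)
    have im: "?\<Phi> ` Wm m \<in> lmeasurable" by (rule measurable_image[OF Wml der det(1)])
    have ge: "d * rvol (Wm m) \<le> rvol (?\<Phi> ` Wm m)"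
      by (rule measure_image_ge[OF Wml der det(1) inj det(2)])
    have sub: "?\<Phi> ` Wm m \<subseteq> outer s (G a \<union> W) - outer s (G a)"
    proof (rule image_subsetI)
      fix y assume y: "y \<in> Wm m"
      hence yW: "y \<in> W" "y \<in> V" "y \<notin> full (- W)" "\<psi> y < a - 1 / Suc m" using WV by (auto simp: Wm_def G_def)
      have u: "norm (n y) = 1" using unit yW by simp
      have "0 < vol (W \<inter> ball y e)"
      proof (rule ccontr)
        assume "\<not> 0 < vol (W \<inter> ball y e)"
        hence "W \<inter> ball y e \<in> nulls" using Ws by (auto simp: null_sets_def simp del: emeasure_completion)
        hence "ball y e - - W \<in> nulls" by (simp add: Diff_eq Int_commute)
        thus False using yW(3) e(1) by (auto simp: full_def)
      qed
      also have "\<dots> \<le> vol ((G a \<union> W) \<inter> ball (?\<Phi> y) s)"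
      proof (rule emeasure_mono)
        have "ball y e \<subseteq> ball (?\<Phi> y) s"
        proof
          fix z assume "z \<in> ball y e"
          hence "norm (y - z) < e" by (simp add: dist_norm)
          moreover have "norm (?\<Phi> y - z) \<le> norm (y - z) + norm (t *\<^sub>R n y)"
            using norm_triangle_ineq4[of "y - z" "t *\<^sub>R n y"] by (simp add: algebra_simps)
          ultimately show "z \<in> ball (?\<Phi> y) s" using u t e by (simp add: dist_norm t_def)
        qed
        thus "W \<inter> ball y e \<subseteq> (G a \<union> W) \<inter> ball (?\<Phi> y) s" by auto
      qed (use Gs Ws in auto)
      finally have 1: "?\<Phi> y \<in> outer s (G a \<union> W)" by (simp add: outer_def)
      have "ball (?\<Phi> y) s \<inter> G a = {}"
      proof (rule ccontr)
        assume "ball (?\<Phi> y) s \<inter> G a \<noteq> {}"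
        then obtain z where z: "norm (?\<Phi> y - z) < s" "a \<le> \<psi> z" by (auto simp: G_def dist_norm)
        \<comment> \<open>Shifting by e along the normal brings z into the ball about y - s n(y),
          where the level is below that of y.\<close>
        define z' where "z' = z - e *\<^sub>R n y"
        have sh: "y - s *\<^sub>R n y - z' = ?\<Phi> y - z" by (simp add: z'_def t_def algebra_simps)
        have "z' \<in> ball (y - s *\<^sub>R n y) s" using z(1) unfolding mem_ball dist_norm sh .
        hence "\<psi> z' < \<psi> y" by (rule touch[OF yW(2)])
        moreover have "dist (\<psi> z') (\<psi> z) < 1 / Suc m"
        proof (rule eta(2))
          have ny: "norm y < R" using yW(2) R(2) by auto
          have "norm z \<le> norm (?\<Phi> y - z) + norm (?\<Phi> y)" using norm_triangle_ineq4[of "?\<Phi> y" "?\<Phi> y - z"] by simp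
          moreover have "norm (?\<Phi> y) \<le> norm y + t" using norm_triangle_ineq4[of y "t *\<^sub>R n y"] u t by simp
          ultimately have nz: "norm z < R + 2 * s" using z(1) ny t by linarith
          thus "z \<in> cball 0 (R + 3 * s)" using s by simp
          have "norm z' \<le> norm z + e" using norm_triangle_ineq4[of z "e *\<^sub>R n y"] u e by (simp add: z'_def)
          thus "z' \<in> cball 0 (R + 3 * s)" using nz e by simp
          show "dist z' z < \<eta>" using u e by (simp add: z'_def dist_norm)
        qed
        ultimately show False using z(2) yW(4) by (simp add: dist_real_def)
      qed
      hence "?\<Phi> y \<notin> outer s (G a)" by (auto simp: outer_def Int_commute)
      thus "?\<Phi> y \<in> outer s (G a \<union> W) - outer s (G a)" using 1 by blast
    qed
    have "ennreal d * vol (Wm m) = ennreal d * ennreal (rvol (Wm m))"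
      by (simp only: emeasure_eq_measure2[OF Wml])
    also have "\<dots> = ennreal (d * rvol (Wm m))" by (simp add: ennreal_mult'')
    also have "\<dots> \<le> ennreal (rvol (?\<Phi> ` Wm m))" by (intro ennreal_leI ge)
    also have "\<dots> = vol (?\<Phi> ` Wm m)" by (rule emeasure_eq_measure2[OF im, symmetric])
    also have "\<dots> \<le> vol (outer s (G a \<union> W) - outer s (G a))"
      by (rule emeasure_mono[OF sub Ps])
    finally show ?thesis .
  qed
  have "incseq Wm"
  proof (rule incseq_SucI)
    fix m :: nat
    have "1 / real (Suc (Suc m)) \<le> 1 / real (Suc m)" by (simp add: divide_simps)
    thus "Wm m \<le> Wm (Suc m)" by (auto simp: Wm_def G_def)
  qed
  hence "(SUP m. vol (Wm m)) = vol (\<Union>m. Wm m)"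
    using Wms by (intro SUP_emeasure_incseq) auto
  moreover have "(\<Union>m. Wm m) = W - full (- W)"
  proof -
    have "\<exists>m. \<psi> y < a - 1 / Suc m" if "y \<in> W" for y
    proof -
      have "y \<notin> G a" using that WV(2) by blast
      hence "0 < a - \<psi> y" by (simp add: G_def)
      then obtain m where "inverse (Suc m) < a - \<psi> y" using reals_Archimedean by blast
      thus ?thesis by (intro exI[of _ m]) (simp add: inverse_eq_divide)
    qed
    hence ex: "\<exists>m. y \<notin> G (a - 1 / Suc m)" if "y \<in> W" for y
      using that by (metis G_def linorder_not_less mem_Collect_eq)
    show ?thesis
    proof
      show "W - full (- W) \<subseteq> (\<Union>m. Wm m)"
      proof
        fix y assume y: "y \<in> W - full (- W)"
        then obtain m where "y \<notin> G (a - 1 / Suc m)" using ex by blast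
        hence "y \<in> Wm m" using y unfolding Wm_def by blast
        thus "y \<in> (\<Union>m. Wm m)" by blast
      qed
    qed (auto simp: Wm_def)
  qed
  moreover have "vol (W - full (- W)) = vol W"
  proof -
    have "W \<inter> full (- W) \<in> nulls"
      using full_diff_null[of "- W"] Ws by (simp add: Diff_eq Int_commute lebesgue_Compl)
    hence "vol (W - (W \<inter> full (- W))) = vol W"
      by (rule emeasure_Diff_null_set[OF _ Ws])
    thus ?thesis by (simp add: Diff_Int_distrib2 Diff_Int del: emeasure_completion)
  qed
  ultimately have "ennreal d * vol W = (SUP m. ennreal d * vol (Wm m))"
    by (simp add: SUP_mult_left_ennreal[symmetric] del: emeasure_completion)
  also have "\<dots> \<le> vol (outer s (G a \<union> W) - outer s (G a))"
    by (rule SUP_least) (rule step)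
  finally show ?thesis .
qed

lemma osc_lmeasurable:
  assumes "A \<in> leb" "bounded A \<or> bounded (- A)"
  shows "osc s A \<in> lmeasurable"
proof -
  obtain R where R: "A \<subseteq> ball 0 R \<or> - A \<subseteq> ball 0 R"
    using assms(2) bounded_subset_ballD[of A 0] bounded_subset_ballD[of "- A" 0] by blast
  show ?thesis by (rule fmeasurableI2[OF lmeasurable_ball osc_subset_ball[OF R] osc_sets[OF assms(1)]])
qed

text \<open>Adding W enlarges the neighbourhood of G and shrinks that of the complement. A lost
  point outside \<open>osc s G\<close> is also a gained one, so the balance is an equality of two
  disjoint unions; it is stated as a sum, without subtraction in \<open>ennreal\<close>.\<close>

lemma osc_Un_variation:
  assumes G: "G \<in> leb" and W: "W \<in> leb"
  shows "vol (osc s (G \<union> W)) + vol (outer s (- G) - outer s (- (G \<union> W))) =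
    vol (osc s G) + vol (outer s (G \<union> W) - outer s G)"
proof -
  have sets: "G \<union> W \<in> leb" "- G \<in> leb" "- (G \<union> W) \<in> leb" using G W by auto
  note o = open_sets_lebesgue[OF open_outer[OF G]] open_sets_lebesgue[OF open_outer[OF sets(1)]]
    open_sets_lebesgue[OF open_outer[OF sets(2)]] open_sets_lebesgue[OF open_outer[OF sets(3)]]
  have m: "outer s G \<subseteq> outer s (G \<union> W)" "outer s (- (G \<union> W)) \<subseteq> outer s (- G)"
    using outer_mono[of G "G \<union> W" s s] outer_mono[of "- (G \<union> W)" "- G" s s] sets by auto
  have cover: "outer s A \<union> outer s (- A) = outer s UNIV" if "A \<in> leb" for A :: "(real^'a) set"
    using outer_Un[of A "- A" s] that by (simp add: lebesgue_Compl)
  have "vol (osc s (G \<union> W)) + vol (outer s (- G) - outer s (- (G \<union> W))) =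
      vol (osc s (G \<union> W) \<union> (outer s (- G) - outer s (- (G \<union> W))))"
    by (rule plus_emeasure) (use sets o in \<open>auto simp: osc_def\<close>)
  also have "osc s (G \<union> W) \<union> (outer s (- G) - outer s (- (G \<union> W))) = osc s G \<union> (outer s (G \<union> W) - outer s G)"
    using m cover[OF G] cover[OF sets(1)] unfolding osc_def by blast
  also have "vol \<dots> = vol (osc s G) + vol (outer s (G \<union> W) - outer s G)"
    by (rule plus_emeasure[symmetric]) (use G sets o in \<open>auto simp: osc_def\<close>)
  finally show ?thesis .
qed

context radial_profile
begin

lemma energy_integral:
  assumes A: "A \<in> leb" and b: "bounded A \<or> bounded (- A)"
  shows "integrable lborel (\<lambda>s. weight s * rvol (osc s A))"
    and "(\<integral>s. weight s * rvol (osc s A) \<partial>lborel) = enn2real (\<E> A)"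
proof -
  have em: "vol (osc s A) = ennreal (rvol (osc s A))" for s
    by (rule emeasure_eq_measure2[OF osc_lmeasurable[OF A b]])
  have eq: "\<E> A = (\<integral>\<^sup>+ s. ennreal (weight s * rvol (osc s A)) \<partial>lborel)"
    unfolding energy_eq[OF A] em using weight_nonneg by (simp add: ennreal_mult)
  have meas: "(\<lambda>s. weight s * rvol (osc s A)) \<in> borel_measurable lborel"
  proof -
    have "(\<lambda>s. enn2real (vol (osc s A))) \<in> borel_measurable borel"
      by (intro borel_measurable_enn2real emeasure_osc_measurable A)
    thus ?thesis by (simp add: measure_def)
  qed
  show "integrable lborel (\<lambda>s. weight s * rvol (osc s A))"
    by (rule integrableI_nonneg[OF meas]) (use weight_nonneg energy_finite[OF A b] in \<open>auto simp: eq[symmetric]\<close>)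
  show "(\<integral>s. weight s * rvol (osc s A) \<partial>lborel) = enn2real (\<E> A)"
    unfolding eq by (rule integral_eq_nn_integral[OF meas]) (use weight_nonneg in auto)
qed

text \<open>c is a lower bound for the signed displacement of F over W = F - G per unit of time. For
  c \<ge> 0 the set W lies outside E at distance at least c h from its boundary; for c < 0 it may
  meet E, but only within |c| h of the boundary. In both cases the dissipation contributes at least
  c times the volume of W.\<close>

lemma solves_variation:
  fixes E F G :: "(real^'n) set"
  assumes h: "0 < h" and s: "solves h E F" and G: "G \<in> leb" "bounded (- G)"
    and ge: "\<And>y. 0 \<le> c \<Longrightarrow> y \<in> F - G \<Longrightarrow> y \<notin> E \<and> c * h \<le> infdist y (frontier E)"
    and le: "\<And>y. c < 0 \<Longrightarrow> y \<in> (F - G) \<inter> E \<Longrightarrow> infdist y (frontier E) \<le> - c * h"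
  shows "enn2real (\<E> (G \<union> (F - G))) + c * rvol (F - G) \<le> enn2real (\<E> G)"
proof -
  note sD = solvesD[OF s]
  define W where "W = F - G"
  have Ws: "W \<in> leb" using sD G by (auto simp: W_def)
  have bW: "bounded W" using G(2) by (rule bounded_subset) (auto simp: W_def)
  obtain R where R: "W \<subseteq> ball 0 R" using bounded_subset_ballD[OF bW] by blast
  have Wl: "W \<in> lmeasurable" by (rule fmeasurableI2[OF lmeasurable_ball R Ws])
  have eG: "\<E> G < \<infinity>" by (rule energy_finite[OF G(1)]) (use G in auto)
  have GW: "G \<union> W \<in> leb" using G Ws by auto
  have eGW: "\<E> (G \<union> W) < \<infinity>"
    by (rule energy_finite[OF GW]) (use G(2) in \<open>auto intro: bounded_subset\<close>)
  have FuG: "F \<union> G = G \<union> W" by (auto simp: W_def)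
  have cmp: "\<E> (G \<union> W) + ennreal (1 / h) * bmass E (W - E) \<le>
      \<E> G + ennreal (1 / h) * bmass E (W \<inter> E)"
    using solves_upper_comparison[OF s h G(1) eG] unfolding FuG W_def[symmetric] .
  obtain e1 e0 where e: "\<E> (G \<union> W) = ennreal e1" "0 \<le> e1" "\<E> G = ennreal e0" "0 \<le> e0"
    using eG eGW by (cases "\<E> (G \<union> W)"; cases "\<E> G") auto
  have em: "vol W = ennreal (rvol W)" by (rule emeasure_eq_measure2[OF Wl])
  have "e1 + c * rvol W \<le> e0"
  proof (cases "0 \<le> c")
    case True
    have WE: "W - E = W" "W \<inter> E = {}" using ge[OF True] by (auto simp: W_def)
    have "ennreal (c * h) * vol W \<le> bmass E W"
      by (rule boundary_mass_ge[OF Ws]) (use ge[OF True] True h in \<open>auto simp: W_def\<close>)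
    hence "ennreal (1 / h) * (ennreal (c * h) * vol W) \<le> ennreal (1 / h) * bmass E W"
      by (rule mult_left_mono) simp
    moreover have "ennreal (1 / h) * (ennreal (c * h) * vol W) = ennreal (c * rvol W)"
      unfolding em using True h by (simp add: ennreal_mult[symmetric])
    ultimately have "ennreal e1 + ennreal (c * rvol W) \<le> ennreal e1 + ennreal (1 / h) * bmass E W"
      by (intro add_left_mono) simp
    also have "\<dots> \<le> ennreal e0" using cmp unfolding WE e by simp
    finally show ?thesis using True e by (simp add: ennreal_plus[symmetric] del: ennreal_plus)
  next
    case False
    hence c: "c < 0" by simp
    have WEs: "W \<inter> E \<in> leb" using Ws sD by auto
    have "bmass E (W \<inter> E) \<le> ennreal (- c * h) * vol (W \<inter> E)"
      by (rule boundary_mass_le[OF WEs]) (use le[OF c] in \<open>auto simp: W_def\<close>)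
    also have "\<dots> \<le> ennreal (- c * h) * vol W"
      by (intro mult_left_mono emeasure_mono) (use Ws in auto)
    finally have "ennreal (1 / h) * bmass E (W \<inter> E) \<le> ennreal (1 / h) * (ennreal (- c * h) * vol W)"
      by (rule mult_left_mono) simp
    also have "\<dots> = ennreal (- c * rvol W)"
      proof -
      have "0 \<le> - c * h" "0 \<le> - c * h * rvol W" using c h by (simp_all add: mult_nonpos_nonneg)
      thus ?thesis unfolding em using h by (simp add: ennreal_mult[symmetric])
    qed
    finally have "\<E> G + ennreal (1 / h) * bmass E (W \<inter> E) \<le> ennreal e0 + ennreal (- c * rvol W)"
      unfolding e by (rule add_left_mono)
    moreover have "ennreal e1 \<le> \<E> (G \<union> W) + ennreal (1 / h) * bmass E (W - E)"
      unfolding e by simp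
    ultimately have "ennreal e1 \<le> ennreal e0 + ennreal (- c * rvol W)" using cmp by (meson order_trans)
    moreover have "0 \<le> - c * rvol W" using c by (intro mult_nonneg_nonneg) auto
    ultimately show ?thesis using e by (simp add: ennreal_plus[symmetric] del: ennreal_plus)
  qed
  thus ?thesis using e by (simp add: W_def[symmetric])
qed

end

section \<open>Normal fields\<close>

lemma norm_unit_dir: "p \<noteq> 0 \<Longrightarrow> norm (unit_dir p) = 1"
  by (simp add: unit_dir_def)

lemma unit_dir_scale: "0 < c \<Longrightarrow> unit_dir (c *\<^sub>R x) = unit_dir x"
  by (simp add: unit_dir_def inverse_mult_distrib mult.commute mult.left_commute)

lemma has_derivative_unit_dir:
  fixes g :: "real^'n \<Rightarrow> real^'n"
  assumes g: "(g has_derivative g') (at y)" and nz: "g y \<noteq> 0"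
  shows "((\<lambda>y. unit_dir (g y)) has_derivative
    (\<lambda>v. (1 / norm (g y)) *\<^sub>R (perp_proj (unit_dir (g y)) *v g' v))) (at y)"
proof -
  have "((\<lambda>y. norm (g y)) has_derivative (\<lambda>v. g' v \<bullet> sgn (g y))) (at y)"
    using has_derivative_compose[OF g has_derivative_norm[OF nz]] by (simp add: inner_commute)
  hence "((\<lambda>y. inverse (norm (g y))) has_derivative
     (\<lambda>v. - (inverse (norm (g y)) * (g' v \<bullet> sgn (g y)) * inverse (norm (g y))))) (at y)"
    by (rule Deriv.has_derivative_inverse[rotated]) (use nz in simp)
  from has_derivative_scaleR[OF this g]
  have "((\<lambda>y. inverse (norm (g y)) *\<^sub>R g y) has_derivative
     (\<lambda>v. inverse (norm (g y)) *\<^sub>R g' v + (- (inverse (norm (g y)) * (g' v \<bullet> sgn (g y)) * inverse (norm (g y)))) *\<^sub>R g y)) (at y)" .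
  thus ?thesis
    unfolding unit_dir_def
  proof (rule has_derivative_eq_rhs)
    show "(\<lambda>v. inverse (norm (g y)) *\<^sub>R g' v + (- (inverse (norm (g y)) * (g' v \<bullet> sgn (g y)) * inverse (norm (g y)))) *\<^sub>R g y) =
      (\<lambda>v. (1 / norm (g y)) *\<^sub>R (perp_proj (g y /\<^sub>R norm (g y)) *v g' v))"
      by (simp add: fun_eq_iff perp_proj_vec sgn_div_norm inverse_eq_divide scaleR_diff_right inner_commute)
  qed
qed

text \<open>The Jacobian matrix of \<open>y \<mapsto> y + s \<nu>(y)\<close> for the field \<open>\<nu> = g / |g|\<close>, in terms of \<open>q = g(y)\<close> and
  \<open>Y = Dg(y)\<close>.\<close>

definition normal_jacobian :: "real \<Rightarrow> real^'n \<Rightarrow> real^'n^'n \<Rightarrow> real^'n^'n" where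
  "normal_jacobian s q Y = mat 1 + (s / norm q) *\<^sub>R (perp_proj (unit_dir q) ** Y)"

lemma matrix_normal_jacobian:
  "matrix (\<lambda>v. v + s *\<^sub>R ((1 / norm q) *\<^sub>R (perp_proj (unit_dir q) *v (Y *v v)))) = normal_jacobian s q Y"
proof -
  have "(\<lambda>v. v + s *\<^sub>R ((1 / norm q) *\<^sub>R (perp_proj (unit_dir q) *v (Y *v v)))) = (*v) (normal_jacobian s q Y)"
    by (simp add: fun_eq_iff normal_jacobian_def matrix_vector_mult_add_rdistrib scaleR_matrix_vector_assoc[symmetric]
        matrix_vector_mul_assoc[symmetric])
  thus ?thesis by (simp add: matrix_of_matrix_vector_mul)
qed

lemma matrix_normal_jacobian':
  "matrix (\<lambda>v. v - s *\<^sub>R ((1 / norm q) *\<^sub>R (perp_proj (unit_dir q) *v (Y *v v)))) = normal_jacobian (- s) q Y"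
  using matrix_normal_jacobian[of "- s" q Y] by simp

lemma infdist_frontier_ge:
  fixes E :: "(real^'n) set"
  assumes ne: "E \<noteq> {}" and T: "0 < T" and far: "ball x T \<inter> E = {}"
  shows "T \<le> infdist x (frontier E)"
proof -
  have "x \<in> ball x T" using T by simp
  hence xE: "x \<notin> E" using far by blast
  have "T \<le> infdist x E"
    unfolding infdist_notempty[OF ne] by (rule cINF_greatest[OF ne]) (use far in \<open>force simp: disjoint_iff\<close>)
  thus ?thesis using infdist_frontier[OF xE ne] by simp
qed

context radial_profile
begin

text \<open>Bounds the normal speed of a ball of radius r in dimension d: the parallel sphere at
  distance s is larger in area by the factor (1 + s / r)^(d - 1).\<close>

definition ball_speed :: "nat \<Rightarrow> real \<Rightarrow> ennreal" where
  "ball_speed d r = (\<integral>\<^sup>+ s. ennreal (weight s) * ennreal ((1 + s / r) ^ (d - 1)) \<partial>lborel)"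

lemma ball_speed_finite:
  assumes "0 < r"
  shows "ball_speed d r < \<infinity>"
proof -
  have "ball_speed d r \<le> (\<integral>\<^sup>+ s. ennreal (L * (1 + \<rho> / r) ^ (d - 1)) * indicator {\<delta>..<\<rho>} s \<partial>lborel)"
    unfolding ball_speed_def
  proof (rule nn_integral_mono)
    fix s
    show "ennreal (weight s) * ennreal ((1 + s / r) ^ (d - 1)) \<le> ennreal (L * (1 + \<rho> / r) ^ (d - 1)) * indicator {\<delta>..<\<rho>} s"
    proof (cases "s \<in> {\<delta>..<\<rho>}")
      case True
      hence "(1 + s / r) ^ (d - 1) \<le> (1 + \<rho> / r) ^ (d - 1)"
        using assms delta by (intro power_mono) (auto simp: divide_right_mono)
      hence "weight s * (1 + s / r) ^ (d - 1) \<le> L * (1 + \<rho> / r) ^ (d - 1)"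
        using True assms delta by (intro mult_mono weight_le L_nonneg) auto
      thus ?thesis using True assms delta weight_nonneg[of s] by (simp add: ennreal_mult[symmetric] ennreal_leI)
    qed (simp add: weight_eq_0)
  qed
  also have "\<dots> < \<infinity>" using delta by (simp add: nn_integral_cmult_indicator ennreal_mult_less_top)
  finally show ?thesis .
qed

text \<open>A small piece of a solution inside a ball at distance more than \<open>T\<close> from the datum would be moved
  out of the ball faster than the curvature of the sphere allows. Smallness of the piece keeps the touching
  points of the first variation away from the center.\<close>

lemma solves_avoids_ball:
  fixes y0 :: "real^'n"
  assumes h: "0 < h" and s: "solves h E F" and a: "0 < a" and T: "0 < T"
    and far: "\<And>x. x \<in> ball y0 a \<Longrightarrow> ball x T \<inter> E = {}"
    and small: "vol (F \<inter> ball y0 (3 * a / 4)) < vol (ball (0::real^'n) (min (a / 4) \<delta> / 2))"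
    and speed: "ball_speed CARD('n) (a / 2) < ennreal (T / h)"
  shows "F \<inter> ball y0 a = {}"
proof (rule ccontr)
  assume ne: "F \<inter> ball y0 a \<noteq> {}"
  note sD = solvesD[OF s]
  define W where "W = F \<inter> ball y0 a"
  define G where "G = {x. a \<le> dist y0 x}"
  have Ws: "W \<in> leb" using sD by (auto simp: W_def)
  have Wm: "W \<in> lmeasurable" unfolding W_def
    by (rule fmeasurableI2[OF lmeasurable_ball[of y0 a]]) (use sD in auto)
  have Gb: "G = - ball y0 a" by (auto simp: G_def)
  have Gs: "G \<in> leb" unfolding Gb by auto
  have Ene: "E \<noteq> {}" using sD(7) ne by auto
  have WE: "x \<notin> E" if "x \<in> W" for x
  proof -
    have "x \<in> ball x T" using T by simp
    moreover have "ball x T \<inter> E = {}" using that by (intro far) (simp add: W_def)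
    ultimately show ?thesis by blast
  qed
  have pos: "0 < vol W"
  proof -
    obtain x where x: "x \<in> F" "x \<in> ball y0 a" using ne by auto
    then obtain e where e: "e > 0" "ball x e \<subseteq> ball y0 a" using openE[OF open_ball] by metis
    have "x \<in> outer e F" by (rule good_representative_pos[OF sD(2,3) x(1) e(1)])
    hence "0 < vol (F \<inter> ball x e)" by (simp add: outer_def)
    also have "\<dots> \<le> vol W" by (rule emeasure_mono) (use e Ws in \<open>auto simp: W_def\<close>)
    finally show ?thesis .
  qed
  have FG: "F - G = W" by (auto simp: W_def Gb)
  have upper: "enn2real (\<E> (G \<union> W)) + T / h * rvol W \<le> enn2real (\<E> G)"
  proof (rule solves_variation[OF h s Gs, unfolded FG])
    show "x \<notin> E \<and> T / h * h \<le> infdist x (frontier E)" if "x \<in> W" for x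
      using infdist_frontier_ge[OF Ene T far, of x] WE[OF that] that h by (simp add: W_def)
    show "infdist x (frontier E) \<le> - (T / h) * h" if "T / h < 0" for x using that T h by (simp add: divide_less_0_iff)
  qed (simp add: Gb)
  \<comment> \<open>Twice the radius of the test ball in \<open>small\<close>. With q \<le> a / 4
    the test ball stays within 3 a / 4 of the center, and q \<le> \<delta> \<le> s lets it fit into
    the ball about x.\<close>
  define q where "q = min (a / 4) \<delta>"
  have q: "0 < q" "q \<le> a / 4" "q \<le> \<delta>" using a delta by (auto simp: q_def)
  have var: "vol (outer s (- G) - outer s (- (G \<union> W))) \<le> ennreal ((1 + s / (a / 2)) ^ (CARD('n) - 1)) * vol W"
    if s: "s \<in> {\<delta>..<\<rho>}" for s
  proof -
    define V where "V = {y. a / 2 < dist y0 y}"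
    have s0: "0 < s" "\<delta> \<le> s" using s delta by auto
    have "vol (outer s (- {x. a \<le> dist y0 x}) - outer s (- ({x. a \<le> dist y0 x} \<union> W)))
        \<le> ennreal ((1 + s / (a / 2)) ^ (CARD('n) - 1)) * vol W"
    proof (rule inner_variation_le[where V=V and n = "\<lambda>y. unit_dir (y - y0)"
          and n' = "\<lambda>y v. (1 / norm (y - y0)) *\<^sub>R (perp_proj (unit_dir (y - y0)) *v (mat 1 *v v))"])
      show "open V" unfolding V_def by (intro open_Collect_less continuous_intros)
      show "continuous_on UNIV (dist y0)" by (intro continuous_intros)
      fix y assume y: "y \<in> V"
      hence nz: "y - y0 \<noteq> 0" using a by (auto simp: V_def)
      show "((\<lambda>y. unit_dir (y - y0)) has_derivative (\<lambda>v. (1 / norm (y - y0)) *\<^sub>R (perp_proj (unit_dir (y - y0)) *v (mat 1 *v v)))) (at y)"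
      proof -
        have "((\<lambda>y. y - y0) has_derivative (\<lambda>v. mat 1 *v v)) (at y)" by (auto intro!: derivative_eq_intros)
        from has_derivative_unit_dir[where g = "\<lambda>y. y - y0", OF this nz] show ?thesis .
      qed
      show "norm (unit_dir (y - y0)) = 1" using nz by (rule norm_unit_dir)
      have r: "a / 2 < norm (y - y0)" using y by (simp add: V_def dist_norm norm_minus_commute)
      have "det (normal_jacobian s (y - y0) (mat 1)) = (1 + s / norm (y - y0)) ^ (CARD('n) - 1)"
        unfolding normal_jacobian_def
        using det_one_plus_perp_proj[OF norm_unit_dir[OF nz], of "s / norm (y - y0)"] by simp
      moreover have "\<bar>(1 + s / norm (y - y0)) ^ (CARD('n) - 1)\<bar> \<le> (1 + s / (a / 2)) ^ (CARD('n) - 1)"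
      proof -
        have "0 < norm (y - y0)" using a r by linarith
        hence "s / norm (y - y0) \<le> s / (a / 2)" using s0 a r by (intro divide_left_mono) auto
        moreover have "0 \<le> s / norm (y - y0)" using s0 by simp
        ultimately show ?thesis unfolding power_abs by (intro power_mono) auto
      qed
      ultimately show "\<bar>det (matrix (\<lambda>v. v + s *\<^sub>R (1 / norm (y - y0)) *\<^sub>R (perp_proj (unit_dir (y - y0)) *v (mat 1 *v v))))\<bar>
          \<le> (1 + s / (a / 2)) ^ (CARD('n) - 1)"
        unfolding matrix_normal_jacobian by simp
    next
      fix x assume "x \<in> outer s (- {x. a \<le> dist y0 x}) - outer s (- ({x. a \<le> dist y0 x} \<union> W))"
      hence x: "x \<in> outer s (- G)" "x \<notin> outer s (- (G \<union> W))" by (auto simp: G_def)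
      have null: "- (G \<union> W) \<inter> ball x s \<in> nulls"
      proof -
        have "- (G \<union> W) \<inter> ball x s \<in> leb" using Gs Ws by auto
        thus ?thesis using x(2) by (auto simp: outer_def null_sets_def simp del: emeasure_completion)
      qed
      \<comment> \<open>A point of the closed ball about x within a / 2 of the center would give a
        ball of radius q / 2 that lies in the ball about x and within 3 a / 4 of y0. W would have to
        fill it up to a null set, against \<open>small\<close>.\<close>
      have no: False if y: "y \<in> cball x s" "dist y0 y \<le> a / 2" for y
      proof -
        define p where "p = y + (q / (2 * s)) *\<^sub>R (x - y)"
        have qs: "0 < q / (2 * s)" "q / (2 * s) \<le> 1" using q s0 by (auto simp: divide_le_eq)
        have dxy: "norm (x - y) \<le> s" using y by (simp add: dist_norm)
        have "norm (y - p) = q / (2 * s) * norm (x - y)" using q s0 by (simp add: p_def)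
        also have "\<dots> \<le> q / (2 * s) * s" using qs dxy by (intro mult_left_mono) auto
        finally have py: "norm (y - p) \<le> q / 2" using s0 by simp
        have "x - p = (1 - q / (2 * s)) *\<^sub>R (x - y)" by (simp add: p_def algebra_simps)
        hence "norm (x - p) = (1 - q / (2 * s)) * norm (x - y)" using qs by simp
        also have "\<dots> \<le> (1 - q / (2 * s)) * s" using qs dxy by (intro mult_left_mono) auto
        finally have px: "norm (x - p) \<le> s - q / 2" using s0 by (simp add: left_diff_distrib)
        have near: "dist x z < s" "dist y0 z < 3 * a / 4" if "z \<in> ball p (q / 2)" for z
        proof -
          have "dist x z \<le> dist x p + dist p z" "dist y0 z \<le> dist y0 y + dist y p + dist p z"
            using dist_triangle[of x z p] dist_triangle[of y0 z p] dist_triangle[of y0 p y] by auto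
          moreover have "dist p z < q / 2" using that by simp
          ultimately show "dist x z < s" "dist y0 z < 3 * a / 4" using px py y(2) q by (auto simp: dist_norm)
        qed
        have "ball p (q / 2) - W \<subseteq> - (G \<union> W) \<inter> ball x s"
          using near a by (fastforce simp: G_def)
        hence n1: "ball p (q / 2) - W \<in> nulls"
          by (intro null_sets_subset[OF null]) (use Ws in auto)
        let ?W = "F \<inter> ball y0 (3 * a / 4)"
        have Fs: "?W \<in> leb" using sD by auto
        have "vol (ball p (q / 2)) \<le> vol (?W \<union> (ball p (q / 2) - W))"
        proof (rule emeasure_mono)
          show "ball p (q / 2) \<subseteq> ?W \<union> (ball p (q / 2) - W)" using near(2) by (auto simp: W_def)
        qed (use Fs n1 in blast)
        also have "\<dots> = vol ?W" by (rule emeasure_Un_null_set[OF Fs n1])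
        also have "\<dots> < vol (ball (0::real^'n) (q / 2))" using small by (simp only: q_def)
        also have "\<dots> = vol (ball p (q / 2))" using q by (simp add: emeasure_ball)
        finally show False by simp
      qed
      have "y0 \<notin> cball x s" using no[of y0] a by auto
      hence d: "s < norm (x - y0)" by (simp add: dist_norm norm_minus_commute)
      \<comment> \<open>The point of the closed ball about x nearest to y0; seen from y0 it has the
        same direction as x.\<close>
      define y where "y = x - s *\<^sub>R unit_dir (x - y0)"
      have xy0: "x - y0 \<noteq> 0" using d s0 by auto
      have yy: "y - y0 = (1 - s / norm (x - y0)) *\<^sub>R (x - y0)"
        by (simp add: y_def unit_dir_def algebra_simps divide_inverse)
      have fac: "0 < 1 - s / norm (x - y0)" using d s0 by (simp add: divide_less_eq)
      have ny: "norm (y - y0) = norm (x - y0) - s"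
        unfolding yy using fac xy0 by (simp add: left_diff_distrib)
      have uy: "unit_dir (y - y0) = unit_dir (x - y0)"
        unfolding yy using fac by (rule unit_dir_scale)
      have yc: "y \<in> cball x s" using s0 xy0 by (simp add: y_def dist_norm norm_unit_dir)
      have "y \<in> V"
      proof (rule ccontr)
        assume "y \<notin> V"
        hence "dist y0 y \<le> a / 2" by (simp add: V_def)
        thus False by (rule no[OF yc])
      qed
      moreover have "dist y0 y < a"
      proof -
        obtain z where z: "z \<in> - G" "dist x z < s" using x(1) outer_subset_neighborhood by blast
        have "norm (x - y0) \<le> dist x z + dist y0 z" using dist_triangle[of x y0 z] by (simp add: dist_norm norm_minus_commute)
        thus ?thesis using z ny by (simp add: G_def dist_norm norm_minus_commute)
      qed
      ultimately show "\<exists>y\<in>V. dist y0 y < a \<and> x = y + s *\<^sub>R unit_dir (y - y0)"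
        by (intro bexI[of _ y]) (auto simp: uy, simp add: y_def)
    qed (use s0 Wm in auto)
    thus ?thesis by (simp only: G_def)
  qed
  have osc: "vol (osc s G) \<le> vol (osc s (G \<union> W)) + ennreal ((1 + s / (a / 2)) ^ (CARD('n) - 1)) * vol W"
    if s: "s \<in> {\<delta>..<\<rho>}" for s
  proof -
    have "vol (osc s G) \<le> vol (osc s G) + vol (outer s (G \<union> W) - outer s G)" by simp
    also have "\<dots> = vol (osc s (G \<union> W)) + vol (outer s (- G) - outer s (- (G \<union> W)))"
      by (rule osc_Un_variation[OF Gs Ws, symmetric])
    also have "\<dots> \<le> vol (osc s (G \<union> W)) + ennreal ((1 + s / (a / 2)) ^ (CARD('n) - 1)) * vol W"
      by (intro add_left_mono var s)
    finally show ?thesis .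
  qed
  have GW: "G \<union> W \<in> leb" using Gs Ws by auto
  have "\<E> G \<le> (\<integral>\<^sup>+ s. ennreal (weight s) * vol (osc s (G \<union> W)) +
      (ennreal (weight s) * ennreal ((1 + s / (a / 2)) ^ (CARD('n) - 1))) * vol W \<partial>lborel)"
    unfolding energy_eq[OF Gs]
  proof (rule nn_integral_mono)
    fix s
    show "ennreal (weight s) * vol (osc s G) \<le> ennreal (weight s) * vol (osc s (G \<union> W)) +
      (ennreal (weight s) * ennreal ((1 + s / (a / 2)) ^ (CARD('n) - 1))) * vol W"
    proof (cases "s \<in> {\<delta>..<\<rho>}")
      case True
      from mult_left_mono[OF osc[OF True], of "ennreal (weight s)"] show ?thesis by (simp only: distrib_left mult.assoc zero_le)
    qed (simp add: weight_eq_0)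
  qed
  also have "\<dots> = \<E> (G \<union> W) + ball_speed CARD('n) (a / 2) * vol W"
  proof -
    note [measurable] = emeasure_osc_measurable[OF GW]
    have m: "(\<lambda>s. ennreal (weight s) * ennreal ((1 + s / (a / 2)) ^ (CARD('n) - 1))) \<in> borel_measurable borel" by measurable
    show ?thesis unfolding energy_eq[OF GW] ball_speed_def
      by (subst nn_integral_add) (use m in \<open>auto simp: nn_integral_multc simp del: emeasure_completion\<close>)
  qed
  finally have lower: "\<E> G \<le> \<E> (G \<union> W) + ball_speed CARD('n) (a / 2) * vol W" .
  obtain k where k: "ball_speed CARD('n) (a / 2) = ennreal k" "0 \<le> k" "k < T / h"
    using speed by (cases "ball_speed CARD('n) (a / 2)") (auto simp: ennreal_less_iff)
  have fin: "\<E> (G \<union> W) < \<infinity>" "\<E> G < \<infinity>"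
    using energy_finite[OF GW] energy_finite[OF Gs] by (auto simp: Gb Compl_Un)
  have "enn2real (\<E> G) \<le> enn2real (\<E> (G \<union> W)) + k * rvol W"
  proof -
    have "enn2real (\<E> G) \<le> enn2real (\<E> (G \<union> W) + ennreal k * ennreal (rvol W))"
      by (rule enn2real_mono) (use lower fin in \<open>simp_all add: k emeasure_eq_measure2[OF Wm] ennreal_mult_less_top del: emeasure_completion\<close>)
    also have "\<dots> = enn2real (\<E> (G \<union> W)) + k * rvol W"
      using fin k by (subst enn2real_plus) (auto simp: ennreal_mult[symmetric] ennreal_mult_less_top)
    finally show ?thesis .
  qed
  moreover have "k * rvol W < T / h * rvol W"
    using k pos by (intro mult_strict_right_mono) (simp_all add: emeasure_eq_measure2[OF Wm] del: emeasure_completion)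
  ultimately show False using upper by linarith
qed

end

section \<open>The time step for functions\<close>

definition nice :: "(real^'n \<Rightarrow> real) \<Rightarrow> bool" where
  "nice u \<longleftrightarrow> bounded (range u) \<and> uniformly_continuous_on UNIV u \<and> (\<exists>c R. \<forall>x. R \<le> norm x \<longrightarrow> u x = c)"

context radial_profile
begin

text \<open>Comparison with the empty set bounds the dissipation of F by a constant depending on R
  and h. Far from E this forces F to have little volume in each unit ball, so
  \<open>solves_avoids_ball\<close> clears that ball. The radius is uniform in E because it must
  serve all levels of a function.\<close>

lemma solves_bounded_uniformly:
  assumes h: "0 < h"
  obtains R' where "\<And>E F. solves h E F \<Longrightarrow> E \<subseteq> ball (0::real^'n) R \<Longrightarrow> F \<subseteq> ball 0 R'"
proof -
  define C where "C = ennreal (1 / h) * (ennreal (2 * R) * vol (ball (0::real^'n) R))"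
  have C: "C < \<infinity>"
    using emeasure_lborel_ball_finite[of "0::real^'n" R] by (simp add: C_def ennreal_mult_less_top)
  define \<theta> where "\<theta> = vol (ball (0::real^'n) (min (1 / 4) \<delta> / 2))"
  have th: "0 < \<theta>" "\<theta> < \<infinity>"
    using emeasure_ball_pos[of "min (1 / 4) \<delta> / 2" "0::real^'n"] delta emeasure_lborel_ball_finite[of "0::real^'n" "min (1 / 4) \<delta> / 2"]
    by (auto simp: \<theta>_def)
  obtain c where c: "C = ennreal c" "0 \<le> c" using C by (cases C) auto
  obtain t where t: "\<theta> = ennreal t" "0 \<le> t" using th(2) by (cases \<theta>) auto
  have t0: "0 < t" using th(1) t by simp
  obtain b where b: "ball_speed CARD('n) (1 / 2) = ennreal b" "0 \<le> b"
    using ball_speed_finite[of "1/2" "CARD('n)"] by (cases "ball_speed CARD('n) (1 / 2)") auto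
  \<comment> \<open>The first entry makes the volume in a unit ball smaller than t, the second makes
    T / h exceed the ball speed at radius 1 / 2; adding 1 makes both strict.\<close>
  define T where "T = max (h * c / t) (h * b) + 1"
  have T: "0 < T" "h * c / t < T" "h * b < T" 
  proof -
    have "0 \<le> h * b" using h b by simp
    thus "0 < T" "h * c / t < T" "h * b < T" unfolding T_def by linarith+
  qed
  show thesis
  proof (rule that[of "\<bar>R\<bar> + T + 1"])
    fix E F :: "(real^'n) set" assume s: "solves h E F" and E: "E \<subseteq> ball 0 R"
    note sD = solvesD[OF s]
    show "F \<subseteq> ball 0 (\<bar>R\<bar> + T + 1)"
    proof
      fix x assume x: "x \<in> F"
      have Ene: "E \<noteq> {}" using x sD(7) by auto
      show "x \<in> ball 0 (\<bar>R\<bar> + T + 1)"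
      proof (rule ccontr)
        assume far: "x \<notin> ball 0 (\<bar>R\<bar> + T + 1)"
        have fE: "ball y T \<inter> E = {}" if "y \<in> ball x 1" for y
        proof (rule ccontr)
          assume "ball y T \<inter> E \<noteq> {}"
          then obtain z where z: "dist y z < T" "z \<in> E" by auto
          have "norm x \<le> dist x y + dist y z + norm z"
            using norm_triangle_ineq[of "x - y" y] norm_triangle_ineq[of "y - z" z] by (simp add: dist_norm)
          moreover have "norm z < R" using z E by auto
          ultimately show False using z that far by auto
        qed
        define W where "W = F \<inter> ball x 1"
        have Ws: "W \<in> leb" using sD by (auto simp: W_def)
        have WE: "W \<subseteq> sym_diff F E"
        proof
          fix y assume y: "y \<in> W"
          hence "ball y T \<inter> E = {}" by (intro fE) (simp add: W_def)
          moreover have "y \<in> ball y T" using T by simp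
          ultimately have "y \<notin> E" by blast
          thus "y \<in> sym_diff F E" using y by (auto simp: W_def)
        qed
        have "ennreal T * vol W \<le> bmass E W"
          by (rule boundary_mass_ge[OF Ws]) (use T in \<open>auto simp: W_def intro!: infdist_frontier_ge[OF Ene] fE\<close>)
        also have "\<dots> \<le> bmass E (sym_diff F E)"
          by (rule emeasure_mono[OF WE]) (use sD in auto)
        finally have 1: "ennreal (1 / h) * (ennreal T * vol W) \<le> ennreal (1 / h) * bmass E (sym_diff F E)"
          by (rule mult_left_mono) simp
        also have "\<dots> \<le> J h E F" unfolding step_functional_eq[OF sD(1,2)] by simp
        also have "\<dots> \<le> J h E {}" by (rule sD(6)) simp
        also have "\<dots> \<le> ennreal c" using J_empty_le[OF sD(1) E, of h] unfolding C_def[symmetric] c .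
        finally have le: "ennreal (T / h) * vol W \<le> ennreal c"
          using T h by (simp add: mult.assoc[symmetric] ennreal_mult[symmetric] del: emeasure_completion)
        have "vol W < \<theta>"
        proof (rule ccontr)
          assume "\<not> vol W < \<theta>"
          hence "ennreal (T / h) * ennreal t \<le> ennreal (T / h) * vol W"
            unfolding t by (intro mult_left_mono) auto
          hence "ennreal (T / h) * ennreal t \<le> ennreal c" using le by (rule order_trans)
          hence "T / h * t \<le> c" using T h t c by (simp add: ennreal_mult[symmetric])
          moreover have "c < T / h * t" using T(2) h t0 by (simp add: divide_simps mult.commute)
          ultimately show False by simp
        qed
        moreover have "vol (F \<inter> ball x (3 * 1 / 4)) \<le> vol W"
          by (rule emeasure_mono) (use Ws in \<open>auto simp: W_def\<close>)
        ultimately have "vol (F \<inter> ball x (3 * 1 / 4)) < vol (ball (0::real^'n) (min (1 / 4) \<delta> / 2))"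
          unfolding \<theta>_def by (rule le_less_trans[rotated])
        hence "F \<inter> ball x 1 = {}"
          by (intro solves_avoids_ball[OF h s _ T(1)] fE) (use T h b in \<open>auto simp: ennreal_less_iff divide_simps mult.commute\<close>)
        thus False using x by auto
      qed
    qed
  qed
qed

text \<open>Open superlevel sets are included so that the relation passes to negated functions by
  complements. The sandwich leaves undecided which points with v x = s belong to F, as the good
  representative does.\<close>

definition step_relation :: "real \<Rightarrow> (real^'n \<Rightarrow> real) \<Rightarrow> (real^'n \<Rightarrow> real) \<Rightarrow> bool" where
  "step_relation h u v \<longleftrightarrow> (\<forall>s. \<forall>E\<in>{{x. s \<le> u x}, {x. s < u x}}.
     \<exists>F. solves h E F \<and> {x. s < v x} \<subseteq> F \<and> F \<subseteq> {x. s \<le> v x})"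

lemma step_relation_uminus:
  assumes "step_relation h u v"
  shows "step_relation h (\<lambda>x. - u x) (\<lambda>x. - v x)"
  unfolding step_relation_def
proof (intro allI ballI)
  fix s E assume "E \<in> {{x. s \<le> - u x}, {x. s < - u x}}"
  hence "E = - {x. - s < u x} \<or> E = - {x. - s \<le> u x}" by auto
  then obtain E' where E': "E = - E'" "E' \<in> {{x. - s \<le> u x}, {x. - s < u x}}" by blast
  then obtain F where F: "solves h E' F" "{x. - s < v x} \<subseteq> F" "F \<subseteq> {x. - s \<le> v x}"
    using assms unfolding step_relation_def by blast
  have "solves h E (- F)" using solves_Compl[OF F(1)] E' by simp
  moreover have "{x. s < - v x} \<subseteq> - F" "- F \<subseteq> {x. s \<le> - v x}" using F by force+
  ultimately show "\<exists>F. solves h E F \<and> {x. s < - v x} \<subseteq> F \<and> F \<subseteq> {x. s \<le> - v x}" by blast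
qed

text \<open>Uniform continuity separates superlevel sets of different levels by a positive distance,
  so \<open>solves_strict_mono\<close> orders their solutions and makes the supremum recover them.
  Applied to translates, the same comparison transfers the modulus of continuity.\<close>

lemma function_step_properties:
  fixes u :: "real^'n \<Rightarrow> real"
  assumes h: "0 < h" and nu: "nice u" and M: "\<And>x. \<bar>u x\<bar> \<le> M"
  defines "v \<equiv> function_step \<rho> f h u"
  shows function_step_relation: "step_relation h u v"
    and function_step_nice: "nice v"
    and function_step_bound: "\<bar>v x\<bar> \<le> M"
proof -
  obtain c R where c: "\<And>x. R \<le> norm x \<Longrightarrow> u x = c" using nu by (auto simp: nice_def)
  have uc: "uniformly_continuous_on UNIV u" using nu by (simp add: nice_def)
  hence cont: "continuous_on UNIV u" by (rule uniformly_continuous_imp_continuous)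
  define E where "E s = {x. s \<le> u x}" for s
  define E' where "E' s = {x. s < u x}" for s
  have sub: "E s \<subseteq> ball 0 R" if "c < s" for s
    using c that by (force simp: E_def not_le[symmetric])
  have sub': "- E s \<subseteq> ball 0 R" if "s \<le> c" for s
    using c that by (force simp: E_def not_le[symmetric])
  have Es: "E s \<in> leb" for s
  proof -
    have "closed (E s)" unfolding E_def by (intro closed_Collect_le continuous_intros cont)
    thus ?thesis by (metis borel_closed sets_completionI_sets sets_lborel)
  qed
  have Es': "E' s \<in> leb" for s
    unfolding E'_def by (intro open_sets_lebesgue open_Collect_less continuous_intros cont)
  have Eb: "bounded (E s) \<or> bounded (- E s)" for s
      proof (cases "c < s")
    case True
    thus ?thesis using bounded_subset[OF bounded_ball sub] by blast
  next
    case False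
    hence "s \<le> c" by simp
    thus ?thesis using bounded_subset[OF bounded_ball sub'] by blast
  qed
  have Eb': "bounded (E' s) \<or> bounded (- E' s)" for s
  proof (cases "c \<le> s")
    case True
    hence "E' s \<subseteq> ball 0 R" using c by (force simp: E'_def not_le[symmetric])
    thus ?thesis using bounded_ball bounded_subset by blast
  next
    case False
    hence "- E' s \<subseteq> ball 0 R" using c by (force simp: E'_def not_le[symmetric])
    thus ?thesis using bounded_ball bounded_subset by blast
  qed
  define F where "F s = step_plus \<rho> f h (E s)" for s
  have F: "solves h (E s) (F s)" for s unfolding F_def by (rule step_plus_solves[OF Es Eb])
  have gap: "\<exists>r>0. \<forall>x y. dist x y < r \<longrightarrow> \<bar>u x - u y\<bar> < e" if "0 < e" for e
    using uc that unfolding uniformly_continuous_on_def dist_real_def by (metis UNIV_I dist_commute)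
  have lt: "F s' \<subseteq> F s" if ss: "s < s'" for s s'
  proof -
    obtain r where r: "r > 0" "\<And>x y. dist x y < r \<Longrightarrow> \<bar>u x - u y\<bar> < s' - s" using gap[of "s' - s"] ss by auto
    have "F s' \<subseteq> interior (F s)"
    proof (rule solves_strict_mono[OF h r(1) F F])
      fix x assume x: "x \<in> E s'"
      show "ball x r \<subseteq> E s"
      proof
        fix y assume "y \<in> ball x r"
        thus "y \<in> E s" using r(2)[of x y] x by (auto simp: E_def)
      qed
    qed
    thus ?thesis using interior_subset by blast
  qed
  have low: "x \<in> F s" if "s \<le> - M" for s x
  proof -
    have "E s = UNIV" using M that by (auto simp: E_def) (smt (verit) M)
    thus ?thesis using solvesD(8)[OF F[of s]] by auto
  qed
  have high: "x \<notin> F s" if "M < s" for s x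
  proof -
    have "E s = {}" using that by (auto simp: E_def) (smt (verit) M)
    thus ?thesis using solvesD(7)[OF F[of s]] by auto
  qed
  have v: "v x = Sup {s. x \<in> F s}" for x by (simp add: v_def function_step_def F_def E_def)
  have bdd: "bdd_above {s. x \<in> F s}" for x using high by (intro bdd_aboveI[of _ M]) (metis mem_Collect_eq not_le)
  have ne: "{s. x \<in> F s} \<noteq> {}" for x using low[of "- M"] by auto
  have v1: "x \<in> F s" if "s < v x" for s x
    using that lt unfolding v less_cSup_iff[OF ne bdd] by blast
  have v2: "s \<le> v x" if "x \<in> F s" for s x
    unfolding v by (rule cSup_upper[OF _ bdd]) (use that in simp)
  show bound: "\<bar>v x\<bar> \<le> M" for x
  proof -
    have "- M \<le> v x" by (rule v2) (rule low, simp)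
    moreover have "v x \<le> M" using v1[of _ x] high by (metis dense not_le)
    ultimately show ?thesis by simp
  qed
  show "step_relation h u v"
    unfolding step_relation_def
  proof (intro allI ballI)
    fix s A assume "A \<in> {{x. s \<le> u x}, {x. s < u x}}"
    then consider "A = E s" | "A = E' s" by (auto simp: E_def E'_def)
    thus "\<exists>F. solves h A F \<and> {x. s < v x} \<subseteq> F \<and> F \<subseteq> {x. s \<le> v x}"
    proof cases
      case 1
      thus ?thesis using F[of s] v1 v2 by (intro exI[of _ "F s"]) auto
    next
      case 2
      \<comment> \<open>The open superlevel set lies, with positive distance, between closed ones of
        slightly higher and lower level, so its solution is squeezed between theirs.\<close>
      define F' where "F' = step_plus \<rho> f h (E' s)"
      have F': "solves h (E' s) F'" unfolding F'_def by (rule step_plus_solves[OF Es' Eb'])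
      have a: "F s' \<subseteq> F'" if ss: "s < s'" for s'
      proof -
        obtain r where r: "r > 0" "\<And>x y. dist x y < r \<Longrightarrow> \<bar>u x - u y\<bar> < s' - s" using gap[of "s' - s"] ss by auto
        have "F s' \<subseteq> interior F'"
        proof (rule solves_strict_mono[OF h r(1) F F'])
          fix x assume x: "x \<in> E s'"
          show "ball x r \<subseteq> E' s"
          proof
            fix y assume "y \<in> ball x r"
            thus "y \<in> E' s" using r(2)[of x y] x by (auto simp: E_def E'_def)
          qed
        qed
        thus ?thesis using interior_subset by blast
      qed
      have b: "F' \<subseteq> F s'" if ss: "s' < s" for s'
      proof -
        obtain r where r: "r > 0" "\<And>x y. dist x y < r \<Longrightarrow> \<bar>u x - u y\<bar> < s - s'" using gap[of "s - s'"] ss by auto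
        have "F' \<subseteq> interior (F s')"
        proof (rule solves_strict_mono[OF h r(1) F' F])
          fix x assume x: "x \<in> E' s"
          show "ball x r \<subseteq> E s'"
          proof
            fix y assume "y \<in> ball x r"
            thus "y \<in> E s'" using r(2)[of x y] x by (auto simp: E_def E'_def)
          qed
        qed
        thus ?thesis using interior_subset by blast
      qed
      have "x \<in> F'" if "s < v x" for x
      proof -
        obtain s' where "s < s'" "s' < v x" using dense[OF \<open>s < v x\<close>] by blast
        thus ?thesis using a v1 by blast
      qed
      moreover have "s \<le> v x" if "x \<in> F'" for x
      proof (rule dense_le)
        fix s' assume "s' < s"
        thus "s' \<le> v x" using b v2 that by blast
      qed
      ultimately show ?thesis using 2 F' by (intro exI[of _ F']) auto
    qed
  qed
  \<comment> \<open>The solution of level s, translated by y - x, is compared with that of level s -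
    e. Half of r absorbs the translation, the other half is the margin for strict
    comparison.\<close>
  have shift: "v x - e \<le> v y" if e: "0 < e" and r: "0 < r" "\<And>x y. dist x y < r \<Longrightarrow> \<bar>u x - u y\<bar> < e" and xy: "dist x y < r / 2" for x y e r
  proof -
    define w where "w = y - x"
    have nw: "norm w < r / 2" using xy by (simp add: w_def dist_norm norm_minus_commute)
    have "s - e \<le> v y" if s: "s < v x" for s
    proof -
      have "(+) w ` F s \<subseteq> interior (F (s - e))"
      proof (rule solves_strict_mono[OF h _ solves_translation[OF F] F])
        show "0 < r / 2" using r by simp
        fix z assume "z \<in> (+) w ` E s"
        then obtain p where p: "p \<in> E s" "z = w + p" by auto
        show "ball z (r / 2) \<subseteq> E (s - e)"
        proof
          fix q assume "q \<in> ball z (r / 2)"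
          hence "norm (z - q) < r / 2" by (simp add: dist_norm)
          moreover have "norm (p - q) \<le> norm (z - q) + norm w"
            using norm_triangle_ineq4[of "z - q" w] p(2) by (simp add: algebra_simps)
          ultimately have "dist p q < r" using nw by (simp add: dist_norm)
          thus "q \<in> E (s - e)" using r(2)[of p q] p(1) by (auto simp: E_def)
        qed
      qed
      moreover have "y \<in> (+) w ` F s"
        unfolding mem_translation using v1[OF s] by (simp add: w_def)
      ultimately have "y \<in> F (s - e)" using interior_subset by blast
      thus ?thesis by (rule v2)
    qed
    hence "s \<le> v y + e" if "s < v x" for s using that by (simp add: diff_le_eq)
    hence "v x \<le> v y + e" by (rule dense_le)
    thus ?thesis by simp
  qed
  have "uniformly_continuous_on UNIV v"
    unfolding uniformly_continuous_on_def
  proof (intro allI impI)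
    fix e :: real assume e: "0 < e"
    obtain r where r: "r > 0" "\<And>x y. dist x y < r \<Longrightarrow> \<bar>u x - u y\<bar> < e / 2" using gap[of "e/2"] e by auto
    have "dist (v y) (v x) < e" if "dist y x < r / 2" for x y
      using shift[of "e/2" r x y] shift[of "e/2" r y x] r e that by (auto simp: dist_real_def dist_commute)
    thus "\<exists>d>0. \<forall>x\<in>UNIV. \<forall>x'\<in>UNIV. dist x' x < d \<longrightarrow> dist (v x') (v x) < e"
      using r by (intro exI[of _ "r / 2"]) auto
  qed
  moreover have "bounded (range v)" using bound by (auto simp: bounded_iff)
  moreover have "\<exists>c R. \<forall>x. R \<le> norm x \<longrightarrow> v x = c"
  proof -
    obtain R' where R': "\<And>E F. solves h E F \<Longrightarrow> E \<subseteq> ball (0::real^'n) R \<Longrightarrow> F \<subseteq> ball 0 R'"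
      using solves_bounded_uniformly[OF h] by blast
    have "v x = c" if x: "R' \<le> norm x" for x
    proof (rule antisym)
      show "v x \<le> c"
      proof (rule ccontr)
        assume "\<not> v x \<le> c"
        then obtain s where s: "c < s" "s < v x" using dense[of c "v x"] by auto
        hence "x \<in> ball 0 R'" using R'[OF F sub] v1 by blast
        thus False using x by simp
      qed
      \<comment> \<open>At level c the superlevel set has a bounded complement, so the uniform bound
        is applied to the complements.\<close>
      have "- F c \<subseteq> ball 0 R'" by (rule R'[OF solves_Compl[OF F] sub']) simp
      hence "x \<in> F c" using x by auto
      thus "c \<le> v x" by (rule v2)
    qed
    thus ?thesis by blast
  qed
  ultimately show "nice v" by (simp add: nice_def)
qed

lemma discrete_evolution_properties:
  fixes u0 :: "real^'n \<Rightarrow> real"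
  assumes h: "0 < h" and nu: "nice u0" and M: "\<And>x. \<bar>u0 x\<bar> \<le> M"
  shows discrete_evolution_bound: "\<bar>discrete_evolution \<rho> f u0 h (x, t)\<bar> \<le> M"
    and discrete_evolution_step: "h \<le> t \<Longrightarrow> step_relation h (\<lambda>x. discrete_evolution \<rho> f u0 h (x, t - h))
      (\<lambda>x. discrete_evolution \<rho> f u0 h (x, t))"
proof -
  let ?T = "function_step \<rho> f h"
  have it: "nice ((?T ^^ n) u0) \<and> (\<forall>x. \<bar>(?T ^^ n) u0 x\<bar> \<le> M)" for n
  proof (induction n)
    case (Suc n)
    thus ?case
      using function_step_nice[OF h, of "(?T ^^ n) u0" M] function_step_bound[OF h, of "(?T ^^ n) u0" M] by simp
  qed (use nu M in auto)
  thus "\<bar>discrete_evolution \<rho> f u0 h (x, t)\<bar> \<le> M" by (simp add: discrete_evolution_def)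
  assume t: "h \<le> t"
  define n where "n = nat \<lfloor>(t - h) / h\<rfloor>"
  have "(t - h) / h = t / h - 1" using h by (simp add: diff_divide_distrib)
  moreover have "1 \<le> t / h" using t h by simp
  ultimately have "nat \<lfloor>t / h\<rfloor> = Suc n" by (simp add: n_def) linarith
  thus "step_relation h (\<lambda>x. discrete_evolution \<rho> f u0 h (x, t - h)) (\<lambda>x. discrete_evolution \<rho> f u0 h (x, t))"
    using function_step_relation[OF h, of "(?T ^^ n) u0" M] it[of n] by (simp add: discrete_evolution_def n_def[symmetric])
qed

end

section \<open>Shrinking balls\<close>

context radial_profile
begin

lemma energy_subset_ball_le:
  fixes A :: "(real^'n) set"
  assumes A: "A \<in> leb" and sub: "A \<subseteq> ball y R"
  shows "\<E> A \<le> ennreal L * vol (ball (0::real^'n) (\<bar>R\<bar> + \<rho>)) * emeasure lborel {\<delta>..<\<rho>}"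
proof -
  have "\<E> A \<le> (\<integral>\<^sup>+ s. (ennreal L * vol (ball (0::real^'n) (\<bar>R\<bar> + \<rho>))) * indicator {\<delta>..<\<rho>} s \<partial>lborel)"
    unfolding energy_eq[OF A]
  proof (rule nn_integral_mono)
    fix s
    show "ennreal (weight s) * vol (osc s A) \<le> (ennreal L * vol (ball (0::real^'n) (\<bar>R\<bar> + \<rho>))) * indicator {\<delta>..<\<rho>} s"
    proof (cases "s \<in> {\<delta>..<\<rho>}")
      case True
      have "osc s A \<subseteq> ball y (\<bar>R\<bar> + \<rho>)"
      proof
        fix x assume "x \<in> osc s A"
        then obtain z where z: "z \<in> A" "dist x z < s" using outer_subset_neighborhood unfolding osc_def by blast
        hence "dist y z < R" using sub by auto
        thus "x \<in> ball y (\<bar>R\<bar> + \<rho>)" using z(2) True dist_triangle[of y x z] by (auto simp: dist_commute)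
      qed
      hence "vol (osc s A) \<le> vol (ball y (\<bar>R\<bar> + \<rho>))"
        by (rule emeasure_mono) auto
      also have "\<dots> = vol (ball (0::real^'n) (\<bar>R\<bar> + \<rho>))" using delta by (simp add: emeasure_ball)
      finally have "ennreal (weight s) * vol (osc s A) \<le> ennreal L * vol (ball (0::real^'n) (\<bar>R\<bar> + \<rho>))"
        by (intro mult_mono ennreal_leI weight_le) simp_all
      thus ?thesis using True by simp
    qed (simp add: weight_eq_0)
  qed
  also have "\<dots> = ennreal L * vol (ball (0::real^'n) (\<bar>R\<bar> + \<rho>)) * emeasure lborel {\<delta>..<\<rho>}"
    by (rule nn_integral_cmult_indicator) simp
  finally show ?thesis .
qed

text \<open>Uses 1 + c s / r \<le> c (1 + s / r). It lets the bound at radius R control the smaller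
  radii that occur while a barrier ball shrinks.\<close>

lemma ball_speed_scale:
  assumes "0 < r" "1 \<le> c"
  shows "ball_speed d (r / c) \<le> ennreal (c ^ (d - 1)) * ball_speed d r"
proof -
  have "ball_speed d (r / c) \<le> (\<integral>\<^sup>+ s. ennreal (c ^ (d - 1)) * (ennreal (weight s) * ennreal ((1 + s / r) ^ (d - 1))) \<partial>lborel)"
    unfolding ball_speed_def
  proof (rule nn_integral_mono)
    fix s
    show "ennreal (weight s) * ennreal ((1 + s / (r / c)) ^ (d - 1)) \<le> ennreal (c ^ (d - 1)) * (ennreal (weight s) * ennreal ((1 + s / r) ^ (d - 1)))"
    proof (cases "s \<in> {\<delta>..<\<rho>}")
      case True
      hence s: "0 < s" using delta by simp
      have "1 + s / (r / c) \<le> c * (1 + s / r)" using assms s by (simp add: field_simps)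
      hence "(1 + s / (r / c)) ^ (d - 1) \<le> (c * (1 + s / r)) ^ (d - 1)" using s assms by (intro power_mono) auto
      hence "ennreal ((1 + s / (r / c)) ^ (d - 1)) \<le> ennreal (c ^ (d - 1)) * ennreal ((1 + s / r) ^ (d - 1))"
        using assms s by (simp add: power_mult_distrib ennreal_mult[symmetric] ennreal_leI)
      hence "ennreal (weight s) * ennreal ((1 + s / (r / c)) ^ (d - 1)) \<le> ennreal (weight s) * (ennreal (c ^ (d - 1)) * ennreal ((1 + s / r) ^ (d - 1)))"
        by (rule mult_left_mono) simp
      thus ?thesis by (simp only: ac_simps)
    qed (simp add: weight_eq_0)
  qed
  also have "\<dots> = ennreal (c ^ (d - 1)) * ball_speed d r"
    unfolding ball_speed_def by (rule nn_integral_cmult) measurable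
  finally show ?thesis .
qed

text \<open>The energy of the complement of a ball of radius at most R0 is bounded, so the
  dissipation bounds the volume of F in a smaller concentric ball by a multiple of h. For small h
  this is below the threshold of \<open>solves_avoids_ball\<close>, uniformly in the radius. The
  argument R0 / 8 arises because a \<ge> R0 / 4 and touching points keep distance a / 2 from the
  center.\<close>

lemma solves_ball_step:
  assumes R0: "0 < R0" and K: "0 < K" "ball_speed CARD('n) (R0 / 8) < ennreal K"
  obtains h0 where "0 < h0"
    "\<And>h R (y0::real^'n) E F. 0 < h \<Longrightarrow> h < h0 \<Longrightarrow> R0 / 2 \<le> R \<Longrightarrow> R \<le> R0 \<Longrightarrow> solves h E F \<Longrightarrow>
       ball y0 R \<inter> E = {} \<Longrightarrow> F \<inter> ball y0 (R - K * h) = {}"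
proof -
  let ?d = "CARD('n)"
  define \<theta> where "\<theta> = rvol (ball (0::real^'n) (min (R0 / 16) \<delta> / 2))"
  have th: "0 < \<theta>" "ennreal \<theta> = vol (ball (0::real^'n) (min (R0 / 16) \<delta> / 2))"
    unfolding \<theta>_def using content_ball_pos[of "min (R0 / 16) \<delta> / 2" "0::real^'n"] R0 delta
      emeasure_eq_measure2[OF lmeasurable_ball, symmetric] by simp_all
  obtain C where C: "0 \<le> C" "\<And>A y r. A \<in> leb \<Longrightarrow> A \<subseteq> ball (y::real^'n) r \<Longrightarrow> 0 \<le> r \<Longrightarrow> r \<le> R0 \<Longrightarrow> \<E> A \<le> ennreal C"
  proof -
    define c where "c = ennreal L * vol (ball (0::real^'n) (\<bar>R0\<bar> + \<rho>)) * emeasure lborel {\<delta>..<\<rho>}"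
    have "c < \<infinity>" using delta emeasure_lborel_ball_finite[of "0::real^'n" "\<bar>R0\<bar> + \<rho>"] by (simp add: c_def ennreal_mult_less_top)
    then obtain C where C: "c = ennreal C" "0 \<le> C" by (cases c) auto
    have le: "\<E> A \<le> c" if "A \<in> leb" "A \<subseteq> ball (y::real^'n) r" "r \<le> R0" for A y r
      unfolding c_def by (rule energy_subset_ball_le[OF that(1) subset_trans[OF that(2) subset_ball[OF that(3)]]])
    show thesis
    proof (rule that[OF C(2)])
      fix A :: "(real^'n) set" and y r assume "A \<in> leb" "A \<subseteq> ball y r" "0 \<le> r" "r \<le> R0"
      thus "\<E> A \<le> ennreal C" using le[of A y r] C(1) by simp
    qed
  qed
  \<comment> \<open>The first bound keeps the radius a above R0 / 4, the second keeps the volume of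
    W1 below \<theta>.\<close>
  define h0 where "h0 = min (R0 / (4 * K)) (R0 / 8 * \<theta> / (C + 1))"
  have h0: "0 < h0" using R0 K th(1) C(1) by (auto simp: h0_def intro!: divide_pos_pos mult_pos_pos)
  show thesis
  proof (rule that[OF h0])
    fix h R and y0 :: "real^'n" and E F
    assume h: "0 < h" "h < h0" and R: "R0 / 2 \<le> R" "R \<le> R0" and s: "solves h E F" and disj: "ball y0 R \<inter> E = {}"
    note sD = solvesD[OF s]
    define a where "a = R - K * h"
    have "K * h < K * (R0 / (4 * K))" using h K by (intro mult_strict_left_mono) (auto simp: h0_def)
    hence Kh: "K * h < R0 / 4" using K by simp
    have a: "R0 / 4 \<le> a" "a < R" using Kh R K h by (auto simp: a_def)
    have a0: "0 < a" using a R0 by linarith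
    have far: "ball x (R - r) \<inter> E = {}" if "x \<in> ball y0 r" for x r
    proof (rule ccontr)
      assume "ball x (R - r) \<inter> E \<noteq> {}"
      then obtain z where z: "dist x z < R - r" "z \<in> E" by auto
      hence "z \<in> ball y0 R" using that dist_triangle[of y0 z x] by simp
      thus False using z disj by blast
    qed
    show "F \<inter> ball y0 (R - K * h) = {}"
    proof (cases "E = {}")
      case True
      thus ?thesis using sD(7) by simp
    next
      case Ene: False
      define W where "W = F \<inter> ball y0 a"
      \<comment> \<open>On the ball of radius 3 a / 4 the distance to E is at least R0 / 8,
        independent of h; on W it is only of order h.\<close>
      define W1 where "W1 = F \<inter> ball y0 (3 * a / 4)"
      define G where "G = - ball y0 a"
      have sets: "W \<in> leb" "W1 \<in> leb" "G \<in> leb" using sD by (auto simp: W_def W1_def G_def)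
      have eG: "\<E> G \<le> ennreal C"
        unfolding G_def using C(2)[of "ball y0 a" y0 a] a a0 R by (simp add: energy_Compl)
      have WE: "W \<inter> E = {}"
      proof -
        have "x \<notin> E" if "x \<in> W" for x
        proof -
          have "x \<in> ball y0 R" using that a by (simp add: W_def)
          thus ?thesis using disj by blast
        qed
        thus ?thesis by blast
      qed
      have FG: "F - G = W" "W - E = W" using WE by (auto simp: W_def G_def)
      have "ennreal (1 / h) * bmass E W \<le> \<E> (F \<union> G) + ennreal (1 / h) * bmass E W" by simp
      also have "\<dots> \<le> \<E> G"
        using solves_upper_comparison[OF s h(1) sets(3) le_less_trans[OF eG]] unfolding FG by (simp add: WE)
      also note eG
      finally have 1: "ennreal (1 / h) * bmass E W \<le> ennreal C" .
      have "ennreal (R0 / 8) * vol W1 \<le> bmass E W1"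
      proof (rule boundary_mass_ge[OF sets(2)])
        fix x assume "x \<in> W1"
        hence "ball x (R - 3 * a / 4) \<inter> E = {}" by (intro far) (simp add: W1_def)
        moreover have "R0 / 8 \<le> R - 3 * a / 4" using a R by linarith
        ultimately show "R0 / 8 \<le> infdist x (frontier E)"
          using infdist_frontier_ge[OF Ene, of "R - 3 * a / 4" x] R0 by linarith
      qed (use R0 in simp)
      also have "\<dots> \<le> bmass E W" by (rule emeasure_mono) (use sets a0 in \<open>auto simp: W1_def W_def\<close>)
      finally have "ennreal (1 / h) * (ennreal (R0 / 8) * vol W1) \<le> ennreal (1 / h) * bmass E W"
        by (rule mult_left_mono) simp
      hence "ennreal (1 / h) * (ennreal (R0 / 8) * vol W1) \<le> ennreal C" using 1 by (rule order_trans)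
      note 2 = this
      have W1l: "W1 \<in> lmeasurable"
        by (rule fmeasurableI2[OF lmeasurable_ball _ sets(2)]) (auto simp: W1_def)
      have "1 / h * (R0 / 8 * rvol W1) \<le> C"
        using 2 R0 h C(1) unfolding emeasure_eq_measure2[OF W1l] by (simp add: ennreal_mult[symmetric])
      hence "R0 / 8 * rvol W1 \<le> C * h" using h by (simp add: field_simps)
      also have "\<dots> \<le> h * (C + 1)" using h by (simp add: algebra_simps)
      also have "\<dots> < R0 / 8 * \<theta>"
      proof -
        have "h < R0 / 8 * \<theta> / (C + 1)" "0 < C + 1" using h C(1) by (auto simp: h0_def)
        thus ?thesis by (simp only: pos_less_divide_eq)
      qed
      finally have "rvol W1 < \<theta>" using R0 by simp
      hence "vol W1 < ennreal \<theta>" unfolding emeasure_eq_measure2[OF W1l] by (rule ennreal_lessI[OF th(1)])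
      also have "\<dots> \<le> vol (ball (0::real^'n) (min (a / 4) \<delta> / 2))"
        unfolding th(2) by (intro emeasure_mono subset_ball) (use a in auto)
      finally have small: "vol (F \<inter> ball y0 (3 * a / 4)) < vol (ball (0::real^'n) (min (a / 4) \<delta> / 2))"
        by (simp only: W1_def)
      have "ball_speed CARD('n) (a / 2) \<le> ball_speed CARD('n) (R0 / 8)"
        unfolding ball_speed_def
      proof (rule nn_integral_mono)
        fix s
        show "ennreal (weight s) * ennreal ((1 + s / (a / 2)) ^ (?d - 1)) \<le> ennreal (weight s) * ennreal ((1 + s / (R0 / 8)) ^ (?d - 1))"
        proof (cases "s \<in> {\<delta>..<\<rho>}")
          case True
          hence "s / (a / 2) \<le> s / (R0 / 8)" using a R0 delta by (intro divide_left_mono) auto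
          moreover have "0 \<le> s / (a / 2)" using True delta a0 by simp
          ultimately show ?thesis by (intro mult_left_mono ennreal_leI power_mono) auto
        qed (simp add: weight_eq_0)
      qed
      also have "\<dots> < ennreal (K * h / h)" using K h by simp
      finally have sp: "ball_speed CARD('n) (a / 2) < ennreal (K * h / h)" .
      have "F \<inter> ball y0 a = {}"
      proof (rule solves_avoids_ball[OF h(1) s a0 _ _ small sp])
        show "0 < K * h" using K h by simp
        show "ball x (K * h) \<inter> E = {}" if "x \<in> ball y0 a" for x using far[OF that] by (simp add: a_def)
      qed
      thus ?thesis by (simp add: a_def)
    qed
  qed
qed

text \<open>A ball lying below the level m loses at most K h of its radius per step, so after n
  steps it still has radius at least R0 / 2 and contains its center.\<close>

lemma step_relation_ball_chain:
  assumes R0: "0 < R0" and K: "0 < K" "ball_speed CARD('n) (R0 / 8) < ennreal K"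
  obtains h0 where "0 < h0"
    "\<And>h n m w (y0::real^'n). 0 < h \<Longrightarrow> h < h0 \<Longrightarrow> real n * K * h \<le> R0 / 2 \<Longrightarrow>
       (\<And>i. i < n \<Longrightarrow> step_relation h (w i) (w (Suc i))) \<Longrightarrow> (\<And>x. x \<in> ball y0 R0 \<Longrightarrow> w 0 x \<le> m) \<Longrightarrow> w n y0 \<le> m"
proof -
  obtain h0 where h0: "0 < h0"
    "\<And>h R (y0::real^'n) E F. 0 < h \<Longrightarrow> h < h0 \<Longrightarrow> R0 / 2 \<le> R \<Longrightarrow> R \<le> R0 \<Longrightarrow> solves h E F \<Longrightarrow>
       ball y0 R \<inter> E = {} \<Longrightarrow> F \<inter> ball y0 (R - K * h) = {}"
    using solves_ball_step[OF R0 K] by metis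
  show thesis
  proof (rule that[OF h0(1)])
    fix h n m w and y0 :: "real^'n"
    assume h: "0 < h" "h < h0" and n: "real n * K * h \<le> R0 / 2"
      and st: "\<And>i. i < n \<Longrightarrow> step_relation h (w i) (w (Suc i))" and w0: "\<And>x. x \<in> ball y0 R0 \<Longrightarrow> w 0 x \<le> m"
    have "\<forall>x\<in>ball y0 (R0 - real i * K * h). w i x \<le> m" if "i \<le> n" for i
      using that
    proof (induction i)
      case (Suc i)
      define R where "R = R0 - real i * K * h"
      have "real i * (K * h) \<le> real n * (K * h)" using Suc.prems K h by (intro mult_right_mono) auto
      moreover have "real n * (K * h) \<le> R0 / 2" using n by (simp only: mult.assoc)
      moreover have "0 \<le> real i * (K * h)" "R = R0 - real i * (K * h)" using K h by (simp_all add: R_def mult.assoc)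
      ultimately have R: "R0 / 2 \<le> R" "R \<le> R0" by linarith+
      have eq: "R0 - real (Suc i) * K * h = R - K * h" by (simp add: R_def algebra_simps)
      show ?case unfolding eq
      proof (intro ballI leI notI)
        fix x assume x: "x \<in> ball y0 (R - K * h)" and "m < w (Suc i) x"
        then obtain s where s: "m < s" "s < w (Suc i) x" using dense by blast
        have "step_relation h (w i) (w (Suc i))" using st Suc.prems by simp
        then obtain F where F: "solves h {x. s \<le> w i x} F" "{x. s < w (Suc i) x} \<subseteq> F"
          unfolding step_relation_def by blast
        have "ball y0 R \<inter> {x. s \<le> w i x} = {}"
          using Suc.IH Suc.prems s(1) by (force simp: R_def)
        hence "F \<inter> ball y0 (R - K * h) = {}" by (rule h0(2)[OF h R F(1)])
        thus False using x F(2) s(2) by blast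
      qed
    qed (use w0 in simp)
    moreover have "y0 \<in> ball y0 (R0 - real n * K * h)" using n R0 by simp
    ultimately show "w n y0 \<le> m" by blast
  qed
qed

end

section \<open>Test functions with vanishing gradient\<close>

text \<open>g' is increasing because g'' is positive, so the mean value theorem gives g r = r g' x
  \<le> R g' R for some x below r.\<close>

lemma radial_family_bounds:
  assumes g: "g \<in> radial_family c"
  obtains g' where "((\<lambda>r. g' r / r * c r) \<longlongrightarrow> 0) (at_right 0)"
    "\<And>r. 0 < r \<Longrightarrow> 0 < g' r" "\<And>r R. 0 \<le> r \<Longrightarrow> r \<le> R \<Longrightarrow> 0 < R \<Longrightarrow> g r \<le> R * g' R" "(g' \<longlongrightarrow> 0) (at_right 0)"
proof -
  obtain g' g'' where d: "\<And>r. r \<ge> 0 \<Longrightarrow> (g has_real_derivative g' r) (at r within {0..})"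
    "\<And>r. r \<ge> 0 \<Longrightarrow> (g' has_real_derivative g'' r) (at r within {0..})"
    and z: "g 0 = 0" "g' 0 = 0" "\<And>r. r > 0 \<Longrightarrow> g'' r > 0"
    and lim: "((\<lambda>r. g' r / r * c r) \<longlongrightarrow> 0) (at_right 0)"
    using g unfolding radial_family_def by blast
  have mvt_g: "\<exists>x. a < x \<and> x < b \<and> \<phi> b - \<phi> a = \<phi>' x * (b - a)"
    if "0 \<le> a" "a < b" "\<And>r. r \<ge> 0 \<Longrightarrow> (\<phi> has_real_derivative \<phi>' r) (at r within {0..})" for a b \<phi> \<phi>'
  proof -
    have "\<exists>x\<in>{a<..<b}. \<phi> b - \<phi> a = \<phi>' x * (b - a)"
    proof (rule mvt_simple[OF that(2)])
      fix x assume x: "a \<le> x" "x \<le> b"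
      have "(\<phi> has_derivative (*) (\<phi>' x)) (at x within {0..})"
        using that(3)[of x] x that(1) by (simp add: has_field_derivative_def)
      thus "(\<phi> has_derivative (*) (\<phi>' x)) (at x within {a..b})"
        by (rule has_derivative_subset) (use that(1) in auto)
    qed
    thus ?thesis by auto
  qed
  have mono: "g' a < g' b" if ab: "0 \<le> a" "a < b" for a b
  proof -
    obtain x where x: "a < x" "g' b - g' a = g'' x * (b - a)" using mvt_g[OF ab d(2)] by blast
    have "0 < g'' x * (b - a)" using z(3)[of x] x ab by (intro mult_pos_pos) auto
    thus ?thesis using x by simp
  qed
  have pos: "0 < g' r" if "0 < r" for r using mono[of 0 r] that z by simp
  show thesis
  proof (rule that[OF lim pos])
    fix r R :: real assume r: "0 \<le> r" "r \<le> R" "0 < R"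
    show "g r \<le> R * g' R"
    proof (cases "r = 0")
      case True
      thus ?thesis using z pos[OF r(3)] r by (simp add: less_imp_le)
    next
      case False
      hence r0: "0 < r" using r by simp
      obtain x where x: "0 < x" "x < r" "g r - g 0 = g' x * (r - 0)" using mvt_g[OF order_refl r0 d(1)] by blast
      have "g r = r * g' x" using x z by (simp add: mult.commute)
      also have "\<dots> \<le> R * g' R"
        using x r r0 mono[of x R] pos[of x] by (intro mult_mono) auto
      finally show ?thesis .
    qed
  next
    have "continuous (at 0 within {0..}) g'" using d(2)[of 0] by (simp add: DERIV_continuous)
    hence "(g' \<longlongrightarrow> 0) (at 0 within {0..})" using z by (simp add: continuous_within)
    thus "(g' \<longlongrightarrow> 0) (at_right 0)" by (rule tendsto_within_subset) auto
  qed
qed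

locale evolution_limit = radial_profile \<rho> \<delta> L f for \<rho> \<delta> L :: real and f :: "real \<Rightarrow> real" +
  fixes v :: "nat \<Rightarrow> (real^'n) \<times> real \<Rightarrow> real" and u :: "(real^'n) \<times> real \<Rightarrow> real"
    and h :: "nat \<Rightarrow> real" and M :: real
  assumes h_pos: "\<And>k. 0 < h k" and h_lim: "h \<longlonglongrightarrow> 0"
    and step: "\<And>k t. h k \<le> t \<Longrightarrow> step_relation (h k) (\<lambda>x. v k (x, t - h k)) (\<lambda>x. v k (x, t))"
    and v_bound: "\<And>k z. \<bar>v k z\<bar> \<le> M"
    and u_bound: "\<And>z. z \<in> UNIV \<times> {0..} \<Longrightarrow> \<bar>u z\<bar> \<le> M"
    and u_cont: "continuous_on (UNIV \<times> {0..}) u"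
    and v_lim: "\<And>K. compact K \<Longrightarrow> K \<subseteq> UNIV \<times> {0..} \<Longrightarrow> uniform_limit K v u sequentially"
begin

text \<open>If b > 0, then at a time about \<tau> earlier u is below u(xh, th) by b \<tau> / 4 on
  the ball of radius R. Such a ball survives as a barrier until th, up to half of its radius, and
  pushes u(xh, th) below itself. Flatness of g makes the required times compatible.\<close>

lemma degenerate_subsolution:
  fixes xh :: "real^'n"
  assumes th: "0 < th" and g: "g \<in> radial_family c" and om: "((\<lambda>r. \<omega> r / r) \<longlongrightarrow> 0) (at_right 0)"
    and bound: "\<And>R. 0 < R \<Longrightarrow> ball_speed CARD('n) R \<le> ennreal (c R / R)" and c: "\<And>r. 0 < r \<Longrightarrow> 0 < c r"
    and test: "\<forall>\<^sub>F w in nhds (xh, th). u w \<le> u (xh, th) + b * (snd w - th) + g (norm (fst w - xh)) + \<omega> \<bar>snd w - th\<bar>"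
  shows "b \<le> 0"
proof (rule ccontr)
  assume "\<not> b \<le> 0"
  hence b: "0 < b" by simp
  let ?d = "CARD('n)"
  obtain g' where g': "((\<lambda>r. g' r / r * c r) \<longlongrightarrow> 0) (at_right 0)"
    "\<And>r. 0 < r \<Longrightarrow> 0 < g' r" "\<And>r R. 0 \<le> r \<Longrightarrow> r \<le> R \<Longrightarrow> 0 < R \<Longrightarrow> g r \<le> R * g' R" "(g' \<longlongrightarrow> 0) (at_right 0)"
    using radial_family_bounds[OF g] by blast
  obtain e where e: "0 < e" "\<And>w. dist w (xh, th) < e \<Longrightarrow> u w \<le> u (xh, th) + b * (snd w - th) + g (norm (fst w - xh)) + \<omega> \<bar>snd w - th\<bar>"
    using test unfolding eventually_nhds_metric by blast
  have "\<forall>\<^sub>F r in at_right 0. \<omega> r / r < b / 4" by (rule order_tendstoD(2)[OF om]) (use b in simp)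
  then obtain e2 where e2: "0 < e2" "\<And>r. 0 < r \<Longrightarrow> r < e2 \<Longrightarrow> \<omega> r / r < b / 4"
    unfolding eventually_at_right_field by auto
  \<comment> \<open>The constant is the one that makes K \<tau> \<le> R / 2 come out for the \<tau>
    and K chosen below.\<close>
  have ev1: "\<forall>\<^sub>F r in at_right 0. g' r / r * c r < b / (4 * 8 ^ ?d)" by (rule order_tendstoD(2)[OF g'(1)]) (use b in simp)
  have "((\<lambda>r. 8 * r * g' r / b) \<longlongrightarrow> 8 * 0 * 0 / b) (at_right 0)"
    by (intro tendsto_intros g'(4)) (use b in auto)
  hence ev2: "\<forall>\<^sub>F r in at_right 0. 8 * r * g' r / b < min (min (e / 2) e2) (th / 2)"
    by (rule order_tendstoD(2)) (use e e2 th in auto)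
  have ev3: "\<forall>\<^sub>F r in at_right 0. 0 < r \<and> r < e / 2"
    using e by (auto simp: eventually_at_right_field intro!: exI[of _ "e / 2"])
  obtain R where R: "g' R / R * c R < b / (4 * 8 ^ ?d)" "8 * R * g' R / b < min (min (e / 2) e2) (th / 2)" "0 < R" "R < e / 2"
    using eventually_happens'[OF trivial_limit_at_right_real eventually_conj[OF ev1 eventually_conj[OF ev2 ev3]]] by auto
  \<comment> \<open>Chosen so that the bound R g'(R) for g on the ball equals b \<tau> / 8, a fixed
    fraction of the gain b \<tau>.\<close>
  define \<tau> where "\<tau> = 8 * R * g' R / b"
  have tau: "0 < \<tau>" "\<tau> < e / 2" "\<tau> < e2" "\<tau> < th / 2" using R b g'(2)[OF R(3)] by (auto simp: \<tau>_def)
  \<comment> \<open>Twice the bound on the ball speed at radius R / 8 obtained by scaling; the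
    factor 2 makes the inequality strict.\<close>
  define K where "K = 2 * 8 ^ (?d - 1) * (c R / R)"
  have K: "0 < K" using c[OF R(3)] R by (simp add: K_def)
  have cR: "0 < c R / R" using c[OF R(3)] R by simp
  have "ball_speed ?d (R / 8) \<le> ennreal (8 ^ (?d - 1)) * ball_speed ?d R" by (rule ball_speed_scale) (use R in auto)
  also have "\<dots> \<le> ennreal (8 ^ (?d - 1)) * ennreal (c R / R)" by (intro mult_left_mono bound R) simp
  also have "\<dots> = ennreal (8 ^ (?d - 1) * (c R / R))" by (rule ennreal_mult[symmetric]) (use cR in auto)
  also have "\<dots> < ennreal K" using K cR by (intro ennreal_lessI) (auto simp: K_def)
  finally have speed: "ball_speed ?d (R / 8) < ennreal K" .
  have dS: "?d = Suc (?d - 1)" by (metis Suc_pred' zero_less_card_finite)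
  have "K * \<tau> = (2 * (8 * 8 ^ (?d - 1))) * (g' R / R * c R) * (R / b)" using R b by (simp add: K_def \<tau>_def field_simps)
  also have "8 * 8 ^ (?d - 1) = (8::real) ^ ?d" by (simp only: power_Suc[symmetric] dS[symmetric])
  also have "2 * 8 ^ ?d * (g' R / R * c R) * (R / b) \<le> 2 * 8 ^ ?d * (b / (4 * 8 ^ ?d)) * (R / b)"
    using R b by (intro mult_right_mono mult_left_mono) auto
  also have "\<dots> = R / 2" using b by simp
  finally have Ktau: "K * \<tau> \<le> R / 2" .
  obtain h0 where h0: "0 < h0"
    "\<And>h n m w (y0::real^'n). 0 < h \<Longrightarrow> h < h0 \<Longrightarrow> real n * K * h \<le> R / 2 \<Longrightarrow>
       (\<And>i. i < n \<Longrightarrow> step_relation h (w i) (w (Suc i))) \<Longrightarrow> (\<And>x. x \<in> ball y0 R \<Longrightarrow> w 0 x \<le> m) \<Longrightarrow> w n y0 \<le> m"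
    using step_relation_ball_chain[OF R(3) K speed] by metis
  define C where "C = cball xh R \<times> {th - \<tau>..th}"
  have "compact C" unfolding C_def by (intro compact_Times) auto
  moreover have "C \<subseteq> UNIV \<times> {0..}" using tau th by (auto simp: C_def)
  ultimately have ul: "uniform_limit C v u sequentially" by (rule v_lim)
  have "\<forall>\<^sub>F k in sequentially. \<forall>z\<in>C. dist (v k z) (u z) < b * \<tau> / 16"
  proof -
    have "0 < b * \<tau> / 16" using b tau by simp
    thus ?thesis using ul unfolding uniform_limit_iff by blast
  qed
  moreover have "\<forall>\<^sub>F k in sequentially. h k < min h0 (\<tau> / 2)" by (rule order_tendstoD(2)[OF h_lim]) (use h0 tau in simp)
  ultimately have "\<exists>k. (\<forall>z\<in>C. dist (v k z) (u z) < b * \<tau> / 16) \<and> h k < min h0 (\<tau> / 2)"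
    using eventually_happens'[OF sequentially_bot eventually_conj] by blast
  then obtain k where k: "\<And>z. z \<in> C \<Longrightarrow> dist (v k z) (u z) < b * \<tau> / 16" "h k < h0" "h k < \<tau> / 2" by auto
  \<comment> \<open>The number of whole steps in \<tau>. Counting back from th makes the last time
    exactly th, and \<sigma> = n h lies between \<tau> / 2 and \<tau>.\<close>
  define n where "n = nat \<lfloor>\<tau> / h k\<rfloor>"
  define \<sigma> where "\<sigma> = real n * h k"
  have hk: "0 < h k" by (rule h_pos)
  have "real n \<le> \<tau> / h k" "\<tau> / h k < real n + 1" using tau hk by (auto simp: n_def)
  hence sig: "\<sigma> \<le> \<tau>" "\<tau> - h k < \<sigma>" using hk by (auto simp: \<sigma>_def field_simps)
  hence sig2: "\<tau> / 2 < \<sigma>" "0 < \<sigma>" using k(3) tau by auto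
  define w where "w i x = v k (x, th - \<sigma> + real i * h k)" for i x
  have "w n xh \<le> u (xh, th) - b * \<tau> / 8"
  proof (rule h0(2)[OF hk k(2)])
    have "real n * K * h k = K * \<sigma>" by (simp add: \<sigma>_def)
    also have "\<dots> \<le> K * \<tau>" using K sig by simp
    finally show "real n * K * h k \<le> R / 2" using Ktau by simp
    fix i assume "i < n"
    have "0 \<le> real i * h k" "real (Suc i) * h k = real i * h k + h k" using hk by (simp_all add: algebra_simps)
    hence "h k \<le> th - \<sigma> + real (Suc i) * h k" using sig tau th by linarith
    from step[OF this] show "step_relation (h k) (w i) (w (Suc i))"
      unfolding w_def by (simp add: algebra_simps)
  next
    fix x assume x: "x \<in> ball xh R"
    have zC: "(x, th - \<sigma>) \<in> C" using x sig sig2 by (auto simp: C_def)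
    have "dist (x, th - \<sigma>) (xh, th) \<le> dist x xh + dist (th - \<sigma>) th"
      unfolding dist_Pair_Pair by (rule sqrt_sum_squares_le_sum) simp_all
    also have "\<dots> < e" using x R sig tau sig2 by (auto simp: dist_commute dist_real_def)
    finally have "u (x, th - \<sigma>) \<le> u (xh, th) + b * (- \<sigma>) + g (norm (x - xh)) + \<omega> \<sigma>"
      using e(2)[of "(x, th - \<sigma>)"] sig2 by simp
    moreover have "g (norm (x - xh)) \<le> R * g' R"
      by (rule g'(3)) (use x R in \<open>auto simp: dist_norm norm_minus_commute\<close>)
    moreover have "R * g' R = b * \<tau> / 8" using b by (simp add: \<tau>_def)
    moreover have "\<omega> \<sigma> \<le> b / 4 * \<sigma>" using e2(2)[of \<sigma>] sig sig2 tau by (simp add: divide_less_eq less_imp_le)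
    moreover have "b * (\<tau> / 2) \<le> b * \<sigma>" using b sig2 by (intro mult_left_mono) auto
    ultimately have "u (x, th - \<sigma>) \<le> u (xh, th) - b * \<tau> / 4" by (simp add: field_simps)
    moreover have "v k (x, th - \<sigma>) < u (x, th - \<sigma>) + b * \<tau> / 16" using k(1)[OF zC] unfolding dist_real_def by linarith
    moreover have "0 < b * \<tau>" using b tau by simp
    ultimately show "w 0 x \<le> u (xh, th) - b * \<tau> / 8" by (simp add: w_def)
  qed
  moreover have "w n xh = v k (xh, th)" by (simp add: w_def \<sigma>_def)
  moreover have "(xh, th) \<in> C" using R tau by (auto simp: C_def)
  hence "u (xh, th) < v k (xh, th) + b * \<tau> / 16" using k(1)[of "(xh, th)"] unfolding dist_real_def by linarith
  moreover have "0 < b * \<tau>" using b tau by simp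
  ultimately show False by simp
qed

end

section \<open>Touching points and second order expansions\<close>

text \<open>y minimizes \<psi> on the closed ball about x. The ball lies in G a \<union> W up to a
  null set, which puts y into the closure of W, and the first order condition on the ball puts x at
  distance s along the normal.\<close>

lemma touching_point:
  fixes \<psi> :: "real^'n \<Rightarrow> real" and \<gamma> :: "real^'n \<Rightarrow> real^'n"
  defines "G \<equiv> \<lambda>a. {x. a \<le> \<psi> x}"
  assumes s: "0 < s" and \<psi>: "continuous_on UNIV \<psi>" and W: "W \<in> leb" and WV: "closure W \<subseteq> V"
    and deriv: "\<And>y. y \<in> V \<Longrightarrow> (\<psi> has_derivative (\<lambda>v. \<gamma> y \<bullet> v)) (at y)" and nz: "\<And>y. y \<in> V \<Longrightarrow> \<gamma> y \<noteq> 0"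
    and x: "x \<in> outer s (- G a) - outer s (- (G a \<union> W))"
  obtains y where "y \<in> V" "\<psi> y < a" "x = y + s *\<^sub>R unit_dir (\<gamma> y)" "\<And>z. z \<in> cball x s \<Longrightarrow> \<psi> y \<le> \<psi> z"
proof -
  have closedG: "closed (G a)"
    unfolding G_def using continuous_closed_vimage[of "{a..}" \<psi>] \<psi>
    by (simp add: vimage_def continuous_on_eq_continuous_at)
  have Gs: "G a \<in> leb" using closedG by (metis borel_closed sets_completionI_sets sets_lborel)
  have null: "- (G a \<union> W) \<inter> ball x s \<in> nulls"
  proof -
    have "- (G a \<union> W) \<inter> ball x s \<in> leb" using Gs W by auto
    thus ?thesis using x by (auto simp: outer_def null_sets_def simp del: emeasure_completion)
  qed
  obtain y where y: "y \<in> cball x s" "\<And>z. z \<in> cball x s \<Longrightarrow> \<psi> y \<le> \<psi> z"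
  proof -
    have "continuous_on (cball x s) \<psi>" using \<psi> by (rule continuous_on_subset) simp
    moreover have "cball x s \<noteq> {}" using s by simp
    ultimately show thesis using continuous_attains_inf[OF compact_cball] that by metis
  qed
  obtain z where z: "z \<in> - G a" "dist x z < s" using x outer_subset_neighborhood by blast
  have ya: "\<psi> y < a" using y(2)[of z] z by (auto simp: G_def)
  \<comment> \<open>Otherwise a neighbourhood of y would meet the open ball about x in a nonempty
    open set outside G a and W, contradicting \<open>null\<close>.\<close>
  have yW: "y \<in> closure W"
  proof (rule ccontr)
    assume "y \<notin> closure W"
    hence "y \<in> - closure W \<inter> - G a" using ya by (auto simp: G_def)
    moreover have "open (- closure W \<inter> - G a)" using closedG by auto
    ultimately obtain e where e: "e > 0" "ball y e \<subseteq> - closure W \<inter> - G a" using openE by metis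
    have "y \<in> closure (ball x s)" using y s by simp
    then obtain p where p: "p \<in> ball x s" "dist p y < e" using closure_approachable e(1) by blast
    obtain d where d: "d > 0" "ball p d \<subseteq> ball x s \<inter> ball y e"
      using openE[of "ball x s \<inter> ball y e" p] p by (auto simp: dist_commute)
    have "ball p d \<subseteq> - (G a \<union> W) \<inter> ball x s" using d e(2) closure_subset[of W] by blast
    hence "ball p d \<in> nulls" by (intro null_sets_subset[OF null]) auto
    thus False using emeasure_ball_pos[OF d(1), of p] by auto
  qed
  hence yV: "y \<in> V" using WV by blast
  define n where "n = unit_dir (\<gamma> y)"
  have nn: "norm n = 1" unfolding n_def by (rule norm_unit_dir[OF nz[OF yV]])
  have gn: "\<gamma> y = norm (\<gamma> y) *\<^sub>R n" using nz[OF yV] by (simp add: n_def unit_dir_def)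
  have dir: "0 \<le> \<gamma> y \<bullet> (z - y)" if z: "z \<in> cball x s" for z
  proof (rule ccontr)
    assume neg: "\<not> 0 \<le> \<gamma> y \<bullet> (z - y)"
    define q where "q t = \<psi> (y + t *\<^sub>R (z - y))" for t :: real
    have "((\<lambda>t. y + t *\<^sub>R (z - y)) has_derivative (\<lambda>t. t *\<^sub>R (z - y))) (at 0)"
      by (auto intro!: derivative_eq_intros)
    moreover have "(\<psi> has_derivative (\<lambda>v. \<gamma> y \<bullet> v)) (at (y + 0 *\<^sub>R (z - y)))" using deriv[OF yV] by simp
    ultimately have "(q has_derivative (\<lambda>t. \<gamma> y \<bullet> (t *\<^sub>R (z - y)))) (at 0)"
      unfolding q_def by (rule has_derivative_compose)
    hence "(q has_real_derivative (\<gamma> y \<bullet> (z - y))) (at 0)"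
      unfolding has_field_derivative_def by (rule has_derivative_eq_rhs) (auto simp: fun_eq_iff)
    then obtain d where d: "d > 0" "\<And>t. 0 < t \<Longrightarrow> t < d \<Longrightarrow> q (0 + t) < q 0"
      using DERIV_neg_dec_right[of q "\<gamma> y \<bullet> (z - y)" 0] neg by force
    define t where "t = min (d / 2) 1"
    have t: "0 < t" "t < d" "t \<le> 1" using d(1) by (auto simp: t_def)
    have "y + t *\<^sub>R (z - y) = (1 - t) *\<^sub>R y + t *\<^sub>R z" by (simp add: algebra_simps)
    hence "y + t *\<^sub>R (z - y) \<in> cball x s"
      using convexD[OF convex_cball y(1) z, of "1 - t" t] t by simp
    hence "q 0 \<le> q t" using y(2) by (simp add: q_def)
    thus False using d(2)[OF t(1,2)] by simp
  qed
  \<comment> \<open>This point minimizes n . z over the ball. The test gives n . (x - y) \<ge> s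
    \<ge> |x - y|, the equality case of Cauchy-Schwarz.\<close>
  have "x - s *\<^sub>R n \<in> cball x s" using nn s by (simp add: dist_norm)
  from dir[OF this] have "0 \<le> norm (\<gamma> y) * (n \<bullet> (x - s *\<^sub>R n - y))"
    by (subst (asm) gn) simp
  hence "0 \<le> n \<bullet> (x - s *\<^sub>R n - y)" using nz[OF yV] by (simp add: zero_le_mult_iff)
  moreover have "n \<bullet> n = 1" using nn by (simp add: norm_eq_1)
  ultimately have ge: "s \<le> n \<bullet> (x - y)" by (simp add: inner_diff_right)
  have xy: "norm (x - y) \<le> s" using y(1) by (simp add: dist_norm)
  have "(x - y - s *\<^sub>R n) \<bullet> (x - y - s *\<^sub>R n) = (norm (x - y))\<^sup>2 - 2 * s * (n \<bullet> (x - y)) + s\<^sup>2"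
  proof -
    have "(d - s *\<^sub>R n) \<bullet> (d - s *\<^sub>R n) = d \<bullet> d - 2 * s * (n \<bullet> d) + s * s * (n \<bullet> n)" for d
      by (simp add: inner_diff_left inner_diff_right inner_commute algebra_simps)
    thus ?thesis using \<open>n \<bullet> n = 1\<close> by (simp only: power2_norm_eq_inner) (simp add: power2_eq_square)
  qed
  also have "\<dots> \<le> s\<^sup>2 - 2 * s * s + s\<^sup>2"
    using xy ge s by (intro add_mono diff_mono power_mono mult_left_mono) auto
  also have "\<dots> = 0" by (simp add: power2_eq_square)
  finally have "x - y - s *\<^sub>R n = 0" by (metis inner_eq_zero_iff inner_ge_zero order_antisym)
  hence "x = y + s *\<^sub>R n" by (simp add: algebra_simps)
  thus thesis using that[OF yV ya] y(2) by (simp add: n_def)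
qed

lemma second_order_taylor:
  fixes \<psi> :: "real^'n \<Rightarrow> real" and \<gamma> :: "real^'n \<Rightarrow> real^'n"
  assumes V: "convex V" "y \<in> V" "y + v \<in> V"
    and \<psi>: "\<And>z. z \<in> V \<Longrightarrow> (\<psi> has_derivative (\<lambda>v. \<gamma> z \<bullet> v)) (at z)"
    and \<gamma>: "\<And>z. z \<in> V \<Longrightarrow> (\<gamma> has_derivative (\<lambda>v. \<Gamma> z *v v)) (at z)"
  obtains t where "0 < t" "t < 1" "\<psi> (y + v) = \<psi> y + \<gamma> y \<bullet> v + (\<Gamma> (y + t *\<^sub>R v) *v v) \<bullet> v / 2"
proof -
  have inV: "y + t *\<^sub>R v \<in> V" if "0 \<le> t" "t \<le> 1" for t
  proof -
    have "y + t *\<^sub>R v = (1 - t) *\<^sub>R y + t *\<^sub>R (y + v)" by (simp add: algebra_simps)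
    thus ?thesis using convexD[OF V(1,2,3), of "1 - t" t] that by simp
  qed
  define q0 where "q0 t = \<psi> (y + t *\<^sub>R v)" for t
  define q1 where "q1 t = \<gamma> (y + t *\<^sub>R v) \<bullet> v" for t
  define q2 where "q2 t = (\<Gamma> (y + t *\<^sub>R v) *v v) \<bullet> v" for t
  have line: "((\<lambda>t. y + t *\<^sub>R v) has_derivative (\<lambda>h. h *\<^sub>R v)) (at t)" for t
    by (auto intro!: derivative_eq_intros)
  have d0: "DERIV q0 t :> q1 t" if "0 \<le> t" "t \<le> 1" for t
    using has_derivative_compose[OF line \<psi>[OF inV[OF that]]]
    unfolding has_field_derivative_def q0_def q1_def by (rule has_derivative_eq_rhs) (auto simp: fun_eq_iff)
  have d1: "DERIV q1 t :> q2 t" if "0 \<le> t" "t \<le> 1" for t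
    using has_derivative_inner_left[OF has_derivative_compose[OF line \<gamma>[OF inV[OF that]]], of v]
    unfolding has_field_derivative_def q1_def q2_def
    by (rule has_derivative_eq_rhs) (auto simp: fun_eq_iff matrix_vector_mult_scaleR)
  define diff where "diff m = (if m = (0::nat) then q0 else if m = 1 then q1 else q2)" for m
  have "\<exists>t>0. t < 1 \<and> q0 1 = (\<Sum>m<2. diff m 0 / fact m * 1 ^ m) + diff 2 t / fact 2 * 1 ^ 2"
  proof (rule Maclaurin)
    show "\<forall>m t. m < 2 \<and> 0 \<le> t \<and> t \<le> 1 \<longrightarrow> DERIV (diff m) t :> diff (Suc m) t"
      using d0 d1 by (auto simp: diff_def less_2_cases_iff)
  qed (auto simp: diff_def)
  then obtain t where t: "0 < t" "t < 1" "q0 1 = (\<Sum>m<2. diff m 0 / fact m * 1 ^ m) + diff 2 t / fact 2 * 1 ^ 2" by blast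
  have "(\<Sum>m<2. diff m 0 / fact m * 1 ^ m) = q0 0 + q1 0" by (simp add: diff_def numeral_2_eq_2)
  with t show thesis by (intro that[of t]) (auto simp: q0_def q1_def q2_def diff_def)
qed

text \<open>For 2 s c > |v|^2 the parabola y + t v - c t^2 n enters the open ball for small t > 0.
  There \<psi> is at most \<psi> y, and the terms of order t^2 in Taylor's formula give the
  curvature bound.\<close>

lemma touching_ball_curvature:
  fixes \<psi> :: "real^'n \<Rightarrow> real" and \<gamma> :: "real^'n \<Rightarrow> real^'n"
  assumes s: "0 < s" and r: "0 < r"
    and \<psi>: "\<And>z. z \<in> ball y r \<Longrightarrow> (\<psi> has_derivative (\<lambda>v. \<gamma> z \<bullet> v)) (at z)"
    and \<gamma>: "\<And>z. z \<in> ball y r \<Longrightarrow> (\<gamma> has_derivative (\<lambda>v. \<Gamma> z *v v)) (at z)"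
    and \<Gamma>: "isCont \<Gamma> y" and nz: "\<gamma> y \<noteq> 0"
    and touch: "\<And>z. z \<in> ball (y - s *\<^sub>R unit_dir (\<gamma> y)) s \<Longrightarrow> \<psi> z \<le> \<psi> y"
    and v: "v \<bullet> \<gamma> y = 0"
  shows "(\<Gamma> y *v v) \<bullet> v \<le> norm (\<gamma> y) / s * (v \<bullet> v)"
proof (rule field_le_epsilon)
  fix e :: real assume e: "0 < e"
  define n where "n = unit_dir (\<gamma> y)"
  have nn: "n \<bullet> n = 1" using norm_unit_dir[OF nz] by (simp add: n_def norm_eq_1)
  have gn: "\<gamma> y = norm (\<gamma> y) *\<^sub>R n" using nz by (simp add: n_def unit_dir_def)
  have vn: "v \<bullet> n = 0" using v by (simp add: n_def unit_dir_def)
  \<comment> \<open>The first term is the critical opening of the parabola; the second makes it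
    strictly larger and contributes exactly e at the end.\<close>
  define c where "c = (v \<bullet> v) / (2 * s) + e / (2 * norm (\<gamma> y))"
  have c0: "0 < c" "v \<bullet> v < 2 * s * c" 
  proof -
    have "0 \<le> (v \<bullet> v) / (2 * s)" "0 < e / (2 * norm (\<gamma> y))" using s e nz by auto
    thus "0 < c" by (simp add: c_def)
    have "2 * s * c = v \<bullet> v + s * (e / norm (\<gamma> y))" using s by (simp add: c_def field_simps)
    moreover have "0 < s * (e / norm (\<gamma> y))" using s e nz by simp
    ultimately show "v \<bullet> v < 2 * s * c" by simp
  qed
  define w where "w t = v - (c * t) *\<^sub>R n" for t
  have wlim: "(w \<longlongrightarrow> v) (at_right 0)" unfolding w_def by (auto intro!: tendsto_eq_intros)
  have zlim: "((\<lambda>t. t *\<^sub>R w t) \<longlongrightarrow> 0) (at_right 0)" using tendsto_scaleR[OF tendsto_ident_at wlim] by simp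
  have "((\<lambda>t. v \<bullet> v - 2 * s * c + c\<^sup>2 * t\<^sup>2) \<longlongrightarrow> v \<bullet> v - 2 * s * c + c\<^sup>2 * 0\<^sup>2) (at_right 0)" by (intro tendsto_intros)
  hence ev1: "\<forall>\<^sub>F t in at_right 0. v \<bullet> v - 2 * s * c + c\<^sup>2 * t\<^sup>2 < 0" by (rule order_tendstoD(2)) (use c0 in simp)
  have ev2: "\<forall>\<^sub>F t in at_right 0. norm (t *\<^sub>R w t) < r" using order_tendstoD(2)[OF tendsto_norm[OF zlim]] r by simp
  have ev0: "\<forall>\<^sub>F t in at_right 0. (0::real) < t" by (simp add: eventually_at_filter)
  have "\<forall>\<^sub>F t in at_right 0. \<exists>\<theta>. 0 < \<theta> \<and> \<theta> < 1 \<and> (\<Gamma> (y + \<theta> *\<^sub>R t *\<^sub>R w t) *v w t) \<bullet> w t \<le> 2 * c * norm (\<gamma> y)"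
    using ev0 ev1 ev2
  proof eventually_elim
    case (elim t)
    define z where "z = y + t *\<^sub>R w t"
    have "z - (y - s *\<^sub>R n) = t *\<^sub>R v + (s - c * t\<^sup>2) *\<^sub>R n" by (simp add: z_def w_def algebra_simps power2_eq_square)
    hence "(norm (z - (y - s *\<^sub>R n)))\<^sup>2 = (t *\<^sub>R v + (s - c * t\<^sup>2) *\<^sub>R n) \<bullet> (t *\<^sub>R v + (s - c * t\<^sup>2) *\<^sub>R n)"
      by (simp only: power2_norm_eq_inner)
    also have "\<dots> = t\<^sup>2 * (v \<bullet> v) + (s - c * t\<^sup>2)\<^sup>2"
      using vn nn by (simp add: inner_add_left inner_add_right inner_commute[of n v] power2_eq_square)
    also have "\<dots> = s\<^sup>2 + t\<^sup>2 * (v \<bullet> v - 2 * s * c + c\<^sup>2 * t\<^sup>2)" by (simp add: power2_eq_square algebra_simps)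
    also have "\<dots> < s\<^sup>2" using elim by (simp add: mult_pos_neg)
    finally have "norm (z - (y - s *\<^sub>R n)) < s" using s by (meson less_imp_le power2_less_imp_less)
    hence "\<psi> z \<le> \<psi> y" by (intro touch) (simp add: dist_norm norm_minus_commute n_def)
    have zr: "y + t *\<^sub>R w t \<in> ball y r" using elim by (simp add: dist_norm)
    obtain \<theta> where th: "0 < \<theta>" "\<theta> < 1" "\<psi> (y + t *\<^sub>R w t) = \<psi> y + \<gamma> y \<bullet> (t *\<^sub>R w t) + (\<Gamma> (y + \<theta> *\<^sub>R t *\<^sub>R w t) *v (t *\<^sub>R w t)) \<bullet> (t *\<^sub>R w t) / 2"
      using second_order_taylor[OF convex_ball _ zr \<psi> \<gamma>] r by auto
    have "\<gamma> y \<bullet> w t = - c * t * norm (\<gamma> y)"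
    proof -
      have "\<gamma> y \<bullet> w t = norm (\<gamma> y) * (n \<bullet> w t)" by (subst gn) simp
      also have "n \<bullet> w t = - c * t" using vn nn by (simp add: w_def inner_diff_right inner_commute)
      finally show ?thesis by simp
    qed
    hence "t\<^sup>2 * ((\<Gamma> (y + \<theta> *\<^sub>R t *\<^sub>R w t) *v w t) \<bullet> w t) \<le> t\<^sup>2 * (2 * c * norm (\<gamma> y))"
      using th(3) \<open>\<psi> z \<le> \<psi> y\<close> by (simp add: z_def matrix_vector_mult_scaleR power2_eq_square algebra_simps)
    thus ?case using th elim by (intro exI[of _ \<theta>]) simp
  qed
  then obtain \<theta> where th: "\<forall>\<^sub>F t in at_right 0. 0 < \<theta> t \<and> \<theta> t < 1 \<and> (\<Gamma> (y + \<theta> t *\<^sub>R t *\<^sub>R w t) *v w t) \<bullet> w t \<le> 2 * c * norm (\<gamma> y)"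
    unfolding eventually_ex by blast
  have "((\<lambda>t. \<theta> t *\<^sub>R t *\<^sub>R w t) \<longlongrightarrow> 0) (at_right 0)"
  proof (rule Lim_null_comparison[OF _ tendsto_norm_zero[OF zlim]])
    show "\<forall>\<^sub>F t in at_right 0. norm (\<theta> t *\<^sub>R t *\<^sub>R w t) \<le> norm (t *\<^sub>R w t)"
      using th by eventually_elim (auto simp: abs_mult intro!: mult_right_mono mult_left_le_one_le)
  qed
  hence "((\<lambda>t. y + \<theta> t *\<^sub>R t *\<^sub>R w t) \<longlongrightarrow> y) (at_right 0)" using tendsto_add[OF tendsto_const[of y]] by fastforce
  hence Gl: "((\<lambda>t. \<Gamma> (y + \<theta> t *\<^sub>R t *\<^sub>R w t)) \<longlongrightarrow> \<Gamma> y) (at_right 0)" by (rule isCont_tendsto_compose[OF \<Gamma>])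
  have "((\<lambda>t. (\<Gamma> (y + \<theta> t *\<^sub>R t *\<^sub>R w t) *v w t) \<bullet> w t) \<longlongrightarrow> (\<Gamma> y *v v) \<bullet> v) (at_right 0)"
    unfolding matrix_vector_mult_def
    by (intro tendsto_inner tendsto_vec_lambda tendsto_sum tendsto_mult tendsto_vec_nth Gl wlim)
  hence "(\<Gamma> y *v v) \<bullet> v \<le> 2 * c * norm (\<gamma> y)"
    by (rule tendsto_upperbound) (use th in \<open>auto elim: eventually_mono\<close>)
  also have "\<dots> = norm (\<gamma> y) / s * (v \<bullet> v) + e" using nz s by (simp add: c_def field_simps)
  finally show "(\<Gamma> y *v v) \<bullet> v \<le> norm (\<gamma> y) / s * (v \<bullet> v) + e" .
qed

text \<open>The second difference of F in directions a and b is symmetric, and by the mean value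
  theorem and differentiability of F' at z its quotient by s^2 tends to the second
  derivative.\<close>

lemma symmetric_second_derivative:
  fixes F :: "'a::real_normed_vector \<Rightarrow> real"
  assumes U: "open U" "z \<in> U" and F1: "\<And>w. w \<in> U \<Longrightarrow> (F has_derivative blinfun_apply (F' w)) (at w)"
    and F2: "(F' has_derivative blinfun_apply F'') (at z)"
  shows "blinfun_apply (F'' a) b = blinfun_apply (F'' b) a"
proof -
  define \<Delta> where "\<Delta> a b s = F (z + (s *\<^sub>R a + s *\<^sub>R b)) - F (z + s *\<^sub>R a) - F (z + s *\<^sub>R b) + F z" for a b and s :: real
  define C where "C a b = norm a + norm b" for a b :: 'a
  have est: "\<forall>\<^sub>F s in at_right 0. \<bar>\<Delta> a b s - s\<^sup>2 * F'' b a\<bar> \<le> 2 * e * s\<^sup>2 * (C a b)\<^sup>2" if e: "0 < e" for e a b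
  proof -
    obtain r where r: "0 < r" "ball z r \<subseteq> U" using U openE by blast
    define R where "R w = F' (z + w) - F' z - F'' w" for w
    obtain d where d: "0 < d" "\<And>w. norm w < d \<Longrightarrow> norm (R w) \<le> e * norm w"
    proof -
      obtain d where "0 < d" "\<And>y. norm (y - z) < d \<Longrightarrow> norm (F' y - F' z - F'' (y - z)) \<le> e * norm (y - z)"
        using F2 e unfolding has_derivative_at_alt by blast
      from this(1) this(2)[of "z + _"] show thesis by (intro that) (auto simp: R_def)
    qed
    have C0: "0 \<le> C a b" by (simp add: C_def)
    have "((\<lambda>s. s * C a b) \<longlongrightarrow> 0 * C a b) (at_right 0)" by (intro tendsto_intros)
    hence "\<forall>\<^sub>F s in at_right 0. s * C a b < min r d" by (rule order_tendstoD(2)) (use r d in simp)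
    moreover have "\<forall>\<^sub>F s in at_right 0. (0::real) < s" by (simp add: eventually_at_filter)
    ultimately show ?thesis
    proof eventually_elim
      case (elim s)
      define w where "w \<theta> k = (\<theta> * s) *\<^sub>R a + (k * s) *\<^sub>R b" for \<theta> k
      have w: "norm (w \<theta> k) \<le> s * C a b" if "\<theta> \<in> {0..1}" "k \<in> {0..1}" for \<theta> k
      proof -
        have "norm (w \<theta> k) \<le> (\<theta> * s) * norm a + (k * s) * norm b"
          using norm_triangle_ineq[of "(\<theta> * s) *\<^sub>R a" "(k * s) *\<^sub>R b"] that elim by (simp add: w_def)
        also have "\<dots> \<le> s * norm a + s * norm b"
          using that elim by (intro add_mono mult_right_mono) (auto intro: mult_left_le_one_le)
        finally show ?thesis by (simp add: C_def algebra_simps)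
      qed
      have der: "((\<lambda>\<theta>. F (z + w \<theta> k)) has_derivative (\<lambda>h. F' (z + w \<theta> k) ((h * s) *\<^sub>R a))) (at \<theta>)"
        if "\<theta> \<in> {0..1}" "k \<in> {0..1}" for \<theta> k
      proof -
        have line: "((\<lambda>\<theta>. z + w \<theta> k) has_derivative (\<lambda>h. (h * s) *\<^sub>R a)) (at \<theta>)"
          unfolding w_def by (auto intro!: derivative_eq_intros)
        have "dist z (z + w \<theta> k) < r" using w[OF that] elim by (simp add: dist_norm)
        hence "z + w \<theta> k \<in> U" using r(2) by auto
        thus ?thesis by (rule has_derivative_compose[OF line F1])
      qed
      have "\<exists>\<theta>\<in>{0..1}. (F (z + w 1 1) - F (z + w 1 0)) - (F (z + w 0 1) - F (z + w 0 0)) =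
          F' (z + w \<theta> 1) (((1 - 0) * s) *\<^sub>R a) - F' (z + w \<theta> 0) (((1 - 0) * s) *\<^sub>R a)"
      proof (rule mvt_very_simple)
        fix \<theta> :: real assume "0 \<le> \<theta>" "\<theta> \<le> 1"
        thus "((\<lambda>\<theta>. F (z + w \<theta> 1) - F (z + w \<theta> 0)) has_derivative
            (\<lambda>h. F' (z + w \<theta> 1) ((h * s) *\<^sub>R a) - F' (z + w \<theta> 0) ((h * s) *\<^sub>R a))) (at \<theta> within {0..1})"
          by (intro has_derivative_at_withinI[OF has_derivative_diff[OF der der]]) auto
      qed simp
      then obtain \<theta> where t: "\<theta> \<in> {0..1}" "\<Delta> a b s = s * (F' (z + w \<theta> 1) a - F' (z + w \<theta> 0) a)"
        by (auto simp: \<Delta>_def w_def blinfun.scaleR_right algebra_simps)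
      have "F'' (w \<theta> 1) a - F'' (w \<theta> 0) a = s * F'' b a"
        by (simp add: w_def blinfun.add_right blinfun.scaleR_right blinfun.add_left blinfun.scaleR_left)
      hence eq: "\<Delta> a b s - s\<^sup>2 * F'' b a = s * (R (w \<theta> 1) a - R (w \<theta> 0) a)"
        unfolding t(2) R_def by (simp add: blinfun.diff_left blinfun.add_left power2_eq_square algebra_simps)
      have Rw: "\<bar>R (w \<theta> k) a\<bar> \<le> e * (s * C a b) * C a b" if k: "k \<in> {0..1}" for k
      proof -
        have "\<bar>R (w \<theta> k) a\<bar> \<le> norm (R (w \<theta> k)) * norm a" using norm_blinfun[of "R (w \<theta> k)" a] by simp
        also have "\<dots> \<le> (e * norm (w \<theta> k)) * C a b"
          using d(2)[of "w \<theta> k"] w[OF t(1) k] elim e by (intro mult_mono) (auto simp: C_def)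
        also have "\<dots> \<le> e * (s * C a b) * C a b" using w[OF t(1) k] e C0 by (intro mult_right_mono mult_left_mono) auto
        finally show ?thesis .
      qed
      have "\<bar>R (w \<theta> 1) a - R (w \<theta> 0) a\<bar> \<le> 2 * (e * (s * C a b) * C a b)" using Rw[of 0] Rw[of 1] by simp
      hence "s * \<bar>R (w \<theta> 1) a - R (w \<theta> 0) a\<bar> \<le> s * (2 * (e * (s * C a b) * C a b))"
        using elim by (intro mult_left_mono) auto
      thus ?case unfolding eq using elim by (simp add: abs_mult power2_eq_square mult_ac)
    qed
  qed
  have "\<bar>F'' b a - F'' a b\<bar> \<le> 0 + e" if e: "0 < e" for e
  proof -
    define e' where "e' = e / (4 * (C a b)\<^sup>2 + 1)"
    have e': "0 < e'" "e' * (4 * (C a b)\<^sup>2 + 1) = e" using e by (auto simp: e'_def add_nonneg_pos less_imp_neq[symmetric])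
    have "\<forall>\<^sub>F s in at_right 0. (0::real) < s" by (simp add: eventually_at_filter)
    then obtain s where s: "0 < s" "\<bar>\<Delta> a b s - s\<^sup>2 * F'' b a\<bar> \<le> 2 * e' * s\<^sup>2 * (C a b)\<^sup>2"
        "\<bar>\<Delta> b a s - s\<^sup>2 * F'' a b\<bar> \<le> 2 * e' * s\<^sup>2 * (C b a)\<^sup>2"
      using eventually_happens'[OF trivial_limit_at_right_real eventually_conj[OF _ eventually_conj[OF est[OF e'(1)] est[OF e'(1)]]]] by blast
    have "\<Delta> b a s = \<Delta> a b s" "C b a = C a b" by (simp_all add: \<Delta>_def C_def algebra_simps)
    hence "\<bar>s\<^sup>2 * F'' b a - s\<^sup>2 * F'' a b\<bar> \<le> s\<^sup>2 * (4 * e' * (C a b)\<^sup>2)" using s(2,3) by (simp add: algebra_simps)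
    hence "s\<^sup>2 * \<bar>F'' b a - F'' a b\<bar> \<le> s\<^sup>2 * (4 * e' * (C a b)\<^sup>2)"
      by (simp add: right_diff_distrib[symmetric] abs_mult)
    hence "\<bar>F'' b a - F'' a b\<bar> \<le> 4 * e' * (C a b)\<^sup>2" using s(1) by simp
    also have "\<dots> \<le> e" using e' by (simp add: algebra_simps)
    finally show ?thesis by simp
  qed
  hence "\<bar>F'' b a - F'' a b\<bar> \<le> 0" by (rule field_le_epsilon)
  thus ?thesis by simp
qed

section \<open>Almost maximum points\<close>

context evolution_limit
begin

lemma M_nonneg: "0 \<le> M"
  using v_bound[of 0 undefined] by linarith

text \<open>The penalty makes the maximum at (xh, th) strict. Since u is bounded and u minus the
  test function is bounded above, it also makes sublevel sets bounded at positive times.\<close>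

definition perturbed :: "((real^'n) \<times> real \<Rightarrow> real) \<Rightarrow> real^'n \<Rightarrow> real \<Rightarrow> real \<Rightarrow> real^'n \<Rightarrow> real \<Rightarrow> real" where
  "perturbed \<phi> xh th \<eta> y s = \<phi> (y, s) + \<eta> * ((norm (y - xh))\<^sup>2 + (s - th)\<^sup>2)"

text \<open>A time step from \<open>E\<close> to \<open>F\<close> at a level where all points of \<open>F\<close> at which the perturbed test function is
  close to its minimum over \<open>F\<close> are close to \<open>xh\<close>.\<close>

definition near_max where
  "near_max \<phi> xh th r \<eta> t h' E F b \<epsilon> \<longleftrightarrow> 0 < \<eta> \<and> \<eta> < r \<and> 0 < t - h' \<and> \<bar>t - th\<bar> < r \<and> 0 < h' \<and> h' < r \<and>
     0 < \<epsilon> \<and> \<epsilon> < r * h' \<and> solves h' E F \<and> E \<subseteq> {y. b \<le> perturbed \<phi> xh th \<eta> y (t - h')} \<and>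
     F \<inter> {y. perturbed \<phi> xh th \<eta> y t < b + \<epsilon>} \<subseteq> ball xh r \<and>
     0 < vol (F \<inter> {y. perturbed \<phi> xh th \<eta> y t < b + \<epsilon>}) \<and>
     bounded {y. perturbed \<phi> xh th \<eta> y t < b + \<epsilon>} \<and> continuous_on UNIV (\<lambda>y. perturbed \<phi> xh th \<eta> y t)"

lemma near_max_exists:
  fixes \<phi> :: "(real^'n) \<times> real \<Rightarrow> real" and xh :: "real^'n" and th :: real
  assumes th: "0 < th" and phi: "continuous_on (UNIV \<times> {0<..}) \<phi>"
    and max: "\<And>w. w \<in> UNIV \<times> {0<..} \<Longrightarrow> u w - \<phi> w \<le> u (xh, th) - \<phi> (xh, th)" and r: "0 < r"
  shows "\<exists>\<eta> t h' E F b \<epsilon>. near_max \<phi> xh th r \<eta> t h' E F b \<epsilon>"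
proof -
  note \<Psi>_def = perturbed_def[of \<phi> xh th]
  let ?\<Psi> = "perturbed \<phi> xh th"
  define \<tau> where "\<tau> = min th r / 2"
  define \<eta> where "\<eta> = r / 2"
  define r' where "r' = \<tau> / 2"
  \<comment> \<open>The penalty is at least 4 \<kappa> beyond distance r', and \<kappa> is the error
    allowed in uniform convergence. Hence D \<le> m - 3 \<kappa> far away, against D \<ge> m -
    \<kappa> at the center.\<close>
  define \<kappa> where "\<kappa> = \<eta> * r'\<^sup>2 / 4"
  define m where "m = u (xh, th) - \<phi> (xh, th)"
  have pos: "0 < \<tau>" "\<tau> < th" "\<tau> < r" "0 < \<eta>" "\<eta> < r" "0 < r'" "r' < r" "2 * r' = \<tau>" "0 < \<kappa>" "4 * \<kappa> = \<eta> * r'\<^sup>2"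
    using th r by (auto simp: \<tau>_def \<eta>_def r'_def \<kappa>_def)
  define I where "I = {th - \<tau>..th + \<tau>}"
  have I0: "0 < s" if "s \<in> I" for s using that pos by (auto simp: I_def)
  have phi_low: "- M - m \<le> \<phi> (y, s)" "u (y, s) - \<phi> (y, s) \<le> m" if "0 < s" for y s
    using max[of "(y, s)"] u_bound[of "(y, s)"] that by (auto simp: m_def)
  \<comment> \<open>Beyond radius R there is no uniform convergence; the penalty there outweighs the
    crude bounds by M on v and by - M - m on \<phi>.\<close>
  define R where "R = 1 + (2 * M + \<eta> * r'\<^sup>2) / \<eta> + r'"
  have R: "1 \<le> R" "r' \<le> R" "2 * M + \<eta> * r'\<^sup>2 \<le> \<eta> * R\<^sup>2"
  proof -
    have q: "0 \<le> (2 * M + \<eta> * r'\<^sup>2) / \<eta>" using pos M_nonneg by simp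
    thus R1: "1 \<le> R" "r' \<le> R" using pos by (auto simp: R_def)
    have "2 * M + \<eta> * r'\<^sup>2 = \<eta> * ((2 * M + \<eta> * r'\<^sup>2) / \<eta>)" using pos by simp
    also have "\<dots> \<le> \<eta> * R" using pos by (intro mult_left_mono) (auto simp: R_def)
    also have "\<dots> \<le> \<eta> * R\<^sup>2" using pos R1 by (intro mult_left_mono) (auto simp: power2_eq_square)
    finally show "2 * M + \<eta> * r'\<^sup>2 \<le> \<eta> * R\<^sup>2" .
  qed
  define C where "C = cball xh R \<times> I"
  have "compact C" unfolding C_def I_def by (intro compact_Times) auto
  moreover have "C \<subseteq> UNIV \<times> {0..}" using I0 by (auto simp: C_def less_imp_le)
  ultimately have ul: "uniform_limit C v u sequentially" by (rule v_lim)
  have "\<forall>\<^sub>F k in sequentially. \<forall>z\<in>C. dist (v k z) (u z) < \<kappa>"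
    using ul pos unfolding uniform_limit_iff by blast
  moreover have "\<forall>\<^sub>F k in sequentially. h k < r'" by (rule order_tendstoD(2)[OF h_lim]) (use pos in simp)
  ultimately have "\<exists>k. (\<forall>z\<in>C. dist (v k z) (u z) < \<kappa>) \<and> h k < r'"
    using eventually_happens'[OF sequentially_bot eventually_conj] by blast
  then obtain k where k: "\<And>z. z \<in> C \<Longrightarrow> dist (v k z) (u z) < \<kappa>" "h k < r'" by auto
  define h' where "h' = h k"
  have h': "0 < h'" "h' < r'" using h_pos k(2) by (auto simp: h'_def)
  define D where "D z = v k z - ?\<Psi> \<eta> (fst z) (snd z)" for z
  have far: "D (y, s) \<le> m - 3 * \<kappa>" if s: "s \<in> I" and f: "\<not> (norm (y - xh) < r' \<and> \<bar>s - th\<bar> < r')" for y s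
  proof (cases "norm (y - xh) \<le> R")
    case True
    hence "(y, s) \<in> C" using s by (auto simp: C_def dist_norm norm_minus_commute)
    hence "v k (y, s) < u (y, s) + \<kappa>" using k(1)[of "(y, s)"] unfolding dist_real_def by linarith
    moreover have "r'\<^sup>2 \<le> (norm (y - xh))\<^sup>2 + (s - th)\<^sup>2"
    proof (cases "norm (y - xh) < r'")
      case True
      hence "r' \<le> \<bar>s - th\<bar>" using f by auto
      hence "r'\<^sup>2 \<le> \<bar>s - th\<bar>\<^sup>2" using pos by (intro power_mono) auto
      thus ?thesis by (simp add: add_increasing)
    next
      case False
      hence "r'\<^sup>2 \<le> (norm (y - xh))\<^sup>2" using pos by (intro power_mono) auto
      thus ?thesis by (simp add: add_increasing2)
    qed
    hence "\<eta> * r'\<^sup>2 \<le> \<eta> * ((norm (y - xh))\<^sup>2 + (s - th)\<^sup>2)" using pos by (intro mult_left_mono) auto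
    ultimately show ?thesis using phi_low(2)[OF I0[OF s], of y] pos unfolding D_def \<Psi>_def fst_conv snd_conv by linarith
  next
    case False
    hence "R\<^sup>2 \<le> (norm (y - xh))\<^sup>2" using R by (intro power_mono) auto
    hence "\<eta> * R\<^sup>2 \<le> \<eta> * ((norm (y - xh))\<^sup>2 + (s - th)\<^sup>2)" using pos by (intro mult_left_mono add_increasing2) auto
    moreover have "v k (y, s) \<le> M" using v_bound[of k "(y, s)"] by linarith
    ultimately show ?thesis using phi_low(1)[OF I0[OF s], of y] R pos unfolding D_def \<Psi>_def fst_conv snd_conv by linarith
  qed
  have thI: "th \<in> I" using pos by (auto simp: I_def)
  have center: "m - \<kappa> \<le> D (xh, th)"
  proof -
    have "(xh, th) \<in> C" using R thI by (auto simp: C_def)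
    thus ?thesis using k(1)[of "(xh, th)"] unfolding dist_real_def by (simp add: D_def \<Psi>_def m_def)
  qed
  have upper: "D z \<le> m + \<kappa>" if z: "z \<in> UNIV \<times> I" for z
  proof (cases "norm (fst z - xh) \<le> R")
    case True
    hence "z \<in> C" using z by (cases z) (auto simp: C_def dist_norm norm_minus_commute)
    hence "v k z < u z + \<kappa>" using k(1)[of z] unfolding dist_real_def by linarith
    moreover have "0 \<le> \<eta> * ((norm (fst z - xh))\<^sup>2 + (snd z - th)\<^sup>2)" using pos by simp
    moreover have "u z - \<phi> z \<le> m" using phi_low(2)[OF I0, of "snd z" "fst z"] z by auto
    ultimately show ?thesis by (simp add: D_def \<Psi>_def)
  next
    case False
    hence "D (fst z, snd z) \<le> m - 3 * \<kappa>" using z R by (intro far) auto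
    thus ?thesis using pos by simp
  qed
  define c where "c = (SUP z\<in>UNIV \<times> I. D z)"
  have bdd: "bdd_above (D ` (UNIV \<times> I))" using upper by (intro bdd_aboveI2)
  have Dc: "D z \<le> c" if "z \<in> UNIV \<times> I" for z unfolding c_def by (rule cSUP_upper[OF that bdd])
  have cm: "m - \<kappa> \<le> c" using center Dc[of "(xh, th)"] thI by auto
  \<comment> \<open>The bound \<kappa> keeps points with D > c - \<epsilon> near the center; the
    bound r h' makes the tolerance negligible against the decrease over one time step.\<close>
  define \<epsilon> where "\<epsilon> = min \<kappa> (r * h' / 2)"
  have eps: "0 < \<epsilon>" "\<epsilon> \<le> \<kappa>" "\<epsilon> < r * h'" 
  proof -
    have "0 < r * h'" using h' r by simp
    thus "0 < \<epsilon>" "\<epsilon> \<le> \<kappa>" "\<epsilon> < r * h'" using pos unfolding \<epsilon>_def by linarith+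
  qed
  obtain z where z: "z \<in> UNIV \<times> I" "c - \<epsilon> / 3 < D z"
  proof -
    have "c - \<epsilon> / 3 < c" using eps by simp
    moreover have "UNIV \<times> I \<noteq> ({} :: ((real^'n) \<times> real) set)" using thI by auto
    ultimately show thesis using that unfolding c_def less_cSUP_iff[OF \<open>UNIV \<times> I \<noteq> _\<close> bdd] by blast
  qed
  obtain x1 t where zt: "z = (x1, t)" by (cases z)
  have near: "norm (y - xh) < r' \<and> \<bar>s - th\<bar> < r'" if "s \<in> I" "c - \<epsilon> < D (y, s)" for y s
    using far[OF that(1), of y] that(2) cm eps pos by linarith
  have t: "t \<in> I" "\<bar>t - th\<bar> < r'" using near[of t x1] z eps by (auto simp: zt)
  have th': "t - h' \<in> I" using t h' pos by (auto simp: I_def)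
  define s where "s = v k z - \<epsilon> / 3"
  \<comment> \<open>As D is at most c, a value of v at least s forces the perturbed test function to
    be at least s - c.\<close>
  define b where "b = s - c"
  have hkt: "h k \<le> t" using I0[OF th'] by (simp add: h'_def)
  obtain F where F: "solves h' {x. s \<le> v k (x, t - h')} F" "{x. s < v k (x, t)} \<subseteq> F" "F \<subseteq> {x. s \<le> v k (x, t)}"
    using step[OF hkt] unfolding step_relation_def h'_def by blast
  have Psi_ge: "b \<le> ?\<Psi> \<eta> y t'" if "t' \<in> I" "s \<le> v k (y, t')" for y t'
    using Dc[of "(y, t')"] that by (simp add: D_def b_def)
  have Wb: "F \<inter> {y. ?\<Psi> \<eta> y t < b + \<epsilon>} \<subseteq> ball xh r'"
  proof
    fix y assume y: "y \<in> F \<inter> {y. ?\<Psi> \<eta> y t < b + \<epsilon>}"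
    hence "s \<le> v k (y, t)" using F(3) by auto
    hence "c - \<epsilon> < D (y, t)" using y by (simp add: D_def b_def)
    thus "y \<in> ball xh r'" using near[OF t(1)] unfolding mem_ball dist_norm norm_minus_commute[of xh] by blast
  qed
  have cont: "continuous_on UNIV (\<lambda>y. ?\<Psi> \<eta> y t)"
    unfolding \<Psi>_def
    by (intro continuous_intros continuous_on_compose2[OF phi]) (use I0[OF t(1)] in auto)
  have x1: "x1 \<in> F" "?\<Psi> \<eta> x1 t < b + \<epsilon>"
    using F(2) z(2) eps by (auto simp: s_def zt D_def b_def)
  have "open {y. ?\<Psi> \<eta> y t < b + \<epsilon>}" by (intro open_Collect_less cont continuous_intros)
  then obtain e where e: "e > 0" "ball x1 e \<subseteq> {y. ?\<Psi> \<eta> y t < b + \<epsilon>}" using x1(2) openE by blast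
  note sD = solvesD[OF F(1)]
  have "0 < vol (F \<inter> ball x1 e)"
    using good_representative_pos[OF sD(2,3) x1(1) e(1)] by (simp add: outer_def)
  also have "\<dots> \<le> vol (F \<inter> {y. ?\<Psi> \<eta> y t < b + \<epsilon>})"
    by (rule emeasure_mono) (use e sD(2) open_sets_lebesgue[OF \<open>open {y. ?\<Psi> \<eta> y t < b + \<epsilon>}\<close>] in auto)
  finally have Wpos: "0 < vol (F \<inter> {y. ?\<Psi> \<eta> y t < b + \<epsilon>})" .
  have bd: "bounded {y. ?\<Psi> \<eta> y t < b + \<epsilon>}"
  proof (rule bounded_subset[OF bounded_cball])
    define B where "B = (b + \<epsilon> + M + m) / \<eta>"
    show "{y. ?\<Psi> \<eta> y t < b + \<epsilon>} \<subseteq> cball xh (1 + \<bar>B\<bar>)"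
    proof
      fix y assume "y \<in> {y. ?\<Psi> \<eta> y t < b + \<epsilon>}"
      hence "\<eta> * ((norm (y - xh))\<^sup>2 + (t - th)\<^sup>2) < b + \<epsilon> + M + m"
        using phi_low(1)[OF I0[OF t(1)], of y] by (simp add: \<Psi>_def)
      moreover have "\<eta> * (norm (y - xh))\<^sup>2 \<le> \<eta> * ((norm (y - xh))\<^sup>2 + (t - th)\<^sup>2)" using pos by simp
      ultimately have "\<eta> * (norm (y - xh))\<^sup>2 < b + \<epsilon> + M + m" by linarith
      hence "(norm (y - xh))\<^sup>2 < B" using pos by (simp add: B_def pos_less_divide_eq mult.commute)
      moreover have "norm (y - xh) \<le> 1 + (norm (y - xh))\<^sup>2"
      proof (cases "norm (y - xh) \<le> 1")
        case False
        hence "norm (y - xh) * 1 \<le> norm (y - xh) * norm (y - xh)" by (intro mult_left_mono) auto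
        thus ?thesis by (simp add: power2_eq_square)
      qed (simp add: add_increasing2)
      ultimately show "y \<in> cball xh (1 + \<bar>B\<bar>)"
        unfolding mem_cball dist_norm norm_minus_commute[of xh] by linarith
    qed
  qed
  have "near_max \<phi> xh th r \<eta> t h' {x. s \<le> v k (x, t - h')} F b \<epsilon>"
    unfolding near_max_def
  proof (intro conjI)
    show "F \<inter> {y. ?\<Psi> \<eta> y t < b + \<epsilon>} \<subseteq> ball xh r" "\<bar>t - th\<bar> < r" "h' < r"
      using Wb t(2) h' pos by (auto intro: order_less_trans)
    show "{x. s \<le> v k (x, t - h')} \<subseteq> {y. b \<le> ?\<Psi> \<eta> y (t - h')}" using Psi_ge[OF th'] by auto
  qed (fact pos(4,5) I0[OF th'] h'(1) eps(1,3) F(1) Wpos bd cont)+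
  thus ?thesis by blast
qed

end

section \<open>First variation along sequences of level sets\<close>

lemma eventually_sequentially_nhdsD:
  fixes x :: "'a::metric_space"
  assumes "\<forall>\<^sub>F z in sequentially \<times>\<^sub>F nhds x. Q (fst z) (snd z)"
  obtains e where "0 < e" "\<forall>\<^sub>F j in sequentially. \<forall>y\<in>ball x e. Q j y"
proof -
  obtain P R where PR: "eventually P sequentially" "eventually R (nhds x)" "\<And>j y. P j \<Longrightarrow> R y \<Longrightarrow> Q j y"
    using assms unfolding eventually_prod_filter by auto
  obtain e where e: "0 < e" "\<And>y. dist y x < e \<Longrightarrow> R y" using PR(2) unfolding eventually_nhds_metric by blast
  show thesis
  proof (rule that[OF e(1)])
    show "\<forall>\<^sub>F j in sequentially. \<forall>y\<in>ball x e. Q j y"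
      using PR(1) by eventually_elim (use PR(3) e(2) in \<open>auto simp: dist_commute\<close>)
  qed
qed

lemma not_eventually_sequentially_nhdsD:
  fixes x :: "'a::metric_space"
  assumes "\<not> (\<forall>\<^sub>F z in sequentially \<times>\<^sub>F nhds x. Q (fst z) (snd z))"
  obtains J Y where "filterlim J at_top sequentially" "Y \<longlonglongrightarrow> x" "\<And>n. \<not> Q (J n) (Y n)"
proof -
  have "\<exists>j y. n \<le> j \<and> dist y x < 1 / real (Suc n) \<and> \<not> Q j y" for n
  proof (rule ccontr)
    assume a: "\<not> ?thesis"
    have "\<forall>\<^sub>F z in sequentially \<times>\<^sub>F nhds x. Q (fst z) (snd z)"
      unfolding eventually_prod_filter
    proof (intro exI conjI allI impI)
      show "\<forall>\<^sub>F j in sequentially. n \<le> j" by (rule eventually_ge_at_top)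
      show "\<forall>\<^sub>F y in nhds x. dist y x < 1 / real (Suc n)"
        unfolding eventually_nhds_metric by (intro exI[of _ "1 / real (Suc n)"]) auto
    qed (use a in auto)
    thus False using assms by blast
  qed
  then obtain J Y where JY: "\<And>n. n \<le> J n" "\<And>n. dist (Y n) x < 1 / real (Suc n)" "\<And>n. \<not> Q (J n) (Y n)"
    by metis
  show thesis
  proof (rule that[OF _ _ JY(3)])
    show "filterlim J at_top sequentially"
      by (rule filterlim_at_top_mono[OF filterlim_ident]) (use JY(1) in auto)
    have "(\<lambda>n. dist (Y n) x) \<longlonglongrightarrow> 0"
      by (rule real_tendsto_sandwich[OF _ _ tendsto_const LIMSEQ_Suc[OF lim_1_over_n]])
        (use JY(2) in \<open>auto intro!: always_eventually less_imp_le simp del: of_nat_Suc\<close>)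
    thus "Y \<longlonglongrightarrow> x" by (rule tendsto_dist_iff[THEN iffD2])
  qed
qed

lemma tendsto_unit_dir:
  assumes "(g \<longlongrightarrow> p) F" "p \<noteq> 0"
  shows "((\<lambda>x. unit_dir (g x)) \<longlongrightarrow> unit_dir p) F"
  unfolding unit_dir_def by (intro tendsto_intros assms) (use assms in auto)

lemma tendsto_matrix_mult [tendsto_intros]:
  fixes A :: "'a \<Rightarrow> real^'n^'m" and B :: "'a \<Rightarrow> real^'k^'n"
  assumes "(A \<longlongrightarrow> A') F" "(B \<longlongrightarrow> B') F"
  shows "((\<lambda>x. A x ** B x) \<longlongrightarrow> A' ** B') F"
  unfolding matrix_matrix_mult_def
  by (intro tendsto_vec_lambda tendsto_intros tendsto_vec_nth assms)

lemma tendsto_matrix_vector_mult [tendsto_intros]: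
  fixes A :: "'a \<Rightarrow> real^'n^'m" and B :: "'a \<Rightarrow> real^'n"
  assumes "(A \<longlongrightarrow> A') F" "(B \<longlongrightarrow> B') F"
  shows "((\<lambda>x. A x *v B x) \<longlongrightarrow> A' *v B') F"
  unfolding matrix_vector_mult_def
  by (intro tendsto_vec_lambda tendsto_intros tendsto_vec_nth assms)

lemma tendsto_det_normal_jacobian:
  assumes s: "(s \<longlongrightarrow> s') F" and q: "(q \<longlongrightarrow> p) F" and Y: "(Y \<longlongrightarrow> X) F" and p: "p \<noteq> 0"
  shows "((\<lambda>x. det (normal_jacobian (s x) (q x) (Y x))) \<longlongrightarrow> det (normal_jacobian s' p X)) F"
proof (rule tendsto_det)
  have "((\<lambda>x. perp_proj (unit_dir (q x))) \<longlongrightarrow> perp_proj (unit_dir p)) F"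
    unfolding perp_proj_def
    by (intro tendsto_vec_lambda tendsto_intros tendsto_vec_nth tendsto_unit_dir q p)
  thus "((\<lambda>x. normal_jacobian (s x) (q x) (Y x)) \<longlongrightarrow> normal_jacobian s' p X) F"
    unfolding normal_jacobian_def by (intro tendsto_intros s q Y) (use p in auto)
qed

text \<open>The filter \<open>sequentially \<times>\<^sub>F nhds y\<close> expresses convergence
  jointly in index and point. Values converge at every y since the Hamiltonian sees a whole
  superlevel set; derivatives converge at x0 only.\<close>

locale c2_convergence =
  fixes \<psi> :: "nat \<Rightarrow> real^'n \<Rightarrow> real" and \<gamma> :: "nat \<Rightarrow> real^'n \<Rightarrow> real^'n" and \<Gamma> :: "nat \<Rightarrow> real^'n \<Rightarrow> real^'n^'n"
    and \<phi> :: "real^'n \<Rightarrow> real" and x0 p :: "real^'n" and X :: "real^'n^'n" and r0 :: real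
    and a :: "nat \<Rightarrow> real" and W :: "nat \<Rightarrow> (real^'n) set"
  assumes r0: "0 < r0" and p: "p \<noteq> 0"
    and psi_cont: "\<And>j. continuous_on UNIV (\<psi> j)"
    and psi_deriv: "\<And>j y. y \<in> ball x0 r0 \<Longrightarrow> (\<psi> j has_derivative (\<lambda>v. \<gamma> j y \<bullet> v)) (at y)"
    and gamma_deriv: "\<And>j y. y \<in> ball x0 r0 \<Longrightarrow> (\<gamma> j has_derivative (\<lambda>v. \<Gamma> j y *v v)) (at y)"
    and psi_lim: "\<And>y. ((\<lambda>z. \<psi> (fst z) (snd z)) \<longlongrightarrow> \<phi> y) (sequentially \<times>\<^sub>F nhds y)"
    and gamma_lim: "((\<lambda>z. \<gamma> (fst z) (snd z)) \<longlongrightarrow> p) (sequentially \<times>\<^sub>F nhds x0)"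
    and Gamma_lim: "((\<lambda>z. \<Gamma> (fst z) (snd z)) \<longlongrightarrow> X) (sequentially \<times>\<^sub>F nhds x0)"
    and W_lmeas: "\<And>j. W j \<in> lmeasurable"
    and W_below: "\<And>j y. y \<in> W j \<Longrightarrow> \<psi> j y < a j"
    and W_shrinks: "\<And>e. 0 < e \<Longrightarrow> \<forall>\<^sub>F j in sequentially. W j \<subseteq> ball x0 e"
begin

abbreviation "near \<equiv> sequentially \<times>\<^sub>F nhds x0"
abbreviation "normal j y \<equiv> unit_dir (\<gamma> j y)"
abbreviation "normal_deriv j y v \<equiv> (1 / norm (\<gamma> j y)) *\<^sub>R (perp_proj (normal j y) *v (\<Gamma> j y *v v))"
abbreviation "jac s z \<equiv> \<bar>det (normal_jacobian s (\<gamma> (fst z) (snd z)) (\<Gamma> (fst z) (snd z)))\<bar>"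

definition G :: "nat \<Rightarrow> (real^'n) set" where
  "G j = {x. a j \<le> \<psi> j x}"

definition lost :: "real \<Rightarrow> nat \<Rightarrow> (real^'n) set" where
  "lost s j = outer s (- G j) - outer s (- (G j \<union> W j))"

definition gained :: "real \<Rightarrow> nat \<Rightarrow> (real^'n) set" where
  "gained s j = outer s (G j \<union> W j) - outer s (G j)"

abbreviation lost_touches :: "real \<Rightarrow> nat \<Rightarrow> bool" where
  "lost_touches e j \<equiv> \<forall>s>0. \<forall>x\<in>lost s j. \<exists>y\<in>ball x0 e. \<psi> j y < a j \<and>
       x = y + s *\<^sub>R normal j y \<and> (\<forall>z\<in>cball x s. \<psi> j y \<le> \<psi> j z)"

lemma has_derivative_normal:
  assumes "y \<in> ball x0 r0" "\<gamma> j y \<noteq> 0"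
  shows "(normal j has_derivative normal_deriv j y) (at y)"
  by (rule has_derivative_unit_dir[OF gamma_deriv[OF assms(1)] assms(2)])

lemma gamma_nonzero: "\<forall>\<^sub>F z in near. \<gamma> (fst z) (snd z) \<noteq> 0"
  using tendsto_imp_eventually_ne[OF gamma_lim p] .

lemma W_closure_shrinks:
  assumes "0 < e"
  shows "\<forall>\<^sub>F j in sequentially. closure (W j) \<subseteq> ball x0 e"
proof -
  have "\<forall>\<^sub>F j in sequentially. W j \<subseteq> ball x0 (e / 2)" using W_shrinks assms by simp
  thus ?thesis
  proof eventually_elim
  case (elim j)
  have "closure (W j) \<subseteq> cball x0 (e / 2)" using elim by (intro closure_minimal) (auto intro: order_trans[OF _ ball_subset_cball])
  thus ?case using assms by (auto simp: subset_iff)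
  qed
qed

text \<open>Feet of lost balls lie in the closure of the shrinking W, so every property valid near
  x0 for large indices holds at all of them.\<close>

lemma lost_touching:
  assumes Q: "\<forall>\<^sub>F z in near. Q (fst z) (snd z)"
  obtains e where "0 < e" "e \<le> r0"
    "\<forall>\<^sub>F j in sequentially. \<forall>y\<in>ball x0 e. Q j y \<and> \<gamma> j y \<noteq> 0"
    "\<forall>\<^sub>F j in sequentially. lost_touches e j"
proof -
  obtain e1 where e1: "0 < e1" "\<forall>\<^sub>F j in sequentially. \<forall>y\<in>ball x0 e1. Q j y \<and> \<gamma> j y \<noteq> 0"
    using eventually_sequentially_nhdsD[OF eventually_conj[OF Q gamma_nonzero]] by blast
  define e where "e = min e1 r0"
  have e: "0 < e" "e \<le> r0" "e \<le> e1" using e1 r0 by (auto simp: e_def)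
  have ev: "\<forall>\<^sub>F j in sequentially. \<forall>y\<in>ball x0 e. Q j y \<and> \<gamma> j y \<noteq> 0"
    using e1(2) by eventually_elim (use e in auto)
  show thesis
  proof (rule that[OF e(1,2) ev])
    show "\<forall>\<^sub>F j in sequentially. lost_touches e j"
      using ev W_closure_shrinks[OF e(1)]
    proof eventually_elim
      case (elim j)
      show ?case
      proof (intro allI impI ballI)
        fix s x assume s: "0 < s" and x: "x \<in> lost s j"
        obtain y where "y \<in> ball x0 e" "\<psi> j y < a j" "x = y + s *\<^sub>R normal j y" "\<And>z. z \<in> cball x s \<Longrightarrow> \<psi> j y \<le> \<psi> j z"
        proof (rule touching_point[OF s psi_cont _ elim(2)])
          show "W j \<in> leb" using W_lmeas by blast
          show "(\<psi> j has_derivative (\<lambda>v. \<gamma> j y \<bullet> v)) (at y)" if "y \<in> ball x0 e" for y using psi_deriv that e by auto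
          show "\<gamma> j y \<noteq> 0" if "y \<in> ball x0 e" for y using elim(1) that by blast
          show "x \<in> outer s (- {x. a j \<le> \<psi> j x}) - outer s (- ({x. a j \<le> \<psi> j x} \<union> W j))"
            using x unfolding lost_def G_def .
        qed blast
        thus "\<exists>y\<in>ball x0 e. \<psi> j y < a j \<and>
           x = y + s *\<^sub>R normal j y \<and> (\<forall>z\<in>cball x s. \<psi> j y \<le> \<psi> j z)" by blast
      qed
    qed
  qed
qed

text \<open>S is a single scale when the limit at that scale is wanted and a compact interval when a
  uniform bound is wanted.\<close>

lemma lost_le_aux:
  assumes D: "\<forall>\<^sub>F z in near. \<forall>s\<in>S. jac s z \<le> D"
    and S: "S \<subseteq> {0<..}"
  shows "\<forall>\<^sub>F j in sequentially. \<forall>s\<in>S. vol (lost s j) \<le> ennreal D * vol (W j)"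
proof -
  obtain e where e: "0 < e" "e \<le> r0"
    "\<forall>\<^sub>F j in sequentially. \<forall>y\<in>ball x0 e. (\<forall>s\<in>S. \<bar>det (normal_jacobian s (\<gamma> j y) (\<Gamma> j y))\<bar> \<le> D) \<and> \<gamma> j y \<noteq> 0"
    "\<forall>\<^sub>F j in sequentially. lost_touches e j"
    using lost_touching[OF D] .
  from e(3,4) show ?thesis
  proof eventually_elim
    case (elim j)
    show ?case
    proof
      fix s assume s: "s \<in> S"
      hence s0: "0 < s" using S by auto
      show "vol (lost s j) \<le> ennreal D * vol (W j)"
        unfolding lost_def G_def
      proof (rule inner_variation_le[OF s0 open_ball psi_cont W_lmeas])
        fix y assume y: "y \<in> ball x0 e"
        hence nz: "\<gamma> j y \<noteq> 0" using elim(1) by blast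
        show "(normal j has_derivative normal_deriv j y) (at y)"
          by (rule has_derivative_normal[OF _ nz]) (use y e(2) in auto)
        show "norm (normal j y) = 1" by (rule norm_unit_dir[OF nz])
        show "\<bar>det (matrix (\<lambda>v. v + s *\<^sub>R (normal_deriv j y v)))\<bar> \<le> D"
          unfolding matrix_normal_jacobian using elim(1) y s by blast
      next
        fix x assume "x \<in> outer s (- {x. a j \<le> \<psi> j x}) - outer s (- ({x. a j \<le> \<psi> j x} \<union> W j))"
        hence "x \<in> lost s j" unfolding lost_def G_def .
        thus "\<exists>y\<in>ball x0 e. \<psi> j y < a j \<and> x = y + s *\<^sub>R normal j y" using elim(2) s0 by blast
      qed
    qed
  qed
qed

lemma lost_le:
  assumes s: "0 < s" and D: "\<bar>det (normal_jacobian s p X)\<bar> < D"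
  shows "\<forall>\<^sub>F j in sequentially. vol (lost s j) \<le> ennreal D * vol (W j)"
proof -
  have "\<forall>\<^sub>F z in near. jac s z < D"
    by (rule order_tendstoD(2)[OF tendsto_rabs[OF tendsto_det_normal_jacobian[OF tendsto_const gamma_lim Gamma_lim p]] D])
  hence "\<forall>\<^sub>F z in near. \<forall>s\<in>{s}. jac s z \<le> D"
    by eventually_elim auto
  from lost_le_aux[OF this] s show ?thesis by simp
qed

text \<open>Supplies the uniform lower bound for Fatou's lemma: the determinant is continuous on a
  compact set of scales, gradients near p and Hessians near X.\<close>

lemma lost_bounded:
  assumes "0 < s0"
  obtains C where "0 \<le> C" "\<forall>\<^sub>F j in sequentially. \<forall>s\<in>{s0..s1}. vol (lost s j) \<le> ennreal C * vol (W j)"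
proof -
  define K where "K = {s0..s1} \<times> cball p (norm p / 2) \<times> cball X 1"
  define d where "d z = det (normal_jacobian (fst z) (fst (snd z)) (snd (snd z)))" for z :: "real \<times> (real^'n) \<times> (real^'n^'n)"
  have "compact K" unfolding K_def by (intro compact_Times) auto
  moreover have "continuous_on K d"
    unfolding continuous_on_def
  proof
    fix z assume z: "z \<in> K"
    have "fst (snd z) \<noteq> 0"
    proof
      assume "fst (snd z) = 0"
      hence "dist p 0 \<le> norm p / 2" using z by (auto simp: K_def)
      thus False using p by simp
    qed
    thus "(d \<longlongrightarrow> d z) (at z within K)"
      unfolding d_def by (intro tendsto_det_normal_jacobian tendsto_fst tendsto_snd tendsto_ident_at)
  qed
  ultimately have "bounded (d ` K)" by (intro compact_imp_bounded compact_continuous_image)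
  then obtain C where C: "0 < C" "\<And>z. z \<in> K \<Longrightarrow> \<bar>d z\<bar> \<le> C" unfolding bounded_pos by auto
  have "\<forall>\<^sub>F z in near. dist (\<gamma> (fst z) (snd z)) p < norm p / 2"
    by (rule tendstoD[OF gamma_lim]) (use p in simp)
  moreover have "\<forall>\<^sub>F z in near. dist (\<Gamma> (fst z) (snd z)) X < 1"
    by (rule tendstoD[OF Gamma_lim]) simp
  ultimately have "\<forall>\<^sub>F z in near. \<forall>s\<in>{s0..s1}. jac s z \<le> C"
  proof eventually_elim
    case (elim z)
    show ?case
    proof
      fix s assume "s \<in> {s0..s1}"
      hence "(s, \<gamma> (fst z) (snd z), \<Gamma> (fst z) (snd z)) \<in> K"
        using elim by (auto simp: K_def dist_commute)
      from C(2)[OF this] show "jac s z \<le> C" by (simp add: d_def)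
    qed
  qed
  from lost_le_aux[OF this] have "\<forall>\<^sub>F j in sequentially. \<forall>s\<in>{s0..s1}. vol (lost s j) \<le> ennreal C * vol (W j)"
    using assms by (auto simp: subset_iff)
  thus thesis using C(1) by (intro that[of C]) auto
qed

lemma psi_lim_along:
  assumes "filterlim J at_top sequentially" "Y \<longlonglongrightarrow> y"
  shows "(\<lambda>n. \<psi> (J n) (Y n)) \<longlonglongrightarrow> \<phi> y"
  using filterlim_compose[OF psi_lim filterlim_Pair[OF assms]] by simp

text \<open>A point q of the interior ball strictly below the level of x0 remains below the level of
  nearby points y and inside their balls, against the minimality of touching points. So no loss
  occurs at scales where the interior ball does not fit.\<close>

lemma lost_empty:
  assumes s: "0 < s" and q: "q \<in> ball (x0 + s *\<^sub>R unit_dir p) s" "\<phi> q < \<phi> x0"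
  shows "\<forall>\<^sub>F j in sequentially. lost s j = {}"
proof -
  define Q where "Q j y \<longleftrightarrow> dist q (y + s *\<^sub>R normal j y) < s \<and> \<psi> j q < \<psi> j y" for j y
  have "\<forall>\<^sub>F z in near. Q (fst z) (snd z)"
    unfolding Q_def
  proof (rule eventually_conj)
    have "((\<lambda>z. snd z) \<longlongrightarrow> x0) near" by (rule filterlim_snd)
    hence "((\<lambda>z. dist q (snd z + s *\<^sub>R unit_dir (\<gamma> (fst z) (snd z)))) \<longlongrightarrow> dist q (x0 + s *\<^sub>R unit_dir p)) near"
      by (intro tendsto_intros tendsto_unit_dir gamma_lim p)
    thus "\<forall>\<^sub>F z in near. dist q (snd z + s *\<^sub>R unit_dir (\<gamma> (fst z) (snd z))) < s"
      by (rule order_tendstoD(2)) (use q in \<open>simp add: dist_commute\<close>)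
    obtain c where c: "\<phi> q < c" "c < \<phi> x0" using dense q(2) by blast
    have "(\<lambda>j. \<psi> j q) \<longlonglongrightarrow> \<phi> q" using psi_lim_along[OF filterlim_ident tendsto_const] .
    hence "\<forall>\<^sub>F j in sequentially. \<psi> j q < c" by (rule order_tendstoD(2)) (rule c)
    hence "\<forall>\<^sub>F z in near. \<psi> (fst z) q < c" by (rule eventually_compose_filterlim[OF _ filterlim_fst])
    moreover have "\<forall>\<^sub>F z in near. c < \<psi> (fst z) (snd z)" by (rule order_tendstoD(1)[OF psi_lim c(2)])
    ultimately show "\<forall>\<^sub>F z in near. \<psi> (fst z) q < \<psi> (fst z) (snd z)"
      by eventually_elim linarith
  qed
  from lost_touching[OF this] obtain e where e: "\<forall>\<^sub>F j in sequentially. \<forall>y\<in>ball x0 e. Q j y \<and> \<gamma> j y \<noteq> 0"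
    "\<forall>\<^sub>F j in sequentially. lost_touches e j" by blast
  from e show ?thesis
  proof eventually_elim
    case (elim j)
    show ?case
    proof (rule ccontr)
      assume "lost s j \<noteq> {}"
      then obtain x y where y: "y \<in> ball x0 e" "x = y + s *\<^sub>R normal j y" "\<forall>z\<in>cball x s. \<psi> j y \<le> \<psi> j z"
        using elim(2) s by blast
      have "Q j y" using elim(1) y by blast
      hence "q \<in> cball x s" "\<psi> j q < \<psi> j y" using y(2) by (auto simp: Q_def dist_commute)
      thus False using y(3) by force
    qed
  qed
qed

text \<open>The limit of a violating sequence either is a point of the smaller closed ball other than
  \<open>x0\<close>, or yields by Taylor's formula a tangential direction in which the curvature is at least
  \<open>norm p / s\<close>.\<close>

lemma balls_touch_from_below:
  assumes s: "0 < s" "s < s1" and below: "\<And>z. z \<in> ball (x0 - s1 *\<^sub>R unit_dir p) s1 \<Longrightarrow> \<phi> z < \<phi> x0"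
    and curv: "\<And>w. w \<bullet> p = 0 \<Longrightarrow> (X *v w) \<bullet> w \<le> norm p / s1 * (w \<bullet> w)"
  shows "\<forall>\<^sub>F z in near. \<forall>q\<in>ball (snd z - s *\<^sub>R unit_dir (\<gamma> (fst z) (snd z))) s.
    \<psi> (fst z) q < \<psi> (fst z) (snd z)"
proof (rule ccontr)
  assume "\<not> ?thesis"
  from not_eventually_sequentially_nhdsD[OF this] obtain J Y where JY: "filterlim J at_top sequentially" "Y \<longlonglongrightarrow> x0"
    "\<And>n. \<not> (\<forall>q\<in>ball (Y n - s *\<^sub>R unit_dir (\<gamma> (J n) (Y n))) s. \<psi> (J n) q < \<psi> (J n) (Y n))"
    by blast
  then obtain Z where Z: "\<And>n. Z n \<in> ball (Y n - s *\<^sub>R unit_dir (\<gamma> (J n) (Y n))) s" "\<And>n. \<psi> (J n) (Y n) \<le> \<psi> (J n) (Z n)"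
    by (metis not_less)
  define N where "N n = unit_dir (\<gamma> (J n) (Y n))" for n
  define n0 where "n0 = unit_dir p"
  have nn: "n0 \<bullet> n0 = 1" using norm_unit_dir[OF p] by (simp add: n0_def norm_eq_1)
  have glim: "(\<lambda>n. \<gamma> (J n) (Y n)) \<longlonglongrightarrow> p" using filterlim_compose[OF gamma_lim filterlim_Pair[OF JY(1,2)]] by simp
  hence Nlim: "N \<longlonglongrightarrow> n0" unfolding N_def n0_def by (rule tendsto_unit_dir[OF _ p])
  have nz: "\<forall>\<^sub>F n in sequentially. \<gamma> (J n) (Y n) \<noteq> 0" by (rule tendsto_imp_eventually_ne[OF glim p])
  have clim: "(\<lambda>n. Y n - s *\<^sub>R N n) \<longlonglongrightarrow> x0 - s *\<^sub>R n0" by (intro tendsto_intros JY Nlim)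
  have Zd: "dist (Y n - s *\<^sub>R N n) (Z n) < s" for n using Z(1)[of n] by (simp add: N_def)
  have "bounded (range Z)"
  proof -
    obtain B where B: "\<And>n. norm (Y n - s *\<^sub>R N n) \<le> B" using convergent_imp_bounded[OF clim] by (auto simp: bounded_iff)
    have "norm (Z n) \<le> B + s" for n
      using B[of n] Zd[of n] norm_triangle_sub[of "Z n" "Y n - s *\<^sub>R N n"] by (simp add: dist_norm norm_minus_commute)
    thus ?thesis by (auto simp: bounded_iff)
  qed
  then obtain zs k where k: "strict_mono k" "(Z \<circ> k) \<longlonglongrightarrow> zs" using bounded_imp_convergent_subsequence by blast
  have Jk: "filterlim (\<lambda>n. J (k n)) at_top sequentially" by (rule filterlim_compose[OF JY(1) filterlim_subseq[OF k(1)]])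
  have Yk: "(\<lambda>n. Y (k n)) \<longlonglongrightarrow> x0" using LIMSEQ_subseq_LIMSEQ[OF JY(2) k(1)] by (simp add: o_def)
  have Zk: "(\<lambda>n. Z (k n)) \<longlonglongrightarrow> zs" using k(2) by (simp add: o_def)
  have "\<phi> x0 \<le> \<phi> zs"
    by (rule LIMSEQ_le[OF psi_lim_along[OF Jk Yk] psi_lim_along[OF Jk Zk]]) (use Z(2) in auto)
  have "(\<lambda>n. dist (Y (k n) - s *\<^sub>R N (k n)) (Z (k n))) \<longlonglongrightarrow> dist (x0 - s *\<^sub>R n0) zs"
    using LIMSEQ_subseq_LIMSEQ[OF clim k(1)] by (intro tendsto_dist Zk) (simp add: o_def)
  hence zs_s: "dist (x0 - s *\<^sub>R n0) zs \<le> s" by (rule LIMSEQ_le_const2) (use Zd in \<open>auto intro: less_imp_le\<close>)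
  \<comment> \<open>Points of the smaller closed ball other than x0 lie in the larger open ball,
    where \<phi> is strictly below its value at x0.\<close>
  have zs: "zs = x0"
  proof (rule ccontr)
    assume ne: "zs \<noteq> x0"
    define d where "d = zs - x0"
    have d0: "0 < d \<bullet> d" using ne by (simp add: d_def)
    have e1: "(norm (d + t *\<^sub>R n0))\<^sup>2 = d \<bullet> d + 2 * t * (d \<bullet> n0) + t\<^sup>2" for t
      unfolding power2_norm_eq_inner using nn by (simp add: inner_add_left inner_add_right inner_commute power2_eq_square)
    have "norm (d + s *\<^sub>R n0) \<le> s" using zs_s by (simp add: d_def dist_norm norm_minus_commute algebra_simps)
    hence "(norm (d + s *\<^sub>R n0))\<^sup>2 \<le> s\<^sup>2" by (intro power_mono) auto
    hence dn: "d \<bullet> d + 2 * s * (d \<bullet> n0) \<le> 0" using e1[of s] by simp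
    hence "s * (d \<bullet> n0) < 0" using d0 by linarith
    hence "d \<bullet> n0 < 0" using s by (simp add: mult_less_0_iff)
    hence "(s1 - s) * (d \<bullet> n0) < 0" using s by (intro mult_pos_neg) auto
    hence "d \<bullet> d + 2 * s1 * (d \<bullet> n0) < 0" using dn by (simp add: algebra_simps)
    hence "(norm (d + s1 *\<^sub>R n0))\<^sup>2 < s1\<^sup>2" using e1[of s1] by simp
    hence "norm (d + s1 *\<^sub>R n0) < s1" using s by (meson less_imp_le order_less_trans power2_less_imp_less)
    hence "zs \<in> ball (x0 - s1 *\<^sub>R unit_dir p) s1"
      by (simp add: n0_def[symmetric] d_def dist_norm norm_minus_commute algebra_simps)
    thus False using below \<open>\<phi> x0 \<le> \<phi> zs\<close> by force
  qed
  define V where "V n = Z (k n) - Y (k n)" for n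
  have Vlim: "V \<longlonglongrightarrow> 0" unfolding V_def using tendsto_diff[OF Zk Yk] zs by simp
  have Vneg: "V n \<bullet> V n + 2 * s * (V n \<bullet> N (k n)) < 0" and Vnz: "V n \<noteq> 0" if nzn: "\<gamma> (J (k n)) (Y (k n)) \<noteq> 0" for n
  proof -
    have NN: "N (k n) \<bullet> N (k n) = 1" using norm_unit_dir[OF nzn] by (simp add: N_def norm_eq_1)
    have "norm (V n + s *\<^sub>R N (k n)) < s" using Zd[of "k n"] by (simp add: V_def dist_norm norm_minus_commute algebra_simps)
    hence "(norm (V n + s *\<^sub>R N (k n)))\<^sup>2 < s\<^sup>2" by (intro power_strict_mono) auto
    moreover have "(norm (V n + s *\<^sub>R N (k n)))\<^sup>2 = V n \<bullet> V n + 2 * s * (V n \<bullet> N (k n)) + s\<^sup>2"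
      unfolding power2_norm_eq_inner using NN by (simp add: inner_add_left inner_add_right inner_commute power2_eq_square)
    ultimately show "V n \<bullet> V n + 2 * s * (V n \<bullet> N (k n)) < 0" by simp
    thus "V n \<noteq> 0" by auto
  qed
  have nzk: "\<forall>\<^sub>F n in sequentially. \<gamma> (J (k n)) (Y (k n)) \<noteq> 0"
    using eventually_subseq[OF k(1) nz] by simp
  \<comment> \<open>Blow-up: unit directions from the base points to the violating points,
    convergent along a subsequence.\<close>
  define w where "w n = V n /\<^sub>R norm (V n)" for n
  have "norm (w n) \<le> 1" for n by (cases "V n = 0") (auto simp: w_def)
  hence "bounded (range w)" by (auto simp: bounded_iff intro!: exI[of _ 1])
  then obtain ws l where l: "strict_mono l" "(w \<circ> l) \<longlonglongrightarrow> ws" using bounded_imp_convergent_subsequence by blast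
  define j where "j n = J (k (l n))" for n
  define y where "y n = Y (k (l n))" for n
  define v where "v n = V (l n)" for n
  have jl: "filterlim j at_top sequentially" unfolding j_def by (rule filterlim_compose[OF Jk filterlim_subseq[OF l(1)]])
  have yl: "y \<longlonglongrightarrow> x0" unfolding y_def using LIMSEQ_subseq_LIMSEQ[OF Yk l(1)] by (simp add: o_def)
  have vl: "v \<longlonglongrightarrow> 0" unfolding v_def using LIMSEQ_subseq_LIMSEQ[OF Vlim l(1)] by (simp add: o_def)
  have wl: "(\<lambda>n. w (l n)) \<longlonglongrightarrow> ws" using l(2) by (simp add: o_def)
  have nzl: "\<forall>\<^sub>F n in sequentially. \<gamma> (j n) (y n) \<noteq> 0"
    using eventually_subseq[OF l(1) nzk] by (simp add: j_def y_def)
  have gl: "(\<lambda>n. \<gamma> (j n) (y n)) \<longlonglongrightarrow> p" using filterlim_compose[OF gamma_lim filterlim_Pair[OF jl yl]] by simp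
  have yv: "(\<lambda>n. y n + v n) \<longlonglongrightarrow> x0" using tendsto_add[OF yl vl] by simp
  have inb: "\<forall>\<^sub>F n in sequentially. y n \<in> ball x0 r0 \<and> y n + v n \<in> ball x0 r0"
    using topological_tendstoD[OF yl open_ball, of x0 r0] topological_tendstoD[OF yv open_ball, of x0 r0] r0
    by (simp add: eventually_conj_iff)
  have "\<forall>\<^sub>F n in sequentially. \<exists>t. 0 < t \<and> t < 1 \<and>
      - ((\<Gamma> (j n) (y n + t *\<^sub>R v n) *v w (l n)) \<bullet> w (l n)) * norm (v n) / 2 \<le> \<gamma> (j n) (y n) \<bullet> w (l n) \<and>
      \<gamma> (j n) (y n) \<bullet> w (l n) \<le> - norm (\<gamma> (j n) (y n)) * norm (v n) / (2 * s) \<and> v n \<noteq> 0"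
    using inb nzl
  proof eventually_elim
    case (elim n)
    have v0: "v n \<noteq> 0" using Vnz[of "l n"] elim by (simp add: v_def j_def y_def)
    have vw: "v n = norm (v n) *\<^sub>R w (l n)" using v0 by (simp add: w_def v_def)
    have neg: "v n \<bullet> v n + 2 * s * (v n \<bullet> unit_dir (\<gamma> (j n) (y n))) < 0"
      using Vneg[of "l n"] elim by (simp add: v_def j_def y_def N_def)
    obtain t where t: "0 < t" "t < 1"
      "\<psi> (j n) (y n + v n) = \<psi> (j n) (y n) + \<gamma> (j n) (y n) \<bullet> v n + (\<Gamma> (j n) (y n + t *\<^sub>R v n) *v v n) \<bullet> v n / 2"
    proof (rule second_order_taylor[OF convex_ball])
      show "y n \<in> ball x0 r0" "y n + v n \<in> ball x0 r0" using elim by blast+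
      show "(\<psi> (j n) has_derivative (\<lambda>v. \<gamma> (j n) z \<bullet> v)) (at z)" if "z \<in> ball x0 r0" for z using psi_deriv that .
      show "(\<gamma> (j n) has_derivative (\<lambda>v. \<Gamma> (j n) z *v v)) (at z)" if "z \<in> ball x0 r0" for z using gamma_deriv that .
    qed
    have "y n + v n = Z (k (l n))" by (simp add: y_def v_def V_def)
    hence "\<psi> (j n) (y n) \<le> \<psi> (j n) (y n + v n)" using Z(2)[of "k (l n)"] by (simp add: j_def y_def)
    hence ge: "0 \<le> \<gamma> (j n) (y n) \<bullet> v n + (\<Gamma> (j n) (y n + t *\<^sub>R v n) *v v n) \<bullet> v n / 2" using t(3) by linarith
    define g where "g = \<gamma> (j n) (y n)"
    define m where "m = norm (v n)"
    define c where "c = (\<Gamma> (j n) (y n + t *\<^sub>R v n) *v w (l n)) \<bullet> w (l n)"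
    have m: "0 < m" using v0 by (simp add: m_def)
    have e1: "g \<bullet> v n = m * (g \<bullet> w (l n))" unfolding m_def by (subst vw) simp
    have e2: "(\<Gamma> (j n) (y n + t *\<^sub>R v n) *v v n) \<bullet> v n = m * (m * c)"
    proof -
      have "(A *v (m *\<^sub>R w')) \<bullet> (m *\<^sub>R w') = m * (m * ((A *v w') \<bullet> w'))" for A :: "real^'n^'n" and w'
        by (simp add: matrix_vector_mult_scaleR)
      thus ?thesis unfolding c_def using vw by (metis m_def)
    qed
    have "0 \<le> m * (g \<bullet> w (l n) + m * c / 2)" using ge unfolding g_def[symmetric] e1 e2 by (simp add: algebra_simps)
    \<comment> \<open>Taylor's formula and the violated inequality bound the slope in direction w
      from below; membership of y + v in the ball bounds it from above by a negative multiple of |v|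
      in \<open>i2\<close>.\<close>
    hence i1: "- c * m / 2 \<le> g \<bullet> w (l n)" using m by (simp add: zero_le_mult_iff mult.commute)
    have g0: "0 < norm g" using elim by (simp add: g_def)
    have "norm g * (v n \<bullet> unit_dir g) = g \<bullet> v n" using g0 by (simp add: unit_dir_def inner_commute)
    moreover have "v n \<bullet> v n = m * m" by (simp add: m_def power2_norm_eq_inner[symmetric] power2_eq_square)
    ultimately have "norm g * (m * m + 2 * s * (v n \<bullet> unit_dir g)) = m * (norm g * m + 2 * s * (g \<bullet> w (l n)))"
      using e1 by (simp add: algebra_simps)
    moreover have "norm g * (m * m + 2 * s * (v n \<bullet> unit_dir g)) < 0"
      using neg g0 \<open>v n \<bullet> v n = m * m\<close> by (intro mult_pos_neg) (auto simp: g_def)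
    ultimately have "norm g * m + 2 * s * (g \<bullet> w (l n)) < 0" using m by (simp add: mult_less_0_iff)
    hence i2: "g \<bullet> w (l n) \<le> - norm g * m / (2 * s)" using s by (simp add: field_simps)
    show ?case using t(1,2) i1 i2 v0 by (intro exI[of _ t]) (auto simp: g_def m_def c_def)
  qed
  then obtain t where t: "\<forall>\<^sub>F n in sequentially. 0 < t n \<and> t n < 1 \<and>
      - ((\<Gamma> (j n) (y n + t n *\<^sub>R v n) *v w (l n)) \<bullet> w (l n)) * norm (v n) / 2 \<le> \<gamma> (j n) (y n) \<bullet> w (l n) \<and>
      \<gamma> (j n) (y n) \<bullet> w (l n) \<le> - norm (\<gamma> (j n) (y n)) * norm (v n) / (2 * s) \<and> v n \<noteq> 0"
    unfolding eventually_ex by blast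
  have "(\<lambda>n. t n *\<^sub>R v n) \<longlonglongrightarrow> 0"
  proof (rule Lim_null_comparison[OF _ tendsto_norm_zero[OF vl]])
    show "\<forall>\<^sub>F n in sequentially. norm (t n *\<^sub>R v n) \<le> norm (v n)"
      using t by eventually_elim (auto intro!: mult_left_le_one_le)
  qed
  hence "(\<lambda>n. y n + t n *\<^sub>R v n) \<longlonglongrightarrow> x0" using tendsto_add[OF yl] by fastforce
  hence Gl: "(\<lambda>n. \<Gamma> (j n) (y n + t n *\<^sub>R v n)) \<longlonglongrightarrow> X"
    using filterlim_compose[OF Gamma_lim filterlim_Pair[OF jl]] by force
  define c where "c n = (\<Gamma> (j n) (y n + t n *\<^sub>R v n) *v w (l n)) \<bullet> w (l n)" for n
  have cl: "c \<longlonglongrightarrow> (X *v ws) \<bullet> ws" unfolding c_def by (intro tendsto_intros Gl wl)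
  have gw: "(\<lambda>n. \<gamma> (j n) (y n) \<bullet> w (l n)) \<longlonglongrightarrow> p \<bullet> ws" by (intro tendsto_intros gl wl)
  have nv: "(\<lambda>n. norm (v n)) \<longlonglongrightarrow> 0" using tendsto_norm_zero[OF vl] .
  have "(\<lambda>n. - c n * norm (v n) / 2) \<longlonglongrightarrow> - ((X *v ws) \<bullet> ws) * 0 / 2" by (intro tendsto_intros cl nv) auto
  hence "- ((X *v ws) \<bullet> ws) * 0 / 2 \<le> p \<bullet> ws"
    by (rule tendsto_le[OF sequentially_bot gw]) (use t in eventually_elim, auto simp: c_def)
  moreover have "(\<lambda>n. - norm (\<gamma> (j n) (y n)) * norm (v n) / (2 * s)) \<longlonglongrightarrow> - norm p * 0 / (2 * s)"
    by (intro tendsto_intros gl nv) (use s in auto)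
  hence "p \<bullet> ws \<le> - norm p * 0 / (2 * s)"
    by (rule tendsto_le[OF sequentially_bot _ gw]) (use t in eventually_elim, auto)
  \<comment> \<open>Both bounds on the slope tend to 0, so the limit direction is tangential.
    Comparing the two bounds after division by |v| then yields curvature at least
    \<open>norm p / s\<close>, too much for the larger ball of radius s1.\<close>
  ultimately have perp: "ws \<bullet> p = 0" by (simp add: inner_commute)
  have "norm p / s \<le> (X *v ws) \<bullet> ws"
  proof (rule tendsto_le[OF sequentially_bot cl])
    show "(\<lambda>n. norm (\<gamma> (j n) (y n)) / s) \<longlonglongrightarrow> norm p / s" by (intro tendsto_intros gl) (use s in auto)
    show "\<forall>\<^sub>F n in sequentially. norm (\<gamma> (j n) (y n)) / s \<le> c n"
      using t
    proof eventually_elim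
      case (elim n)
      hence "- c n * norm (v n) / 2 \<le> - norm (\<gamma> (j n) (y n)) * norm (v n) / (2 * s)" "0 < norm (v n)" by (auto simp: c_def)
      hence "norm (v n) * (norm (\<gamma> (j n) (y n)) / s) \<le> norm (v n) * c n" using s by (simp add: field_simps)
      thus ?case using \<open>0 < norm (v n)\<close> by (simp only: mult_le_cancel_left_pos)
    qed
  qed
  moreover have "(X *v ws) \<bullet> ws \<le> norm p / s1 * 1"
  proof -
    have "(\<lambda>n. norm (w (l n))) \<longlonglongrightarrow> norm ws" by (intro tendsto_intros wl)
    moreover have "(\<lambda>n. norm (w (l n))) \<longlonglongrightarrow> 1"
    proof (rule tendsto_eventually)
      show "\<forall>\<^sub>F n in sequentially. norm (w (l n)) = 1"
        using t by eventually_elim (auto simp: w_def v_def)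
    qed
    ultimately have "norm ws = 1" by (rule LIMSEQ_unique)
    thus ?thesis using curv[OF perp] by (simp add: norm_eq_1)
  qed
  moreover have "norm p / s1 < norm p / s" using s p by (intro divide_strict_left_mono) auto
  ultimately show False by simp
qed

text \<open>The slack s < s1 makes touching stable under perturbation, and d strictly below the
  limit determinant leaves room for varying scale, index and point.\<close>

lemma gained_ge:
  assumes s: "0 < s" "s < s1" and below: "\<And>z. z \<in> ball (x0 - s1 *\<^sub>R unit_dir p) s1 \<Longrightarrow> \<phi> z < \<phi> x0"
    and curv: "\<And>w. w \<bullet> p = 0 \<Longrightarrow> (X *v w) \<bullet> w \<le> norm p / s1 * (w \<bullet> w)"
    and d: "d < \<bar>det (normal_jacobian (- s) p X)\<bar>"
  shows "\<forall>\<^sub>F j in sequentially. ennreal d * vol (W j) \<le> vol (gained s j)"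
proof -
  define D where "D = \<bar>det (normal_jacobian (- s) p X)\<bar> + 1"
  let ?A = "\<lambda>t z. jac (- t) z"
  have lim: "((\<lambda>w. ?A (fst w) (snd w)) \<longlongrightarrow> \<bar>det (normal_jacobian (- s) p X)\<bar>) (nhds s \<times>\<^sub>F near)"
    by (intro tendsto_rabs tendsto_det_normal_jacobian tendsto_minus filterlim_fst p
        filterlim_compose[OF gamma_lim filterlim_snd] filterlim_compose[OF Gamma_lim filterlim_snd])
  have "\<forall>\<^sub>F w in nhds s \<times>\<^sub>F near. d < ?A (fst w) (snd w) \<and> ?A (fst w) (snd w) < D"
    by (intro eventually_conj order_tendstoD[OF lim]) (use d in \<open>auto simp: D_def\<close>)
  then obtain P R where PR: "eventually P (nhds s)" "eventually R near"
    "\<And>t z. P t \<Longrightarrow> R z \<Longrightarrow> d < ?A t z \<and> ?A t z < D"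
    unfolding eventually_prod_filter[of _ "nhds s"] by auto
  obtain \<tau> where tau: "0 < \<tau>" "\<And>t. dist t s < \<tau> \<Longrightarrow> P t" using PR(1) unfolding eventually_nhds_metric by blast
  define Q where "Q j y \<longleftrightarrow> R (j, y) \<and> \<gamma> j y \<noteq> 0 \<and> (\<forall>q\<in>ball (y - s *\<^sub>R normal j y) s. \<psi> j q < \<psi> j y)" for j y
  have "\<forall>\<^sub>F z in near. Q (fst z) (snd z)"
  proof -
    have "\<forall>\<^sub>F z in near. \<forall>q\<in>ball (snd z - s *\<^sub>R unit_dir (\<gamma> (fst z) (snd z))) s.
        \<psi> (fst z) q < \<psi> (fst z) (snd z)"
      by (rule balls_touch_from_below[OF s below curv])
    with PR(2) gamma_nonzero show ?thesis by eventually_elim (simp add: Q_def)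
  qed
  from eventually_sequentially_nhdsD[OF this] obtain e1 where e1: "0 < e1" "\<forall>\<^sub>F j in sequentially. \<forall>y\<in>ball x0 e1. Q j y" .
  define e where "e = min e1 r0"
  have e: "0 < e" "e \<le> e1" "e \<le> r0" using e1 r0 by (auto simp: e_def)
  from e1(2) W_shrinks[OF e(1)] show ?thesis
  proof eventually_elim
    case (elim j)
    have Q: "Q j y" if "y \<in> ball x0 e" for y using elim(1) e that by auto
    show ?case unfolding gained_def G_def
    proof (rule outer_variation_ge[OF s(1) open_ball bounded_ball psi_cont W_lmeas elim(2) _ _ _ tau(1)])
      show "W j \<inter> {x. a j \<le> \<psi> j x} = {}" using W_below by force
    next
      fix y assume y: "y \<in> ball x0 e"
      hence nz: "\<gamma> j y \<noteq> 0" using Q by (auto simp: Q_def)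
      show "(normal j has_derivative normal_deriv j y) (at y)"
        by (rule has_derivative_normal[OF _ nz]) (use y e in auto)
      show "norm (normal j y) = 1" by (rule norm_unit_dir[OF nz])
      fix t assume t: "s - \<tau> < t" "t < s"
      hence "d < ?A t (j, y) \<and> ?A t (j, y) < D"
        using Q[OF y] by (intro PR(3) tau(2)) (auto simp: Q_def dist_real_def)
      thus "d \<le> \<bar>det (matrix (\<lambda>v. v - t *\<^sub>R (normal_deriv j y v)))\<bar>"
        "\<bar>det (matrix (\<lambda>v. v - t *\<^sub>R (normal_deriv j y v)))\<bar> \<le> D"
        unfolding matrix_normal_jacobian' by auto
    next
      fix y z assume "y \<in> ball x0 e" "z \<in> ball (y - s *\<^sub>R normal j y) s"
      thus "\<psi> j z < \<psi> j y" using Q by (auto simp: Q_def)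
    qed
  qed
qed

end

section \<open>The Hamiltonian as a density of first variations\<close>

lemma le_set_distance_iff: "ereal s \<le> set_distance x A \<longleftrightarrow> ball x s \<inter> A = {}"
  unfolding set_distance_def le_INF_iff by (force simp: disjoint_iff)

lemma det_normal_jacobian:
  assumes "p \<noteq> 0"
  shows "det (normal_jacobian s p X) = det (mat 1 + (s / norm p) *\<^sub>R (perp_proj (unit_dir p) ** X ** perp_proj (unit_dir p)))"
  unfolding normal_jacobian_def by (rule det_one_plus_proj_mult[OF norm_unit_dir[OF assms]])

lemma matrix_vector_mult_minus_left: "(- A) *v x = - ((A :: real^'n^'m) *v x)"
  by (simp add: vec_eq_iff matrix_vector_mult_def sum_negf)

text \<open>The bound \<open>curv\<close> says that s X / |p| is at most the identity on the tangent
  space, and N differs from the identity only there.\<close>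

lemma normal_form_psd:
  fixes X :: "real^'n^'n"
  assumes s: "0 < s" and p: "p \<noteq> 0" and X: "self_adjoint_matrix X"
    and curv: "\<And>v. v \<bullet> p = 0 \<Longrightarrow> (X *v v) \<bullet> v \<le> norm p / s * (v \<bullet> v)"
  defines "N \<equiv> mat 1 - (s / norm p) *\<^sub>R (perp_proj (unit_dir p) ** X ** perp_proj (unit_dir p))"
  shows "matrix_pos_part N = N" and "0 \<le> det N"
proof -
  let ?P = "perp_proj (unit_dir p)"
  have P: "(?P *v x) \<bullet> y = x \<bullet> (?P *v y)" for x y
    using perp_proj_self_adjoint[of "unit_dir p"] by (simp add: self_adjoint_matrix_def)
  have Nx: "N *v x = x - (s / norm p) *\<^sub>R (?P *v (X *v (?P *v x)))" for x
    by (simp add: N_def matrix_vector_mult_diff_rdistrib scaleR_matrix_vector_assoc[symmetric]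
        matrix_vector_mul_assoc[symmetric])
  have sa: "self_adjoint_matrix N"
    unfolding self_adjoint_matrix_def Nx
    using X P by (simp add: self_adjoint_matrix_def inner_diff_left inner_diff_right)
  have nn: "unit_dir p \<bullet> unit_dir p = 1" using norm_unit_dir[OF p] by (simp add: norm_eq_1)
  have pos: "0 \<le> x \<bullet> (N *v x)" for x
  proof -
    define y where "y = ?P *v x"
    have yp: "y \<bullet> p = 0"
    proof -
      have "y \<bullet> unit_dir p = 0" by (simp add: y_def perp_proj_vec inner_diff_left nn inner_commute[of x])
      thus ?thesis using p by (simp add: unit_dir_def)
    qed
    have "y \<bullet> y = x \<bullet> x - (unit_dir p \<bullet> x)\<^sup>2"
      using nn by (simp add: y_def perp_proj_vec inner_diff_left inner_diff_right inner_commute power2_eq_square algebra_simps)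
    hence "y \<bullet> y \<le> x \<bullet> x" by simp
    moreover have "(s / norm p) * ((X *v y) \<bullet> y) \<le> (s / norm p) * (norm p / s * (y \<bullet> y))"
      by (rule mult_left_mono[OF curv[OF yp]]) (use s in simp)
    moreover have "(s / norm p) * (norm p / s * (y \<bullet> y)) = y \<bullet> y" using s p by simp
    moreover have "x \<bullet> (?P *v (X *v y)) = (X *v y) \<bullet> y" using P[of x "X *v y"] by (simp add: y_def inner_commute)
    ultimately show ?thesis unfolding Nx by (simp add: y_def[symmetric] inner_diff_right)
  qed
  show "matrix_pos_part N = N" by (rule matrix_pos_part_psd[OF sa pos])
  show "0 \<le> det N" by (rule det_psd_nonneg[OF sa pos])
qed

text \<open>The integrand F of the Hamiltonian multiplied by 2 s / |p|, with positive parts removed: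
  the limit of the gained volume per volume of W minus that of the lost volume.\<close>

definition speed_density :: "real^'n \<Rightarrow> real^'n \<Rightarrow> real^'n^'n \<Rightarrow> (real^'n) set \<Rightarrow> real \<Rightarrow> real" where
  "speed_density x p X K s =
     (if ball (x - s *\<^sub>R unit_dir p) s \<inter> K = {} then det (normal_jacobian (- s) p X) else 0) -
     (if ball (x + s *\<^sub>R unit_dir p) s \<subseteq> K then det (normal_jacobian s p X) else 0)"

text \<open>The two curvature conditions are the second order necessary conditions for balls
  touching the level set from either side. They make the matrices in the Hamiltonian positive
  semidefinite.\<close>

locale touching_data =
  fixes x p :: "real^'n" and X :: "real^'n^'n" and K :: "(real^'n) set"
  assumes p: "p \<noteq> 0" and X: "self_adjoint_matrix X"
    and outer_curvature: "\<And>s v. 0 < s \<Longrightarrow> ball (x - s *\<^sub>R unit_dir p) s \<inter> K = {} \<Longrightarrow> v \<bullet> p = 0 \<Longrightarrow>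
      (X *v v) \<bullet> v \<le> norm p / s * (v \<bullet> v)"
    and inner_curvature: "\<And>s v. 0 < s \<Longrightarrow> ball (x + s *\<^sub>R unit_dir p) s \<subseteq> K \<Longrightarrow> v \<bullet> p = 0 \<Longrightarrow>
      - ((X *v v) \<bullet> v) \<le> norm p / s * (v \<bullet> v)"
begin

lemma outer_det:
  assumes "0 < s" "ball (x - s *\<^sub>R unit_dir p) s \<inter> K = {}"
  shows "det (matrix_pos_part (mat 1 - (s / norm p) *\<^sub>R (perp_proj (unit_dir p) ** X ** perp_proj (unit_dir p)))) =
      det (normal_jacobian (- s) p X)" and "0 \<le> det (normal_jacobian (- s) p X)"
  using normal_form_psd[OF assms(1) p X outer_curvature[OF assms]] by (simp_all add: det_normal_jacobian[OF p])

lemma inner_det: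
  assumes s: "0 < s" "ball (x + s *\<^sub>R unit_dir p) s \<subseteq> K"
  shows "det (matrix_pos_part (mat 1 + (s / norm p) *\<^sub>R (perp_proj (unit_dir p) ** X ** perp_proj (unit_dir p)))) =
      det (normal_jacobian s p X)" and "0 \<le> det (normal_jacobian s p X)"
proof -
  have m: "self_adjoint_matrix (- X)"
    using X by (simp add: self_adjoint_matrix_def matrix_vector_mult_minus_left)
  have "((- X) *v v) \<bullet> v \<le> norm p / s * (v \<bullet> v)" if "v \<bullet> p = 0" for v
    using inner_curvature[OF s that] by (simp add: matrix_vector_mult_minus_left)
  from normal_form_psd[OF s(1) p m this]
  show "det (matrix_pos_part (mat 1 + (s / norm p) *\<^sub>R (perp_proj (unit_dir p) ** X ** perp_proj (unit_dir p)))) =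
      det (normal_jacobian s p X)" "0 \<le> det (normal_jacobian s p X)"
    by (simp_all add: det_normal_jacobian[OF p] matrix_mult_uminus)
qed

lemma F_scale_eq_speed_density:
  assumes s: "0 < s"
  shows "2 * s * F_scale s x p X K = norm p * speed_density x p X K s"
proof -
  have "ball (x + s *\<^sub>R unit_dir p) s \<inter> - K = {} \<longleftrightarrow> ball (x + s *\<^sub>R unit_dir p) s \<subseteq> K" by blast
  thus ?thesis
    using s p outer_det(1)[OF s] inner_det(1)[OF s]
    by (simp add: F_scale_def F_plus_def F_minus_def le_set_distance_iff speed_density_def algebra_simps)
qed

lemma ball_in_ball:
  assumes "0 < s" "s \<le> t" "norm n = 1"
  shows "ball (x + s *\<^sub>R n) s \<subseteq> ball (x + t *\<^sub>R n) t"
proof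
  fix y assume "y \<in> ball (x + s *\<^sub>R n) s"
  moreover have "dist (x + t *\<^sub>R n) (x + s *\<^sub>R n) = t - s"
    using assms by (simp add: dist_norm scaleR_left_diff_distrib[symmetric])
  ultimately show "y \<in> ball (x + t *\<^sub>R n) t"
    using dist_triangle[of "x + t *\<^sub>R n" y "x + s *\<^sub>R n"] by simp
qed

lemma outer_scales_interval: "is_interval {s. 0 < s \<and> ball (x - s *\<^sub>R unit_dir p) s \<inter> K = {}}"
  and inner_scales_interval: "is_interval {s. 0 < s \<and> ball (x + s *\<^sub>R unit_dir p) s \<subseteq> K}"
proof -
  have o: "ball (x - s *\<^sub>R unit_dir p) s \<subseteq> ball (x - t *\<^sub>R unit_dir p) t"
    and i: "ball (x + s *\<^sub>R unit_dir p) s \<subseteq> ball (x + t *\<^sub>R unit_dir p) t" if "0 < s" "s \<le> t" for s t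
    using ball_in_ball[OF that, of "- unit_dir p"] ball_in_ball[OF that, of "unit_dir p"] norm_unit_dir[OF p] by simp_all
  show "is_interval {s. 0 < s \<and> ball (x - s *\<^sub>R unit_dir p) s \<inter> K = {}}"
  proof -
    have "ball (x - s *\<^sub>R unit_dir p) s \<inter> K = {}" if "0 < s" "s \<le> t" "ball (x - t *\<^sub>R unit_dir p) t \<inter> K = {}" for s t
      using o[OF that(1,2)] that(3) by blast
    thus ?thesis unfolding is_interval_1 by force
  qed
  show "is_interval {s. 0 < s \<and> ball (x + s *\<^sub>R unit_dir p) s \<subseteq> K}"
  proof -
    have "ball (x + s *\<^sub>R unit_dir p) s \<subseteq> K" if "0 < s" "s \<le> t" "ball (x + t *\<^sub>R unit_dir p) t \<subseteq> K" for s t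
      using i[OF that(1,2)] that(3) by (rule subset_trans)
    thus ?thesis unfolding is_interval_1 by force
  qed
qed

lemma continuous_det_normal_jacobian: "continuous_on UNIV (\<lambda>s. det (normal_jacobian s p X))"
  unfolding normal_jacobian_def by (intro continuous_on_det continuous_intros) (use p in auto)

text \<open>Balls through x with a common normal are nested, so the scales at which they fit form
  intervals; the density is a difference of continuous functions cut off to intervals.\<close>

lemma speed_density_borel: "(\<lambda>s. indicator {0<..} s * speed_density x p X K s) \<in> borel_measurable borel"
proof -
  have d: "(\<lambda>s. det (normal_jacobian s p X)) \<in> borel_measurable borel"
    by (rule borel_measurable_continuous_onI[OF continuous_det_normal_jacobian])
  have d': "(\<lambda>s. det (normal_jacobian (- s) p X)) \<in> borel_measurable borel"
    by (rule measurable_compose[OF borel_measurable_uminus[OF measurable_ident] d, simplified id_def])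
  have "(\<lambda>s. indicator {s. 0 < s \<and> ball (x - s *\<^sub>R unit_dir p) s \<inter> K = {}} s * det (normal_jacobian (- s) p X)
      - indicator {s. 0 < s \<and> ball (x + s *\<^sub>R unit_dir p) s \<subseteq> K} s * det (normal_jacobian s p X)) \<in> borel_measurable borel"
    by (intro borel_measurable_diff borel_measurable_times borel_measurable_indicator d d'
        real_interval_borel_measurable outer_scales_interval inner_scales_interval)
  also have "(\<lambda>s. indicator {s. 0 < s \<and> ball (x - s *\<^sub>R unit_dir p) s \<inter> K = {}} s * det (normal_jacobian (- s) p X)
      - indicator {s. 0 < s \<and> ball (x + s *\<^sub>R unit_dir p) s \<subseteq> K} s * det (normal_jacobian s p X)) =
      (\<lambda>s. indicator {0<..} s * speed_density x p X K s)"
    by (auto simp: fun_eq_iff speed_density_def indicator_def)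
  finally show ?thesis .
qed

lemma speed_density_bounded:
  obtains C where "0 \<le> C" "\<And>s. s \<in> {0..b} \<Longrightarrow> \<bar>speed_density x p X K s\<bar> \<le> C"
proof -
  have "compact ((\<lambda>s. det (normal_jacobian s p X)) ` {-b..b})"
    by (intro compact_continuous_image continuous_on_subset[OF continuous_det_normal_jacobian]) auto
  then obtain C where C: "0 < C" "\<And>s. s \<in> {-b..b} \<Longrightarrow> \<bar>det (normal_jacobian s p X)\<bar> \<le> C"
    using compact_imp_bounded bounded_pos by (metis (no_types, lifting) image_eqI real_norm_def)
  show thesis
  proof (rule that[of "C + C"])
    fix s assume "s \<in> {0..b}"
    hence "\<bar>det (normal_jacobian s p X)\<bar> \<le> C" "\<bar>det (normal_jacobian (- s) p X)\<bar> \<le> C" using C(2) by auto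
    thus "\<bar>speed_density x p X K s\<bar> \<le> C + C" using C(1) by (auto simp: speed_density_def)
  qed (use C in auto)
qed

end

context radial_profile
begin

lemma weight_integrable: "integrable lborel weight"
proof -
  have "integrable lborel (\<lambda>s. indicator {\<delta>..\<rho>} s *\<^sub>R L)"
    by (intro integrable_real_indicator integrable_scaleR_left) (use delta in auto)
  thus ?thesis
  proof (rule Bochner_Integration.integrable_bound)
    show "AE s in lborel. norm (weight s) \<le> norm (indicator {\<delta>..\<rho>} s *\<^sub>R L)"
      using weight_nonneg weight_le weight_eq_0 by (intro AE_I2) (auto simp: indicator_def abs_of_nonneg intro: order_trans[OF _ abs_ge_self])
  qed simp
qed

lemma hamiltonian_closed_eq:
  assumes "touching_data x p X K"
  shows "integrable lborel (\<lambda>s. weight s * speed_density x p X K s)"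
    and "hamiltonian_closed \<rho> f x p X K = norm p * (\<integral>s. weight s * speed_density x p X K s \<partial>lborel)"
proof -
  interpret t: touching_data x p X K by fact
  let ?A = "speed_density x p X K"
  have w0: "weight s = 0" if "s \<le> 0 \<or> \<rho> \<le> s" for s using that delta by (intro weight_eq_0) auto
  have meas: "(\<lambda>s. weight s * ?A s) \<in> borel_measurable borel"
  proof -
    have "(\<lambda>s. weight s * (indicator {0<..} s * ?A s)) \<in> borel_measurable borel"
      by (intro borel_measurable_times weight_measurable t.speed_density_borel)
    also have "(\<lambda>s. weight s * (indicator {0<..} s * ?A s)) = (\<lambda>s. weight s * ?A s)"
      using w0 by (auto simp: fun_eq_iff indicator_def)
    finally show ?thesis .
  qed
  obtain C where C: "0 \<le> C" "\<And>s. s \<in> {0..\<rho>} \<Longrightarrow> \<bar>?A s\<bar> \<le> C" by (rule t.speed_density_bounded[of \<rho>]) blast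
  show "integrable lborel (\<lambda>s. weight s * ?A s)"
  proof (rule Bochner_Integration.integrable_bound)
    show "integrable lborel (\<lambda>s. weight s * C)" using weight_integrable by simp
    show "AE s in lborel. norm (weight s * ?A s) \<le> norm (weight s * C)"
    proof (rule AE_I2)
      fix s
      show "norm (weight s * ?A s) \<le> norm (weight s * C)"
      proof (cases "0 < s \<and> s < \<rho>")
        case True
        hence "\<bar>?A s\<bar> \<le> C" using C(2) by simp
        thus ?thesis using C(1) by (simp add: abs_mult mult_left_mono)
      next
        case False
        thus ?thesis using w0[of s] by auto
      qed
    qed
  qed (use meas in simp)
  \<comment> \<open>\<open>deriv f\<close> is known only almost everywhere. Agreement with a Borel
    function off a null set makes the integrand Lebesgue measurable and fixes its integral.\<close>
  have ae: "AE s in lebesgue. norm p * (weight s * ?A s) =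
      indicator {0<..<\<rho>} s *\<^sub>R ((- 2 * s * deriv f s) * F_scale s x p X K)"
    using weight_AE
  proof eventually_elim
    case (elim s)
    show ?case
    proof (cases "0 < s \<and> s < \<rho>")
      case True
      have "(- 2 * s * deriv f s) * F_scale s x p X K = weight s * (2 * s * F_scale s x p X K)" using elim True by simp
      also have "\<dots> = weight s * (norm p * ?A s)" using t.F_scale_eq_speed_density True by simp
      finally show ?thesis using True by simp
    next
      case False
      thus ?thesis using w0[of s] by auto
    qed
  qed
  have m: "(\<lambda>s. norm p * (weight s * ?A s)) \<in> borel_measurable lborel" using meas by simp
  have ml: "(\<lambda>s. norm p * (weight s * ?A s)) \<in> borel_measurable lebesgue" by (rule measurable_completion[OF m])
  have "hamiltonian_closed \<rho> f x p X K = (\<integral>s. norm p * (weight s * ?A s) \<partial>lebesgue)"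
    unfolding hamiltonian_closed_def set_lebesgue_integral_def
    by (rule integral_cong_AE[OF borel_measurable_AE[OF ml ae] ml]) (use ae in \<open>auto elim: eventually_mono\<close>)
  also have "\<dots> = (\<integral>s. norm p * (weight s * ?A s) \<partial>lborel)" by (rule integral_completion[OF m])
  finally show "hamiltonian_closed \<rho> f x p X K = norm p * (\<integral>s. weight s * ?A s \<partial>lborel)" by simp
qed

end

section \<open>Passage to the limit in the first variation of the energy\<close>

locale variation_limit = radial_profile \<rho> \<delta> L f + c2_convergence \<psi> \<gamma> \<Gamma> \<phi> x0 p X r0 a W
  for \<rho> \<delta> L :: real and f and \<psi> :: "nat \<Rightarrow> real^'n \<Rightarrow> real" and \<gamma> :: "nat \<Rightarrow> real^'n \<Rightarrow> real^'n" and \<Gamma> \<phi> x0 p X r0 a W +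
  assumes level_bounded: "\<And>j. bounded {y. \<psi> j y < a j}"
    and W_pos: "\<And>j. 0 < rvol (W j)"
    and touching: "touching_data x0 p X {y. \<phi> x0 \<le> \<phi> y}"
begin

definition osc_variation :: "nat \<Rightarrow> real \<Rightarrow> real" where
  "osc_variation j s = (rvol (osc s (G j \<union> W j)) - rvol (osc s (G j))) / rvol (W j)"

abbreviation "A \<equiv> speed_density x0 p X {y. \<phi> x0 \<le> \<phi> y}"

interpretation t: touching_data x0 p X "{y. \<phi> x0 \<le> \<phi> y}" by (rule touching)

lemma G_sets: "G j \<in> leb" and GW_sets: "G j \<union> W j \<in> leb"
  and G_bounded: "bounded (- G j)" and GW_bounded: "bounded (- (G j \<union> W j))"
proof -
  have "closed (G j)" unfolding G_def by (intro closed_Collect_le continuous_on_const psi_cont)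
  thus "G j \<in> leb" by (simp add: borel_closed)
  moreover have "W j \<in> leb" using W_lmeas by blast
  ultimately show "G j \<union> W j \<in> leb" by (rule sets.Un)
  have "- G j = {y. \<psi> j y < a j}" by (auto simp: G_def)
  thus "bounded (- G j)" using level_bounded by simp
  thus "bounded (- (G j \<union> W j))" by (rule bounded_subset) auto
qed

lemma variation_measure:
  assumes "0 < s"
  shows "rvol (osc s (G j \<union> W j)) + rvol (lost s j) = rvol (osc s (G j)) + rvol (gained s j)"
    and "vol (lost s j) = ennreal (rvol (lost s j))"
    and "vol (gained s j) = ennreal (rvol (gained s j))"
proof -
  note sets = G_sets[of j] GW_sets[of j]
  note o = osc_lmeasurable[OF sets(1) disjI2[OF G_bounded], of s] osc_lmeasurable[OF sets(2) disjI2[OF GW_bounded], of s]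
  have W: "W j \<in> leb" using W_lmeas by blast
  note v = osc_Un_variation[OF sets(1) W, of s, folded lost_def gained_def]
  have "vol (lost s j) < \<infinity>"
  proof -
    have "lost s j \<subseteq> outer s (- G j)" by (auto simp: lost_def)
    moreover obtain R where "- G j \<subseteq> ball 0 R" using bounded_subset_ballD[OF G_bounded[of j], of 0] by blast
    hence "outer s (- G j) \<subseteq> ball 0 (R + s)"
    proof (intro subsetI)
      fix x assume "x \<in> outer s (- G j)"
      then obtain y where "y \<in> - G j" "dist x y < s" using outer_subset_neighborhood by blast
      thus "x \<in> ball 0 (R + s)" using \<open>- G j \<subseteq> ball 0 R\<close> dist_triangle[of 0 x y] by (auto simp: dist_commute)
    qed
    ultimately have "vol (lost s j) \<le> vol (ball (0::real^'n) (R + s))"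
      by (intro emeasure_mono) auto
    also have "\<dots> < \<infinity>" using lmeasurable_ball by (simp add: fmeasurable_def)
    finally show ?thesis .
  qed
  thus el: "vol (lost s j) = ennreal (rvol (lost s j))"
    by (simp add: emeasure_eq_ennreal_measure)
  have "vol (gained s j) \<le> vol (osc s (G j \<union> W j)) + vol (lost s j)"
    unfolding v by simp
  also have "\<dots> < \<infinity>" using el emeasure_eq_measure2[OF o(2)] by (simp del: emeasure_completion)
  finally show eg: "vol (gained s j) = ennreal (rvol (gained s j))"
    by (simp add: emeasure_eq_ennreal_measure)
  from v show "rvol (osc s (G j \<union> W j)) + rvol (lost s j) = rvol (osc s (G j)) + rvol (gained s j)"
    unfolding el eg emeasure_eq_measure2[OF o(1)] emeasure_eq_measure2[OF o(2)]
    by (simp add: ennreal_plus[symmetric] del: ennreal_plus)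
qed

lemma osc_variation_eq:
  assumes "0 < s"
  shows "osc_variation j s = (rvol (gained s j) - rvol (lost s j)) / rvol (W j)"
  using variation_measure(1)[OF assms, of j] by (simp add: osc_variation_def)

lemma W_emeasure: "vol (W j) = ennreal (rvol (W j))"
  by (rule emeasure_eq_measure2[OF W_lmeas])

lemma lost_measure_le:
  assumes "0 < s" "0 \<le> D" and le: "vol (lost s j) \<le> ennreal D * vol (W j)"
  shows "rvol (lost s j) \<le> D * rvol (W j)"
  using le assms(2) unfolding variation_measure(2)[OF assms(1)] W_emeasure by (simp add: ennreal_mult[symmetric])

lemma osc_variation_lower:
  obtains C where "0 \<le> C" "\<forall>\<^sub>F j in sequentially. \<forall>s\<in>{\<delta>..\<rho>}. - C \<le> osc_variation j s"
proof -
  obtain C where C: "0 \<le> C" "\<forall>\<^sub>F j in sequentially. \<forall>s\<in>{\<delta>..\<rho>}. vol (lost s j) \<le> ennreal C * vol (W j)"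
    using lost_bounded delta(1) by blast
  show thesis
  proof (rule that[OF C(1)])
    show "\<forall>\<^sub>F j in sequentially. \<forall>s\<in>{\<delta>..\<rho>}. - C \<le> osc_variation j s"
      using C(2)
    proof eventually_elim
      case (elim j)
      show ?case
      proof
        fix s assume s: "s \<in> {\<delta>..\<rho>}"
        hence s0: "0 < s" using delta by auto
        have "rvol (lost s j) \<le> C * rvol (W j)"
          by (rule lost_measure_le[OF s0 C(1)]) (use elim s in blast)
        hence "- C * rvol (W j) \<le> rvol (gained s j) - rvol (lost s j)"
          using measure_nonneg[of lebesgue "gained s j"] unfolding mult_minus_left by linarith
        thus "- C \<le> osc_variation j s" unfolding osc_variation_eq[OF s0] using W_pos by (simp add: le_divide_eq)
      qed
    qed
  qed
qed

text \<open>At any other scale at which the exterior ball fits, a larger ball fits too; this is the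
  slack that \<open>gained_ge\<close> asks for.\<close>

definition last_scale :: "real \<Rightarrow> bool" where
  "last_scale s \<longleftrightarrow> ball (x0 - s *\<^sub>R unit_dir p) s \<inter> {y. \<phi> x0 \<le> \<phi> y} = {} \<and>
     (\<forall>t>s. ball (x0 - t *\<^sub>R unit_dir p) t \<inter> {y. \<phi> x0 \<le> \<phi> y} \<noteq> {})"

lemma AE_not_last_scale: "AE s in lborel. \<not> last_scale s"
proof -
  have "s = t" if "last_scale s" "last_scale t" for s t using that unfolding last_scale_def by (metis linorder_neqE)
  hence "{s. last_scale s} = {} \<or> (\<exists>s. {s. last_scale s} = {s})" by blast
  hence "{s. last_scale s} \<in> null_sets lborel" by (auto intro: finite_imp_null_set_lborel)
  thus ?thesis by (rule AE_I') auto
qed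

text \<open>Gain and loss are estimated separately, each up to e / 3. Where the exterior ball does
  not fit, the gain is bounded below by 0; where the interior ball does not fit, nothing is lost
  eventually.\<close>

lemma osc_variation_liminf:
  assumes s: "0 < s" "\<not> last_scale s" and e: "0 < e"
  shows "\<forall>\<^sub>F j in sequentially. A s - e < osc_variation j s"
proof -
  define P where "P = (if ball (x0 - s *\<^sub>R unit_dir p) s \<inter> {y. \<phi> x0 \<le> \<phi> y} = {} then det (normal_jacobian (- s) p X) else 0)"
  define N where "N = (if ball (x0 + s *\<^sub>R unit_dir p) s \<subseteq> {y. \<phi> x0 \<le> \<phi> y} then det (normal_jacobian s p X) else 0)"
  have gain: "\<forall>\<^sub>F j in sequentially. (P - e / 3) * rvol (W j) \<le> rvol (gained s j)"
  proof (cases "ball (x0 - s *\<^sub>R unit_dir p) s \<inter> {y. \<phi> x0 \<le> \<phi> y} = {}")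
    case True
    then obtain t where t: "s < t" "ball (x0 - t *\<^sub>R unit_dir p) t \<inter> {y. \<phi> x0 \<le> \<phi> y} = {}"
      using s(2) unfolding last_scale_def by blast
    have "\<forall>\<^sub>F j in sequentially. ennreal (P - e / 3) * vol (W j) \<le> vol (gained s j)"
    proof (rule gained_ge[OF s(1) t(1)])
      show "\<phi> z < \<phi> x0" if "z \<in> ball (x0 - t *\<^sub>R unit_dir p) t" for z using t(2) that by force
      show "(X *v w) \<bullet> w \<le> norm p / t * (w \<bullet> w)" if "w \<bullet> p = 0" for w
        using t.outer_curvature[OF _ t(2) that] s t(1) by simp
      show "P - e / 3 < \<bar>det (normal_jacobian (- s) p X)\<bar>" using True e by (simp add: P_def)
    qed
    thus ?thesis
    proof eventually_elim
      case (elim j)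
      show ?case
      proof (cases "0 \<le> P - e / 3")
        case True
        thus ?thesis using elim unfolding variation_measure(3)[OF s(1)] W_emeasure by (simp add: ennreal_mult[symmetric])
      next
        case False
        hence "(P - e / 3) * rvol (W j) \<le> 0" by (intro mult_nonpos_nonneg) auto
        also have "0 \<le> rvol (gained s j)" by simp
        finally show ?thesis .
      qed
    qed
  next
    case False
    have "(P - e / 3) * rvol (W j) \<le> rvol (gained s j)" for j
    proof -
      have "(P - e / 3) * rvol (W j) \<le> 0" using False e by (intro mult_nonpos_nonneg) (auto simp: P_def)
      also have "0 \<le> rvol (gained s j)" by simp
      finally show ?thesis .
    qed
    thus ?thesis by simp
  qed
  have loss: "\<forall>\<^sub>F j in sequentially. rvol (lost s j) \<le> (N + e / 3) * rvol (W j)"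
  proof (cases "ball (x0 + s *\<^sub>R unit_dir p) s \<subseteq> {y. \<phi> x0 \<le> \<phi> y}")
    case True
    have N0: "0 \<le> N" using t.inner_det(2)[OF s(1) True] by (simp add: N_def)
    have "\<bar>det (normal_jacobian s p X)\<bar> < N + e / 3" using t.inner_det(2)[OF s(1) True] True e by (simp add: N_def)
    from lost_le[OF s(1) this] show ?thesis
      by eventually_elim (rule lost_measure_le[OF s(1)], use N0 e in auto)
  next
    case False
    then obtain q where "q \<in> ball (x0 + s *\<^sub>R unit_dir p) s" "\<phi> q < \<phi> x0" by force
    from lost_empty[OF s(1) this] show ?thesis
      by eventually_elim (use False e in \<open>simp add: N_def\<close>)
  qed
  from gain loss show ?thesis
  proof eventually_elim
    case (elim j)
    have "(P - e / 3 - (N + e / 3)) * rvol (W j) \<le> rvol (gained s j) - rvol (lost s j)"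
      using elim by (simp add: algebra_simps)
    hence "P - e / 3 - (N + e / 3) \<le> osc_variation j s"
      unfolding osc_variation_eq[OF s(1)] using W_pos by (simp add: le_divide_eq)
    thus ?case using e by (simp add: speed_density_def P_def N_def)
  qed
qed

lemma osc_variation_integral:
  assumes "enn2real (\<E> (G j \<union> W j)) + c * rvol (W j) \<le> enn2real (\<E> (G j))"
  shows "integrable lborel (\<lambda>s. weight s * osc_variation j s)" "(\<integral>s. weight s * osc_variation j s \<partial>lborel) \<le> - c"
proof -
  note I = energy_integral[OF GW_sets disjI2[OF GW_bounded], of j] energy_integral[OF G_sets disjI2[OF G_bounded], of j]
  have eq: "weight s * osc_variation j s = (weight s * rvol (osc s (G j \<union> W j)) - weight s * rvol (osc s (G j))) / rvol (W j)" for s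
    by (simp add: osc_variation_def right_diff_distrib)
  show "integrable lborel (\<lambda>s. weight s * osc_variation j s)"
    unfolding eq by (intro integrable_divide Bochner_Integration.integrable_diff I)
  have "(\<integral>s. weight s * osc_variation j s \<partial>lborel) = (enn2real (\<E> (G j \<union> W j)) - enn2real (\<E> (G j))) / rvol (W j)"
    unfolding eq using Bochner_Integration.integral_diff[OF I(1,3)] by (simp add: I(2,4))
  also have "\<dots> \<le> - c" using assms W_pos[of j] by (simp add: divide_le_eq)
  finally show "(\<integral>s. weight s * osc_variation j s \<partial>lborel) \<le> - c" .
qed

text \<open>Fatou's lemma, applied after adding a constant that makes the variations nonnegative on
  the support of the weight; the energy inequality bounds their integrals by - c.\<close>

lemma speed_density_integral_le:
  assumes ev: "\<forall>\<^sub>F j in sequentially. enn2real (\<E> (G j \<union> W j)) + c * rvol (W j) \<le> enn2real (\<E> (G j))"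
  shows "(\<integral>s. weight s * A s \<partial>lborel) \<le> - c"
proof -
  obtain C1 where C1: "0 \<le> C1" "\<forall>\<^sub>F j in sequentially. \<forall>s\<in>{\<delta>..\<rho>}. - C1 \<le> osc_variation j s"
    using osc_variation_lower .
  obtain C2 where C2: "0 \<le> C2" "\<And>s. s \<in> {0..\<rho>} \<Longrightarrow> \<bar>A s\<bar> \<le> C2" by (rule t.speed_density_bounded[of \<rho>]) blast
  \<comment> \<open>C1 bounds the variations from below, C2 the limit density, so both become
    nonnegative after adding C.\<close>
  define C where "C = C1 + C2"
  define B where "B = (\<integral>s. weight s * C \<partial>lborel) - c"
  have wC: "integrable lborel (\<lambda>s. weight s * C)" using weight_integrable by simp
  note wA = hamiltonian_closed_eq(1)[OF touching]
  have wAC: "integrable lborel (\<lambda>s. weight s * (A s + C))"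
    using Bochner_Integration.integrable_add[OF wA wC] by (simp add: distrib_left)
  have ev2: "\<forall>\<^sub>F j in sequentially. (\<forall>s. 0 \<le> weight s * (osc_variation j s + C)) \<and>
      integrable lborel (\<lambda>s. weight s * (osc_variation j s + C)) \<and> (\<integral>s. weight s * (osc_variation j s + C) \<partial>lborel) \<le> B"
    using C1(2) ev
  proof eventually_elim
    case (elim j)
    note I = osc_variation_integral[OF elim(2)]
    have "0 \<le> weight s * (osc_variation j s + C)" for s
    proof (cases "s \<in> {\<delta>..<\<rho>}")
      case True
      hence "- C1 \<le> osc_variation j s" using elim(1) by auto
      thus ?thesis using weight_nonneg[of s] C2(1) by (simp add: C_def)
    qed (simp add: weight_eq_0)
    moreover have "integrable lborel (\<lambda>s. weight s * (osc_variation j s + C))"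
      using Bochner_Integration.integrable_add[OF I(1) wC] by (simp add: distrib_left)
    moreover have "(\<integral>s. weight s * (osc_variation j s + C) \<partial>lborel) \<le> B"
      using Bochner_Integration.integral_add[OF I(1) wC] I(2) by (simp add: distrib_left B_def)
    ultimately show ?case by blast
  qed
  have B0: "0 \<le> B"
  proof -
    obtain j where j: "\<forall>s. 0 \<le> weight s * (osc_variation j s + C)" "(\<integral>s. weight s * (osc_variation j s + C) \<partial>lborel) \<le> B"
      using eventually_happens'[OF sequentially_bot ev2] by blast
    have "0 \<le> (\<integral>s. weight s * (osc_variation j s + C) \<partial>lborel)" by (rule integral_nonneg_AE) (use j(1) in auto)
    thus ?thesis using j(2) by (rule order_trans)
  qed
  define g where "g j s = ennreal (weight s * (osc_variation j s + C))" for j s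
  have gm: "g j \<in> borel_measurable lborel" for j
  proof -
    have "(\<lambda>s. rvol (osc s (G j \<union> W j))) \<in> borel_measurable borel"
      unfolding measure_def by (intro borel_measurable_enn2real emeasure_osc_measurable GW_sets)
    moreover have "(\<lambda>s. rvol (osc s (G j))) \<in> borel_measurable borel"
      unfolding measure_def by (intro borel_measurable_enn2real emeasure_osc_measurable G_sets)
    ultimately have "(\<lambda>s. weight s * (osc_variation j s + C)) \<in> borel_measurable borel"
      unfolding osc_variation_def by (intro borel_measurable_times borel_measurable_add borel_measurable_divide
          borel_measurable_diff weight_measurable borel_measurable_const)
    thus ?thesis unfolding g_def by simp
  qed
  have "(\<integral>\<^sup>+ s. ennreal (weight s * (A s + C)) \<partial>lborel) \<le> (\<integral>\<^sup>+ s. liminf (\<lambda>j. g j s) \<partial>lborel)"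
  proof (rule nn_integral_mono_AE)
    show "AE s in lborel. ennreal (weight s * (A s + C)) \<le> liminf (\<lambda>j. g j s)"
      using AE_not_last_scale
    proof eventually_elim
      case (elim s)
      show ?case
      proof (cases "s \<in> {\<delta>..<\<rho>}")
        case True
        hence s: "0 < s" using delta by auto
        show ?thesis
          unfolding le_Liminf_iff
        proof (intro allI impI)
          fix y assume y: "y < ennreal (weight s * (A s + C))"
          then obtain z where z: "y = ennreal z" "0 \<le> z" "z < weight s * (A s + C)"
            by (cases y) (auto simp: ennreal_less_iff)
          hence w: "0 < weight s" using weight_nonneg[of s] by (cases "weight s = 0") auto
          define e where "e = (weight s * (A s + C) - z) / weight s"
          have e: "0 < e" "weight s * e = weight s * (A s + C) - z" using z w by (auto simp: e_def)
          from osc_variation_liminf[OF s elim e(1)]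
          show "\<forall>\<^sub>F j in sequentially. y < g j s"
          proof eventually_elim
            case (elim j)
            have "weight s * (A s - e + C) < weight s * (osc_variation j s + C)" using elim w by simp
            hence "z < weight s * (osc_variation j s + C)" using e(2) by (simp add: algebra_simps)
            thus ?case using z by (simp add: g_def ennreal_less_iff)
          qed
        qed
      qed (simp add: weight_eq_0)
    qed
  qed
  also have "\<dots> \<le> liminf (\<lambda>j. \<integral>\<^sup>+ s. g j s \<partial>lborel)" by (rule nn_integral_liminf) (rule gm)
  also have "\<dots> \<le> ennreal B"
  proof (rule order_trans[OF Liminf_mono])
    show "\<forall>\<^sub>F j in sequentially. (\<integral>\<^sup>+ s. g j s \<partial>lborel) \<le> ennreal B"
      using ev2
    proof eventually_elim
      case (elim j)
      have "(\<integral>\<^sup>+ s. g j s \<partial>lborel) = ennreal (\<integral>s. weight s * (osc_variation j s + C) \<partial>lborel)"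
        unfolding g_def by (rule nn_integral_eq_integral) (use elim in auto)
      thus ?case using elim by (simp add: ennreal_leI)
    qed
  qed (simp add: Liminf_const)
  also have "(\<integral>\<^sup>+ s. ennreal (weight s * (A s + C)) \<partial>lborel) = ennreal (\<integral>s. weight s * (A s + C) \<partial>lborel)"
  proof (rule nn_integral_eq_integral[OF wAC], rule AE_I2)
    fix s
    show "0 \<le> weight s * (A s + C)"
    proof (cases "s \<in> {\<delta>..<\<rho>}")
      case True
      hence "\<bar>A s\<bar> \<le> C2" using C2 delta by auto
      thus ?thesis using weight_nonneg[of s] C1(1) by (intro mult_nonneg_nonneg) (auto simp: C_def)
    qed (simp add: weight_eq_0)
  qed
  finally have "(\<integral>s. weight s * (A s + C) \<partial>lborel) \<le> B" using B0 by simp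
  thus ?thesis
    using Bochner_Integration.integral_add[OF wA wC] by (simp add: distrib_left B_def)
qed

end

section \<open>Test functions with nonvanishing gradient\<close>

lemma linear_space_time:
  fixes B :: "(real^'n) \<times> real \<Rightarrow> real"
  assumes "linear B"
  shows "B (v, t) = (\<chi> i. B (axis i 1, 0)) \<bullet> v + B (0, 1) * t"
proof -
  interpret linear B by fact
  have "(v, t) = (\<Sum>i\<in>UNIV. v $ i *\<^sub>R (axis i 1, 0)) + t *\<^sub>R (0, 1)"
  proof (rule prod_eqI)
    show "fst (v, t) = fst ((\<Sum>i\<in>UNIV. v $ i *\<^sub>R (axis i 1, 0)) + t *\<^sub>R (0, 1))"
      using basis_expansion[of v] by (simp add: fst_sum scalar_mult_eq_scaleR)
  qed (simp add: snd_sum)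
  hence "B (v, t) = (\<Sum>i\<in>UNIV. v $ i * B (axis i 1, 0)) + t * B (0, 1)"
    by (simp only: add sum scale real_scaleR_def)
  thus ?thesis by (simp add: inner_vec_def mult.commute)
qed

lemma space_time_derivatives:
  fixes \<phi> :: "(real^'n) \<times> real \<Rightarrow> real"
  assumes U: "open U" "z \<in> U"
    and dphi: "\<And>w. w \<in> U \<Longrightarrow> (\<phi> has_derivative (\<lambda>v. g w \<bullet> fst v + d w * snd v)) (at w)"
    and dg: "((\<lambda>y. g (y, snd z)) has_derivative (\<lambda>v. H *v v)) (at (fst z))"
    and symm: "\<And>i j. H $ i $ j = H $ j $ i"
  shows "space_grad \<phi> z = g z" and "space_hessian \<phi> z = H" and "time_deriv \<phi> z = d z"
proof -
  have line: "((\<lambda>r. (fst w + r *\<^sub>R axis i 1, snd w)) has_derivative (\<lambda>r. (r *\<^sub>R axis i 1, 0))) (at 0)" for w :: "(real^'n) \<times> real" and i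
    by (auto intro!: derivative_eq_intros)
  have sg: "space_grad \<phi> w = g w" if w: "w \<in> U" for w
  proof -
    have "deriv (\<lambda>r. \<phi> (fst w + r *\<^sub>R axis i 1, snd w)) 0 = g w $ i" for i
    proof (rule DERIV_imp_deriv)
      have "(\<phi> has_derivative (\<lambda>v. g w \<bullet> fst v + d w * snd v)) (at (fst w + 0 *\<^sub>R axis i 1, snd w))"
        using dphi[OF w] by simp
      from has_derivative_compose[OF line this]
      show "((\<lambda>r. \<phi> (fst w + r *\<^sub>R axis i 1, snd w)) has_real_derivative g w $ i) (at 0)"
        unfolding has_field_derivative_def by (rule has_derivative_eq_rhs) (auto simp: fun_eq_iff inner_axis)
    qed
    thus ?thesis by (simp add: space_grad_def vec_eq_iff)
  qed
  show "space_grad \<phi> z = g z" by (rule sg[OF U(2)])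
    have "deriv (\<lambda>r. space_grad \<phi> (fst z + r *\<^sub>R axis i 1, snd z) $ j) 0 = H $ i $ j" for i j
    proof -
      have "((\<lambda>r::real. (fst z + r *\<^sub>R axis i 1, snd z)) \<longlongrightarrow> (fst z + 0 *\<^sub>R axis i 1, snd z)) (nhds 0)"
        by (intro tendsto_intros filterlim_ident)
      hence "\<forall>\<^sub>F r in nhds 0. (fst z + r *\<^sub>R axis i 1, snd z) \<in> U"
        by (rule topological_tendstoD) (use U in auto)
      hence "\<forall>\<^sub>F r in nhds 0. space_grad \<phi> (fst z + r *\<^sub>R axis i 1, snd z) $ j = g (fst z + r *\<^sub>R axis i 1, snd z) $ j"
        by eventually_elim (simp add: sg)
      hence "deriv (\<lambda>r. space_grad \<phi> (fst z + r *\<^sub>R axis i 1, snd z) $ j) 0 = deriv (\<lambda>r. g (fst z + r *\<^sub>R axis i 1, snd z) $ j) 0"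
        by (rule deriv_cong_ev) simp
      also have "\<dots> = H $ i $ j"
      proof (rule DERIV_imp_deriv)
        have "((\<lambda>r. fst z + r *\<^sub>R axis i 1) has_derivative (\<lambda>r. r *\<^sub>R axis i 1)) (at 0)" by (auto intro!: derivative_eq_intros)
        moreover have "((\<lambda>y. g (y, snd z)) has_derivative (\<lambda>v. H *v v)) (at (fst z + 0 *\<^sub>R axis i 1))"
          using dg by simp
        ultimately have "((\<lambda>r. g (fst z + r *\<^sub>R axis i 1, snd z)) has_derivative (\<lambda>r. H *v (r *\<^sub>R axis i 1))) (at 0)"
          by (rule has_derivative_compose)
        from bounded_linear.has_derivative[OF bounded_linear_vec_nth this, of j]
        show "((\<lambda>r. g (fst z + r *\<^sub>R axis i 1, snd z) $ j) has_real_derivative H $ i $ j) (at 0)"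
          unfolding has_field_derivative_def
          by (rule has_derivative_eq_rhs) (auto simp: fun_eq_iff matrix_vector_mult_scaleR matrix_vector_mult_basis column_def symm[of j i])
      qed
      finally show ?thesis .
    qed
    thus "space_hessian \<phi> z = H" by (simp add: space_hessian_def vec_eq_iff)
    have "((\<lambda>\<tau>. (fst z, \<tau>)) has_derivative (\<lambda>\<tau>. (0, \<tau>))) (at (snd z))"
      by (rule has_derivative_Pair[OF has_derivative_const has_derivative_ident])
    moreover have "(\<phi> has_derivative (\<lambda>v. g z \<bullet> fst v + d z * snd v)) (at (fst z, snd z))"
      using dphi[OF U(2)] by simp
    ultimately have "((\<lambda>\<tau>. \<phi> (fst z, \<tau>)) has_derivative (\<lambda>\<tau>. g z \<bullet> fst ((0::real^'n), \<tau>) + d z * snd ((0::real^'n), \<tau>))) (at (snd z))"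
      by (rule has_derivative_compose)
    hence "((\<lambda>\<tau>. \<phi> (fst z, \<tau>)) has_real_derivative d z) (at (snd z))"
      unfolding has_field_derivative_def by (rule has_derivative_eq_rhs) auto
    thus "time_deriv \<phi> z = d z" unfolding time_deriv_def by (rule DERIV_imp_deriv)
qed

text \<open>The Frechet derivatives of the definition, evaluated on coordinate vectors, give the
  coordinatewise derivatives; the Hessian is symmetric by
  \<open>symmetric_second_derivative\<close>.\<close>

lemma C2_near_space_time:
  fixes \<phi> :: "(real^'n) \<times> real \<Rightarrow> real"
  assumes "C2_near \<phi> z"
  obtains U g H d where "open U" "z \<in> U"
    "\<And>w. w \<in> U \<Longrightarrow> (\<phi> has_derivative (\<lambda>v. g w \<bullet> fst v + d w * snd v)) (at w)"
    "\<And>y t. (y, t) \<in> U \<Longrightarrow> ((\<lambda>y. g (y, t)) has_derivative (\<lambda>v. H (y, t) *v v)) (at y)"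
    "continuous_on U g" "continuous_on U d" "continuous_on U H" "self_adjoint_matrix (H z)"
    "space_grad \<phi> z = g z" "space_hessian \<phi> z = H z" "time_deriv \<phi> z = d z"
proof -
  obtain U and F :: "(real^'n) \<times> real \<Rightarrow> ((real^'n) \<times> real) \<Rightarrow>\<^sub>L real"
      and F2 :: "(real^'n) \<times> real \<Rightarrow> ((real^'n) \<times> real) \<Rightarrow>\<^sub>L ((real^'n) \<times> real) \<Rightarrow>\<^sub>L real"
    where U: "open U" "z \<in> U" and F: "\<And>w. w \<in> U \<Longrightarrow> (\<phi> has_derivative blinfun_apply (F w)) (at w)"
      and F2: "\<And>w. w \<in> U \<Longrightarrow> (F has_derivative blinfun_apply (F2 w)) (at w)" and cont: "continuous_on U F2"
    using assms unfolding C2_near_def by blast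
  define g where "g w = (\<chi> i. F w (axis i 1, 0))" for w
  define d where "d w = F w (0, 1)" for w
  define H where "H w = (\<chi> i j. F2 w (axis j 1, 0) (axis i 1, 0))" for w
  have Fw: "blinfun_apply (F w) = (\<lambda>v. g w \<bullet> fst v + d w * snd v)" for w
  proof
    fix v show "blinfun_apply (F w) v = g w \<bullet> fst v + d w * snd v"
      using linear_space_time[OF bounded_linear.linear[OF blinfun.bounded_linear_right], of "F w" "fst v" "snd v"]
      by (simp add: g_def d_def)
  qed
  have gd: "((\<lambda>y. g (y, t)) has_derivative (\<lambda>v. H (y, t) *v v)) (at y)" if "(y, t) \<in> U" for y t
  proof -
    have "((\<lambda>y. (y, t)) has_derivative (\<lambda>v. (v, 0))) (at y)"
      by (rule has_derivative_Pair[OF has_derivative_ident has_derivative_const])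
    from has_derivative_compose[OF this F2[OF that]]
    have Fy: "((\<lambda>y. F (y, t)) has_derivative (\<lambda>v. F2 (y, t) (v, 0))) (at y)" .
    have comp: "((\<lambda>y. g (y, t) $ i) has_derivative (\<lambda>v. (H (y, t) *v v) $ i)) (at y)" for i
    proof -
      have "((\<lambda>y. F (y, t) (axis i 1, 0)) has_derivative (\<lambda>v. F2 (y, t) (v, 0) (axis i 1, 0))) (at y)"
        by (rule bounded_linear.has_derivative[OF blinfun.bounded_linear_left Fy])
      moreover have "F2 (y, t) (v, 0) (axis i 1, 0) = (H (y, t) *v v) $ i" for v
      proof -
        have "linear (\<lambda>v. F2 (y, t) v (axis i 1, 0))"
          by (intro bounded_linear.linear bounded_linear_compose[OF blinfun.bounded_linear_left blinfun.bounded_linear_right])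
        from linear_space_time[OF this, of v 0] show ?thesis
          by (simp add: H_def matrix_vector_mult_def inner_vec_def)
      qed
      ultimately show ?thesis by (simp add: g_def)
    qed
    show ?thesis
    proof (rule has_derivative_componentwise_within[THEN iffD2], rule ballI)
      fix b :: "real^'n" assume "b \<in> Basis"
      then obtain i where "b = axis i 1" by (auto simp: Basis_vec_def)
      thus "((\<lambda>y. g (y, t) \<bullet> b) has_derivative (\<lambda>v. (H (y, t) *v v) \<bullet> b)) (at y)"
        using comp[of i] by (simp add: inner_axis)
    qed
  qed
  have contF: "continuous_on U F"
    by (intro continuous_at_imp_continuous_on ballI has_derivative_continuous[OF F2])
  have cg: "continuous_on U g" unfolding g_def by (intro continuous_intros contF)
  have cd: "continuous_on U d" unfolding d_def by (intro continuous_intros contF)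
  have cH: "continuous_on U H" unfolding H_def by (intro continuous_intros cont)
  have symm: "H z $ i $ j = H z $ j $ i" for i j
    using symmetric_second_derivative[OF U F F2[OF U(2)]] by (simp add: H_def)
  have dF: "(\<phi> has_derivative (\<lambda>v. g w \<bullet> fst v + d w * snd v)) (at w)" if "w \<in> U" for w
    using F[OF that] by (simp add: Fw)
  have dz: "((\<lambda>y. g (y, snd z)) has_derivative (\<lambda>v. H z *v v)) (at (fst z))"
    using gd[of "fst z" "snd z"] U by simp
  show thesis
    by (rule that[OF U dF gd cg cd cH self_adjoint_matrixI[OF symm] space_time_derivatives[OF U dF dz symm]])
qed

text \<open>With p = g(xh, th), the first order change over the step is p . v - d h \<le> (\<mu> |p|
  - d) h, which is negative. Applied to y in W it shows that y + v was not in E, that is, F has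
  moved with speed at least \<mu>.\<close>

lemma time_step_decrease:
  fixes \<phi> :: "(real^'n) \<times> real \<Rightarrow> real" and xh :: "real^'n" and th :: real
  assumes U: "open U" "(xh, th) \<in> U"
    and deriv: "\<And>w. w \<in> U \<Longrightarrow> (\<phi> has_derivative (\<lambda>v. g w \<bullet> fst v + d w * snd v)) (at w)"
    and cont: "continuous_on U g" "continuous_on U d"
    and speed: "\<mu> * norm (g (xh, th)) < d (xh, th)"
  obtains r \<theta> where "0 < r" "0 < \<theta>"
    "\<And>\<eta> y t h v. 0 \<le> \<eta> \<Longrightarrow> \<eta> \<le> r \<Longrightarrow> norm (y - xh) < r \<Longrightarrow> \<bar>t - th\<bar> < r \<Longrightarrow> 0 < h \<Longrightarrow> h < r \<Longrightarrow>
      norm v \<le> \<bar>\<mu>\<bar> * h \<Longrightarrow> g (xh, th) \<bullet> v \<le> \<mu> * norm (g (xh, th)) * h \<Longrightarrow>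
      \<phi> (y + v, t - h) + \<eta> * ((norm (y + v - xh))\<^sup>2 + (t - h - th)\<^sup>2) \<le>
      \<phi> (y, t) + \<eta> * ((norm (y - xh))\<^sup>2 + (t - th)\<^sup>2) - \<theta> * h"
proof -
  define z where "z = (xh, th)"
  define p where "p = g z"
  \<comment> \<open>Half of the gap, so the first order change is at most - 2 \<theta> h. Errors
    from continuity of the derivatives and the growth of the penalty use up \<theta> h / 2
    each.\<close>
  define \<theta> where "\<theta> = (d z - \<mu> * norm p) / 2"
  define e where "e = \<theta> / (2 * (\<bar>\<mu>\<bar> + 1))"
  have th: "0 < \<theta>" using speed by (simp add: \<theta>_def p_def z_def)
  have e: "0 < e" "2 * (\<bar>\<mu>\<bar> + 1) * e = \<theta>" using th by (auto simp: e_def)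
  have zU: "z \<in> U" using U by (simp add: z_def)
  have "\<forall>\<^sub>F w in nhds z. w \<in> U \<and> dist (g w) (g z) < e \<and> dist (d w) (d z) < e"
  proof (intro eventually_conj)
    show "\<forall>\<^sub>F w in nhds z. w \<in> U" by (rule eventually_nhds_in_open[OF U(1) zU])
    have "isCont g z" "isCont d z" using cont U(1) zU by (auto simp: continuous_on_eq_continuous_at)
    hence "(g \<longlongrightarrow> g z) (nhds z)" "(d \<longlongrightarrow> d z) (nhds z)" by (auto simp: isCont_def tendsto_at_iff_tendsto_nhds)
    thus "\<forall>\<^sub>F w in nhds z. dist (g w) (g z) < e" "\<forall>\<^sub>F w in nhds z. dist (d w) (d z) < e"
      using e(1) by (auto dest: tendstoD)
  qed
  then obtain R where R: "0 < R" "\<And>w. dist w z < R \<Longrightarrow> w \<in> U \<and> dist (g w) (g z) < e \<and> dist (d w) (d z) < e"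
    unfolding eventually_nhds_metric by blast
  \<comment> \<open>Growth of the squared distances in the penalty per unit of h: the product comes
    from space, the 3 from time.\<close>
  define k where "k = (2 + \<bar>\<mu>\<bar>) * \<bar>\<mu>\<bar> + 3"
  have k: "0 < k" by (simp add: k_def add_nonneg_pos)
  define r where "r = min 1 (min (R / (3 + \<bar>\<mu>\<bar>)) (\<theta> / (2 * k)))"
  have l3: "0 < 3 + \<bar>\<mu>\<bar>" by simp
  have r: "0 < r" "r \<le> 1" "(3 + \<bar>\<mu>\<bar>) * r \<le> R" "r * k \<le> \<theta> / 2"
  proof -
    show "0 < r" using R th k l3 by (simp add: r_def del: abs_ge_self)
    show "r \<le> 1" by (simp add: r_def)
    have "r \<le> R / (3 + \<bar>\<mu>\<bar>)" "r \<le> \<theta> / (2 * k)" by (simp_all add: r_def)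
    thus "(3 + \<bar>\<mu>\<bar>) * r \<le> R" "r * k \<le> \<theta> / 2" using k l3 by (auto simp: field_simps)
  qed
  show thesis
  proof (rule that[OF r(1) th])
    fix \<eta> h t :: real and y v :: "real^'n"
    assume a: "0 \<le> \<eta>" "\<eta> \<le> r" "norm (y - xh) < r" "\<bar>t - th\<bar> < r" "0 < h" "h < r"
      "norm v \<le> \<bar>\<mu>\<bar> * h" "g (xh, th) \<bullet> v \<le> \<mu> * norm (g (xh, th)) * h"
    define c where "c \<tau> = (y + \<tau> *\<^sub>R v, t - \<tau> * h)" for \<tau>
    have cR: "dist (c \<tau>) z < R" if "0 \<le> \<tau>" "\<tau> \<le> 1" for \<tau>
    proof -
      have "dist (c \<tau>) z \<le> dist (y + \<tau> *\<^sub>R v) xh + dist (t - \<tau> * h) th"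
        unfolding c_def z_def dist_Pair_Pair by (rule sqrt_sum_squares_le_sum) auto
      also have "dist (y + \<tau> *\<^sub>R v) xh \<le> norm (y - xh) + \<tau> * norm v"
        using norm_triangle_ineq[of "y - xh" "\<tau> *\<^sub>R v"] that by (simp add: dist_norm algebra_simps)
      also have "\<tau> * norm v \<le> 1 * (\<bar>\<mu>\<bar> * h)" using a that by (intro mult_mono) auto
      also have "dist (t - \<tau> * h) th \<le> \<bar>t - th\<bar> + h"
      proof -
        have "0 \<le> \<tau> * h" "\<tau> * h \<le> 1 * h" using that a by (auto intro!: mult_right_mono)
        thus ?thesis unfolding dist_real_def by linarith
      qed
      also have "norm (y - xh) + 1 * (\<bar>\<mu>\<bar> * h) + (\<bar>t - th\<bar> + h) < r + \<bar>\<mu>\<bar> * r + (r + r)"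
      proof -
        have "\<bar>\<mu>\<bar> * h \<le> \<bar>\<mu>\<bar> * r" using a by (intro mult_left_mono) auto
        thus ?thesis using a by linarith
      qed
      also have "\<dots> = (3 + \<bar>\<mu>\<bar>) * r" by (simp add: algebra_simps)
      finally show ?thesis using r(3) by simp
    qed
    have "((\<lambda>\<tau>. \<phi> (c \<tau>)) has_derivative (\<lambda>s. g (c \<tau>) \<bullet> (s *\<^sub>R v) + d (c \<tau>) * (- (s * h)))) (at \<tau>)" if "0 \<le> \<tau>" "\<tau> \<le> 1" for \<tau>
    proof -
      have "(c has_derivative (\<lambda>s. (s *\<^sub>R v, - (s * h)))) (at \<tau>)"
        unfolding c_def by (auto intro!: derivative_eq_intros)
      from has_derivative_compose[OF this deriv[of "c \<tau>"]] show ?thesis using R(2) cR[OF that] by simp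
    qed
    note der = this
    have "\<exists>\<tau>\<in>{0..1}. \<phi> (c 1) - \<phi> (c 0) = g (c \<tau>) \<bullet> ((1 - 0) *\<^sub>R v) + d (c \<tau>) * (- ((1 - 0) * h))"
    proof (rule mvt_very_simple)
      show "((\<lambda>\<tau>. \<phi> (c \<tau>)) has_derivative (\<lambda>s. g (c \<tau>) \<bullet> (s *\<^sub>R v) + d (c \<tau>) * (- (s * h)))) (at \<tau> within {0..1})"
        if "0 \<le> \<tau>" "\<tau> \<le> 1" for \<tau>
        by (rule has_derivative_at_withinI[OF der[OF that]])
    qed simp
    then obtain \<tau> where tau: "0 \<le> \<tau>" "\<tau> \<le> 1" "\<phi> (c 1) - \<phi> (c 0) = g (c \<tau>) \<bullet> v - d (c \<tau>) * h" by auto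
    have near: "norm (g (c \<tau>) - p) \<le> e" "\<bar>d (c \<tau>) - d z\<bar> \<le> e"
      using R(2)[OF cR[OF tau(1,2)]] by (auto simp: dist_norm p_def)
    have "g (c \<tau>) \<bullet> v - p \<bullet> v \<le> e * (\<bar>\<mu>\<bar> * h)"
    proof -
      have "(g (c \<tau>) - p) \<bullet> v \<le> norm (g (c \<tau>) - p) * norm v" by (rule norm_cauchy_schwarz)
      also have "\<dots> \<le> e * (\<bar>\<mu>\<bar> * h)" using near a e by (intro mult_mono) auto
      finally show ?thesis by (simp add: inner_diff_left)
    qed
    moreover have "d z * h - d (c \<tau>) * h \<le> e * h"
    proof -
      have "(d z - d (c \<tau>)) * h \<le> e * h" using near a by (intro mult_right_mono) auto
      thus ?thesis by (simp add: left_diff_distrib)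
    qed
    moreover have "p \<bullet> v - d z * h \<le> - 2 * \<theta> * h"
      using a(8) by (simp add: p_def z_def \<theta>_def algebra_simps)
    moreover have "e * (\<bar>\<mu>\<bar> * h) + e * h = \<theta> / 2 * h"
    proof -
      have "e * (\<bar>\<mu>\<bar> * h) + e * h = (2 * (\<bar>\<mu>\<bar> + 1) * e) / 2 * h" by (simp add: algebra_simps)
      thus ?thesis using e(2) by simp
    qed
    ultimately have i1: "\<phi> (c 1) - \<phi> (c 0) \<le> - 2 * \<theta> * h + \<theta> / 2 * h" using tau(3) by linarith
    have n1: "(norm (y + v - xh))\<^sup>2 \<le> (norm (y - xh))\<^sup>2 + (2 + \<bar>\<mu>\<bar>) * \<bar>\<mu>\<bar> * h"
    proof -
      have "norm (y + v - xh) \<le> norm (y - xh) + norm v" using norm_triangle_ineq[of "y - xh" v] by (simp add: algebra_simps)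
      hence "(norm (y + v - xh))\<^sup>2 \<le> (norm (y - xh) + norm v)\<^sup>2" by (intro power_mono) auto
      also have "\<dots> = (norm (y - xh))\<^sup>2 + (2 * norm (y - xh) + norm v) * norm v" by (simp add: power2_eq_square algebra_simps)
      also have "(2 * norm (y - xh) + norm v) * norm v \<le> (2 + \<bar>\<mu>\<bar>) * (\<bar>\<mu>\<bar> * h)"
      proof (intro mult_mono)
        have "\<bar>\<mu>\<bar> * h \<le> \<bar>\<mu>\<bar> * 1" using a r(2) by (intro mult_left_mono) auto
        thus "2 * norm (y - xh) + norm v \<le> 2 + \<bar>\<mu>\<bar>" using a r(2) by linarith
      qed (use a in auto)
      finally show ?thesis by (simp add: mult.assoc)
    qed
    have n2: "(t - h - th)\<^sup>2 \<le> (t - th)\<^sup>2 + 3 * h"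
    proof -
      have "(t - h - th)\<^sup>2 = (t - th)\<^sup>2 + h * (h - 2 * (t - th))" by (simp add: power2_eq_square algebra_simps)
      also have "h * (h - 2 * (t - th)) \<le> h * 3" using a r(2) by (intro mult_left_mono) auto
      finally show ?thesis by (simp add: mult.commute)
    qed
    have "\<eta> * ((norm (y + v - xh))\<^sup>2 + (t - h - th)\<^sup>2) \<le> \<eta> * ((norm (y - xh))\<^sup>2 + (t - th)\<^sup>2 + k * h)"
      using n1 n2 a(1) by (intro mult_left_mono) (auto simp: k_def algebra_simps)
    also have "\<dots> = \<eta> * ((norm (y - xh))\<^sup>2 + (t - th)\<^sup>2) + \<eta> * k * h" by (simp add: algebra_simps)
    also have "\<eta> * k * h \<le> \<theta> / 2 * h"
    proof -
      have "\<eta> * k \<le> r * k" using a k by (intro mult_right_mono) auto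
      thus ?thesis using r(4) a(5) by (intro mult_right_mono) auto
    qed
    finally have i2: "\<eta> * ((norm (y + v - xh))\<^sup>2 + (t - h - th)\<^sup>2) \<le> \<eta> * ((norm (y - xh))\<^sup>2 + (t - th)\<^sup>2) + \<theta> / 2 * h" by simp
    show "\<phi> (y + v, t - h) + \<eta> * ((norm (y + v - xh))\<^sup>2 + (t - h - th)\<^sup>2) \<le>
      \<phi> (y, t) + \<eta> * ((norm (y - xh))\<^sup>2 + (t - th)\<^sup>2) - \<theta> * h"
      using i1 i2 unfolding c_def by (simp add: algebra_simps)
  qed
qed

text \<open>Both conditions come from \<open>touching_ball_curvature\<close>, the second for -
  \<psi>, since a ball inside the superlevel set lies below the level for the negated
  function.\<close>

lemma touching_data_level_set:
  fixes \<psi> :: "real^'n \<Rightarrow> real" and g :: "real^'n \<Rightarrow> real^'n"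
  assumes r: "0 < r" and d1: "\<And>y. y \<in> ball x r \<Longrightarrow> (\<psi> has_derivative (\<lambda>v. g y \<bullet> v)) (at y)"
    and d2: "\<And>y. y \<in> ball x r \<Longrightarrow> (g has_derivative (\<lambda>v. H y *v v)) (at y)"
    and H: "isCont H x" "self_adjoint_matrix (H x)" and nz: "g x \<noteq> 0"
  shows "touching_data x (g x) (H x) {y. \<psi> x \<le> \<psi> y}"
proof
  fix s v assume s: "0 < s" and t: "ball (x - s *\<^sub>R unit_dir (g x)) s \<inter> {y. \<psi> x \<le> \<psi> y} = {}" and v: "v \<bullet> g x = 0"
  show "(H x *v v) \<bullet> v \<le> norm (g x) / s * (v \<bullet> v)"
    by (rule touching_ball_curvature[OF s r d1 d2 H(1) nz _ v]) (use t in force)+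
next
  fix s v assume s: "0 < s" and t: "ball (x + s *\<^sub>R unit_dir (g x)) s \<subseteq> {y. \<psi> x \<le> \<psi> y}" and v: "v \<bullet> g x = 0"
  have d1': "((\<lambda>y. - \<psi> y) has_derivative (\<lambda>v. - g y \<bullet> v)) (at y)" if "y \<in> ball x r" for y
    using has_derivative_minus[OF d1[OF that]] by simp
  have d2': "((\<lambda>y. - g y) has_derivative (\<lambda>v. - H y *v v)) (at y)" if "y \<in> ball x r" for y
    using has_derivative_minus[OF d2[OF that]] by (simp add: matrix_vector_mult_minus_left)
  have "(- H x *v v) \<bullet> v \<le> norm (- g x) / s * (v \<bullet> v)"
    by (rule touching_ball_curvature[where \<psi> = "\<lambda>y. - \<psi> y" and \<gamma> = "\<lambda>y. - g y" and \<Gamma> = "\<lambda>y. - H y", OF s r d1' d2' isCont_minus[OF H(1)]])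
      (use t nz v in \<open>auto simp: unit_dir_minus\<close>)
  thus "- ((H x *v v) \<bullet> v) \<le> norm (g x) / s * (v \<bullet> v)" by (simp add: matrix_vector_mult_minus_left)
qed (use nz H in auto)

context evolution_limit
begin

text \<open>For each \<mu> with \<mu> |p| below the time derivative, F has moved with speed at least
  \<mu> over W. The variation inequality then holds with constant \<mu>, and in the limit the
  density integral is at most - \<mu>. The claim follows as \<mu> tends to the time derivative
  divided by |p|.\<close>

lemma nondegenerate_subsolution:
  fixes \<phi> :: "(real^'n) \<times> real \<Rightarrow> real" and xh :: "real^'n" and th :: real
  assumes th: "0 < th" and phi: "continuous_on (UNIV \<times> {0<..}) \<phi>" and C2: "C2_near \<phi> (xh, th)"
    and max: "\<And>w. w \<in> UNIV \<times> {0<..} \<Longrightarrow> u w - \<phi> w \<le> u (xh, th) - \<phi> (xh, th)"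
    and nz: "space_grad \<phi> (xh, th) \<noteq> 0"
  shows "time_deriv \<phi> (xh, th) + hamiltonian_closed \<rho> f xh (space_grad \<phi> (xh, th)) (space_hessian \<phi> (xh, th))
    {y. \<phi> (xh, th) \<le> \<phi> (y, th)} \<le> 0"
proof -
  obtain U g H d where U: "open U" "(xh, th) \<in> U"
    and dphi: "\<And>w. w \<in> U \<Longrightarrow> (\<phi> has_derivative (\<lambda>v. g w \<bullet> fst v + d w * snd v)) (at w)"
    and dg: "\<And>y t. (y, t) \<in> U \<Longrightarrow> ((\<lambda>y. g (y, t)) has_derivative (\<lambda>v. H (y, t) *v v)) (at y)"
    and cont: "continuous_on U g" "continuous_on U d" "continuous_on U H"
    and Hs: "self_adjoint_matrix (H (xh, th))"
    and eqs: "space_grad \<phi> (xh, th) = g (xh, th)" "space_hessian \<phi> (xh, th) = H (xh, th)" "time_deriv \<phi> (xh, th) = d (xh, th)"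
    by (rule C2_near_space_time[OF C2], rule that)
  define p where "p = g (xh, th)"
  define X where "X = H (xh, th)"
  have p: "p \<noteq> 0" using nz by (simp add: eqs p_def)
  obtain r0 where r0: "0 < r0" "\<And>y t. y \<in> ball xh r0 \<Longrightarrow> \<bar>t - th\<bar> < r0 \<Longrightarrow> (y, t) \<in> U"
  proof -
    obtain A B where AB: "open A" "open B" "(xh, th) \<in> A \<times> B" "A \<times> B \<subseteq> U" using open_prod_elim[OF U] .
    obtain e1 e2 where e: "0 < e1" "ball xh e1 \<subseteq> A" "0 < e2" "ball th e2 \<subseteq> B"
      using AB openE by (metis mem_Sigma_iff)
    show thesis
      by (rule that[of "min e1 e2"]) (use e AB(4) in \<open>auto simp: subset_iff dist_real_def abs_minus_commute\<close>)
  qed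
  have slice: "((\<lambda>y. \<phi> (y, t)) has_derivative (\<lambda>v. g (y, t) \<bullet> v)) (at y)" if "(y, t) \<in> U" for y t
  proof -
    have "((\<lambda>y. (y, t)) has_derivative (\<lambda>v. (v, 0))) (at y)"
      by (rule has_derivative_Pair[OF has_derivative_ident has_derivative_const])
    from has_derivative_compose[OF this dphi[OF that]] show ?thesis by simp
  qed
  have Uc: "isCont g (xh, th)" "isCont H (xh, th)"
    using cont U by (auto simp: continuous_on_eq_continuous_at)
  define K where "K = {y. \<phi> (xh, th) \<le> \<phi> (y, th)}"
  have touch: "touching_data xh p X K"
    unfolding p_def X_def K_def
  proof (rule touching_data_level_set[OF r0(1)])
    show "((\<lambda>y. \<phi> (y, th)) has_derivative (\<lambda>v. g (y, th) \<bullet> v)) (at y)"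
      "((\<lambda>y. g (y, th)) has_derivative (\<lambda>v. H (y, th) *v v)) (at y)" if "y \<in> ball xh r0" for y
      using slice dg r0(2)[OF that, of th] r0(1) by auto
    show "isCont (\<lambda>y. H (y, th)) xh"
      by (rule isCont_o2[where g = H and f = "\<lambda>y. (y, th)"]) (use Uc in \<open>auto intro: continuous_intros\<close>)
    show "self_adjoint_matrix (H (xh, th))" by (rule Hs)
    show "g (xh, th) \<noteq> 0" using p by (simp add: p_def)
  qed
  let ?\<Psi> = "perturbed \<phi> xh th"
  \<comment> \<open>At most r0, where the derivatives exist, and tending to 0, so that W shrinks to
    xh and all parameters converge.\<close>
  define R where "R j = min r0 (1 / real (Suc j))" for j
  have R: "0 < R j" "R j \<le> r0" for j using r0 by (auto simp: R_def)
  have "\<exists>\<eta> t h' E F b \<epsilon>. near_max \<phi> xh th (R j) \<eta> t h' E F b \<epsilon>" for j by (rule near_max_exists[OF th phi max R(1)])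
  then obtain \<eta> t h' E F b \<epsilon> where "\<And>j. near_max \<phi> xh th (R j) (\<eta> j) (t j) (h' j) (E j) (F j) (b j) (\<epsilon> j)" by metis
  note Q = this[unfolded near_max_def]
  have Q1: "0 < \<eta> j" "\<eta> j < R j" "0 < t j - h' j" "\<bar>t j - th\<bar> < R j" "0 < h' j" "h' j < R j" "0 < \<epsilon> j" "\<epsilon> j < R j * h' j"
      "solves (h' j) (E j) (F j)" "E j \<subseteq> {y. b j \<le> ?\<Psi> (\<eta> j) y (t j - h' j)}"
      "F j \<inter> {y. ?\<Psi> (\<eta> j) y (t j) < b j + \<epsilon> j} \<subseteq> ball xh (R j)"
      "0 < vol (F j \<inter> {y. ?\<Psi> (\<eta> j) y (t j) < b j + \<epsilon> j})"
      "bounded {y. ?\<Psi> (\<eta> j) y (t j) < b j + \<epsilon> j}" "continuous_on UNIV (\<lambda>y. ?\<Psi> (\<eta> j) y (t j))" for j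
    using Q[of j] by blast+
  define \<psi> where "\<psi> j y = ?\<Psi> (\<eta> j) y (t j)" for j y
  define \<gamma> where "\<gamma> j y = g (y, t j) + (2 * \<eta> j) *\<^sub>R (y - xh)" for j y
  define \<Gamma> where "\<Gamma> j y = H (y, t j) + (2 * \<eta> j) *\<^sub>R mat 1" for j y
  define a where "a j = b j + \<epsilon> j" for j
  define W where "W j = F j \<inter> {y. \<psi> j y < a j}" for j
  have Rlim: "R \<longlonglongrightarrow> 0"
    by (rule real_tendsto_sandwich[OF _ _ tendsto_const LIMSEQ_Suc[OF lim_1_over_n]])
      (auto intro!: always_eventually less_imp_le r0(1) simp: R_def)
  have inv: "\<forall>\<^sub>F j in sequentially. R j < e" if "0 < e" for e :: real
    using order_tendstoD(2)[OF Rlim that] .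
  have eta0: "\<eta> \<longlonglongrightarrow> 0"
    by (rule real_tendsto_sandwich[OF _ _ tendsto_const Rlim]) (auto intro!: always_eventually less_imp_le Q1)
  have tlim: "t \<longlonglongrightarrow> th"
  proof (rule tendstoI)
    fix e :: real assume "0 < e"
    from inv[OF this] show "\<forall>\<^sub>F j in sequentially. dist (t j) th < e"
    proof eventually_elim
      case (elim j)
      thus ?case using Q1(4)[of j] unfolding dist_real_def by linarith
    qed
  qed
  have path: "((\<lambda>z. (snd z, t (fst z))) \<longlongrightarrow> (y, th)) (sequentially \<times>\<^sub>F nhds y)" for y :: "real^'n"
    by (intro tendsto_Pair filterlim_snd filterlim_compose[OF tlim filterlim_fst])
  have etaf: "((\<lambda>z. \<eta> (fst z)) \<longlongrightarrow> 0) (sequentially \<times>\<^sub>F nhds y)" for y :: "real^'n"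
    by (rule filterlim_compose[OF eta0 filterlim_fst])
  have Fs: "F j \<in> leb" for j using solvesD(2)[OF Q1(9)] .
  have lev_open: "open {y. \<psi> j y < a j}" for j
    unfolding \<psi>_def by (intro open_Collect_less Q1 continuous_on_const)
  have Ws: "W j \<in> leb" for j
    unfolding W_def using Fs open_sets_lebesgue[OF lev_open] by blast
  have Wl: "W j \<in> lmeasurable" for j
  proof (rule fmeasurableI2[OF lmeasurable_ball _ Ws])
    show "W j \<subseteq> ball xh (R j)" using Q1(11) by (simp add: W_def \<psi>_def a_def)
  qed
  interpret c: variation_limit \<rho> \<delta> L f \<psi> \<gamma> \<Gamma> "\<lambda>y. \<phi> (y, th)" xh p X r0 a W
  proof (intro variation_limit.intro variation_limit_axioms.intro c2_convergence.intro radial_profile_axioms)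
    show "0 < r0" "p \<noteq> 0" by (fact r0 p)+
    show "continuous_on UNIV (\<psi> j)" for j unfolding \<psi>_def by (rule Q1)
    show "W j \<in> lmeasurable" for j by (rule Wl)
    show "\<psi> j y < a j" if "y \<in> W j" for j y using that by (simp add: W_def)
    show "bounded {y. \<psi> j y < a j}" for j unfolding \<psi>_def a_def by (rule Q1)
    show "touching_data xh p X {y. \<phi> (xh, th) \<le> \<phi> (y, th)}" using touch unfolding K_def .
    show "0 < rvol (W j)" for j
      using Q1(12)[of j] emeasure_eq_measure2[OF Wl, of j] by (simp add: W_def \<psi>_def a_def del: emeasure_completion)
    show "\<forall>\<^sub>F j in sequentially. W j \<subseteq> ball xh e" if "0 < e" for e
      using inv[OF that]
    proof eventually_elim
      case (elim j)
      hence "ball xh (R j) \<subseteq> ball xh e" by auto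
      thus ?case using Q1(11)[of j] by (auto simp: W_def \<psi>_def a_def)
    qed
    show "(\<psi> j has_derivative (\<lambda>v. \<gamma> j y \<bullet> v)) (at y)" if "y \<in> ball xh r0" for j y
    proof -
      have "((\<lambda>y. y - xh) has_derivative (\<lambda>v. v)) (at y)" by (auto intro!: derivative_eq_intros)
      from has_derivative_inner[OF this this]
      have "((\<lambda>y. (y - xh) \<bullet> (y - xh) + (t j - th)\<^sup>2) has_derivative (\<lambda>v. (y - xh) \<bullet> v + v \<bullet> (y - xh) + 0)) (at y)"
        by (rule has_derivative_add[OF _ has_derivative_const])
      from has_derivative_add[OF slice[OF r0(2)[OF that less_le_trans[OF Q1(4) R(2), of j]]] has_derivative_mult_right[OF this, of "\<eta> j"]]
      show ?thesis
        unfolding \<psi>_def perturbed_def power2_norm_eq_inner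
        by (rule has_derivative_eq_rhs) (auto simp: fun_eq_iff \<gamma>_def inner_add_left inner_add_right inner_commute)
    qed
    show "(\<gamma> j has_derivative (\<lambda>v. \<Gamma> j y *v v)) (at y)" if "y \<in> ball xh r0" for j y
    proof -
      have "((\<lambda>y. (2 * \<eta> j) *\<^sub>R (y - xh)) has_derivative (\<lambda>v. (2 * \<eta> j) *\<^sub>R v)) (at y)"
        by (auto intro!: derivative_eq_intros)
      from has_derivative_add[OF dg[OF r0(2)[OF that less_le_trans[OF Q1(4) R(2), of j]]] this]
      show ?thesis
        unfolding \<gamma>_def
        by (rule has_derivative_eq_rhs)
          (auto simp: fun_eq_iff \<Gamma>_def matrix_vector_mult_add_rdistrib scaleR_matrix_vector_assoc[symmetric])
    qed
    show "((\<lambda>z. \<psi> (fst z) (snd z)) \<longlongrightarrow> \<phi> (y, th)) (sequentially \<times>\<^sub>F nhds y)" for y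
    proof -
      have "open (UNIV \<times> {0<..} :: ((real^'n) \<times> real) set)" by (intro open_Times) auto
      hence "isCont \<phi> (y, th)" using phi th by (simp add: continuous_on_eq_continuous_at)
      hence 1: "((\<lambda>z. \<phi> (snd z, t (fst z))) \<longlongrightarrow> \<phi> (y, th)) (sequentially \<times>\<^sub>F nhds y)"
        by (rule isCont_tendsto_compose[OF _ path])
      have "((\<lambda>z. \<phi> (snd z, t (fst z)) + \<eta> (fst z) * ((norm (snd z - xh))\<^sup>2 + (t (fst z) - th)\<^sup>2)) \<longlongrightarrow>
          \<phi> (y, th) + 0 * ((norm (y - xh))\<^sup>2 + (th - th)\<^sup>2)) (sequentially \<times>\<^sub>F nhds y)"
        by (intro tendsto_intros 1 etaf filterlim_snd filterlim_compose[OF tlim filterlim_fst])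
      thus ?thesis by (simp add: \<psi>_def perturbed_def)
    qed
    show "((\<lambda>z. \<gamma> (fst z) (snd z)) \<longlongrightarrow> p) (sequentially \<times>\<^sub>F nhds xh)"
    proof -
      have "((\<lambda>z. g (snd z, t (fst z)) + (2 * \<eta> (fst z)) *\<^sub>R (snd z - xh)) \<longlongrightarrow> g (xh, th) + (2 * 0) *\<^sub>R (xh - xh)) (sequentially \<times>\<^sub>F nhds xh)"
        by (intro tendsto_intros isCont_tendsto_compose[OF Uc(1) path] etaf filterlim_snd)
      thus ?thesis by (simp add: \<gamma>_def p_def)
    qed
    show "((\<lambda>z. \<Gamma> (fst z) (snd z)) \<longlongrightarrow> X) (sequentially \<times>\<^sub>F nhds xh)"
    proof -
      have "((\<lambda>z. H (snd z, t (fst z)) + (2 * \<eta> (fst z)) *\<^sub>R mat 1) \<longlongrightarrow> H (xh, th) + (2 * 0) *\<^sub>R mat 1) (sequentially \<times>\<^sub>F nhds xh)"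
        by (intro tendsto_intros isCont_tendsto_compose[OF Uc(2) path] etaf)
      thus ?thesis by (simp add: \<Gamma>_def X_def)
    qed
  qed
  define I where "I = (\<integral>s. weight s * speed_density xh p X K s \<partial>lborel)"
  have key: "I \<le> - \<mu>" if lam: "\<mu> * norm p < d (xh, th)" for \<mu>
    unfolding I_def K_def
  proof (rule c.speed_density_integral_le)
    obtain r \<theta> where r: "0 < r" "0 < \<theta>"
      and dec: "\<And>\<eta> y t h v. 0 \<le> \<eta> \<Longrightarrow> \<eta> \<le> r \<Longrightarrow> norm (y - xh) < r \<Longrightarrow> \<bar>t - th\<bar> < r \<Longrightarrow> 0 < h \<Longrightarrow> h < r \<Longrightarrow>
        norm v \<le> \<bar>\<mu>\<bar> * h \<Longrightarrow> p \<bullet> v \<le> \<mu> * norm p * h \<Longrightarrow>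
        \<phi> (y + v, t - h) + \<eta> * ((norm (y + v - xh))\<^sup>2 + (t - h - th)\<^sup>2) \<le>
        \<phi> (y, t) + \<eta> * ((norm (y - xh))\<^sup>2 + (t - th)\<^sup>2) - \<theta> * h"
      using time_step_decrease[OF U dphi cont(1,2) lam[unfolded p_def], folded p_def] by blast
    show "\<forall>\<^sub>F j in sequentially. enn2real (\<E> (c.G j \<union> W j)) + \<mu> * rvol (W j) \<le> enn2real (\<E> (c.G j))"
      using inv[OF r(1)] inv[OF r(2)]
    proof eventually_elim
      case (elim j)
      have FG: "F j - c.G j = W j" by (auto simp: W_def c.G_def)
      \<comment> \<open>Otherwise the decrease over the step would bring the perturbed test function
        at y + v below b, while E lies where it is at least b.\<close>
      have out: "y + v \<notin> E j" if y: "y \<in> W j" and v: "norm v \<le> \<bar>\<mu>\<bar> * h' j" "p \<bullet> v \<le> \<mu> * norm p * h' j" for y v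
      proof
        assume "y + v \<in> E j"
        hence "b j \<le> ?\<Psi> (\<eta> j) (y + v) (t j - h' j)" using Q1(10) by auto
        also have "\<dots> \<le> ?\<Psi> (\<eta> j) y (t j) - \<theta> * h' j"
          unfolding perturbed_def
        proof (rule dec[OF less_imp_le[OF Q1(1)] _ _ _ Q1(5) _ v])
          show "\<eta> j \<le> r" "\<bar>t j - th\<bar> < r" "h' j < r" using Q1(2,4,6)[of j] elim(1) by linarith+
          have "y \<in> ball xh (R j)" using y Q1(11)[of j] by (auto simp: W_def \<psi>_def a_def)
          hence "norm (y - xh) < R j" unfolding mem_ball dist_norm norm_minus_commute[of xh] .
          thus "norm (y - xh) < r" using elim(1) by linarith
        qed
        also have "\<dots> < b j + \<epsilon> j - \<theta> * h' j" using y by (simp add: W_def \<psi>_def a_def)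
        also have "\<epsilon> j < \<theta> * h' j"
        proof -
          have "R j * h' j \<le> \<theta> * h' j" using elim(2) Q1(5)[of j] by (intro mult_right_mono) auto
          thus ?thesis using Q1(8)[of j] by linarith
        qed
        finally show False by simp
      qed
      have pn: "p \<bullet> unit_dir p = norm p" using p by (simp add: unit_dir_def dot_square_norm power2_eq_square)
      have "enn2real (\<E> (c.G j \<union> (F j - c.G j))) + \<mu> * rvol (F j - c.G j) \<le> enn2real (\<E> (c.G j))"
      proof (rule solves_variation[OF Q1(5) Q1(9) c.G_sets c.G_bounded])
        fix y assume l0: "0 \<le> \<mu>" and "y \<in> F j - c.G j"
        hence y: "y \<in> W j" by (simp add: FG)
        have far: "y + v \<notin> E j" if "norm v \<le> \<mu> * h' j" for v
        proof (rule out[OF y])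
          show "norm v \<le> \<bar>\<mu>\<bar> * h' j" using that l0 by simp
          have "p \<bullet> v \<le> norm p * norm v" by (rule norm_cauchy_schwarz)
          also have "\<dots> \<le> norm p * (\<mu> * h' j)" using that by (intro mult_left_mono) auto
          finally show "p \<bullet> v \<le> \<mu> * norm p * h' j" by (simp add: mult_ac)
        qed
        have yE: "y \<notin> E j" using far[of 0] l0 Q1(5)[of j] by simp
        have ne: "E j \<noteq> {}" using solvesD(7)[OF Q1(9)[of j]] y by (auto simp: W_def)
        have "\<mu> * h' j \<le> infdist y (frontier (E j))"
        proof (cases "0 < \<mu> * h' j")
          case True
          have "ball y (\<mu> * h' j) \<inter> E j = {}"
          proof (intro equals0I)
            fix q assume "q \<in> ball y (\<mu> * h' j) \<inter> E j"
            hence "norm (q - y) \<le> \<mu> * h' j" "y + (q - y) \<in> E j" by (auto simp: dist_norm norm_minus_commute)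
            thus False using far by blast
          qed
          thus ?thesis by (rule infdist_frontier_ge[OF ne True])
        next
          case False
          thus ?thesis using infdist_nonneg[of y "frontier (E j)"] by linarith
        qed
        with yE show "y \<notin> E j \<and> \<mu> * h' j \<le> infdist y (frontier (E j))" by blast
      next
        fix y assume l0: "\<mu> < 0" and "y \<in> (F j - c.G j) \<inter> E j"
        hence y: "y \<in> W j" "y \<in> E j" by (simp_all add: FG)
        \<comment> \<open>For negative \<mu> the set may have retreated; a step of length |\<mu>| h
          against the gradient leaves E, so y is that close to its complement.\<close>
        have "y + (\<mu> * h' j) *\<^sub>R unit_dir p \<notin> E j"
          by (rule out[OF y(1)]) (use norm_unit_dir[OF p] pn Q1(5)[of j] in \<open>simp_all add: abs_mult mult_ac\<close>)
        hence q: "y + (\<mu> * h' j) *\<^sub>R unit_dir p \<in> - E j" by simp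
        have "infdist y (frontier (E j)) = infdist y (- E j)" by (rule infdist_frontier_mem[OF y(2)]) (use q in blast)
        also have "\<dots> \<le> dist y (y + (\<mu> * h' j) *\<^sub>R unit_dir p)" by (rule infdist_le[OF q])
        also have "\<dots> = - \<mu> * h' j"
          using norm_unit_dir[OF p] l0 Q1(5)[of j] by (simp add: dist_norm abs_mult abs_of_neg)
        finally show "infdist y (frontier (E j)) \<le> - \<mu> * h' j" .
      qed
      thus ?case unfolding FG .
    qed
  qed
  have np: "0 < norm p" using p by simp
  have "d (xh, th) / norm p \<le> - I"
  proof (rule dense_le)
    fix l assume "l < d (xh, th) / norm p"
    hence "l * norm p < d (xh, th)" using np by (simp add: pos_less_divide_eq)
    from key[OF this] show "l \<le> - I" by simp
  qed
  hence "d (xh, th) \<le> - I * norm p" using np by (simp add: pos_divide_le_eq)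
  moreover have "hamiltonian_closed \<rho> f xh p X K = norm p * I"
    unfolding I_def by (rule hamiltonian_closed_eq(2)[OF touch])
  ultimately show ?thesis
    unfolding eqs p_def[symmetric] X_def[symmetric] K_def[symmetric] by (simp add: mult.commute)
qed

end

section \<open>Sub- and supersolutions\<close>

lemma C2_near_uminus:
  fixes \<phi> :: "(real^'n) \<times> real \<Rightarrow> real"
  assumes C2: "C2_near \<phi> z"
  shows "C2_near (\<lambda>w. - \<phi> w) z" and "space_grad (\<lambda>w. - \<phi> w) z = - space_grad \<phi> z"
    and "space_hessian (\<lambda>w. - \<phi> w) z = - space_hessian \<phi> z" and "time_deriv (\<lambda>w. - \<phi> w) z = - time_deriv \<phi> z"
proof -
  obtain U and F :: "(real^'n) \<times> real \<Rightarrow> ((real^'n) \<times> real) \<Rightarrow>\<^sub>L real"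
      and F2 :: "(real^'n) \<times> real \<Rightarrow> ((real^'n) \<times> real) \<Rightarrow>\<^sub>L ((real^'n) \<times> real) \<Rightarrow>\<^sub>L real"
    where F: "open U" "z \<in> U" "\<forall>w\<in>U. (\<phi> has_derivative blinfun_apply (F w)) (at w)"
      "\<forall>w\<in>U. (F has_derivative blinfun_apply (F2 w)) (at w)" "continuous_on U F2"
    using C2 unfolding C2_near_def by blast
  have m: "blinfun_apply (- B) = (\<lambda>v. - blinfun_apply B v)" for B :: "'a::real_normed_vector \<Rightarrow>\<^sub>L 'b::real_normed_vector"
    by (simp add: fun_eq_iff blinfun.minus_left)
  show "C2_near (\<lambda>w. - \<phi> w) z"
    unfolding C2_near_def
  proof (intro exI conjI)
    show "\<forall>w\<in>U. ((\<lambda>w. - \<phi> w) has_derivative blinfun_apply (- F w)) (at w)"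
      "\<forall>w\<in>U. ((\<lambda>w. - F w) has_derivative blinfun_apply (- F2 w)) (at w)"
      unfolding m using F by (auto intro: has_derivative_minus)
    show "continuous_on U (\<lambda>w. - F2 w)" by (intro continuous_on_minus F)
  qed (use F in auto)
next
  show "space_grad (\<lambda>w. - \<phi> w) z = - space_grad \<phi> z"
    and "space_hessian (\<lambda>w. - \<phi> w) z = - space_hessian \<phi> z" and "time_deriv (\<lambda>w. - \<phi> w) z = - time_deriv \<phi> z"
  proof -
    obtain U g H d where U: "open U" "z \<in> U"
      "\<And>w. w \<in> U \<Longrightarrow> (\<phi> has_derivative (\<lambda>v. g w \<bullet> fst v + d w * snd v)) (at w)"
      "\<And>y t. (y, t) \<in> U \<Longrightarrow> ((\<lambda>y. g (y, t)) has_derivative (\<lambda>v. H (y, t) *v v)) (at y)"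
      "continuous_on U g" "continuous_on U d" "continuous_on U H" "self_adjoint_matrix (H z)"
      "space_grad \<phi> z = g z" "space_hessian \<phi> z = H z" "time_deriv \<phi> z = d z"
      by (rule C2_near_space_time[OF C2], rule that)
    have symm: "H z $ i $ j = H z $ j $ i" for i j
    proof -
      have "(H z *v axis j 1) \<bullet> axis i 1 = axis j 1 \<bullet> (H z *v axis i 1)"
        using U(8) by (simp add: self_adjoint_matrix_def)
      thus ?thesis by (simp add: inner_axis inner_axis' matrix_vector_mult_basis column_def)
    qed
    have d1: "((\<lambda>w. - \<phi> w) has_derivative (\<lambda>v. - g w \<bullet> fst v + (- d w) * snd v)) (at w)" if "w \<in> U" for w
      using has_derivative_minus[OF U(3)[OF that]] by (simp add: algebra_simps)
    have d2: "((\<lambda>y. - g (y, snd z)) has_derivative (\<lambda>v. - H z *v v)) (at (fst z))"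
      using has_derivative_minus[OF U(4)[of "fst z" "snd z"]] U(2) by (simp add: matrix_vector_mult_minus_left)
    have "(- H z) $ i $ j = (- H z) $ j $ i" for i j using symm[of i j] by simp
    from space_time_derivatives[where g = "\<lambda>w. - g w" and d = "\<lambda>w. - d w", OF U(1,2) d1 d2 this]
    show "space_grad (\<lambda>w. - \<phi> w) z = - space_grad \<phi> z" "space_hessian (\<lambda>w. - \<phi> w) z = - space_hessian \<phi> z"
      "time_deriv (\<lambda>w. - \<phi> w) z = - time_deriv \<phi> z" by (simp_all add: U(9-11))
  qed
qed

text \<open>The one-sided half of admissibility at critical points: the subsolution test uses it for
  \<phi>, the supersolution test for - \<phi>.\<close>

definition flat_above :: "(real \<Rightarrow> real) \<Rightarrow> ((real^'n) \<times> real \<Rightarrow> real) \<Rightarrow> (real^'n) \<times> real \<Rightarrow> bool" where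
  "flat_above c \<phi> z \<longleftrightarrow> (\<exists>g \<omega>. g \<in> radial_family c \<and> ((\<lambda>r. \<omega> r / r) \<longlongrightarrow> 0) (at_right 0) \<and>
     (\<forall>\<^sub>F w in nhds z. \<phi> w \<le> \<phi> z + time_deriv \<phi> z * (snd w - snd z) + g (norm (fst w - fst z)) + \<omega> \<bar>snd w - snd z\<bar>))"

lemma admissible_flat_above:
  assumes a: "admissible c \<phi> z" "space_grad \<phi> z = 0"
  shows "flat_above c \<phi> z" and "flat_above c (\<lambda>w. - \<phi> w) z"
proof -
  obtain g \<omega> where g: "g \<in> radial_family c" "((\<lambda>r. \<omega> r / r) \<longlongrightarrow> 0) (at_right 0)"
    "\<forall>\<^sub>F w in nhds z. \<bar>\<phi> w - \<phi> z - time_deriv \<phi> z * (snd w - snd z)\<bar> \<le> g (norm (fst w - fst z)) + \<omega> \<bar>snd w - snd z\<bar>"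
    using a by (auto simp: admissible_def)
  have n: "time_deriv (\<lambda>w. - \<phi> w) z = - time_deriv \<phi> z" by (rule C2_near_uminus(4)) (use a in \<open>simp add: admissible_def\<close>)
  show "flat_above c \<phi> z" "flat_above c (\<lambda>w. - \<phi> w) z"
    unfolding flat_above_def n
    by (rule exI[of _ g], rule exI[of _ \<omega>], intro conjI g(1,2) eventually_mono[OF g(3)], simp add: algebra_simps)+
qed

lemma hamiltonian_open:
  assumes "open A"
  shows "hamiltonian \<rho> f x p X A = - hamiltonian_closed \<rho> f x (- p) (- X) (- A)"
proof (cases "closed A")
  case True
  hence "A = {} \<or> A = UNIV" using assms clopen by blast
  thus ?thesis
    using True hamiltonian_closed_UNIV[of \<rho> f x p X] hamiltonian_closed_empty[of \<rho> f x p X]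
    by (auto simp: hamiltonian_def)
qed (simp add: hamiltonian_def)

lemma inf_principal_tendsto:
  assumes "continuous_on S u" "z \<in> S"
  shows "(u \<longlongrightarrow> u z) (inf (nhds z) (principal S))"
  unfolding tendsto_def eventually_inf_principal
proof (intro allI impI)
  fix T assume T: "open T" "u z \<in> T"
  have "(u \<longlongrightarrow> u z) (at z within S)" using assms by (simp add: continuous_on_def)
  hence "\<forall>\<^sub>F w in at z within S. u w \<in> T" using T by (rule topological_tendstoD)
  thus "\<forall>\<^sub>F w in nhds z. w \<in> S \<longrightarrow> u w \<in> T"
    unfolding eventually_at_filter by eventually_elim (use T in auto)
qed

lemma envelopes_continuous:
  assumes u: "continuous_on S u" "z \<in> S"
  shows "usc_envelope S u z = u z" and "lsc_envelope S u z = u z"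
proof -
  have nb: "inf (nhds z) (principal S) \<noteq> bot"
    unfolding trivial_limit_def eventually_inf_principal
    using eventually_nhds_x_imp_x[of "\<lambda>w. w \<in> S \<longrightarrow> False" z] u(2) by auto
  have "((\<lambda>w. ereal (u w)) \<longlongrightarrow> ereal (u z)) (inf (nhds z) (principal S))"
    by (intro tendsto_ereal inf_principal_tendsto u)
  from lim_imp_Limsup[OF nb this] lim_imp_Liminf[OF nb this]
  show "usc_envelope S u z = u z" "lsc_envelope S u z = u z"
    by (simp_all add: usc_envelope_def lsc_envelope_def)
qed

context radial_profile
begin

text \<open>Testing the bound with \<open>E = UNIV\<close> and \<open>X = mat 1\<close> bounds the normal speed of balls.\<close>

lemma ball_speed_le:
  assumes c: "hamiltonian_bound \<rho> f TYPE('n::finite) c" and R: "0 < R"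
  shows "ball_speed CARD('n) R \<le> ennreal (c R / R)"
proof -
  fix k :: 'n
  define p :: "real^'n" where "p = R *\<^sub>R axis k 1"
  have p: "p \<noteq> 0" "norm p = R" using R by (auto simp: p_def)
  have t: "touching_data 0 p (mat 1) (UNIV :: (real^'n) set)"
  proof
    show "self_adjoint_matrix (mat 1 :: real^'n^'n)" by (rule self_adjoint_matrixI) (auto simp: mat_def)
    show "((mat 1 :: real^'n^'n) *v v) \<bullet> v \<le> norm p / s * (v \<bullet> v)"
      if "0 < s" "ball (0 - s *\<^sub>R unit_dir p) s \<inter> (UNIV :: (real^'n) set) = {}" for s v
      using that by simp
    show "- (((mat 1 :: real^'n^'n) *v v) \<bullet> v) \<le> norm p / s * (v \<bullet> v)" if "0 < s" for s v
    proof -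
      have "0 \<le> norm p / s * (v \<bullet> v)" using that by simp
      hence "- (v \<bullet> v) \<le> norm p / s * (v \<bullet> v)" using inner_ge_zero[of v] by linarith
      thus ?thesis by simp
    qed
  qed (rule p)
  have eq: "weight s * speed_density 0 p (mat 1) (UNIV :: (real^'n) set) s = - (weight s * (1 + s / R) ^ (CARD('n) - 1))" for s
  proof (cases "0 < s")
    case True
    thus ?thesis
      using det_one_plus_perp_proj[OF norm_unit_dir[OF p(1)], of "s / R"] p(2)
      by (simp add: speed_density_def normal_jacobian_def)
  next
    case False
    thus ?thesis using delta by (simp add: weight_eq_0)
  qed
  note H = hamiltonian_closed_eq[OF t, unfolded eq]
  have int: "integrable lborel (\<lambda>s. weight s * (1 + s / R) ^ (CARD('n) - 1))" using H(1) by simp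
  have "- c R \<le> hamiltonian \<rho> f 0 p (mat 1) UNIV"
    using c p unfolding hamiltonian_bound_def by fastforce
  hence "R * (\<integral>s. weight s * (1 + s / R) ^ (CARD('n) - 1) \<partial>lborel) \<le> c R"
    using H(2) p(2) by (simp add: hamiltonian_def)
  hence le: "(\<integral>s. weight s * (1 + s / R) ^ (CARD('n) - 1) \<partial>lborel) \<le> c R / R"
    using R by (simp add: pos_le_divide_eq mult.commute)
  have nn: "0 \<le> weight s * (1 + s / R) ^ (CARD('n) - 1)" for s
    using weight_nonneg[of s] weight_eq_0[of s] delta R by (cases "0 < s") auto
  have "ball_speed CARD('n) R = (\<integral>\<^sup>+ s. ennreal (weight s * (1 + s / R) ^ (CARD('n) - 1)) \<partial>lborel)"
    unfolding ball_speed_def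
  proof (rule nn_integral_cong)
    fix s
    show "ennreal (weight s) * ennreal ((1 + s / R) ^ (CARD('n) - 1)) = ennreal (weight s * (1 + s / R) ^ (CARD('n) - 1))"
      using weight_eq_0[of s] weight_nonneg[of s] delta R by (cases "0 < s") (auto simp: ennreal_mult)
  qed
  also have "\<dots> = ennreal (\<integral>s. weight s * (1 + s / R) ^ (CARD('n) - 1) \<partial>lborel)"
    by (rule nn_integral_eq_integral[OF int]) (use nn in auto)
  also have "\<dots> \<le> ennreal (c R / R)" by (rule ennreal_leI[OF le])
  finally show ?thesis .
qed

end

context evolution_limit
begin

lemma subsolution_test:
  assumes c: "hamiltonian_bound \<rho> f TYPE('n) c" and t: "0 < t" and phi: "continuous_on (UNIV \<times> {0<..}) \<phi>" "C2_near \<phi> (x, t)"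
    and adm: "space_grad \<phi> (x, t) = 0 \<Longrightarrow> flat_above c \<phi> (x, t)"
    and max: "\<And>w. w \<in> UNIV \<times> {0<..} \<Longrightarrow> u w - \<phi> w \<le> u (x, t) - \<phi> (x, t)"
  shows "if space_grad \<phi> (x, t) \<noteq> 0
    then time_deriv \<phi> (x, t) + hamiltonian_closed \<rho> f x (space_grad \<phi> (x, t)) (space_hessian \<phi> (x, t)) {y. \<phi> (x, t) \<le> \<phi> (y, t)} \<le> 0
    else time_deriv \<phi> (x, t) \<le> 0"
proof (cases "space_grad \<phi> (x, t) = 0")
  case True
  then obtain g \<omega> where g: "g \<in> radial_family c" "((\<lambda>r. \<omega> r / r) \<longlongrightarrow> 0) (at_right 0)"
    "\<forall>\<^sub>F w in nhds (x, t). \<phi> w \<le> \<phi> (x, t) + time_deriv \<phi> (x, t) * (snd w - t) + g (norm (fst w - x)) + \<omega> \<bar>snd w - t\<bar>"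
    using adm unfolding flat_above_def by auto
  have "time_deriv \<phi> (x, t) \<le> 0"
  proof (rule degenerate_subsolution[OF t g(1,2)])
    show "ball_speed CARD('n) R \<le> ennreal (c R / R)" if "0 < R" for R by (rule ball_speed_le[OF c that])
    show "0 < c r" if "0 < r" for r using c that by (simp add: hamiltonian_bound_def)
    have "open (UNIV \<times> {0<..} :: ((real^'n) \<times> real) set)" by (intro open_Times) auto
    hence "\<forall>\<^sub>F w in nhds (x, t). w \<in> UNIV \<times> {0<..}" by (rule eventually_nhds_in_open) (use t in auto)
    with g(3) show "\<forall>\<^sub>F w in nhds (x, t). u w \<le> u (x, t) + time_deriv \<phi> (x, t) * (snd w - t) + g (norm (fst w - x)) + \<omega> \<bar>snd w - t\<bar>"
    proof eventually_elim
      case (elim w)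
      thus ?case using max[of w] by linarith
    qed
  qed
  thus ?thesis using True by simp
next
  case False
  thus ?thesis using nondegenerate_subsolution[OF t phi max] by simp
qed

text \<open>Complements of solutions solve the step for complements, so the whole setting is
  invariant under a change of sign.\<close>

lemma evolution_limit_uminus: "evolution_limit \<rho> \<delta> L f (\<lambda>k z. - v k z) (\<lambda>z. - u z) h M"
proof (intro evolution_limit.intro evolution_limit_axioms.intro radial_profile_axioms)
  show "0 < h k" "h \<longlonglongrightarrow> 0" "\<bar>- v k z\<bar> \<le> M" for k z using h_pos h_lim v_bound by auto
  show "step_relation (h k) (\<lambda>x. - v k (x, t - h k)) (\<lambda>x. - v k (x, t))" if "h k \<le> t" for k t
    by (rule step_relation_uminus[OF step[OF that]])
  show "\<bar>- u z\<bar> \<le> M" if "z \<in> UNIV \<times> {0..}" for z using u_bound[OF that] by simp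
  show "continuous_on (UNIV \<times> {0..}) (\<lambda>z. - u z)" by (intro continuous_on_minus u_cont)
  show "uniform_limit K (\<lambda>k z. - v k z) (\<lambda>z. - u z) sequentially" if "compact K" "K \<subseteq> UNIV \<times> {0..}" for K
    by (rule uniform_limit_uminus[OF v_lim[OF that]])
qed

lemma level_set_slice:
  assumes "continuous_on (UNIV \<times> {0<..}) \<phi>" "0 < t"
  shows "continuous_on UNIV (\<lambda>y. \<phi> (y, t))"
  by (rule continuous_on_compose2[OF assms(1)]) (use assms(2) in \<open>auto intro: continuous_intros\<close>)

text \<open>u' stands for the upper envelope, which agrees with u at nonnegative times by
  continuity.\<close>

lemma subsolution_limit:
  assumes c: "hamiltonian_bound \<rho> f TYPE('n) c" and u': "\<And>z. z \<in> UNIV \<times> {0..} \<Longrightarrow> u' z = u z"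
  shows "subsolution \<rho> f c u'"
  unfolding subsolution_def
proof (intro conjI allI impI)
  show "usc_on (UNIV \<times> {0..}) u'"
    unfolding usc_on_def
  proof (intro ballI allI impI)
    fix z a assume z: "z \<in> UNIV \<times> {0..}" "u' z < a"
    have "\<forall>\<^sub>F w in at z within UNIV \<times> {0..}. u w < a"
      using u_cont z u' by (auto simp: continuous_on_def dest!: bspec intro: order_tendstoD(2))
    thus "\<forall>\<^sub>F w in at z within UNIV \<times> {0..}. u' w < a"
      unfolding eventually_at_filter by eventually_elim (use u' in auto)
  qed
next
  fix x :: "real^'n" and t and \<phi> :: "(real^'n) \<times> real \<Rightarrow> real"
  assume a: "t > 0 \<and> admissible c \<phi> (x, t) \<and> (\<forall>w\<in>UNIV \<times> {0<..}. u' w - \<phi> w \<le> u' (x, t) - \<phi> (x, t))"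
  hence t: "0 < t" and phi: "continuous_on (UNIV \<times> {0<..}) \<phi>" "C2_near \<phi> (x, t)"
    by (auto simp: admissible_def)
  have max: "u w - \<phi> w \<le> u (x, t) - \<phi> (x, t)" if "w \<in> UNIV \<times> {0<..}" for w
  proof -
    have "u' w - \<phi> w \<le> u' (x, t) - \<phi> (x, t)" using a that by blast
    moreover have "u' w = u w" "u' (x, t) = u (x, t)" using that t by (auto intro!: u')
    ultimately show ?thesis by simp
  qed
  have "closed {y. \<phi> (x, t) \<le> \<phi> (y, t)}" by (intro closed_Collect_le continuous_on_const level_set_slice phi t)
  hence H: "hamiltonian \<rho> f x p X {y. \<phi> (x, t) \<le> \<phi> (y, t)} = hamiltonian_closed \<rho> f x p X {y. \<phi> (x, t) \<le> \<phi> (y, t)}" for p X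
    by (simp add: hamiltonian_def)
  show "if space_grad \<phi> (x, t) \<noteq> 0
     then time_deriv \<phi> (x, t) + hamiltonian \<rho> f x (space_grad \<phi> (x, t)) (space_hessian \<phi> (x, t)) {y. \<phi> (y, t) \<ge> \<phi> (x, t)} \<le> 0
     else time_deriv \<phi> (x, t) \<le> 0"
    unfolding H
  proof (rule subsolution_test[OF c t phi _ max])
    show "flat_above c \<phi> (x, t)" if "space_grad \<phi> (x, t) = 0"
      using admissible_flat_above(1) a that by blast
  qed
qed

lemma supersolution_limit:
  assumes c: "hamiltonian_bound \<rho> f TYPE('n) c" and u': "\<And>z. z \<in> UNIV \<times> {0..} \<Longrightarrow> u' z = u z"
  shows "supersolution \<rho> f c u'"
  unfolding supersolution_def
proof (intro conjI allI impI)
  show "lsc_on (UNIV \<times> {0..}) u'"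
    unfolding lsc_on_def
  proof (intro ballI allI impI)
    fix z a assume z: "z \<in> UNIV \<times> {0..}" "a < u' z"
    have "\<forall>\<^sub>F w in at z within UNIV \<times> {0..}. a < u w"
      using u_cont z u' by (auto simp: continuous_on_def dest!: bspec intro: order_tendstoD(1))
    thus "\<forall>\<^sub>F w in at z within UNIV \<times> {0..}. a < u' w"
      unfolding eventually_at_filter by eventually_elim (use u' in auto)
  qed
next
  fix x :: "real^'n" and t and \<phi> :: "(real^'n) \<times> real \<Rightarrow> real"
  assume a: "t > 0 \<and> admissible c \<phi> (x, t) \<and> (\<forall>w\<in>UNIV \<times> {0<..}. u' w - \<phi> w \<ge> u' (x, t) - \<phi> (x, t))"
  hence t: "0 < t" and phi: "continuous_on (UNIV \<times> {0<..}) \<phi>" and C2: "C2_near \<phi> (x, t)"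
    by (auto simp: admissible_def)
  interpret m: evolution_limit \<rho> \<delta> L f "\<lambda>k z. - v k z" "\<lambda>z. - u z" h M by (rule evolution_limit_uminus)
  note n = C2_near_uminus[OF C2]
  have max: "- u w - - \<phi> w \<le> - u (x, t) - - \<phi> (x, t)" if "w \<in> UNIV \<times> {0<..}" for w
  proof -
    have "u' w - \<phi> w \<ge> u' (x, t) - \<phi> (x, t)" using a that by blast
    moreover have "u' w = u w" "u' (x, t) = u (x, t)" using that t by (auto intro!: u')
    ultimately show ?thesis by simp
  qed
  have "open {y. \<phi> (x, t) < \<phi> (y, t)}" by (intro open_Collect_less continuous_on_const level_set_slice phi t)
  from hamiltonian_open[OF this]
  have H: "hamiltonian \<rho> f x p X {y. \<phi> (x, t) < \<phi> (y, t)} = - hamiltonian_closed \<rho> f x (- p) (- X) {y. - \<phi> (x, t) \<le> - \<phi> (y, t)}" for p X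
    by (simp add: Collect_neg_eq[symmetric] not_less)
  have phi': "continuous_on (UNIV \<times> {0<..}) (\<lambda>w. - \<phi> w)" by (intro continuous_on_minus phi)
  have "if space_grad (\<lambda>w. - \<phi> w) (x, t) \<noteq> 0
     then time_deriv (\<lambda>w. - \<phi> w) (x, t) + hamiltonian_closed \<rho> f x (space_grad (\<lambda>w. - \<phi> w) (x, t)) (space_hessian (\<lambda>w. - \<phi> w) (x, t)) {y. - \<phi> (x, t) \<le> - \<phi> (y, t)} \<le> 0
     else time_deriv (\<lambda>w. - \<phi> w) (x, t) \<le> 0"
  proof (rule m.subsolution_test[OF c t phi' n(1) _ max])
    show "flat_above c (\<lambda>w. - \<phi> w) (x, t)" if "space_grad (\<lambda>w. - \<phi> w) (x, t) = 0"
      using admissible_flat_above(2)[of c \<phi> "(x, t)"] a that n(2) by simp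
  qed
  thus "if space_grad \<phi> (x, t) \<noteq> 0
     then time_deriv \<phi> (x, t) + hamiltonian \<rho> f x (space_grad \<phi> (x, t)) (space_hessian \<phi> (x, t)) {y. \<phi> (y, t) > \<phi> (x, t)} \<ge> 0
     else time_deriv \<phi> (x, t) \<ge> 0"
    unfolding H n by (auto split: if_splits)
qed

end

theorem theorem4p6:
  fixes \<rho>0 \<delta> :: real and f c :: "real \<Rightarrow> real"
    and u0 :: "real^'n \<Rightarrow> real" and u :: "(real^'n) \<times> real \<Rightarrow> real"
    and h :: "nat \<Rightarrow> real"
  assumes "0 < \<rho>0" and "0 < \<delta>" and "\<delta> < \<rho>0"
    and "\<exists>L. L-lipschitz_on UNIV f"
    and "\<forall>r. f (- r) = f r"
    and "\<forall>r. 0 \<le> f r"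
    and "closure {r. f r \<noteq> 0} = {- \<rho>0..\<rho>0}"
    and "f constant_on {- \<delta>..\<delta>}"
    and "antimono_on {0..} f"
    and "hamiltonian_bound \<rho>0 f TYPE('n) c"
    and "bounded (range u0)"
    and "uniformly_continuous_on UNIV u0"
    and "compact (closure {x. u0 x \<noteq> 0})"
    and "\<forall>k. 0 < h k" and "h \<longlonglongrightarrow> 0"
    and "bounded (u ` (UNIV \<times> {0..}))"
    and "uniformly_continuous_on (UNIV \<times> {0..}) u"
    and "\<forall>K. compact K \<and> K \<subseteq> UNIV \<times> {0..} \<longrightarrow>
           uniform_limit K (\<lambda>k. discrete_evolution \<rho>0 f u0 (h k)) u sequentially"
  shows "cauchy_viscosity_solution \<rho>0 f c u0 u"
proof -
  obtain L where L: "L-lipschitz_on UNIV f" using assms(4) by blast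
  interpret radial_profile \<rho>0 \<delta> L f
    using assms L by unfold_locales auto
  have cont: "continuous_on (UNIV \<times> {0..}) u" using assms(17) by (rule uniformly_continuous_imp_continuous)
  obtain M1 where M1: "\<And>x. \<bar>u0 x\<bar> \<le> M1" using assms(11) by (auto simp: bounded_iff)
  obtain M2 where M2: "\<And>z. z \<in> UNIV \<times> {0..} \<Longrightarrow> \<bar>u z\<bar> \<le> M2" using assms(16) by (auto simp: bounded_iff)
  have M: "\<bar>u0 x\<bar> \<le> max M1 M2" "z \<in> UNIV \<times> {0..} \<Longrightarrow> \<bar>u z\<bar> \<le> max M1 M2" for x z
    using M1[of x] M2[of z] by linarith+
  have nice: "nice u0"
  proof -
    obtain R where R: "\<And>x. x \<in> closure {x. u0 x \<noteq> 0} \<Longrightarrow> norm x \<le> R"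
      using compact_imp_bounded[OF assms(13)] by (auto simp: bounded_iff)
    have "u0 x = 0" if "R + 1 \<le> norm x" for x
      using R[of x] closure_subset[of "{x. u0 x \<noteq> 0}"] that by force
    thus ?thesis unfolding nice_def using assms(11,12) by blast
  qed
  interpret evolution_limit \<rho>0 \<delta> L f "\<lambda>k. discrete_evolution \<rho>0 f u0 (h k)" u h "max M1 M2"
  proof (intro evolution_limit.intro evolution_limit_axioms.intro radial_profile_axioms)
    show "0 < h k" "h \<longlonglongrightarrow> 0" for k using assms by auto
    show "step_relation (h k) (\<lambda>x. discrete_evolution \<rho>0 f u0 (h k) (x, t - h k)) (\<lambda>x. discrete_evolution \<rho>0 f u0 (h k) (x, t))"
      if "h k \<le> t" for k t
      by (rule discrete_evolution_step[OF _ nice M(1) that]) (use assms in auto)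
    show "\<bar>discrete_evolution \<rho>0 f u0 (h k) z\<bar> \<le> max M1 M2" for k z
      using discrete_evolution_bound[OF _ nice M(1), of "h k" "fst z" "snd z"] assms by simp
    show "\<bar>u z\<bar> \<le> max M1 M2" if "z \<in> UNIV \<times> {0..}" for z by (rule M(2)[OF that])
    show "continuous_on (UNIV \<times> {0..}) u" by (rule cont)
    show "uniform_limit K (\<lambda>k. discrete_evolution \<rho>0 f u0 (h k)) u sequentially" if "compact K" "K \<subseteq> UNIV \<times> {0..}" for K
      using assms(18) that by blast
  qed
  \<comment> \<open>At time 0 no step has been taken, so every discrete evolution equals u0
    there.\<close>
  have "u (x, 0) = u0 x" for x
  proof -
    have "uniform_limit {(x, 0)} (\<lambda>k. discrete_evolution \<rho>0 f u0 (h k)) u sequentially" by (rule v_lim) auto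
    hence "(\<lambda>k. discrete_evolution \<rho>0 f u0 (h k) (x, 0)) \<longlonglongrightarrow> u (x, 0)" by (rule tendsto_uniform_limitI) simp
    moreover have "(\<lambda>k. discrete_evolution \<rho>0 f u0 (h k) (x, 0)) = (\<lambda>k. u0 x)" by (simp add: discrete_evolution_def)
    ultimately show ?thesis by (simp add: LIMSEQ_const_iff)
  qed
  moreover have "subsolution \<rho>0 f c (usc_envelope (UNIV \<times> {0..}) u)"
    by (rule subsolution_limit[OF assms(10)]) (rule envelopes_continuous(1)[OF cont])
  moreover have "supersolution \<rho>0 f c (lsc_envelope (UNIV \<times> {0..}) u)"
    by (rule supersolution_limit[OF assms(10)]) (rule envelopes_continuous(2)[OF cont])
  ultimately show ?thesis by (simp add: cauchy_viscosity_solution_def viscosity_solution_def)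
qed

end
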